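(* Let $\Gamma$ be a finite group acting on an affine scheme $X$ and on a finite-dimensional Lie algebra $\mathfrak{g}$, and let $\mathfrak{M}=M(X,\mathfrak{g})^\Gamma$. If $\mathfrak{M}$ is perfect (i.e. $[\mathfrak{M},\mathfrak{M}]=\mathfrak{M}$), then the map $\Psi\mapsto\mathrm{ev}_\Psi$ is a bijection between $\mathcal{E}$ and $\mathcal{S}$. In particular, this is true if any one of the following conditions holds: (1) $[\mathfrak{g}^\Gamma,\mathfrak{g}]=\mathfrak{g}$; (2) $\mathfrak{g}$ is simple, $\mathfrak{g}^\Gamma\neq\{0\}$ is perfect and acts on $\mathfrak{g}_\Gamma$ without a trivial non-zero submodule; (3) $\mathfrak{g}$ is semisimple and $\Gamma$ acts on $\mathfrak{g}$ by diagram automorphisms.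
   Context: $k$ is an algebraically closed field of characteristic zero; all tensor products are over $k$. $X=\operatorname{Spec}A$ is an affine $k$-scheme ($A$ a commutative associative unital $k$-algebra, not assumed finitely generated or reduced). The finite group $\Gamma$ acts on $X$ by scheme automorphisms (over $k$), hence on $A$ by $g\cdot f=f\circ g^{-1}$, and on the finite-dimensional $k$-Lie algebra $\mathfrak{g}$ by Lie algebra automorphisms. $\mathfrak{M}=M(X,\mathfrak{g})^\Gamma$ is the Lie algebra of $\Gamma$-equivariant regular maps $X\to\mathfrak{g}$ with pointwise operations; equivalently $\mathfrak{M}=(\mathfrak{g}\otimes A)^\Gamma$ for the diagonal action, with bracket $[u\otimes f,v\otimes h]=[u,v]\otimes fh$. $\mathfrak{g}^\Gamma=\{u\in\mathfrak{g}:g\cdot u=u\ \forall g\in\Gamma\}$ and $\mathfrak{g}_\Gamma=\operatorname{Span}\{g\cdot u-u:g\in\Gamma,u\in\mathfrak{g}\}$, so $\mathfrak{g}=\mathfrak{g}^\Gamma\oplus\mathfrak{g}_\Gamma$, and $\mathfrak{g}^\Gamma$ acts on $\mathfrak{g}_\Gamma$ by the adjoint action. For $\mathfrak{g}$ semisimple with Chevalley generators $\{h_i,e_i,f_i\}_{i\in I}$, $\Gamma$ acts by diagram automorphisms if there is an action of $\Gamma$ on the Dynkin diagram (with vertex set $I$) such that $g\cdot h_i=h_{g\cdot i}$, $g\cdot e_i=e_{g\cdot i}$, $g\cdot f_i=f_{g\cdot i}$. $X_{\rm rat}$ is the set of $k$-rational points of $X$. For $x\in X_{\rm rat}$ and $\alpha=\sum_i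 u_i\otimes f_i$, put $\alpha(x)=\sum_i f_i(x)u_i$. Let $\Gamma_x=\{g\in\Gamma:g\cdot x=x\}$ and $\mathfrak{g}^x=\{u\in\mathfrak{g}:g\cdot u=u\ \forall g\in\Gamma_x\}$; one has $\alpha(x)\in\mathfrak{g}^x$ for $\alpha\in\mathfrak{M}$. For a finite subset $\mathbf{x}\subseteq X_{\rm rat}$ let $\mathrm{ev}_{\mathbf x}:\mathfrak{M}\to\bigoplus_{x\in\mathbf{x}}\mathfrak{g}^x$, $\alpha\mapsto(\alpha(x))_{x\in\mathbf{x}}$. Given representations $\rho_x:\mathfrak{g}^x\to\operatorname{End}_kV_x$ ($x\in\mathbf{x}$), the evaluation representation $\mathrm{ev}_{\mathbf x}(\rho_x)_{x\in\mathbf{x}}$ of $\mathfrak{M}$ on $\bigotimes_{x\in\mathbf x}V_x$ is the composition of $\mathrm{ev}_{\mathbf x}$ with the tensor product representation of $\bigoplus_{x\in\mathbf{x}}\mathfrak{g}^x$. $\mathcal{R}_x$ is the set of isomorphism classes of irreducible finite-dimensional representations of $\mathfrak{g}^x$, and $\mathcal{R}_X=\bigsqcup_{x\in X_{\rm rat}}\mathcal{R}_x$, with $\Gamma$ acting by $g\cdot[\rho]=[\rho\circ g^{-1}]\in\mathcal{R}_{g\cdot x}$ for $[\rho]\in\mathcal{R}_x$. $\mathcal{E}$ is the set of finitely supported $\Gamma$-equivariant functions $\Psi:X_{\rm rat}\to\mathcal{R}_X$ with $\Psi(x)\in\mathcal{R}_x$, where $\operatorname{supp}\Psi=\{x:\Psi(x)\neq0\}$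 and $0$ denotes the class of the one-dimensional trivial representation. For $\Psi\in\mathcal{E}$, $\mathrm{ev}_\Psi$ is the isomorphism class of $\mathrm{ev}_{\mathbf x}(\Psi(x))_{x\in\mathbf{x}}$, where $\mathbf{x}$ contains exactly one element of each $\Gamma$-orbit in $\operatorname{supp}\Psi$ (independent of the choice); if $\operatorname{supp}\Psi=\emptyset$, it is the class of the trivial representation. $\mathcal{S}$ is the set of isomorphism classes of irreducible finite-dimensional representations of $\mathfrak{M}$. *)

theory Defs
  imports
    "HOL-Algebra.Group_Action"
    "HOL-Computational_Algebra.Polynomial"
    "HOL-Library.FuncSet"
    "HOL-Library.Function_Algebras"
begin

section \<open>Lie algebras\<close>

text \<open>
  A Lie algebra is a subspace \<open>L\<close> of an ambient vector space together with a bracket that is only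
  constrained on \<open>L\<close>; this lets fixed-point subalgebras share the bracket of the ambient algebra.
\<close>

locale lie_algebra = vector_space scale
  for scale :: "'k::field \<Rightarrow> 'l::ab_group_add \<Rightarrow> 'l" +
  fixes br :: "'l \<Rightarrow> 'l \<Rightarrow> 'l" and L :: "'l set"
  assumes carrier_subspace: "subspace L"
    and br_closed: "\<lbrakk>u \<in> L; v \<in> L\<rbrakk> \<Longrightarrow> br u v \<in> L"
    and br_add_left: "\<lbrakk>u \<in> L; v \<in> L; w \<in> L\<rbrakk> \<Longrightarrow> br (u + v) w = br u w + br v w"
    and br_add_right: "\<lbrakk>u \<in> L; v \<in> L; w \<in> L\<rbrakk> \<Longrightarrow> br u (v + w) = br u v + br u w"
    and br_scale_left: "\<lbrakk>u \<in> L; v \<in> L\<rbrakk> \<Longrightarrow> br (scale c u) v = scale c (br u v)"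
    and br_scale_right: "\<lbrakk>u \<in> L; v \<in> L\<rbrakk> \<Longrightarrow> br u (scale c v) = scale c (br u v)"
    and br_alternating: "u \<in> L \<Longrightarrow> br u u = 0"
    and br_jacobi: "\<lbrakk>u \<in> L; v \<in> L; w \<in> L\<rbrakk> \<Longrightarrow>
          br u (br v w) + br v (br w u) + br w (br u v) = 0"

definition commutator ::
  "('k::field \<Rightarrow> 'l::ab_group_add \<Rightarrow> 'l) \<Rightarrow> ('l \<Rightarrow> 'l \<Rightarrow> 'l) \<Rightarrow> 'l set \<Rightarrow> 'l set \<Rightarrow> 'l set" where
  "commutator s br U V = module.span s {br u v | u v. u \<in> U \<and> v \<in> V}"

definition perfect ::
  "('k::field \<Rightarrow> 'l::ab_group_add \<Rightarrow> 'l) \<Rightarrow> ('l \<Rightarrow> 'l \<Rightarrow> 'l) \<Rightarrow> 'l set \<Rightarrow> bool" where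
  "perfect s br L \<longleftrightarrow> commutator s br L L = L"

definition lie_ideal ::
  "('k::field \<Rightarrow> 'l::ab_group_add \<Rightarrow> 'l) \<Rightarrow> ('l \<Rightarrow> 'l \<Rightarrow> 'l) \<Rightarrow> 'l set \<Rightarrow> 'l set \<Rightarrow> bool" where
  "lie_ideal s br L J \<longleftrightarrow> module.subspace s J \<and> J \<subseteq> L \<and> (\<forall>u\<in>L. \<forall>v\<in>J. br u v \<in> J)"

definition solvable_lie ::
  "('k::field \<Rightarrow> 'l::ab_group_add \<Rightarrow> 'l) \<Rightarrow> ('l \<Rightarrow> 'l \<Rightarrow> 'l) \<Rightarrow> 'l set \<Rightarrow> bool" where
  "solvable_lie s br L \<longleftrightarrow> (\<exists>n. ((\<lambda>U. commutator s br U U) ^^ n) L = {0})"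

definition nilpotent_lie ::
  "('k::field \<Rightarrow> 'l::ab_group_add \<Rightarrow> 'l) \<Rightarrow> ('l \<Rightarrow> 'l \<Rightarrow> 'l) \<Rightarrow> 'l set \<Rightarrow> bool" where
  "nilpotent_lie s br L \<longleftrightarrow> (\<exists>n. ((\<lambda>U. commutator s br L U) ^^ n) L = {0})"

definition simple_lie ::
  "('k::field \<Rightarrow> 'l::ab_group_add \<Rightarrow> 'l) \<Rightarrow> ('l \<Rightarrow> 'l \<Rightarrow> 'l) \<Rightarrow> 'l set \<Rightarrow> bool" where
  "simple_lie s br L \<longleftrightarrow>
     (\<exists>u\<in>L. \<exists>v\<in>L. br u v \<noteq> 0) \<and> (\<forall>J. lie_ideal s br L J \<longrightarrow> J = {0} \<or> J = L)"

definition semisimple_lie ::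
  "('k::field \<Rightarrow> 'l::ab_group_add \<Rightarrow> 'l) \<Rightarrow> ('l \<Rightarrow> 'l \<Rightarrow> 'l) \<Rightarrow> 'l set \<Rightarrow> bool" where
  "semisimple_lie s br L \<longleftrightarrow>
     (\<forall>J. lie_ideal s br L J \<and> solvable_lie s br J \<longrightarrow> J = {0})"

text \<open>\<open>M\<close> is a module over \<open>U\<close> under the adjoint action.\<close>

definition has_nonzero_trivial_submodule ::
  "('k::field \<Rightarrow> 'l::ab_group_add \<Rightarrow> 'l) \<Rightarrow> ('l \<Rightarrow> 'l \<Rightarrow> 'l) \<Rightarrow> 'l set \<Rightarrow> 'l set \<Rightarrow> bool" where
  "has_nonzero_trivial_submodule s br U M \<longleftrightarrow>
     (\<exists>N. module.subspace s N \<and> N \<subseteq> M \<and> N \<noteq> {0} \<and>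
        (\<forall>u\<in>U. \<forall>v\<in>N. br u v \<in> N \<and> br u v = 0))"

definition cartan_subalgebra ::
  "('k::field \<Rightarrow> 'l::ab_group_add \<Rightarrow> 'l) \<Rightarrow> ('l \<Rightarrow> 'l \<Rightarrow> 'l) \<Rightarrow> 'l set \<Rightarrow> 'l set \<Rightarrow> bool" where
  "cartan_subalgebra s br L H \<longleftrightarrow>
     module.subspace s H \<and> H \<subseteq> L \<and> (\<forall>u\<in>H. \<forall>v\<in>H. br u v \<in> H) \<and>
     nilpotent_lie s br H \<and> {u \<in> L. \<forall>v\<in>H. br u v \<in> H} = H"

definition root_space ::
  "('k::field \<Rightarrow> 'l::ab_group_add \<Rightarrow> 'l) \<Rightarrow> ('l \<Rightarrow> 'l \<Rightarrow> 'l) \<Rightarrow> 'l set \<Rightarrow> 'l set \<Rightarrow> ('l \<Rightarrow> 'k) \<Rightarrow> 'l set"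
  where "root_space s br L H \<phi> = {u \<in> L. \<forall>h\<in>H. br h u = s (\<phi> h) u}"

text \<open>Roots are functions on the whole ambient space of which only the restriction to \<open>H\<close> matters.\<close>

definition is_root ::
  "('k::field \<Rightarrow> 'l::ab_group_add \<Rightarrow> 'l) \<Rightarrow> ('l \<Rightarrow> 'l \<Rightarrow> 'l) \<Rightarrow> 'l set \<Rightarrow> 'l set \<Rightarrow> ('l \<Rightarrow> 'k) \<Rightarrow> bool"
  where "is_root s br L H \<phi> \<longleftrightarrow> (\<exists>h\<in>H. \<phi> h \<noteq> 0) \<and> root_space s br L H \<phi> \<noteq> {0}"

definition is_root_base ::
  "('k::field \<Rightarrow> 'l::ab_group_add \<Rightarrow> 'l) \<Rightarrow> ('l \<Rightarrow> 'l \<Rightarrow> 'l) \<Rightarrow> 'l set \<Rightarrow> 'l set \<Rightarrow>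
     'i set \<Rightarrow> ('i \<Rightarrow> 'l \<Rightarrow> 'k) \<Rightarrow> bool" where
  "is_root_base s br L H I \<alpha> \<longleftrightarrow>
     (\<forall>i\<in>I. is_root s br L H (\<alpha> i)) \<and>
     (\<forall>c. (\<forall>h\<in>H. (\<Sum>i\<in>I. c i * \<alpha> i h) = 0) \<longrightarrow> (\<forall>i\<in>I. c i = 0)) \<and>
     (\<forall>\<phi>. is_root s br L H \<phi> \<longrightarrow>
        (\<exists>n :: 'i \<Rightarrow> nat.
           (\<forall>h\<in>H. \<phi> h = (\<Sum>i\<in>I. of_nat (n i) * \<alpha> i h)) \<or>
           (\<forall>h\<in>H. \<phi> h = - (\<Sum>i\<in>I. of_nat (n i) * \<alpha> i h))))"

text \<open>The conditions on \<open>h i\<close> say that it is the coroot of the simple root \<open>\<alpha> i\<close>.\<close>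

definition chevalley_generators ::
  "('k::field \<Rightarrow> 'l::ab_group_add \<Rightarrow> 'l) \<Rightarrow> ('l \<Rightarrow> 'l \<Rightarrow> 'l) \<Rightarrow> 'l set \<Rightarrow>
     'i set \<Rightarrow> ('i \<Rightarrow> 'l) \<Rightarrow> ('i \<Rightarrow> 'l) \<Rightarrow> ('i \<Rightarrow> 'l) \<Rightarrow> bool" where
  "chevalley_generators s br L I h e f \<longleftrightarrow>
     finite I \<and>
     (\<exists>H \<alpha>. cartan_subalgebra s br L H \<and> is_root_base s br L H I \<alpha> \<and>
        (\<forall>i\<in>I. h i \<in> H \<and> \<alpha> i (h i) = 2 \<and>
           e i \<in> root_space s br L H (\<alpha> i) \<and>
           f i \<in> root_space s br L H (\<lambda>x. - \<alpha> i x) \<and>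
           br (e i) (f i) = h i))"

definition cartan_integer ::
  "('k::field \<Rightarrow> 'l::ab_group_add \<Rightarrow> 'l) \<Rightarrow> ('l \<Rightarrow> 'l \<Rightarrow> 'l) \<Rightarrow>
     ('i \<Rightarrow> 'l) \<Rightarrow> ('i \<Rightarrow> 'l) \<Rightarrow> 'i \<Rightarrow> 'i \<Rightarrow> 'k" where
  "cartan_integer s br h e i j = (THE c. br (h i) (e j) = s c (e j))"

text \<open>
  An action on the Dynkin diagram is an action on its vertex set \<open>I\<close> that preserves the Cartan
  integers, that is, the edges with their multiplicities and directions.
\<close>

definition acts_by_diagram_automorphisms ::
  "('k::field \<Rightarrow> 'l::ab_group_add \<Rightarrow> 'l) \<Rightarrow> ('l \<Rightarrow> 'l \<Rightarrow> 'l) \<Rightarrow> ('c, 'd) monoid_scheme \<Rightarrow>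
     ('c \<Rightarrow> 'l \<Rightarrow> 'l) \<Rightarrow> 'i set \<Rightarrow> ('i \<Rightarrow> 'l) \<Rightarrow> ('i \<Rightarrow> 'l) \<Rightarrow> ('i \<Rightarrow> 'l) \<Rightarrow> bool" where
  "acts_by_diagram_automorphisms s br \<Gamma> act I h e f \<longleftrightarrow>
     (\<exists>\<pi>. group_action \<Gamma> I \<pi> \<and>
        (\<forall>g\<in>carrier \<Gamma>. \<forall>i\<in>I. \<forall>j\<in>I.
           cartan_integer s br h e (\<pi> g i) (\<pi> g j) = cartan_integer s br h e i j) \<and>
        (\<forall>g\<in>carrier \<Gamma>. \<forall>i\<in>I.
           act g (h i) = h (\<pi> g i) \<and> act g (e i) = e (\<pi> g i) \<and> act g (f i) = f (\<pi> g i)))"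


section \<open>Finite-dimensional representations\<close>

definition fscale :: "'k::times \<Rightarrow> ('i \<Rightarrow> 'k) \<Rightarrow> 'i \<Rightarrow> 'k" where
  "fscale c v = (\<lambda>i. c * v i)"

lemma vector_space_fscale: "vector_space (fscale :: 'k::field \<Rightarrow> ('i \<Rightarrow> 'k) \<Rightarrow> 'i \<Rightarrow> 'k)"
  by standard (auto simp: fscale_def algebra_simps fun_eq_iff)

definition linear_on ::
  "('k \<Rightarrow> 'v::plus \<Rightarrow> 'v) \<Rightarrow> ('k \<Rightarrow> 'w::plus \<Rightarrow> 'w) \<Rightarrow> 'v set \<Rightarrow> ('v \<Rightarrow> 'w) \<Rightarrow> bool" where
  "linear_on s1 s2 V T \<longleftrightarrow>
     (\<forall>u\<in>V. \<forall>v\<in>V. T (u + v) = T u + T v) \<and> (\<forall>c. \<forall>v\<in>V. T (s1 c v) = s2 c (T v))"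

text \<open>
  A representation of \<open>L\<close> is a pair \<open>(V, \<rho>)\<close> with \<open>V\<close> a finite-dimensional subspace of some space of
  functions to \<open>k\<close>. The values of \<open>\<rho>\<close> outside \<open>L\<close> and \<open>V\<close> are irrelevant.
\<close>

type_synonym ('l, 'i, 'k) rep = "('i \<Rightarrow> 'k) set \<times> ('l \<Rightarrow> ('i \<Rightarrow> 'k) \<Rightarrow> ('i \<Rightarrow> 'k))"

definition is_rep ::
  "('k::field \<Rightarrow> 'l::ab_group_add \<Rightarrow> 'l) \<Rightarrow> ('l \<Rightarrow> 'l \<Rightarrow> 'l) \<Rightarrow> 'l set \<Rightarrow> ('l, 'i, 'k) rep \<Rightarrow> bool" where
  "is_rep s br L R \<longleftrightarrow> (let V = fst R; \<rho> = snd R in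
     module.subspace fscale V \<and> (\<exists>B. finite B \<and> module.span fscale B = V) \<and>
     (\<forall>a\<in>L. \<rho> a ` V \<subseteq> V \<and> linear_on fscale fscale V (\<rho> a)) \<and>
     (\<forall>v\<in>V. linear_on s fscale L (\<lambda>a. \<rho> a v)) \<and>
     (\<forall>a\<in>L. \<forall>b\<in>L. \<forall>v\<in>V. \<rho> (br a b) v = \<rho> a (\<rho> b v) - \<rho> b (\<rho> a v)))"

definition irreducible_rep ::
  "('k::field \<Rightarrow> 'l::ab_group_add \<Rightarrow> 'l) \<Rightarrow> ('l \<Rightarrow> 'l \<Rightarrow> 'l) \<Rightarrow> 'l set \<Rightarrow> ('l, 'i, 'k) rep \<Rightarrow> bool" where
  "irreducible_rep s br L R \<longleftrightarrow>
     is_rep s br L R \<and> fst R \<noteq> {0} \<and>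
     (\<forall>W. module.subspace fscale W \<and> W \<subseteq> fst R \<and> (\<forall>a\<in>L. snd R a ` W \<subseteq> W) \<longrightarrow>
        W = {0} \<or> W = fst R)"

definition rep_iso :: "'l set \<Rightarrow> ('l, 'i, 'k::field) rep \<Rightarrow> ('l, 'j, 'k) rep \<Rightarrow> bool" where
  "rep_iso L R R' \<longleftrightarrow>
     (\<exists>T. linear_on fscale fscale (fst R) T \<and> bij_betw T (fst R) (fst R') \<and>
        (\<forall>a\<in>L. \<forall>v\<in>fst R. T (snd R a v) = snd R' a (T v)))"

text \<open>
  Isomorphism classes are taken among representations on finite-dimensional subspaces of
  \<open>nat \<Rightarrow> 'k\<close>. Every finite-dimensional vector space is isomorphic to such a subspace, so no
  isomorphism class is lost; the representation \<open>R\<close> itself may live elsewhere.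
\<close>

definition rep_class ::
  "('k::field \<Rightarrow> 'l::ab_group_add \<Rightarrow> 'l) \<Rightarrow> ('l \<Rightarrow> 'l \<Rightarrow> 'l) \<Rightarrow> 'l set \<Rightarrow> ('l, 'i, 'k) rep \<Rightarrow>
     ('l, nat, 'k) rep set" where
  "rep_class s br L R = {R'. is_rep s br L R' \<and> rep_iso L R R'}"

definition irr_classes ::
  "('k::field \<Rightarrow> 'l::ab_group_add \<Rightarrow> 'l) \<Rightarrow> ('l \<Rightarrow> 'l \<Rightarrow> 'l) \<Rightarrow> 'l set \<Rightarrow>
     ('l, nat, 'k) rep set set" where
  "irr_classes s br L = {rep_class s br L R | R :: ('l, nat, 'k) rep. irreducible_rep s br L R}"

definition trivial_class ::
  "('k::field \<Rightarrow> 'l::ab_group_add \<Rightarrow> 'l) \<Rightarrow> ('l \<Rightarrow> 'l \<Rightarrow> 'l) \<Rightarrow> 'l set \<Rightarrow>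
     ('l, nat, 'k) rep set" where
  "trivial_class s br L =
     rep_class s br L (UNIV :: (unit \<Rightarrow> 'k) set, \<lambda>_ _. 0)"


section \<open>Tensor products\<close>

text \<open>
  Tensor products are realised in the dual of the space of multilinear forms: the pure tensor
  of a family of vectors is evaluation of forms at this family, and the tensor product is the
  span of the pure tensors. By convention its elements vanish on functions that are not
  multilinear forms.
\<close>

definition multilinear_form ::
  "'p set \<Rightarrow> ('p \<Rightarrow> ('i \<Rightarrow> 'k::field) set) \<Rightarrow> (('p \<Rightarrow> 'i \<Rightarrow> 'k) \<Rightarrow> 'k) \<Rightarrow> bool" where
  "multilinear_form P V b \<longleftrightarrow>
     (\<forall>v \<in> PiE P V. \<forall>x\<in>P. linear_on fscale (*) (V x) (\<lambda>w. b (v(x := w))))"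

definition pure_tensor ::
  "'p set \<Rightarrow> ('p \<Rightarrow> ('i \<Rightarrow> 'k::field) set) \<Rightarrow> ('p \<Rightarrow> 'i \<Rightarrow> 'k) \<Rightarrow> (('p \<Rightarrow> 'i \<Rightarrow> 'k) \<Rightarrow> 'k) \<Rightarrow> 'k" where
  "pure_tensor P V v = (\<lambda>b. if multilinear_form P V b then b v else 0)"

definition tensor_product_space ::
  "'p set \<Rightarrow> ('p \<Rightarrow> ('i \<Rightarrow> 'k::field) set) \<Rightarrow> ((('p \<Rightarrow> 'i \<Rightarrow> 'k) \<Rightarrow> 'k) \<Rightarrow> 'k) set" where
  "tensor_product_space P V = module.span fscale (pure_tensor P V ` PiE P V)"

text \<open>
  The tensor product representation of a direct sum of Lie algebras: the family \<open>u\<close> acts as the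
  sum over \<open>x \<in> P\<close> of \<open>\<rho> x (u x)\<close> in the tensor factor \<open>x\<close>.
\<close>

definition tensor_rep_action ::
  "'p set \<Rightarrow> ('p \<Rightarrow> ('i \<Rightarrow> 'k::field) set) \<Rightarrow> ('p \<Rightarrow> 'l \<Rightarrow> ('i \<Rightarrow> 'k) \<Rightarrow> 'i \<Rightarrow> 'k) \<Rightarrow> ('p \<Rightarrow> 'l) \<Rightarrow>
     ((('p \<Rightarrow> 'i \<Rightarrow> 'k) \<Rightarrow> 'k) \<Rightarrow> 'k) \<Rightarrow> (('p \<Rightarrow> 'i \<Rightarrow> 'k) \<Rightarrow> 'k) \<Rightarrow> 'k" where
  "tensor_rep_action P V \<rho> u t =
     (\<lambda>b. if multilinear_form P V b
          then t (\<lambda>v. \<Sum>x\<in>P. b (v(x := \<rho> x (u x) (v x)))) else 0)"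

lemma tensor_rep_action_pure_tensor:
  assumes "finite P" and v: "v \<in> PiE P V"
    and \<rho>: "\<And>x. x \<in> P \<Longrightarrow> \<rho> x (u x) ` V x \<subseteq> V x \<and> linear_on fscale fscale (V x) (\<rho> x (u x))"
  shows "tensor_rep_action P V \<rho> u (pure_tensor P V v) =
           (\<Sum>x\<in>P. pure_tensor P V (v(x := \<rho> x (u x) (v x))))"
proof
  fix b
  have sum_app: "(\<Sum>x\<in>P. F x) b = (\<Sum>x\<in>P. F x b)" for F :: "'a \<Rightarrow> (('a \<Rightarrow> 'b \<Rightarrow> 'c) \<Rightarrow> 'c) \<Rightarrow> 'c"
    using \<open>finite P\<close> by (induction P rule: finite_induct) auto
  show "tensor_rep_action P V \<rho> u (pure_tensor P V v) b =
          (\<Sum>x\<in>P. pure_tensor P V (v(x := \<rho> x (u x) (v x)))) b"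
  proof (cases "multilinear_form P V b")
    case True
    have "linear_on fscale (*) (V x) (\<lambda>w. b ((v'(x := w))(y := \<rho> y (u y) ((v'(x := w)) y))))"
      if v': "v' \<in> PiE P V" and x: "x \<in> P" and y: "y \<in> P" for v' x y
    proof (cases "x = y")
      case eq: True
      have "linear_on fscale (*) (V y) (\<lambda>w. b (v'(y := w)))"
        using True v' y unfolding multilinear_form_def by blast
      then show ?thesis
        using \<rho>[OF y] eq by (auto simp: linear_on_def image_subset_iff)
    next
      case False
      have "v'(y := \<rho> y (u y) (v' y)) \<in> PiE P V"
        using v' y \<rho>[OF y] by (fastforce simp: PiE_iff extensional_def)
      then have "linear_on fscale (*) (V x) (\<lambda>w. b ((v'(y := \<rho> y (u y) (v' y)))(x := w)))"
        using True x unfolding multilinear_form_def by blast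
      then show ?thesis
        using False by (simp add: fun_upd_twist)
    qed
    then have "multilinear_form P V (\<lambda>v. \<Sum>x\<in>P. b (v(x := \<rho> x (u x) (v x))))"
      unfolding multilinear_form_def linear_on_def
      by (auto simp: sum.distrib[symmetric] sum_distrib_left intro!: sum.cong)
    then show ?thesis
      using True by (simp add: tensor_rep_action_def pure_tensor_def sum_app)
  qed (simp add: tensor_rep_action_def pure_tensor_def sum_app)
qed


section \<open>Equivariant map algebras\<close>

text \<open>
  The affine scheme \<open>X = Spec A\<close> is given by the commutative algebra \<open>A\<close>, whose carrier is the type
  \<open>'a\<close>. The unit of \<open>A\<close> is an explicit parameter because the class \<open>comm_ring_1\<close> excludes the zero
  ring, i.e. the empty scheme. An action of the group on \<open>X\<close> by scheme automorphisms is the same as an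
  action on \<open>A\<close> by algebra automorphisms, \<open>g \<cdot> f = f \<circ> g\<inverse>\<close>.
\<close>

locale equivariant_maps =
  lie_algebra sg br UNIV + A: vector_space sA + group \<Gamma>
  for sg :: "'k::{alg_closed_field, field_char_0} \<Rightarrow> 'g::ab_group_add \<Rightarrow> 'g"
    and br :: "'g \<Rightarrow> 'g \<Rightarrow> 'g"
    and sA :: "'k \<Rightarrow> 'a::comm_ring \<Rightarrow> 'a"
    and oneA :: 'a
    and \<Gamma> :: "('c, 'd) monoid_scheme" (structure)
    and actg :: "'c \<Rightarrow> 'g \<Rightarrow> 'g"
    and actA :: "'c \<Rightarrow> 'a \<Rightarrow> 'a" +
  assumes g_finite_dim: "\<exists>B. finite B \<and> span B = UNIV"
    and oneA: "oneA * f = f"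
    and A_scale_mult: "sA c f * f' = sA c (f * f')"
    and finite_\<Gamma>: "finite (carrier \<Gamma>)"
    and actg: "group_action \<Gamma> UNIV actg"
    and actg_linear: "g \<in> carrier \<Gamma> \<Longrightarrow> Vector_Spaces.linear sg sg (actg g)"
    and actg_br: "g \<in> carrier \<Gamma> \<Longrightarrow> actg g (br u v) = br (actg g u) (actg g v)"
    and actA: "group_action \<Gamma> UNIV actA"
    and actA_linear: "g \<in> carrier \<Gamma> \<Longrightarrow> Vector_Spaces.linear sA sA (actA g)"
    and actA_mult: "g \<in> carrier \<Gamma> \<Longrightarrow> actA g (f * f') = actA g f * actA g f'"
begin

subsection \<open>The algebra of equivariant maps\<close>

definition bilinear_form :: "('g \<Rightarrow> 'a \<Rightarrow> 'k) \<Rightarrow> bool" where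
  "bilinear_form b \<longleftrightarrow>
     (\<forall>f. Vector_Spaces.linear sg (*) (\<lambda>u. b u f)) \<and> (\<forall>u. Vector_Spaces.linear sA (*) (b u))"

text \<open>The pure tensor of \<open>u\<close> and \<open>f\<close> in the tensor product of \<open>\<gg>\<close> and \<open>A\<close>.\<close>

definition tens :: "'g \<Rightarrow> 'a \<Rightarrow> ('g \<Rightarrow> 'a \<Rightarrow> 'k) \<Rightarrow> 'k" where
  "tens u f = (\<lambda>b. if bilinear_form b then b u f else 0)"

definition tensor_space :: "(('g \<Rightarrow> 'a \<Rightarrow> 'k) \<Rightarrow> 'k) set" where
  "tensor_space = module.span fscale {tens u f | u f. True}"

definition tensor_bracket ::
  "(('g \<Rightarrow> 'a \<Rightarrow> 'k) \<Rightarrow> 'k) \<Rightarrow> (('g \<Rightarrow> 'a \<Rightarrow> 'k) \<Rightarrow> 'k) \<Rightarrow> ('g \<Rightarrow> 'a \<Rightarrow> 'k) \<Rightarrow> 'k" where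
  "tensor_bracket \<alpha> \<beta> =
     (\<lambda>b. if bilinear_form b then \<alpha> (\<lambda>u f. \<beta> (\<lambda>v f'. b (br u v) (f * f'))) else 0)"

definition tensor_act :: "'c \<Rightarrow> (('g \<Rightarrow> 'a \<Rightarrow> 'k) \<Rightarrow> 'k) \<Rightarrow> ('g \<Rightarrow> 'a \<Rightarrow> 'k) \<Rightarrow> 'k" where
  "tensor_act g \<alpha> = (\<lambda>b. if bilinear_form b then \<alpha> (\<lambda>u f. b (actg g u) (actA g f)) else 0)"

definition map_algebra :: "(('g \<Rightarrow> 'a \<Rightarrow> 'k) \<Rightarrow> 'k) set" where
  "map_algebra = {\<alpha> \<in> tensor_space. \<forall>g\<in>carrier \<Gamma>. tensor_act g \<alpha> = \<alpha>}"

lemma bilinear_formI: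
  assumes "\<And>u v f. b (u + v) f = b u f + b v f" "\<And>c u f. b (sg c u) f = c * b u f"
    and "\<And>u f f'. b u (f + f') = b u f + b u f'" "\<And>c u f. b u (sA c f) = c * b u f"
  shows "bilinear_form b"
proof -
  have k: "vector_space ((*) :: 'k \<Rightarrow> 'k \<Rightarrow> 'k)"
    by (rule vector_space.intro) (simp_all only: distrib_left distrib_right mult.assoc mult_1_left)
  show ?thesis
    unfolding bilinear_form_def Vector_Spaces.linear_iff
    using vector_space_axioms A.vector_space_axioms k assms by blast
qed

lemma bilinear_formD:
  assumes "bilinear_form b"
  shows "b (u + v) f = b u f + b v f" "b (sg c u) f = c * b u f"
    and "b u (f + f') = b u f + b u f'" "b u (sA c f) = c * b u f"
  using assms unfolding bilinear_form_def Vector_Spaces.linear_iff by blast+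

lemma A_mult_scale: "f * sA c f' = sA c (f * f')"
  using A_scale_mult[of c f' f] by (simp only: mult.commute)

lemma tensor_bracket_tens: "tensor_bracket (tens u f) (tens v f') = tens (br u v) (f * f')"
proof
  fix b
  show "tensor_bracket (tens u f) (tens v f') b = tens (br u v) (f * f') b"
  proof (cases "bilinear_form b")
    case True
    have right: "bilinear_form (\<lambda>v f'. b (br u v) (f * f'))" for u f
      by (rule bilinear_formI; simp add: bilinear_formD[OF True] br_add_right
          br_scale_right distrib_left A_mult_scale)
    have left: "bilinear_form (\<lambda>u f. b (br u v) (f * f'))"
      by (rule bilinear_formI; simp add: bilinear_formD[OF True] br_add_left
          br_scale_left distrib_right A_scale_mult)
    have "tensor_bracket (tens u f) (tens v f') b =
            tens u f (\<lambda>u f. tens v f' (\<lambda>v f'. b (br u v) (f * f')))"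
      using True by (simp only: tensor_bracket_def if_True)
    also have "\<dots> = tens u f (\<lambda>u f. b (br u v) (f * f'))"
      by (simp only: tens_def[of v f'] right if_True)
    also have "\<dots> = tens (br u v) (f * f') b"
      using True by (simp only: tens_def left if_True)
    finally show ?thesis .
  qed (simp add: tensor_bracket_def tens_def)
qed

lemma tensor_act_tens:
  assumes "g \<in> carrier \<Gamma>"
  shows "tensor_act g (tens u f) = tens (actg g u) (actA g f)"
proof
  fix b
  interpret lg: Vector_Spaces.linear sg sg "actg g" by (rule actg_linear[OF assms])
  interpret lA: Vector_Spaces.linear sA sA "actA g" by (rule actA_linear[OF assms])
  have "bilinear_form (\<lambda>u f. b (actg g u) (actA g f))" if b: "bilinear_form b"
    by (rule bilinear_formI; simp add: bilinear_formD[OF b] lg.add lg.scale lA.add lA.scale)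
  then show "tensor_act g (tens u f) b = tens (actg g u) (actA g f) b"
    by (simp add: tensor_act_def tens_def)
qed

subsection \<open>Rational points and evaluation\<close>

definition rational_points :: "('a \<Rightarrow> 'k) set" where
  "rational_points =
     {x. Vector_Spaces.linear sA (*) x \<and> (\<forall>f f'. x (f * f') = x f * x f') \<and> x oneA = 1}"

text \<open>A point is identified with the homomorphism \<open>f \<mapsto> f(x)\<close>, so \<open>f(g \<cdot> x) = (g\<inverse> \<cdot> f)(x)\<close>.\<close>

definition point_act :: "'c \<Rightarrow> ('a \<Rightarrow> 'k) \<Rightarrow> 'a \<Rightarrow> 'k" where
  "point_act g x = (\<lambda>f. x (actA (inv g) f))"

definition fixed_subalgebra :: "'c set \<Rightarrow> 'g set" where
  "fixed_subalgebra H = {u. \<forall>g\<in>H. actg g u = u}"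

text \<open>The complement of the invariants, spanned by the elements \<open>g \<cdot> u - u\<close>.\<close>

definition coinvariant_part :: "'g set" where
  "coinvariant_part = span {actg g u - u | g u. g \<in> carrier \<Gamma>}"

definition isotropy_algebra :: "('a \<Rightarrow> 'k) \<Rightarrow> 'g set" where
  "isotropy_algebra x = fixed_subalgebra (stabilizer \<Gamma> point_act x)"

definition eval_at :: "('a \<Rightarrow> 'k) \<Rightarrow> (('g \<Rightarrow> 'a \<Rightarrow> 'k) \<Rightarrow> 'k) \<Rightarrow> 'g" where
  "eval_at x \<alpha> =
     (THE w. \<exists>(n::nat) u f. \<alpha> = (\<Sum>i<n. tens (u i) (f i)) \<and> w = (\<Sum>i<n. sg (x (f i)) (u i)))"

lemma eval_at_sum_tens:
  fixes n :: nat
  assumes x: "x \<in> rational_points"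
  shows "eval_at x (\<Sum>i<n. tens (u i) (f i)) = (\<Sum>i<n. sg (x (f i)) (u i))"
  unfolding eval_at_def
proof (rule the_equality)
  fix w
  assume "\<exists>(m::nat) v h. (\<Sum>i<n. tens (u i) (f i)) = (\<Sum>i<m. tens (v i) (h i)) \<and>
            w = (\<Sum>i<m. sg (x (h i)) (v i))"
  then obtain m :: nat and v h where
    eq: "(\<Sum>i<n. tens (u i) (f i)) = (\<Sum>i<m. tens (v i) (h i))" and
    w: "w = (\<Sum>i<m. sg (x (h i)) (v i))" by blast
  have k: "vector_space ((*) :: 'k \<Rightarrow> 'k \<Rightarrow> 'k)"
    by (rule vector_space.intro) (simp_all only: distrib_left distrib_right mult.assoc mult_1_left)
  have x_add: "x (f + f') = x f + x f'" and x_scale: "x (sA c f) = c * x f" for f f' c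
    using x unfolding rational_points_def Vector_Spaces.linear_iff by blast+
  let ?z = "w - (\<Sum>i<n. sg (x (f i)) (u i))"
  have sum_app: "(\<Sum>i<j. F i) b = (\<Sum>i<j. F i b)"
    for F :: "nat \<Rightarrow> ('g \<Rightarrow> 'a \<Rightarrow> 'k) \<Rightarrow> 'k" and b and j :: nat
    by (induction j) auto
  have separate: "\<phi> ?z = 0" if \<phi>: "Vector_Spaces.linear sg (*) \<phi>" for \<phi>
  proof -
    have hom: "module_hom sg (*) \<phi>"
      using \<phi> by (simp only: module_hom_iff_linear)
    have b: "bilinear_form (\<lambda>u f. \<phi> u * x f)"
      by (rule bilinear_formI)
        (simp_all only: module_hom.add[OF hom] module_hom.scale[OF hom] x_add x_scale
          distrib_left distrib_right mult.assoc mult.left_commute)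
    have "(\<Sum>i<n. \<phi> (u i) * x (f i)) = (\<Sum>i<m. \<phi> (v i) * x (h i))"
      using fun_cong[OF eq, of "\<lambda>u f. \<phi> u * x f"] by (simp only: sum_app tens_def b if_True)
    then show ?thesis
      by (simp only: w module_hom.diff[OF hom] module_hom.sum[OF hom] module_hom.scale[OF hom]
          mult.commute right_minus_eq)
  qed
  have "?z = 0"
  proof (rule ccontr)
    assume "?z \<noteq> 0"
    then have indep: "independent {?z}"
      by (simp only: independent_insert independent_empty span_empty empty_iff singleton_iff if_False
          not_False_eq_True simp_thms)
    have pair: "vector_space_pair sg ((*) :: 'k \<Rightarrow> 'k \<Rightarrow> 'k)"
      using vector_space_axioms k by (rule vector_space_pair.intro)
    obtain \<phi> where "Vector_Spaces.linear sg (*) \<phi>" "\<phi> ?z = (1 :: 'k)"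
      using vector_space_pair.linear_independent_extend[OF pair indep, of "\<lambda>_. 1"] by blast
    with separate show False by (metis zero_neq_one)
  qed
  then show "w = (\<Sum>i<n. sg (x (f i)) (u i))" by simp
qed blast

definition eval_rep ::
  "('a \<Rightarrow> 'k) set \<Rightarrow> (('a \<Rightarrow> 'k) \<Rightarrow> ('g, nat, 'k) rep) \<Rightarrow>
     ((('g \<Rightarrow> 'a \<Rightarrow> 'k) \<Rightarrow> 'k), (('a \<Rightarrow> 'k) \<Rightarrow> nat \<Rightarrow> 'k) \<Rightarrow> 'k, 'k) rep" where
  "eval_rep xs R =
     (tensor_product_space xs (\<lambda>x. fst (R x)),
      \<lambda>\<alpha>. tensor_rep_action xs (\<lambda>x. fst (R x)) (\<lambda>x. snd (R x)) (\<lambda>x. eval_at x \<alpha>))"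

subsection \<open>The sets \<open>\<E>\<close> and \<open>\<S>\<close> and the map between them\<close>

definition point_classes :: "('a \<Rightarrow> 'k) \<Rightarrow> ('g, nat, 'k) rep set set" where
  "point_classes x = irr_classes sg br (isotropy_algebra x)"

definition class_act :: "'c \<Rightarrow> ('g, nat, 'k) rep set \<Rightarrow> ('g, nat, 'k) rep set" where
  "class_act g C = (\<lambda>(V, \<rho>). (V, \<lambda>u. \<rho> (actg (inv g) u))) ` C"

definition class_support ::
  "(('a \<Rightarrow> 'k) \<Rightarrow> ('g, nat, 'k) rep set) \<Rightarrow> ('a \<Rightarrow> 'k) set" where
  "class_support \<Psi> =
     {x \<in> rational_points. \<Psi> x \<noteq> trivial_class sg br (isotropy_algebra x)}"

definition equivariant_class_functions :: "(('a \<Rightarrow> 'k) \<Rightarrow> ('g, nat, 'k) rep set) set" where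
  "equivariant_class_functions =
     {\<Psi> \<in> PiE rational_points point_classes.
        finite (class_support \<Psi>) \<and>
        (\<forall>g\<in>carrier \<Gamma>. \<forall>x\<in>rational_points. \<Psi> (point_act g x) = class_act g (\<Psi> x))}"

definition orbit_transversal :: "('a \<Rightarrow> 'k) set \<Rightarrow> ('a \<Rightarrow> 'k) set \<Rightarrow> bool" where
  "orbit_transversal Y xs \<longleftrightarrow>
     xs \<subseteq> Y \<and> (\<forall>x\<in>Y. \<exists>!y. y \<in> xs \<and> y \<in> orbit \<Gamma> point_act x)"

text \<open>
  The class of the evaluation representation for any choice of orbit representatives \<open>xs\<close> and of
  representations \<open>R x\<close> in the classes \<open>\<Psi> x\<close>. For empty support, \<open>xs\<close> is empty and the empty tensor
  product is the one-dimensional trivial representation.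
\<close>

definition ev_class ::
  "(('a \<Rightarrow> 'k) \<Rightarrow> ('g, nat, 'k) rep set) \<Rightarrow> (('g \<Rightarrow> 'a \<Rightarrow> 'k) \<Rightarrow> 'k, nat, 'k) rep set" where
  "ev_class \<Psi> =
     (THE C. \<exists>xs R. orbit_transversal (class_support \<Psi>) xs \<and> (\<forall>x\<in>xs. R x \<in> \<Psi> x) \<and>
        C = rep_class fscale tensor_bracket map_algebra (eval_rep xs R))"

definition map_algebra_classes :: "(('g \<Rightarrow> 'a \<Rightarrow> 'k) \<Rightarrow> 'k, nat, 'k) rep set set" where
  "map_algebra_classes = irr_classes fscale tensor_bracket map_algebra"

end

end

theory Submission
 imports Defs
begin

text \<open>
  Points enter through evaluation: the algebra \<open>M\<close> of equivariant maps surjects onto the direct sum of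
  the isotropy algebras at finitely many points in distinct orbits (\<open>evaluation_surjective\<close>, by
  averaging over the group a function that separates the points). Hence the factors of an evaluation
  representation can be acted on one at a time, and Burnside's theorem makes the tensor product of
  irreducible representations irreducible (\<open>tensor_rep_irreducible\<close>). Contracting the other factors
  recovers each factor from the tensor product (\<open>tensor_rep_factors_unique\<close>). Comparing two class
  functions on common orbit representatives of both supports, this gives injectivity.

  For surjectivity, let \<open>M\<close> be perfect and \<open>W\<close> irreducible with kernel \<open>K\<close>. An ideal of \<open>M\<close> that acts on
  \<open>W\<close> by commuting operators acts by scalars of trace zero, so it lies in \<open>K\<close>
  (\<open>perfect_abelian_ideal_acts_trivially\<close>). Consider the ideal of the functions \<open>f\<close> for which the averages
  of all \<open>u \<otimes> a f\<close> lie in \<open>K\<close>. By the previous remark it is a radical ideal, and \<open>K\<close> is stable under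
  multiplication by invariant functions, so that modulo the ideal the invariants are
  finite-dimensional. Therefore a prime ideal containing it has residue field \<open>k\<close>: the invariants
  become algebraic over \<open>k\<close>, and every function is integral over the invariants. So the ideal consists
  of all functions vanishing at certain rational points, which lie in finitely many orbits, and maps
  in \<open>M\<close> vanishing at representatives of these orbits act by 0 (\<open>kernel_determined_at_points\<close>). The
  action on \<open>W\<close> thus factors through the isotropy algebras at these representatives, which act by
  commuting operators, and \<open>W\<close> is a tensor product of irreducible representations of them
  (\<open>commuting_reps_factor\<close>, \<open>tensor_rep_universal\<close>).

  As to the three conditions: if brackets with fixed vectors span the Lie algebra, then averaging
  shows that \<open>M\<close> is perfect (\<open>perfect_if_commutator_full\<close>). When the Killing form is nondegenerate, this
  holds as soon as no nonzero vector is both orthogonal to the span of these brackets and centralized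
  by the fixed vectors (\<open>centralizer_zero_imp_commutator_full\<close>). In the simple case such a vector has
  average zero and spans a trivial submodule of the coinvariant part. For diagram automorphisms, a
  regular fixed element of the Cartan subalgebra and the sum of the simple root vectors have no common
  nonzero centralizing vector (\<open>chevalley_centralizer_zero\<close>).
\<close>

section \<open>Linear algebra on subspaces\<close>

abbreviation "flinear \<equiv> linear_on  fscale fscale"

definition finite_dim :: "('k::field => 'v::ab_group_add => 'v) => 'v set => bool" where
 "finite_dim s V \<longleftrightarrow> (\<exists>B. finite B & module.span s B = V)"

definition endo :: "('k::field => 'v::ab_group_add => 'v) => 'v set => ('v => 'v) => bool" where
 "endo s V T \<longleftrightarrow> T ` V \<subseteq> V & linear_on s s V T"

definition trace ::
 "('k::field => 'v::ab_group_add => 'v) => 'v set => ('v => 'v) => 'k" where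
 "trace s B T = (\<Sum>b\<in>B. module.representation s B (T b) b)"

lemma vector_space_mult: "vector_space ((*) :: 'k::field => 'k => 'k)"
 by (rule vector_space.intro) (simp_all add: algebra_simps)

lemma linear_on_add: "linear_on s t V T ==> u \<in> V ==> v \<in> V ==> T (u + v) = T u + T v"
 and linear_on_scale: "linear_on s t V T ==> v \<in> V ==> T (s c v) = t c (T v)"
 by (auto simp: linear_on_def)

lemma linear_on_subset: "linear_on s t V T ==> U \<subseteq> V ==> linear_on s t U T"
 unfolding linear_on_def by blast

context vector_space_pair
begin

lemma linear_on_zero:
 assumes "linear_on s1 s2 V T" "vs1.subspace V" shows "T 0 = 0"
 using linear_on_scale[OF assms(1), of 0 0] vs1.subspace_0[OF assms(2)] by simp

lemma linear_on_diff:
 assumes "linear_on s1 s2 V T" "vs1.subspace V" "u \<in> V" "v \<in> V"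
 shows "T (u - v) = T u - T v"
proof -
 have "T (u - v) + T v = T u"
  using linear_on_add[OF assms(1), of "u - v" v] vs1.subspace_diff[OF assms(2-4)] assms(4)
  by simp
 then show ?thesis by (simp add: algebra_simps)
qed

lemma linear_on_sum:
 assumes "linear_on s1 s2 V T" "vs1.subspace V" "!!i. i \<in> I ==> f i \<in> V"
 shows "T (\<Sum>i\<in>I. f i) = (\<Sum>i\<in>I. T (f i))"
 using assms(3)
proof (induction I rule: infinite_finite_induct)
 case (insert x F)
 then show ?case
  using linear_on_add[OF assms(1), of "f x" "sum f F"] vs1.subspace_sum[OF assms(2), of F f]
  by simp
qed (use linear_on_zero[OF assms(1,2)] in auto)

lemma linear_on_sum_scale:
 assumes "linear_on s1 s2 V T" "vs1.subspace V" "!!i. i \<in> I ==> f i \<in> V"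
 shows "T (\<Sum>i\<in>I. s1 (c i) (f i)) = (\<Sum>i\<in>I. s2 (c i) (T (f i)))"
 using linear_on_sum[OF assms(1,2), of I "\<lambda>i. s1 (c i) (f i)"] assms
  vs1.subspace_scale[OF assms(2)]
 by (simp add: linear_on_scale)

lemma linear_on_kernel_subspace:
 assumes "linear_on s1 s2 V T" "vs1.subspace V"
 shows "vs1.subspace {v \<in> V. T v = 0}"
 by (rule vs1.subspaceI)
  (use assms linear_on_zero[OF assms] vs1.subspace_0[OF assms(2)] vs1.subspace_add[OF assms(2)]
   vs1.subspace_scale[OF assms(2)] in
   \<open>auto simp: linear_on_add linear_on_scale\<close>)

lemma linear_on_image_subspace:
 assumes "linear_on s1 s2 V T" "vs1.subspace V"
 shows "vs2.subspace (T ` V)"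
proof (rule vs2.subspaceI)
 show "0 \<in> T ` V" using linear_on_zero[OF assms] vs1.subspace_0[OF assms(2)] by force
next
 fix x y assume "x \<in> T ` V" "y \<in> T ` V"
 then show "x + y \<in> T ` V"
  using vs1.subspace_add[OF assms(2)] by (auto simp: linear_on_add[OF assms(1), symmetric])
next
 fix c x assume "x \<in> T ` V"
 then show "s2 c x \<in> T ` V"
  using vs1.subspace_scale[OF assms(2)] by (auto simp: linear_on_scale[OF assms(1), symmetric])
qed

lemma linear_on_eq_span:
 assumes "linear_on s1 s2 (vs1.span B) T" "linear_on s1 s2 (vs1.span B) S"
  and "!!b. b \<in> B ==> T b = S b" and "v \<in> vs1.span B"
 shows "T v = S v"
proof -
 from assms(4) obtain t r where "finite t" "t \<subseteq> B" "v = (\<Sum>a\<in>t. s1 (r a) a)"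
  unfolding vs1.span_explicit by auto
 then show ?thesis
  using linear_on_sum_scale[OF assms(1) vs1.subspace_span, of t "\<lambda>x. x" r]
   linear_on_sum_scale[OF assms(2) vs1.subspace_span, of t "\<lambda>x. x" r] assms(3)
   vs1.span_base by (auto intro!: sum.cong simp: subset_eq)
qed

end

context vector_space
begin

lemma self_pair: "vector_space_pair scale scale"
 by unfold_locales

lemma field_pair: "vector_space_pair scale ((*) :: 'a => 'a => 'a)"
 using vector_space_mult vector_space_axioms by (auto simp: vector_space_pair_def)

lemma finite_dim_subspace: "finite_dim scale V ==> subspace V"
 by (auto simp: finite_dim_def)

lemma finite_dim_basis:
 assumes "finite_dim scale V" "subspace U" "U \<subseteq> V"
 obtains B where "finite B" "independent B" "span B = U" "card B = dim U" "card B \<le> dim V"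
proof -
 obtain B where B: "B \<subseteq> U" "independent B" "U \<subseteq> span B"
  using maximal_independent_subset by blast
 obtain C where C: "finite C" "span C = V" using assms(1) by (auto simp: finite_dim_def)
 obtain D where D: "D \<subseteq> V" "independent D" "V \<subseteq> span D"
  using maximal_independent_subset by blast
 have "finite D" using independent_span_bound[of C D] C D by auto
 then have "finite B & card B \<le> card D" using independent_span_bound[of D B] B D assms(3) by auto
 moreover have "card D = dim V" using basis_card_eq_dim D by blast
 moreover have "card B = dim U" using basis_card_eq_dim B by blast
 moreover have "span B = U" using B assms(2) by (simp add: span_minimal subset_antisym)
 ultimately show ?thesis using that[of B] B(2) by auto
qed

lemma finite_dim_subset:
 assumes "finite_dim scale V" "subspace U" "U \<subseteq> V" shows "finite_dim scale U"
 using finite_dim_basis[OF assms] by (metis finite_dim_def)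

lemma finite_dim_dim_le:
 assumes "finite_dim scale V" "subspace U" "U \<subseteq> V" shows "dim U \<le> dim V"
 using finite_dim_basis[OF assms] by metis

lemma finite_dim_dim_less:
 assumes "finite_dim scale V" "subspace U" "U \<subset> V" shows "dim U < dim V"
proof -
 obtain B where B: "finite B" "independent B" "span B = U" "card B = dim U"
  using finite_dim_basis[OF assms(1,2)] assms(3) by blast
 obtain v where v: "v \<in> V" "v \<notin> span B" using assms(3) B(3) by auto
 then have i: "independent (insert v B)" using B(2) independent_insertI by blast
 have V: "subspace V" using finite_dim_subspace assms(1) by auto
 have "span (insert v B) \<subseteq> V"
  by (rule span_minimal[OF _ V]) (use B(3) assms(3) v span_superset[of B] in auto)
 then have "dim (span (insert v B)) \<le> dim V"
  using finite_dim_dim_le[OF assms(1) subspace_span] by blast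
 moreover have "dim (span (insert v B)) = Suc (card B)"
  using dim_span_eq_card_independent[OF i] v(2) B(1) span_base by (metis card_insert_disjoint)
 ultimately show ?thesis using B(4) by simp
qed

lemma finite_dim_chain_dependent:
 assumes "finite_dim scale V" "!!i. v i \<in> V"
 shows "\<exists>n. v n \<in> span (v ` {..<n::nat})"
proof (rule ccontr)
 assume "\<not> ?thesis"
 then have n: "v n \<notin> span (v ` {..<n})" for n by auto
 have i: "independent (v ` {..<n}) & inj_on v {..<n}" for n
 proof (induction n)
  case (Suc n)
  then show ?case
   using n[of n] independent_insertI[OF n[of n]] span_base[of _ "v ` {..<n}"]
   by (auto simp: lessThan_Suc)
 qed (simp add: independent_empty)
 obtain C where C: "finite C" "span C = V" using assms(1) by (auto simp: finite_dim_def)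
 let ?n = "Suc (card C)"
 have "card (v ` {..<?n}) \<le> card C"
  using independent_span_bound[of C "v ` {..<?n}"] C i assms(2) by auto
 then show False using i[of ?n] card_image[of v "{..<?n}"] by simp
qed

lemma span_image_lessThan:
 assumes "w \<in> span (v ` {..<n::nat})"
 obtains c where "w = (\<Sum>i<n. c i *s v i)"
proof -
 have "\<exists>c. w = (\<Sum>i<n. c i *s v i)"
  using assms
 proof (induction n arbitrary: w)
  case (Suc n)
  then obtain k where "w - k *s v n \<in> span (v ` {..<n})"
   by (auto simp: lessThan_Suc span_insert)
  then obtain c where "w - k *s v n = (\<Sum>i<n. c i *s v i)" using Suc.IH by blast
  then have "w = (\<Sum>i<Suc n. (c(n := k)) i *s v i)" by (simp add: algebra_simps)
  then show ?case by blast
 qed simp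
 then show ?thesis using that by blast
qed

lemma finite_dim_minimal_subspace:
 assumes "finite_dim scale V" "P V" "!!U. P U ==> subspace U"
 obtains U where "P U" "U \<subseteq> V" "!!W. P W ==> W \<subseteq> U ==> W = U"
proof -
 have "\<exists>U. (P U & U \<subseteq> V) & (\<forall>W. P W & W \<subseteq> V --> dim U \<le> dim W)"
  using ex_has_least_nat[of "\<lambda>U. P U & U \<subseteq> V" V dim] assms(2) by auto
 then obtain U where U: "P U" "U \<subseteq> V" "!!W. P W & W \<subseteq> V ==> dim U \<le> dim W" by blast
 have "W = U" if "P W" "W \<subseteq> U" for W
 proof (rule ccontr)
  assume "W ~= U"
  then have "dim W < dim U"
   using that finite_dim_dim_less[OF finite_dim_subset[OF assms(1)], of U W] U assms(3) by auto
  then show False using U(3)[of W] that U(2) by auto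
 qed
 then show ?thesis using that U by blast
qed

lemma finite_dim_maximal_subspace:
 assumes "finite_dim scale V" "P U0" "!!U. P U ==> subspace U & U \<subseteq> V"
 obtains U where "P U" "!!W. P W ==> U \<subseteq> W ==> W = U"
proof -
 have "\<exists>U. P U & (\<forall>W. P W --> dim V - dim U \<le> dim V - dim W)"
  using ex_has_least_nat[of P U0 "\<lambda>U. dim V - dim U"] assms(2) by auto
 then obtain U where U: "P U" "!!W. P W ==> dim V - dim U \<le> dim V - dim W" by blast
 have "W = U" if "P W" "U \<subseteq> W" for W
 proof (rule ccontr)
  assume "W ~= U"
  then have "dim U < dim W"
   using that finite_dim_dim_less[OF finite_dim_subset[OF assms(1)], of W U] U assms(3) by auto
  then show False
   using U(2)[of W] that finite_dim_dim_le[OF assms(1)] assms(3)[OF that(1)] by fastforce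
 qed
 then show ?thesis using that U by blast
qed

lemma endo_in: "endo scale V T ==> v \<in> V ==> T v \<in> V"
 and endo_linear: "endo scale V T ==> linear_on scale scale V T"
 by (auto simp: endo_def)

lemma endo_funpow:
 assumes "endo scale V T" shows "endo scale V (T ^^ n)"
 using assms by (induction n) (auto simp: endo_def linear_on_def image_subset_iff)

lemma endo_subset:
 assumes "endo scale V T" "U \<subseteq> V" "T ` U \<subseteq> U" shows "endo scale U T"
 using assms linear_on_subset by (auto simp: endo_def)

end

text \<open>
  If a polynomial in \<open>T\<close> moves some vector of \<open>V\<close> into the subspace \<open>U\<close>, then \<open>T\<close> has an eigenvector
  modulo \<open>U\<close>: split off linear factors of the polynomial one at a time, and stop at the first one
  whose application lands in \<open>U\<close>.
\<close>

lemma eigenvector_modulo: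
 fixes s :: "'k::alg_closed_field => 'v::ab_group_add => 'v"
 assumes vs: "vector_space s" and V: "module.subspace s V" and U: "module.subspace s U"
  and T: "endo s V T" and TU: "T ` U \<subseteq> U"
  and v: "v \<in> V" "v \<notin> U" and p: "p ~= 0"
  and pv: "(\<Sum>i\<le>degree p. s (coeff p i) ((T ^^ i) v)) \<in> U"
 shows "\<exists>c w. w \<in> V & w \<notin> U & T w - s c w \<in> U"
proof -
 interpret vector_space s by (rule vs)
 interpret vector_space_pair s s by (rule self_pair)
 define E where "E p v = fold_coeffs (\<lambda>a w. s a v + T w) p 0" for p v
 have E0: "E 0 v = 0" for v by (simp add: E_def)
 have T0: "T 0 = 0" using linear_on_zero[OF endo_linear[OF T] V] .
 have EC: "E (pCons a p) v = s a v + T (E p v)" for a p v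
  by (cases "p = 0 & a = 0") (auto simp: E_def T0)
 have E_in: "E p v \<in> V" if "v \<in> V" for p v
  using that by (induction p)
   (auto simp: E0 EC subspace_0[OF V] intro!: subspace_add[OF V] subspace_scale[OF V] endo_in[OF T])
 have E_add: "E (p + q) v = E p v + E q v" if "v \<in> V" for p q v
  by (induction p q rule: poly_induct2)
   (use that in \<open>simp_all add: E0 EC linear_on_add[OF endo_linear[OF T]] E_in algebra_simps\<close>)
 have E_smult: "E (smult c p) v = s c (E p v)" if "v \<in> V" for p c v
  by (induction p)
   (use that in \<open>simp_all add: E0 EC linear_on_scale[OF endo_linear[OF T]] E_in algebra_simps\<close>)
 have E_lin: "E ([:-c, 1:] * q) v = T (E q v) - s c (E q v)" if "v \<in> V" for c q v
 proof -
  have "[:-c, 1:] * q = smult (-c) q + pCons 0 q" by simp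
  then show ?thesis
   by (simp only: E_add[OF that] E_smult[OF that] EC) simp
 qed
 have E_sum: "E p v = (\<Sum>i\<le>degree p. s (coeff p i) ((T ^^ i) v))" if "v \<in> V" for p v
 proof -
  have "E p v = (\<Sum>i\<le>n. s (coeff p i) ((T ^^ i) v))" if "degree p \<le> n" for n
   using that
  proof (induction n arbitrary: p)
   case 0
   then show ?case by (cases p) (auto simp: E0 EC T0 split: if_splits)
  next
   case (Suc n)
   obtain a q where p: "p = pCons a q" by (cases p)
   have "degree q \<le> n" using Suc.prems p by (auto split: if_splits)
   then have "E q v = (\<Sum>i\<le>n. s (coeff q i) ((T ^^ i) v))" by (rule Suc.IH)
   moreover have "(T ^^ i) v \<in> V" for i
    using endo_funpow[OF T] `v \<in> V` endo_in by blast
   ultimately have "T (E q v) = (\<Sum>i\<le>n. s (coeff q i) ((T ^^ Suc i) v))"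
    using linear_on_sum_scale[OF endo_linear[OF T] V, of "{..n}" "\<lambda>i. (T ^^ i) v" "coeff q"]
    by simp
   then show ?case unfolding p EC by (subst sum.atMost_Suc_shift) simp
  qed
  then show ?thesis by simp
 qed
 have "\<exists>c w. w \<in> V & w \<notin> U & T w - s c w \<in> U" if "p ~= 0" "E p v \<in> U" for p
  using that
 proof (induction "degree p" arbitrary: p)
  case 0
  then obtain a where a: "p = [:a:]" "a ~= 0" by (metis degree_eq_zeroE pCons_0_0)
  then have "s a v \<in> U" using 0 by (simp add: EC E0 T0)
  from subspace_scale[OF U this, of "inverse a"] show ?case using a v(2) by simp
 next
  case (Suc n)
  then obtain c where "poly p c = 0" using alg_closed_imp_poly_has_root[of p] by auto
  then obtain q where q: "p = [:-c, 1:] * q" by (auto simp: poly_eq_0_iff_dvd)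
  with Suc.prems have "q ~= 0" by auto
  then have "degree p = Suc (degree q)" unfolding q
   using degree_mult_eq[of "[:-c, 1:]" q] by (simp del: mult_pCons_left)
  show ?case
  proof (cases "E q v \<in> U")
   case True
   then show ?thesis using Suc `q ~= 0` `degree p = Suc (degree q)` by auto
  next
   case False
   then show ?thesis using E_lin[OF v(1)] Suc.prems(2) E_in[OF v(1)] unfolding q by metis
  qed
 qed
 then show ?thesis using p pv E_sum[OF v(1)] by metis
qed

context
 fixes s :: "'k::alg_closed_field => 'v::ab_group_add => 'v"
 assumes vs: "vector_space s"
begin

interpretation vector_space s by (rule vs)

lemma finite_dim_eigenvector_modulo:
 assumes V: "finite_dim s V" and U: "subspace U" and UV: "U \<subset> V"
  and T: "endo s V T" and TU: "T ` U \<subseteq> U"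
 shows "\<exists>c w. w \<in> V & w \<notin> U & T w - s c w \<in> U"
proof -
 obtain v where v: "v \<in> V" "v \<notin> U" using UV by auto
 have "(T ^^ i) v \<in> V" for i using endo_in[OF endo_funpow[OF T]] v(1) by blast
 then obtain n where "(T ^^ n) v \<in> span ((\<lambda>i. (T ^^ i) v) ` {..<n})"
  using finite_dim_chain_dependent[OF V, of "\<lambda>i. (T ^^ i) v"] by auto
 then obtain c where c: "(T ^^ n) v = (\<Sum>i<n. s (c i) ((T ^^ i) v))"
  by (rule span_image_lessThan)
 define p where "p = monom 1 n - (\<Sum>i<n. monom (c i) i)"
 have co: "coeff p i = (if i = n then 1 else if i < n then - c i else 0)" for i
  unfolding p_def by (auto simp: coeff_sum sum.delta)
 have "p ~= 0" using co[of n] by auto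
 moreover have "degree p = n"
  by (rule antisym) (use co in \<open>auto intro: degree_le le_degree\<close>)
 moreover have "(\<Sum>i\<le>n. s (coeff p i) ((T ^^ i) v)) = 0"
  unfolding lessThan_Suc_atMost[symmetric] by (simp add: co c sum_negf)
 ultimately show ?thesis
  using eigenvector_modulo[OF vs finite_dim_subspace[OF V] U T TU v, of p] subspace_0[OF U] by auto
qed

lemma finite_dim_eigenvector:
 assumes "finite_dim s V" "V ~= {0}" "endo s V T"
 obtains c w where "w \<in> V" "w ~= 0" "T w = s c w"
proof -
 have "subspace V" using assms finite_dim_subspace by blast
 then have "{0} \<subset> V" using assms subspace_0 by auto
 moreover have "T 0 = 0"
  using vector_space_pair.linear_on_zero[OF self_pair endo_linear[OF assms(3)]] `subspace V` .
 ultimately show ?thesis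
  using finite_dim_eigenvector_modulo[OF assms(1) subspace_single_0 _ assms(3)] that by force
qed

end

section \<open>The trace\<close>

context vector_space
begin

lemma representation_sum_scale:
 assumes "independent B" "!!i. i \<in> I ==> f i \<in> span B"
 shows "representation B (\<Sum>i\<in>I. c i *s f i) b = (\<Sum>i\<in>I. c i * representation B (f i) b)"
 using assms by (simp add: representation_sum span_scale representation_scale)

lemma trace_commute:
 assumes B: "finite B" "independent B" and C: "finite C" "independent C"
  and S: "S ` span B \<subseteq> span C" "linear_on scale scale (span B) S"
  and T: "T ` span C \<subseteq> span B" "linear_on scale scale (span C) T"
 shows "trace scale B (\<lambda>v. T (S v)) = trace scale C (\<lambda>v. S (T v))"
proof -
 interpret vector_space_pair scale scale by (rule self_pair)
 have 1: "representation B (T (S b)) b' =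
   (\<Sum>c\<in>C. representation C (S b) c * representation B (T c) b')" if "b \<in> B" for b b'
 proof -
  have "S b \<in> span C" using S(1) that span_base by blast
  then have "S b = (\<Sum>c\<in>C. representation C (S b) c *s c)"
   using sum_representation_eq[OF C(2) _ C(1) subset_refl] by metis
  then have "T (S b) = T (\<Sum>c\<in>C. representation C (S b) c *s c)" by simp
  also have "\<dots> = (\<Sum>c\<in>C. representation C (S b) c *s T c)"
   using linear_on_sum_scale[OF T(2) subspace_span, of C "\<lambda>x. x"] by (simp add: span_base)
  finally show ?thesis
   using representation_sum_scale[OF B(2), of C T] T(1) span_base by (auto simp: image_subset_iff)
 qed
 have 2: "representation C (S (T c)) c' =
   (\<Sum>b\<in>B. representation B (T c) b * representation C (S b) c')" if "c \<in> C" for c c'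
 proof -
  have "T c \<in> span B" using T(1) that span_base by blast
  then have "T c = (\<Sum>b\<in>B. representation B (T c) b *s b)"
   using sum_representation_eq[OF B(2) _ B(1) subset_refl] by metis
  then have "S (T c) = S (\<Sum>b\<in>B. representation B (T c) b *s b)" by simp
  also have "\<dots> = (\<Sum>b\<in>B. representation B (T c) b *s S b)"
   using linear_on_sum_scale[OF S(2) subspace_span, of B "\<lambda>x. x"] by (simp add: span_base)
  finally show ?thesis
   using representation_sum_scale[OF C(2), of B S] S(1) span_base by (auto simp: image_subset_iff)
 qed
 have "trace scale B (\<lambda>v. T (S v)) =
   (\<Sum>b\<in>B. \<Sum>c\<in>C. representation C (S b) c * representation B (T c) b)"
  unfolding trace_def using 1 by simp
 also have "\<dots> = trace scale C (\<lambda>v. S (T v))"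
  unfolding trace_def using 2 by (subst sum.swap) (simp add: mult.commute)
 finally show ?thesis .
qed

lemma trace_add:
 assumes "independent B" "!!b. b \<in> B ==> S b \<in> span B" "!!b. b \<in> B ==> T b \<in> span B"
 shows "trace scale B (\<lambda>v. S v + T v) = trace scale B S + trace scale B T"
 using assms by (simp add: trace_def representation_add sum.distrib)

lemma trace_diff:
 assumes "independent B" "!!b. b \<in> B ==> S b \<in> span B" "!!b. b \<in> B ==> T b \<in> span B"
 shows "trace scale B (\<lambda>v. S v - T v) = trace scale B S - trace scale B T"
 using assms by (simp add: trace_def representation_diff sum_subtractf)

lemma trace_scale:
 assumes "independent B" "!!b. b \<in> B ==> T b \<in> span B"
 shows "trace scale B (\<lambda>v. c *s T v) = c * trace scale B T"
 using assms by (simp add: trace_def representation_scale sum_distrib_left)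

lemma trace_cong:
 assumes "!!b. b \<in> B ==> S b = T b" shows "trace scale B S = trace scale B T"
 using assms by (simp add: trace_def)

lemma trace_scalar:
 assumes "finite B" "independent B"
 shows "trace scale B (\<lambda>v. c *s v) = c * of_nat (card B)"
 using assms by (simp add: trace_def representation_scale span_base representation_basis)

lemma trace_commutator:
 assumes "finite B" "independent B" "endo scale (span B) S" "endo scale (span B) T"
 shows "trace scale B (\<lambda>v. S (T v) - T (S v)) = 0"
proof -
 have "S (T b) \<in> span B" "T (S b) \<in> span B" if "b \<in> B" for b
  using endo_in[OF assms(3) endo_in[OF assms(4) span_base[OF that]]]
   endo_in[OF assms(4) endo_in[OF assms(3) span_base[OF that]]] .
 then have "trace scale B (\<lambda>v. S (T v) - T (S v)) = trace scale B (\<lambda>v. S (T v)) - trace scale B (\<lambda>v. T (S v))"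
  by (rule trace_diff[OF assms(2)])
 also have "\<dots> = 0" using trace_commute[OF assms(1,2,1,2), of T S] assms(3,4)
  by (simp add: endo_def)
 finally show ?thesis .
qed

text \<open>
  A nilpotent operator factors through its image, so cyclicity of the trace replaces the space by
  the image, on which the order of nilpotency has dropped.
\<close>

lemma trace_nilpotent:
 assumes "finite B" "independent B" "endo scale (span B) T" "!!v. v \<in> span B ==> (T ^^ n) v = 0"
 shows "trace scale B T = 0"
 using assms
proof (induction n arbitrary: B)
 case 0
 then have "B = {}"
  using dependent_zero span_base by (metis all_not_in_conv funpow_0)
 then show ?case by (simp add: trace_def)
next
 case (Suc n)
 interpret vector_space_pair scale scale by (rule self_pair)
 have V: "finite_dim scale (span B)" using Suc.prems(1) by (auto simp: finite_dim_def)
 have "subspace (T ` span B)"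
  using linear_on_image_subspace[OF endo_linear[OF Suc.prems(3)] subspace_span] .
 moreover have sub: "T ` span B \<subseteq> span B" using Suc.prems(3) by (auto simp: endo_def)
 ultimately obtain C where C: "finite C" "independent C" "span C = T ` span B"
  using finite_dim_basis[OF V] by metis
 have "linear_on scale scale (span C) T"
  using linear_on_subset[OF endo_linear[OF Suc.prems(3)]] sub C(3) by auto
 have "trace scale B T = trace scale C T"
  using trace_commute[OF Suc.prems(1,2) C(1,2), of T "\<lambda>v. v"] sub C(3)
   endo_linear[OF Suc.prems(3)] linear_on_subset[OF endo_linear[OF Suc.prems(3)] sub]
  by (auto simp: linear_on_def[of _ _ _ "\<lambda>v. v"])
 also have "trace scale C T = 0"
 proof (rule Suc.IH[OF C(1,2)])
  show "endo scale (span C) T"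
   using endo_subset[OF Suc.prems(3)] sub C(3) by auto
  show "(T ^^ n) v = 0" if "v \<in> span C" for v
   using that Suc.prems(4) unfolding C(3) by (auto simp: funpow_swap1)
 qed
 finally show ?case .
qed

lemma trace_basis_change:
 assumes "finite B" "independent B" "finite C" "independent C" "span B = span C"
  and "endo scale (span B) T"
 shows "trace scale B T = trace scale C T"
 using trace_commute[OF assms(1-4), of T "\<lambda>v. v"] assms(5,6)
 by (auto simp: endo_def linear_on_def)

end

lemma (in vector_space) subspace_scale_cancel:
 assumes "subspace S" "c *s v \<in> S" "c ~= 0" shows "v \<in> S"
 using subspace_scale[OF assms(1,2), of "inverse c"] assms(3) by simp

section \<open>Abelian ideals in irreducible representations\<close>

text \<open>
  A common eigenvector \<open>v\<close> of the ideal stays one after applying \<open>a\<close>. Modulo the span of the earlier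
  vectors, \<open>j - \<lambda> j\<close> sends \<open>a\<^sup>i v\<close> to \<open>i \<mu> a\<^sup>i\<^sup>-\<^sup>1 v\<close>, where \<open>\<mu>\<close> is the eigenvalue of \<open>[j, a]\<close>. Applied to the
  first linear dependence among the \<open>a\<^sup>i v\<close>, this produces an earlier one unless \<open>\<mu> = 0\<close>; this is where
  characteristic zero enters.
\<close>

lemma abelian_ideal_acts_by_scalars:
 fixes s :: "'k::{alg_closed_field, field_char_0} => 'v::ab_group_add => 'v"
  and \<rho> :: "'l => 'v => 'v"
 assumes vs: "vector_space s" and V: "finite_dim s V" "V ~= {0}"
  and endo: "!!a. a \<in> L ==> endo s V (\<rho> a)"
  and J: "J \<subseteq> L" "!!j a. j \<in> J ==> a \<in> L ==> bk j a \<in> J"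
  and bk: "!!j a v. j \<in> J ==> a \<in> L ==> v \<in> V ==> \<rho> (bk j a) v = \<rho> j (\<rho> a v) - \<rho> a (\<rho> j v)"
  and comm: "!!i j v. i \<in> J ==> j \<in> J ==> v \<in> V ==> \<rho> i (\<rho> j v) = \<rho> j (\<rho> i v)"
  and irr: "!!W. module.subspace s W ==> W \<subseteq> V ==> (!!a. a \<in> L ==> \<rho> a ` W \<subseteq> W) ==> W = {0} \<or> W = V"
 shows "\<exists>l. \<forall>j\<in>J. \<forall>v\<in>V. \<rho> j v = s (l j) v"
proof -
 interpret vector_space s by (rule vs)
 interpret vector_space_pair s s by (rule self_pair)
 note sV = finite_dim_subspace[OF V(1)]
 note lin = endo_linear[OF endo] and inV = endo_in[OF endo]
 define P where "P U \<longleftrightarrow> subspace U & U \<subseteq> V & U ~= {0} & (\<forall>j\<in>J. \<rho> j ` U \<subseteq> U)" for U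
 have "P V" using V sV inV J(1) by (auto simp: P_def)
 then obtain V0 where V0: "P V0" "V0 \<subseteq> V" and min: "!!W. P W ==> W \<subseteq> V0 ==> W = V0"
  using finite_dim_minimal_subspace[OF V(1), of P] by (metis P_def)
 have sV0: "subspace V0" and n0: "V0 ~= {0}" using V0 by (auto simp: P_def)
 have "\<exists>c. \<forall>v\<in>V0. \<rho> j v = s c v" if j: "j \<in> J" for j
 proof -
  have jL: "j \<in> L" using j J(1) by auto
  have "endo s V0 (\<rho> j)"
   using endo_subset[OF endo[OF jL] V0(2)] V0(1) j by (auto simp: P_def)
  then obtain c w where w: "w \<in> V0" "w ~= 0" "\<rho> j w = s c w"
   using finite_dim_eigenvector[OF vs finite_dim_subset[OF V(1) sV0 V0(2)] n0] by metis
  define E where "E = {v \<in> V0. \<rho> j v = s c v}"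
  have "P E"
  proof -
   have "subspace E"
    by (rule subspaceI) (use V0(2) subspace_0[OF sV0] linear_on_zero[OF lin[OF jL] sV]
      subspace_add[OF sV0] subspace_scale[OF sV0]
      linear_on_add[OF lin[OF jL]] linear_on_scale[OF lin[OF jL]] in
      \<open>auto simp: E_def scale_right_distrib subset_iff mult.commute\<close>)
   moreover have "\<rho> i v \<in> E" if "i \<in> J" "v \<in> E" for i v
   proof -
    have v: "v \<in> V0" "\<rho> j v = s c v" "v \<in> V" using that V0(2) by (auto simp: E_def)
    have "\<rho> j (\<rho> i v) = \<rho> i (s c v)" using comm[OF j that(1) v(3)] v by simp
    also have "\<dots> = s c (\<rho> i v)" using linear_on_scale[OF lin] that(1) J(1) v(3) by blast
    finally show ?thesis using V0(1) that v(1) by (auto simp: E_def P_def)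
   qed
   ultimately show ?thesis using w V0(2) by (auto simp: P_def E_def)
  qed
  then have "E = V0" by (rule min) (auto simp: E_def)
  then show ?thesis by (auto simp: E_def)
 qed
 then obtain l where l: "!!j v. j \<in> J ==> v \<in> V0 ==> \<rho> j v = s (l j) v" by metis
 define E where "E = {v \<in> V. \<forall>j\<in>J. \<rho> j v = s (l j) v}"
 have sE: "subspace E"
  by (rule subspaceI) (use J(1) subspace_0[OF sV] linear_on_zero[OF lin sV]
    subspace_add[OF sV] subspace_scale[OF sV]
    linear_on_add[OF lin] linear_on_scale[OF lin] in
    \<open>auto simp: E_def scale_right_distrib subset_iff mult.commute\<close>)
 have "V0 \<subseteq> E" using l V0(2) by (auto simp: E_def)
 then have nE: "E ~= {0}" using n0 subspace_0[OF sV0] by auto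
 have mu: "l (bk j a) = 0" if a: "a \<in> L" and j: "j \<in> J" and v: "v \<in> E" "v ~= 0" for a j v
 proof -
  define x where "x i = (\<rho> a ^^ i) v" for i
  define W where "W i = span (x ` {..<i})" for i
  have vV: "v \<in> V" using v by (auto simp: E_def)
  have xV: "x i \<in> V" for i using endo_in[OF endo_funpow[OF endo[OF a]] vV] by (simp add: x_def)
  have xS: "x (Suc i) = \<rho> a (x i)" for i by (simp add: x_def)
  have WV: "W i \<subseteq> V" for i unfolding W_def by (rule span_minimal[OF _ sV]) (use xV in auto)
  have W_mono: "W i \<subseteq> W k" if "i \<le> k" for i k
   unfolding W_def by (rule span_mono) (use that in auto)
  have sW: "subspace (W i)" for i by (simp add: W_def)
  have xW: "x i \<in> W k" if "i < k" for i k using that by (auto simp: W_def intro: span_base)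
  have aW: "\<rho> a w \<in> W k" if "w \<in> W i" "i < k" for w i k
  proof -
   have "w \<in> V & \<rho> a w \<in> W k"
    using that(1) unfolding W_def[of i]
   proof (induction rule: span_induct_alt)
    case base
    then show ?case using linear_on_zero[OF lin[OF a] sV] subspace_0 sW sV by simp
   next
    case (step c y z)
    then obtain n where n: "y = x n" "n < i" by auto
    then have "s c (\<rho> a y) \<in> W k"
     using xW[of "Suc n" k] that(2) subspace_scale[OF sW] by (simp add: xS)
    then show ?case
     using step n xV subspace_add[OF sV] subspace_scale[OF sV] subspace_add[OF sW]
      linear_on_add[OF lin[OF a]] linear_on_scale[OF lin[OF a]] by simp
   qed
   then show ?thesis ..
  qed
  define m where "m j = l (bk j a)" for j
  have N: "\<rho> j (x i) - s (l j) (x i) - s (of_nat i * m j) (x (i - 1)) \<in> W (i - 1)"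
   if "j \<in> J" for j i
   using that
  proof (induction i arbitrary: j)
   case 0
   then show ?case using v subspace_0[OF sW] by (simp add: x_def E_def)
  next
   case (Suc i)
   define b where "b = bk j a"
   have b: "b \<in> J" using J(2)[OF Suc.prems a] by (simp add: b_def)
   define w where "w = \<rho> j (x i) - s (l j) (x i) - s (of_nat i * m j) (x (i - 1))"
   define w' where "w' = \<rho> b (x i) - s (l b) (x i) - s (of_nat i * m b) (x (i - 1))"
   have w: "w \<in> W (i - 1)" "w' \<in> W (i - 1)"
    using Suc.IH[OF Suc.prems] Suc.IH[OF b] by (auto simp: w_def w'_def)
   have aw: "\<rho> a w \<in> W i"
   proof (cases i)
    case 0
    then have "w = 0" using w by (simp add: W_def)
    then show ?thesis using linear_on_zero[OF lin[OF a] sV] subspace_0[OF sW] by simp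
   qed (use aW[OF w(1), of i] in auto)
   have w'i: "w' \<in> W i" using w W_mono[of "i - 1" i] by auto
   have t: "s (of_nat i * m b) (x (i - 1)) \<in> W i"
    by (cases i) (use subspace_0[OF sW] subspace_scale[OF sW] xW in auto)
   have t': "\<rho> a (s (of_nat i * m j) (x (i - 1))) = s (of_nat i * m j) (x i)"
    by (cases i) (use linear_on_scale[OF lin[OF a] xV] linear_on_zero[OF lin[OF a] sV] xS in auto)
   have e: "\<rho> j (x i) = s (l j) (x i) + s (of_nat i * m j) (x (i - 1)) + w"
    by (simp add: w_def)
   have "\<rho> j (x (Suc i)) = \<rho> a (\<rho> j (x i)) + \<rho> b (x i)"
    using bk[OF Suc.prems a xV] by (simp add: xS b_def)
   also have "\<rho> a (\<rho> j (x i)) = s (l j) (x (Suc i)) + s (of_nat i * m j) (x i) + \<rho> a w"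
    unfolding e using w(1) WV t' xS
    by (subst linear_on_add[OF lin[OF a]] |
      use xV subspace_add[OF sV] subspace_scale[OF sV] in \<open>force simp: linear_on_scale[OF lin[OF a]]\<close>)+
   also have "\<rho> b (x i) = s (m j) (x i) + s (of_nat i * m b) (x (i - 1)) + w'"
    by (simp add: w'_def m_def b_def)
   finally have "\<rho> j (x (Suc i)) - s (l j) (x (Suc i)) - s (of_nat (Suc i) * m j) (x (Suc i - 1))
     = \<rho> a w + s (of_nat i * m b) (x (i - 1)) + w'"
    by (simp add: algebra_simps)
   then show ?case using aw w'i t subspace_add[OF sW] by simp
  qed
  have NW: "\<rho> j w - s (l j) w \<in> W (k - 1)" if "w \<in> W k" for w k
  proof -
   have "w \<in> V & \<rho> j w - s (l j) w \<in> W (k - 1)"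
    using that unfolding W_def[of k]
   proof (induction rule: span_induct_alt)
    case base
    then show ?case using linear_on_zero[OF lin sV] j J(1) subspace_0 sW sV by auto
   next
    case (step c y z)
    then obtain n where n: "y = x n" "n < k" by auto
    have "s (of_nat n * m j) (x (n - 1)) \<in> W (k - 1)"
     by (cases n) (use n subspace_0[OF sW] subspace_scale[OF sW] xW in auto)
    then have y: "\<rho> j y - s (l j) y \<in> W (k - 1)"
     using subspace_add[OF sW, of _ "k - 1"] N[OF j, of n] W_mono[of "n - 1" "k - 1"] n
     by (metis diff_add_cancel diff_le_mono less_imp_le_nat subsetD)
    have "\<rho> j (s c y + z) - s (l j) (s c y + z) = s c (\<rho> j y - s (l j) y) + (\<rho> j z - s (l j) z)"
     using step n xV subspace_scale[OF sV] j J(1) linear_on_add[OF lin] linear_on_scale[OF lin]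
     by (simp add: subset_iff algebra_simps)
    then show ?case
     using step n xV y subspace_add[OF sV] subspace_scale[OF sV] subspace_add[OF sW]
      subspace_scale[OF sW] by simp
   qed
   then show ?thesis ..
  qed
  define n where "n = (LEAST n. x n \<in> W n)"
  have ex: "\<exists>n. x n \<in> W n"
   using finite_dim_chain_dependent[OF V(1), of x] xV by (simp add: W_def)
  have n: "x n \<in> W n" unfolding n_def by (rule LeastI_ex[OF ex])
  have n_pos: "n ~= 0" using n v(2) by (cases n) (auto simp: W_def x_def)
  have nn: "x (n - 1) \<notin> W (n - 1)" using not_less_Least[of "n - 1" "\<lambda>n. x n \<in> W n"] n_pos
   by (simp add: n_def)
  have "s (of_nat n * m j) (x (n - 1)) \<in> W (n - 1)"
   using subspace_diff[OF sW NW[OF n] N[OF j]] by simp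
  then have "of_nat n * m j = 0"
   using subspace_scale_cancel[OF sW] nn by blast
  then show ?thesis using n_pos by (simp add: m_def)
 qed
 have "\<rho> a v \<in> E" if a: "a \<in> L" and v: "v \<in> E" for a v
 proof (cases "v = 0")
  case True
  then show ?thesis using linear_on_zero[OF lin[OF a] sV] v by simp
 next
  case False
  have vV: "v \<in> V" using v by (auto simp: E_def)
  have "\<rho> j (\<rho> a v) = s (l j) (\<rho> a v)" if j: "j \<in> J" for j
  proof -
   have "\<rho> (bk j a) v = 0" using mu[OF a j v False] J(2)[OF j a] v by (simp add: E_def)
   then have "\<rho> j (\<rho> a v) = \<rho> a (\<rho> j v)" using bk[OF j a vV] by simp
   then show ?thesis using v j linear_on_scale[OF lin[OF a] vV] by (simp add: E_def)
  qed
  then show ?thesis using inV[OF a vV] by (simp add: E_def)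
 qed
 then have "E = V" using irr[OF sE] nE by (auto simp: E_def)
 then show ?thesis by (auto simp: E_def)
qed

lemma trace_sum_of_commutators:
 fixes s :: "'k::field => 'v::ab_group_add => 'v" and sl :: "'k => 'l::ab_group_add => 'l"
 assumes vs: "vector_space s" "vector_space sl"
  and L: "module.subspace sl L" and br: "!!a b. a \<in> U ==> b \<in> U' ==> br a b \<in> L"
  and UL: "U \<subseteq> L" "U' \<subseteq> L"
  and B: "finite B" "module.span s B = V" "\<not> module.dependent s B"
  and endo: "!!a. a \<in> L ==> endo s V (\<rho> a)"
  and lin: "!!v. v \<in> V ==> linear_on sl s L (\<lambda>a. \<rho> a v)"
  and brk: "!!a b v. a \<in> U ==> b \<in> U' ==> v \<in> V ==> \<rho> (br a b) v = \<rho> a (\<rho> b v) - \<rho> b (\<rho> a v)"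
  and a: "a \<in> module.span sl {br u v | u v. u \<in> U & v \<in> U'}"
 shows "trace s B (\<rho> a) = 0"
proof -
 interpret vector_space s by (rule vs)
 interpret l: vector_space sl by (rule vs)
 interpret p: vector_space_pair sl s by unfold_locales
 have BV: "b \<in> V" if "b \<in> B" for b using B(2) that span_base by auto
 have "a \<in> L & trace s B (\<rho> a) = 0"
  using a
 proof (induction rule: l.span_induct_alt)
  case base
  have "\<rho> 0 b = 0" if "b \<in> B" for b using p.linear_on_zero[OF lin L] BV that by blast
  then have "trace s B (\<rho> 0) = 0" using representation_zero by (simp add: trace_def)
  then show ?case using l.subspace_0[OF L] by simp
 next
  case (step c x y)
  then obtain u v where x: "x = br u v" "u \<in> U" "v \<in> U'" by auto
  then have xL: "x \<in> L" using br by auto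
  have "trace s B (\<rho> x) = trace s B (\<lambda>w. \<rho> u (\<rho> v w) - \<rho> v (\<rho> u w))"
   unfolding x(1) by (rule trace_cong) (use brk x BV in auto)
  also have "\<dots> = 0" using trace_commutator[OF B(1,3)] endo x UL unfolding B(2) by blast
  finally have t: "trace s B (\<rho> x) = 0" .
  have in_span: "\<rho> z b \<in> span B" if "z \<in> L" "b \<in> B" for z b
   using endo_in[OF endo] BV that unfolding B(2) by blast
  have "trace s B (\<rho> (sl c x + y)) = trace s B (\<lambda>b. s c (\<rho> x b) + \<rho> y b)"
   by (rule trace_cong)
    (use lin[OF BV] xL step l.subspace_scale[OF L] in \<open>simp add: linear_on_def\<close>)
  also have "\<dots> = trace s B (\<lambda>b. s c (\<rho> x b)) + trace s B (\<rho> y)"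
   by (rule trace_add[OF B(3)]) (use in_span xL step span_scale in auto)
  also have "trace s B (\<lambda>b. s c (\<rho> x b)) = c * trace s B (\<rho> x)"
   by (rule trace_scale[OF B(3)]) (use in_span xL in auto)
  finally show ?case using t step xL l.subspace_add[OF L] l.subspace_scale[OF L] by simp
 qed
 then show ?thesis ..
qed

section \<open>Generalized eigenspaces\<close>

definition shift :: "('k::field => 'v::ab_group_add => 'v) => ('v => 'v) => 'k => 'v => 'v" where
 "shift s T c v = T v - s c v"

definition geig :: "('k::field => 'v::ab_group_add => 'v) => ('v => 'v) => 'k => 'v set" where
 "geig s T c = {v. \<exists>n. (shift s T c ^^ n) v = 0}"

lemma funpow_zero_mono:
 fixes S :: "'v::zero => 'v"
 assumes "(S ^^ n) v = 0" "S 0 = 0" "n \<le> m" shows "(S ^^ m) v = 0"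
proof -
 have "(S ^^ k) 0 = 0" for k using assms(2) by (induction k) auto
 moreover have "(S ^^ m) v = (S ^^ (m - n)) ((S ^^ n) v)"
  using assms(3) by (metis comp_apply funpow_add le_add_diff_inverse2)
 ultimately show ?thesis using assms(1) by simp
qed

lemma (in vector_space) geig_zero_iff: "v \<in> geig scale T 0 \<longleftrightarrow> (\<exists>n. (T ^^ n) v = 0)"
proof -
 have "shift scale T 0 = T" by (simp add: shift_def fun_eq_iff)
 then show ?thesis by (simp add: geig_def)
qed

lemma (in vector_space) trace_locally_nilpotent:
 assumes C: "finite C" "independent C" and N: "endo scale (span C) N"
  and nil: "!!v. v \<in> span C ==> \<exists>n. (N ^^ n) v = 0"
 shows "trace scale C N = 0"
proof -
 interpret vector_space_pair scale scale by (rule self_pair)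
 have "\<exists>n. (N ^^ n) b = 0" if "b \<in> C" for b using nil span_base that by blast
 then obtain n where n: "!!b. b \<in> C ==> (N ^^ n b) b = 0" by metis
 have N0: "N 0 = 0" by (rule linear_on_zero[OF endo_linear[OF N] subspace_span])
 define m where "m = (\<Sum>b\<in>C. n b)"
 have "(N ^^ m) b = 0" if "b \<in> C" for b
  by (rule funpow_zero_mono[OF n N0]) (use that C(1) in \<open>simp_all add: m_def member_le_sum\<close>)
 then have "(N ^^ m) v = 0" if "v \<in> span C" for v
  using linear_on_eq_span[of C "N ^^ m" "\<lambda>_. 0" v] that endo_funpow[OF N, of m]
  by (auto simp: endo_def linear_on_def)
 then show ?thesis by (rule trace_nilpotent[OF C N])
qed

context
 fixes s :: "'k::field => 'v::ab_group_add => 'v" and T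
 assumes vs: "vector_space s" and T: "linear_on s s UNIV T"
begin

interpretation vector_space s by (rule vs)
interpretation vector_space_pair s s by (rule self_pair)

lemma shift_linear: "linear_on s s UNIV (shift s T c)"
 using T by (simp add: linear_on_def shift_def algebra_simps)

lemma shift_funpow_linear: "linear_on s s UNIV (shift s T c ^^ n)"
 using endo_funpow[of UNIV "shift s T c" n] shift_linear by (simp add: endo_def)

lemma shift_zero: "shift s T c 0 = 0"
 by (rule linear_on_zero[OF shift_linear subspace_UNIV])

lemma geig_subspace: "subspace (geig s T c)"
proof (rule subspaceI)
 show "0 \<in> geig s T c" by (auto simp: geig_def intro!: exI[of _ 0])
next
 fix x y assume "x \<in> geig s T c" "y \<in> geig s T c"
 then obtain n m where "(shift s T c ^^ n) x = 0" "(shift s T c ^^ m) y = 0"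
  by (auto simp: geig_def)
 then have "(shift s T c ^^ (n + m)) x = 0" "(shift s T c ^^ (n + m)) y = 0"
  using funpow_zero_mono[of n "shift s T c" x "n + m"] funpow_zero_mono[of m "shift s T c" y "n + m"]
   shift_zero by auto
 then have "(shift s T c ^^ (n + m)) (x + y) = 0"
  using linear_on_add[OF shift_funpow_linear, of x y "n + m" c] by simp
 then show "x + y \<in> geig s T c" unfolding geig_def by blast
next
 fix k x assume "x \<in> geig s T c"
 then obtain n where "(shift s T c ^^ n) x = 0" by (auto simp: geig_def)
 then have "(shift s T c ^^ n) (s k x) = 0"
  using linear_on_scale[OF shift_funpow_linear, of x n c k] by simp
 then show "s k x \<in> geig s T c" unfolding geig_def by blast
qed

lemma geigI_shift: "shift s T c v \<in> geig s T c ==> v \<in> geig s T c"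
 unfolding geig_def by (auto simp: funpow_swap1[symmetric] intro: exI[of _ "Suc n" for n])

lemma shift_in_geig:
 assumes "v \<in> geig s T c" shows "shift s T d v \<in> geig s T c"
proof -
 obtain n where "(shift s T c ^^ n) v = 0" using assms by (auto simp: geig_def)
 then have "(shift s T c ^^ Suc n) v = 0" using shift_zero by simp
 then have "(shift s T c ^^ n) (shift s T c v) = 0" by (simp add: funpow_swap1)
 then have "shift s T c v \<in> geig s T c" unfolding geig_def by blast
 moreover have "shift s T d v = shift s T c v + s (c - d) v"
  by (simp add: shift_def algebra_simps)
 ultimately show ?thesis
  using geig_subspace[of c] assms subspace_add subspace_scale by metis
qed

lemma geig_shift_inj:
 assumes "v \<in> geig s T c" "shift s T d v = 0" "c ~= d" shows "v = 0"
proof -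
 obtain n where n: "(shift s T c ^^ n) v = 0" using assms by (auto simp: geig_def)
 have T': "shift s T c v = s (d - c) v" using assms(2) by (simp add: shift_def algebra_simps)
 have "(shift s T c ^^ n) v = s ((d - c) ^ n) v" for n
  by (induction n) (simp_all add: linear_on_scale[OF shift_linear] T' mult.commute)
 then show ?thesis using n assms(3) by simp
qed

lemma geig_shift_surj:
 assumes V: "subspace V" "T ` V \<subseteq> V" and u: "u \<in> geig s T c" "u \<in> V" and "c ~= d"
 shows "\<exists>w \<in> geig s T c \<inter> V. shift s T d w = u"
proof -
 obtain n where "(shift s T c ^^ n) u = 0" using u by (auto simp: geig_def)
 then show ?thesis using u
 proof (induction n arbitrary: u)
  case 0
  then show ?case using subspace_0[OF geig_subspace] subspace_0[OF V(1)] shift_zero by auto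
 next
  case (Suc n)
  have "shift s T c u \<in> V"
   using Suc.prems V subspace_diff subspace_scale by (auto simp: shift_def)
  then obtain w where w: "w \<in> geig s T c" "w \<in> V" "shift s T d w = shift s T c u"
   using Suc.IH[of "shift s T c u"] Suc.prems shift_in_geig by (auto simp: funpow_swap1)
  let ?w = "s (inverse (c - d)) (u - w)"
  have "shift s T d (u - w) = shift s T d u - shift s T c u"
   using linear_on_diff[OF shift_linear subspace_UNIV, of u w d] w(3) by simp
  also have "\<dots> = s (c - d) u" by (simp add: shift_def algebra_simps)
  finally have "shift s T d ?w = u"
   using linear_on_scale[OF shift_linear, of "u - w" d "inverse (c - d)"] assms(5) by simp
  moreover have "?w \<in> geig s T c \<inter> V"
   using Suc.prems w geig_subspace[of c] V(1) by (auto intro!: subspace_scale subspace_diff)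
  ultimately show ?case by blast
 qed
qed

lemma geig_independent:
 assumes "finite F" "!!c. c \<in> F ==> v c \<in> geig s T c" "(\<Sum>c\<in>F. v c) = 0" "c \<in> F"
 shows "v c = 0"
 using assms
proof (induction F arbitrary: v c rule: finite_induct)
 case (insert d F)
 obtain n where n: "(shift s T d ^^ n) (v d) = 0" using insert.prems by (auto simp: geig_def)
 have in_geig: "(shift s T d ^^ m) w \<in> geig s T e" if "w \<in> geig s T e" for m w e
  using that by (induction m) (auto intro: shift_in_geig)
 have "(\<Sum>e\<in>insert d F. (shift s T d ^^ n) (v e)) = 0"
  using linear_on_sum[OF shift_funpow_linear subspace_UNIV, of "insert d F" v n d] insert.prems(2)
   linear_on_zero[OF shift_funpow_linear subspace_UNIV, of n d] by simp
 then have "(\<Sum>e\<in>F. (shift s T d ^^ n) (v e)) = 0" using n insert.hyps by simp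
 then have z: "(shift s T d ^^ n) (v e) = 0" if "e \<in> F" for e
  using insert.IH[of "\<lambda>e. (shift s T d ^^ n) (v e)" e] insert.prems(1) in_geig that by auto
 have F: "v e = 0" if e: "e \<in> F" for e
 proof -
  have "(shift s T d ^^ m) (v e) = 0 ==> v e = 0" for m
  proof (induction m)
   case (Suc m)
   have "(shift s T d ^^ m) (v e) = 0"
    by (rule geig_shift_inj[of _ e d])
     (use in_geig insert.prems(1) e Suc.prems insert.hyps in auto)
   then show ?case by (rule Suc.IH)
  qed simp
  then show ?thesis using z[OF e] by blast
 qed
 then have "v d = 0" using insert by simp
 then show ?case using F insert.prems(3) by auto
qed simp

lemma geig_eigenvector:
 assumes V: "subspace V" "T ` V \<subseteq> V" and v: "v \<in> geig s T c" "v \<in> V" "v ~= 0"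
 shows "\<exists>w. w \<in> V & w ~= 0 & T w = s c w"
proof -
 obtain n where "(shift s T c ^^ n) v = 0" using v by (auto simp: geig_def)
 then show ?thesis using v
 proof (induction n arbitrary: v)
  case (Suc n)
  show ?case
  proof (cases "shift s T c v = 0")
   case True
   then show ?thesis using Suc.prems by (auto simp: shift_def)
  next
   case False
   have "shift s T c v \<in> V"
    using Suc.prems V subspace_diff subspace_scale by (auto simp: shift_def)
   then show ?thesis
    using Suc.IH[of "shift s T c v"] Suc.prems False shift_in_geig by (auto simp: funpow_swap1)
  qed
 qed simp
qed

end

context
 fixes s :: "'k::alg_closed_field => 'v::ab_group_add => 'v" and T
 assumes vs: "vector_space s" and T: "linear_on s s UNIV T"
begin

interpretation vector_space s by (rule vs)
interpretation vector_space_pair s s by (rule self_pair)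

text \<open>
  An eigenvector modulo the sum \<open>U\<close> of the generalized eigenspaces can be corrected by an element of
  \<open>U\<close> to a generalized eigenvector, since \<open>T - c\<close> is onto on the eigenspaces for other eigenvalues.
\<close>

lemma geig_span:
 assumes V: "finite_dim s V" "T ` V \<subseteq> V"
 shows "V = span (\<Union>c. geig s T c \<inter> V)" (is "_ = ?U")
proof (rule ccontr)
 assume ne: "V ~= ?U"
 note sV = finite_dim_subspace[OF V(1)]
 have "?U \<subseteq> V" by (rule span_minimal[OF _ sV]) auto
 then have UV: "?U \<subset> V" using ne by auto
 have eT: "endo s V T" using V(2) linear_on_subset[OF T] by (auto simp: endo_def)
 have TU: "T u \<in> ?U" if "u \<in> ?U" for u
  using that
 proof (induction rule: span_induct_alt)
  case base
  show ?case using linear_on_zero[OF T subspace_UNIV] span_zero by simp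
 next
  case (step c x y)
  then obtain d where d: "x \<in> geig s T d" "x \<in> V" by auto
  have "T x = shift s T 0 x" by (simp add: shift_def)
  then have "T x \<in> geig s T d \<inter> V" using shift_in_geig[OF vs T d(1)] V(2) d(2) by auto
  then have "T x \<in> ?U" by (auto intro: span_base)
  then show ?case using step linear_on_add[OF T] linear_on_scale[OF T]
   by (simp add: span_add span_scale)
 qed
 obtain c w where w: "w \<in> V" "w \<notin> ?U" "T w - s c w \<in> ?U"
  using finite_dim_eigenvector_modulo[OF vs V(1) subspace_span UV eT] TU by blast
 have "\<exists>w'\<in>?U. u - shift s T c w' \<in> geig s T c \<inter> V" if "u \<in> ?U" for u
  using that
 proof (induction rule: span_induct_alt)
  case base
  show ?case
   by (rule bexI[of _ 0])
    (auto simp: shift_zero[OF vs T] span_zero subspace_0[OF sV] subspace_0[OF geig_subspace[OF vs T]])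
 next
  case (step k x y)
  then obtain d w1 where d: "x \<in> geig s T d" "x \<in> V"
   and w1: "w1 \<in> ?U" "y - shift s T c w1 \<in> geig s T c" "y - shift s T c w1 \<in> V" by auto
  show ?case
  proof (cases "d = c")
   case True
   have "(s k x + y) - shift s T c w1 = s k x + (y - shift s T c w1)" by simp
   then show ?thesis
    using True d w1 geig_subspace[OF vs T, of c] sV
    by (intro bexI[of _ w1]) (auto intro!: subspace_add subspace_scale simp del: add_diff_eq simp: add_diff_eq[symmetric])
  next
   case False
   then obtain w2 where w2: "w2 \<in> geig s T d \<inter> V" "shift s T c w2 = x"
    using geig_shift_surj[OF vs T sV V(2) d, of c] by auto
   have "s k x + y - shift s T c (s k w2 + w1) = y - shift s T c w1"
    using w2(2) by (simp add: linear_on_add[OF shift_linear[OF vs T]]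
      linear_on_scale[OF shift_linear[OF vs T]])
   moreover have "s k w2 + w1 \<in> ?U"
    using w1(1) w2(1) by (intro span_add span_scale) (auto intro: span_base)
   ultimately show ?thesis using w1 by (metis IntI)
  qed
 qed
 then obtain w' where w': "w' \<in> ?U" "(T w - s c w) - shift s T c w' \<in> geig s T c" using w(3) by blast
 have "shift s T c (w - w') = (T w - s c w) - shift s T c w'"
  using linear_on_diff[OF shift_linear[OF vs T] subspace_UNIV, of w w' c] by (simp add: shift_def)
 then have "w - w' \<in> geig s T c" using w'(2) geigI_shift[OF vs T] by simp
 moreover have "w - w' \<in> V" using w(1) w'(1) UV sV subspace_diff by blast
 ultimately have "w - w' \<in> ?U" by (auto intro: span_base)
 then have "w \<in> ?U" using w'(1) span_add by fastforce
 then show False using w(2) by blast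
qed

lemma no_eigenvalue_nilpotent:
 assumes V: "finite_dim s V" "T ` V \<subseteq> V"
  and no: "!!c w. w \<in> V ==> T w = s c w ==> w ~= 0 ==> c = 0" and v: "v \<in> V"
 shows "\<exists>n. (T ^^ n) v = 0"
proof -
 have "geig s T c \<inter> V \<subseteq> geig s T 0" for c
  using geig_eigenvector[OF vs T finite_dim_subspace[OF V(1)] V(2)] no
   subspace_0[OF geig_subspace[OF vs T, of 0]] by blast
 then have "span (\<Union>c. geig s T c \<inter> V) \<subseteq> geig s T 0"
  by (intro span_minimal geig_subspace[OF vs T]) auto
 then have "v \<in> geig s T 0" using geig_span[OF V] v by auto
 then show ?thesis using geig_zero_iff by blast
qed

lemma geig_basis:
 assumes "finite_dim s UNIV"
 obtains C \<kappa> where "finite C" "independent C" "span C = UNIV" "!!b. b \<in> C ==> b \<in> geig s T (\<kappa> b)"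
proof -
 obtain C where C: "C \<subseteq> (\<Union>c. geig s T c)" "independent C" "(\<Union>c. geig s T c) \<subseteq> span C"
  using maximal_independent_subset by blast
 have "UNIV = span (\<Union>c. geig s T c)" using geig_span[OF assms] by simp
 also have "\<dots> \<subseteq> span C" using C(3) by (simp add: span_minimal)
 finally have "span C = UNIV" by auto
 moreover have "finite C"
  using assms independent_span_bound[OF _ C(2)] by (auto simp: finite_dim_def)
 moreover obtain \<kappa> where "!!b. b \<in> C ==> b \<in> geig s T (\<kappa> b)" using C(1) by (metis UN_E subsetD)
 ultimately show ?thesis using that C(2) by blast
qed

lemma geig_scalar_operator:
 assumes C: "finite C" "independent C" "span C = UNIV" "!!b. b \<in> C ==> b \<in> geig s T (\<kappa> b)"
 obtains D where "linear_on s s UNIV D" "!!c v. v \<in> geig s T c ==> D v = s (\<phi> c) v"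
proof -
 obtain D where D: "Vector_Spaces.linear s s D" "!!b. b \<in> C ==> D b = s (\<phi> (\<kappa> b)) b"
  using linear_independent_extend[OF C(2), of "\<lambda>b. s (\<phi> (\<kappa> b)) b"] by blast
 have Dl: "linear_on s s UNIV D"
  using D(1) by (auto simp: linear_on_def Vector_Spaces.linear_iff)
 have "D v = s (\<phi> c) v" if v: "v \<in> geig s T c" for c v
 proof -
  let ?r = "\<lambda>b. representation C v b"
  have v_eq: "v = (\<Sum>b\<in>C. s (?r b) b)"
   using sum_representation_eq[OF C(2) _ C(1) subset_refl, of v] C(3) by simp
  define p where "p d = (\<Sum>b\<in>{b\<in>C. \<kappa> b = d}. s (?r b) b)" for d
  have p: "p d \<in> geig s T d" for d
   unfolding p_def using geig_subspace[OF vs T, of d] C(4)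
   by (auto intro!: subspace_sum subspace_scale)
  let ?F = "insert c (\<kappa> ` C)"
  have sum_p: "(\<Sum>d\<in>?F. p d) = v"
   unfolding p_def using sum.group[of C ?F \<kappa> "\<lambda>b. s (?r b) b"] C(1) v_eq by auto
  have "(p(c := p c - v)) d = 0" if "d \<in> ?F" for d
  proof (rule geig_independent[OF vs T, of ?F])
   show "(p(c := p c - v)) d \<in> geig s T d" for d
    using p v geig_subspace[OF vs T, of d] by (auto intro!: subspace_diff)
   have "(\<Sum>d\<in>?F. (p(c := p c - v)) d) = (\<Sum>d\<in>?F. p d) - v"
    using C(1) by (subst (1 2) sum.remove[of _ c]) (auto intro!: sum.cong)
   then show "(\<Sum>d\<in>?F. (p(c := p c - v)) d) = 0" using sum_p by simp
  qed (use C(1) that in auto)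
  then have pc: "p c = v" and pd: "d \<in> \<kappa> ` C ==> d ~= c ==> p d = 0" for d
   by (force, metis fun_upd_apply insertCI)
  have "D v = (\<Sum>b\<in>C. s (?r b) (D b))"
   using linear_on_sum_scale[OF Dl subspace_UNIV, of C "\<lambda>b. b" ?r] v_eq by simp
  also have "\<dots> = (\<Sum>b\<in>C. s (\<phi> (\<kappa> b)) (s (?r b) b))"
   using D(2) by (intro sum.cong) (auto simp: mult.commute)
  also have "\<dots> = (\<Sum>d\<in>?F. \<Sum>b\<in>{b\<in>C. \<kappa> b = d}. s (\<phi> (\<kappa> b)) (s (?r b) b))"
   by (rule sum.group[symmetric]) (use C(1) in auto)
  also have "\<dots> = (\<Sum>d\<in>?F. s (\<phi> d) (p d))"
   unfolding p_def scale_sum_right by (intro sum.cong) auto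
  also have "\<dots> = s (\<phi> c) v"
   using C(1) pc pd by (subst sum.remove[of _ c]) (auto intro!: sum.neutral)
  finally show ?thesis .
 qed
 then show ?thesis using that Dl by blast
qed

text \<open>
  Subtracting from \<open>T\<close> the operator acting by \<open>c\<close> on each generalized eigenspace leaves a nilpotent
  operator there, which contributes nothing to the trace.
\<close>

lemma trace_geig:
 assumes C: "finite C" "independent C" "span C = UNIV" "!!b. b \<in> C ==> b \<in> geig s T (\<kappa> b)"
  and D: "linear_on s s UNIV D" "!!c v. v \<in> geig s T c ==> D v = s (\<phi> c) v"
 shows "trace s C (\<lambda>v. T (D v)) = (\<Sum>b\<in>C. \<kappa> b * \<phi> (\<kappa> b))"
proof -
 obtain S where S: "linear_on s s UNIV S" "!!c v. v \<in> geig s T c ==> S v = s c v"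
  using geig_scalar_operator[OF C, of "\<lambda>c. c"] by blast
 define N where "N v = T (D v) - S (D v)" for v
 have N: "linear_on s s UNIV N"
  using T D(1) S(1) by (simp add: linear_on_def N_def algebra_simps)
 have "v \<in> geig s N 0" if v: "v \<in> geig s T c" for v c
 proof -
  have *: "N w = s (\<phi> c) (shift s T c w)" if "w \<in> geig s T c" for w
   using D(2)[OF that] S(2)[OF that] linear_on_scale[OF T, of w] linear_on_scale[OF S(1), of w]
   by (simp add: N_def shift_def algebra_simps)
  have **: "(N ^^ n) v = s (\<phi> c ^ n) ((shift s T c ^^ n) v) & (shift s T c ^^ n) v \<in> geig s T c" for n
  proof (induction n)
   case (Suc n)
   then show ?case
    using *[of "(shift s T c ^^ n) v"] linear_on_scale[OF N, of _ "\<phi> c ^ n"]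
     shift_in_geig[OF vs T] by (simp add: mult.commute)
  qed (use v in simp)
  obtain n where "(shift s T c ^^ n) v = 0" using v by (auto simp: geig_def)
  then have "(N ^^ n) v = 0" using ** by simp
  then show ?thesis using geig_zero_iff by blast
 qed
 then have "span C \<subseteq> geig s N 0"
  using C(4) by (intro span_minimal geig_subspace[OF vs N]) auto
 then have "\<exists>n. (N ^^ n) b = 0" for b
  unfolding C(3) using geig_zero_iff by blast
 moreover have "endo s (span C) N" using N C(3) by (simp add: endo_def)
 ultimately have "trace s C N = 0" using trace_locally_nilpotent[OF C(1,2)] by blast
 moreover have "trace s C (\<lambda>v. T (D v)) = trace s C (\<lambda>v. N v + S (D v))"
  by (simp add: N_def)
 moreover have "\<dots> = trace s C N + trace s C (\<lambda>v. S (D v))"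
  by (rule trace_add[OF C(2)]) (simp_all add: C(3))
 moreover have "trace s C (\<lambda>v. S (D v)) = (\<Sum>b\<in>C. \<kappa> b * \<phi> (\<kappa> b))"
  unfolding trace_def
 proof (rule sum.cong[OF refl])
  fix b assume b: "b \<in> C"
  have "S (D b) = s (\<kappa> b * \<phi> (\<kappa> b)) b"
   using D(2)[OF C(4)[OF b]] S(2)[OF C(4)[OF b]] linear_on_scale[OF S(1), of b]
   by (simp add: mult.commute)
  then show "representation C (S (D b)) b = \<kappa> b * \<phi> (\<kappa> b)"
   using b C(2) by (simp add: representation_scale span_base representation_basis)
 qed
 ultimately show ?thesis by simp
qed

end

lemma rational_functional:
 fixes c :: "'k::field_char_0"
 assumes "c ~= 0"
 obtains \<psi> :: "'k => rat" where "!!x y. \<psi> (x + y) = \<psi> x + \<psi> y" "!!q x. \<psi> (of_rat q * x) = q * \<psi> x" "\<psi> c = 1"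
proof -
 interpret vector_space_pair "\<lambda>q (x::'k). of_rat q * x" "(*) :: rat => rat => rat"
  by standard (simp_all add: algebra_simps of_rat_add of_rat_mult)
 have "vs1.independent {c}" using assms by (simp add: vs1.dependent_single)
 then obtain \<psi> where "Vector_Spaces.linear (\<lambda>q (x::'k). of_rat q * x) (*) \<psi>" "\<psi> c = (1::rat)"
  using linear_independent_extend[of "{c}" "\<lambda>_. 1"] by blast
 then show ?thesis using that[of \<psi>] by (auto simp: Vector_Spaces.linear_iff)
qed

section \<open>Finite-dimensional Lie algebras: Engel and the Killing form\<close>

locale finite_dim_lie_algebra = lie_algebra s br UNIV
 for s :: "'k::{alg_closed_field, field_char_0} => 'g::ab_group_add => 'g" and br +
 assumes finite_dim: "finite_dim s UNIV"
begin

lemma vs: "vector_space s" ..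

sublocale ss: vector_space_pair s s by (rule self_pair)

lemma br_add [simp]: "br (u + v) w = br u w + br v w" "br u (v + w) = br u v + br u w"
 using br_add_left br_add_right by auto

lemma br_scale [simp]: "br (s c u) v = s c (br u v)" "br u (s c v) = s c (br u v)"
 using br_scale_left br_scale_right by auto

lemma ad_linear: "linear_on s s UNIV (br z)"
 by (simp add: linear_on_def)

lemma br_zero [simp]: "br 0 v = 0" "br u 0 = 0"
 using br_scale(1)[of 0 0 v] br_scale(2)[of u 0 0] by auto

lemma br_minus: "br (- u) v = - br u v" "br u (- v) = - br u v"
 using br_scale(1)[of "-1" u v] br_scale(2)[of u "-1" v] by auto

lemma br_diff: "br (u - v) w = br u w - br v w" "br u (v - w) = br u v - br u w"
 using br_add(1)[of u "- v" w] br_add(2)[of u v "- w"] by (simp_all add: br_minus)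

lemma br_skew: "br u v = - br v u"
proof -
 have "br (u + v) (u + v) = 0" "br u u = 0" "br v v = 0" by (simp_all only: br_alternating UNIV_I)
 then have "br u v + br v u = 0" by (simp add: add.commute)
 then show ?thesis by (simp add: eq_neg_iff_add_eq_0)
qed

lemma br_derivation: "br u (br v w) = br (br u v) w + br v (br u w)"
proof -
 have "br u (br v w) + br v (br w u) + br w (br u v) = 0" by (rule br_jacobi) auto
 moreover have "br v (br w u) = - br v (br u w)" using br_skew[of w u] by (simp add: br_minus)
 moreover have "br w (br u v) = - br (br u v) w" by (rule br_skew)
 ultimately show ?thesis by (simp add: algebra_simps)
qed

lemma finite_dim_any: "subspace V ==> finite_dim s V"
 using finite_dim_subset[OF finite_dim] by simp

lemma bracket_geig:
 assumes "x \<in> geig s (br z) a" "y \<in> geig s (br z) b"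
 shows "br x y \<in> geig s (br z) (a + b)"
proof -
 note vT = vs ad_linear
 have "(shift s (br z) a ^^ n) x = 0 ==> (shift s (br z) b ^^ m) y = 0 ==> n + m = N ==>
   br x y \<in> geig s (br z) (a + b)" for n m N x y
 proof (induction N arbitrary: n m x y)
  case 0
  then show ?case using subspace_0[OF geig_subspace[OF vT]] by simp
 next
  case (Suc N)
  have sh: "shift s (br z) (a + b) (br x y) =
    br (shift s (br z) a x) y + br x (shift s (br z) b y)"
   using br_derivation[of z x y] by (simp add: shift_def br_diff algebra_simps)
  show ?case
  proof (cases "n = 0 \<or> m = 0")
   case True
   then show ?thesis using Suc.prems subspace_0[OF geig_subspace[OF vT]] by auto
  next
   case False
   then obtain n' m' where nm: "n = Suc n'" "m = Suc m'" by (metis not0_implies_Suc)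
   have "br (shift s (br z) a x) y \<in> geig s (br z) (a + b)"
    by (rule Suc.IH[of n' _ m]) (use Suc.prems nm in \<open>auto simp: funpow_swap1\<close>)
   moreover have "br x (shift s (br z) b y) \<in> geig s (br z) (a + b)"
    by (rule Suc.IH[of n _ m']) (use Suc.prems nm in \<open>auto simp: funpow_swap1\<close>)
   ultimately show ?thesis
    using sh subspace_add[OF geig_subspace[OF vT]] geigI_shift[OF vT] by metis
  qed
 qed
 then show ?thesis using assms by (auto simp: geig_def)
qed

definition subalgebra :: "'g set => bool" where
 "subalgebra K \<longleftrightarrow> subspace K & (\<forall>x\<in>K. \<forall>y\<in>K. br x y \<in> K)"

definition ad_stable :: "'g set => 'g set => bool" where
 "ad_stable K U \<longleftrightarrow> subspace U & (\<forall>x\<in>K. \<forall>u\<in>U. br x u \<in> U)"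

lemma br_insert_span:
 assumes "subspace U" "!!k. k \<in> K ==> br k v \<in> U" "br y v \<in> U" "z \<in> span (insert y K)" "subspace K"
 shows "br z v \<in> U"
proof -
 have "span K = K" using assms(5) by simp
 moreover have "\<exists>c. z - s c y \<in> span K" using assms(4) by (simp only: span_insert mem_Collect_eq)
 ultimately obtain c where "z - s c y \<in> K" by metis
 then have "br (z - s c y) v + s c (br y v) \<in> U"
  using assms subspace_add subspace_scale by blast
 then show ?thesis by (simp add: br_diff)
qed

text \<open>
  Engel's theorem in relative form. A maximal proper subalgebra \<open>K\<close> has codimension one, because the
  theorem for \<open>K\<close> acting on \<open>L\<close> modulo \<open>K\<close> provides an element \<open>y\<close> normalizing \<open>K\<close>; the vectors killed by \<open>K\<close>
  modulo \<open>U\<close> are then stable under the nilpotent operator \<open>ad y\<close>.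
\<close>

lemma engel:
 assumes "subalgebra L" "L \<subseteq> V0" "ad_stable L V0"
  and "!!z v. z \<in> L ==> v \<in> V0 ==> \<exists>n. (br z ^^ n) v = 0"
  and "ad_stable L U" "ad_stable L V" "U \<subset> V" "V \<subseteq> V0"
 shows "\<exists>v. v \<in> V & v \<notin> U & (\<forall>z\<in>L. br z v \<in> U)"
 using assms
proof (induction "dim L" arbitrary: L U V rule: less_induct)
 case less
 have sL: "subspace L" and Lbr: "!!x y. x \<in> L ==> y \<in> L ==> br x y \<in> L"
  using less.prems(1) by (auto simp: subalgebra_def)
 have sU: "subspace U" and sV: "subspace V" using less.prems by (auto simp: ad_stable_def)
 show ?case
 proof (cases "L = {0}")
  case True
  then show ?thesis using less.prems(7) subspace_0[OF sU] by auto
 next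
  case False
  define P where "P K \<longleftrightarrow> subalgebra K & K \<subset> L" for K
  have "P {0}" using False subspace_0[OF sL] by (auto simp: P_def subalgebra_def)
  then obtain K where K: "P K" and max: "!!W. P W ==> K \<subseteq> W ==> W = K"
   using finite_dim_maximal_subspace[OF finite_dim_any[OF sL], of P "{0}"]
   by (auto simp: P_def subalgebra_def)
  have KL: "K \<subset> L" and sK: "subspace K" and Kbr: "!!x y. x \<in> K ==> y \<in> K ==> br x y \<in> K"
   using K by (auto simp: P_def subalgebra_def)
  have dimK: "dim K < dim L" by (rule finite_dim_dim_less[OF finite_dim_any[OF sL] sK KL])
  have K': "subalgebra K" "K \<subseteq> V0" "ad_stable K V0" "ad_stable K U" "ad_stable K V"
   "ad_stable K K" "ad_stable K L"
   using K less.prems KL by (auto simp: P_def subalgebra_def ad_stable_def)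
  have nil: "\<exists>n. (br z ^^ n) v = 0" if "z \<in> K" "v \<in> V0" for z v
   using less.prems(4) KL that by auto
  obtain y where y: "y \<in> L" "y \<notin> K" "!!z. z \<in> K ==> br z y \<in> K"
   using less.hyps[OF dimK K'(1-3) nil K'(6,7) KL less.prems(2)] by blast
  have yK: "br y z \<in> K" if "z \<in> K" for z
   using y(3)[OF that] br_skew[of y z] subspace_neg[OF sK] by simp
  let ?K = "span (insert y K)"
  have "?K \<subseteq> L" using y(1) KL sL by (intro span_minimal) auto
  moreover have "br x x' \<in> K" if "x \<in> ?K" "x' \<in> ?K" for x x'
  proof (rule br_insert_span[OF sK _ _ that(1) sK])
   have *: "br x' k \<in> K" if "k \<in> K" for k
    by (rule br_insert_span[OF sK Kbr[OF _ that] yK[OF that] `x' \<in> ?K` sK])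
   show "br k x' \<in> K" if "k \<in> K" for k
    using *[OF that] br_skew[of k x'] subspace_neg[OF sK] by simp
   have "br x' y \<in> K"
    by (rule br_insert_span[OF sK y(3) _ `x' \<in> ?K` sK]) (use br_alternating subspace_0[OF sK] in auto)
   then show "br y x' \<in> K" using br_skew[of y x'] subspace_neg[OF sK] by simp
  qed
  ultimately have "?K = L"
   using max[of ?K] y(2) span_superset[of "insert y K"]
   by (auto simp: P_def subalgebra_def intro: span_base)
  define W where "W = {v \<in> V. \<forall>z\<in>K. br z v \<in> U}"
  have yW: "br y w \<in> W" if "w \<in> W" for w
  proof -
   have "br z (br y w) \<in> U" if z: "z \<in> K" for z
   proof -
    have "br (br z y) w \<in> U" using y(3)[OF z] `w \<in> W` by (auto simp: W_def)
    moreover have "br y (br z w) \<in> U"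
     using z `w \<in> W` less.prems(5) y(1) by (auto simp: W_def ad_stable_def)
    ultimately show ?thesis using br_derivation[of z y w] subspace_add[OF sU] by simp
   qed
   then show ?thesis using that less.prems(6) y(1) by (auto simp: W_def ad_stable_def)
  qed
  obtain w where w: "w \<in> W" "w \<notin> U"
   using less.hyps[OF dimK K'(1-3) nil K'(4,5) less.prems(7,8)] by (auto simp: W_def)
  have "\<exists>n. (br y ^^ n) w \<in> U"
   using less.prems(4)[OF y(1), of w] w(1) less.prems(8) subspace_0[OF sU] by (metis (lifting) W_def mem_Collect_eq subsetD)
  then obtain n where n: "(br y ^^ n) w \<in> U" "!!m. m < n ==> (br y ^^ m) w \<notin> U"
   using LeastI_ex[of "\<lambda>n. (br y ^^ n) w \<in> U"] not_less_Least by metis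
  then obtain m where m: "n = Suc m" using w(2) by (cases n) auto
  define v where "v = (br y ^^ m) w"
  have "v \<in> W" unfolding v_def by (induction m) (use w yW in auto)
  moreover have "v \<notin> U" "br y v \<in> U" using n m by (auto simp: v_def)
  moreover have "br z v \<in> U" if "z \<in> L" for z
   by (rule br_insert_span[OF sU _ `br y v \<in> U` _ sK]) (use `v \<in> W` that `?K = L` in \<open>auto simp: W_def\<close>)
  ultimately show ?thesis by (auto simp: W_def)
 qed
qed

lemma perfect_ad_nilpotent_zero:
 assumes J: "subalgebra J" and perf: "commutator s br J J = J"
  and nil: "!!z v. z \<in> J ==> \<exists>n. (br z ^^ n) v = 0"
 shows "J = {0}"
proof (rule ccontr)
 assume n0: "J ~= {0}"
 have sJ: "subspace J" using J by (simp add: subalgebra_def)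
 define P where "P U \<longleftrightarrow> ad_stable J U & U \<subset> J" for U
 have "P {0}" using n0 subspace_0[OF sJ] by (auto simp: P_def ad_stable_def)
 then obtain U where U: "P U" and max: "!!W. P W ==> U \<subseteq> W ==> W = U"
  using finite_dim_maximal_subspace[OF finite_dim_any[OF sJ], of P "{0}"]
  by (auto simp: P_def ad_stable_def)
 have sU: "subspace U" and UJ: "U \<subset> J" and Ust: "ad_stable J U"
  using U by (auto simp: P_def ad_stable_def)
 have "ad_stable J J" "ad_stable J UNIV" using J by (auto simp: subalgebra_def ad_stable_def)
 then obtain v where v: "v \<in> J" "v \<notin> U" "!!z. z \<in> J ==> br z v \<in> U"
  using engel[OF J subset_UNIV _ nil Ust _ UJ subset_UNIV] by blast
 have in_U: "br z w \<in> U" if "z \<in> J" "w \<in> span (insert v U)" for z w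
 proof -
  have "br w z \<in> U"
  proof (rule br_insert_span[OF sU _ _ that(2) sU])
   show "br u z \<in> U" if "u \<in> U" for u
    using Ust `z \<in> J` that br_skew[of u z] subspace_neg[OF sU] by (auto simp: ad_stable_def)
   show "br v z \<in> U" using v(3)[OF `z \<in> J`] br_skew[of v z] subspace_neg[OF sU] by simp
  qed
  then show ?thesis using br_skew[of z w] subspace_neg[OF sU] by simp
 qed
 have sub: "U \<subseteq> span (insert v U)" using span_superset[of "insert v U"] by auto
 have "span (insert v U) \<subseteq> J" using v(1) UJ sJ by (intro span_minimal) auto
 then have "span (insert v U) = J"
  using max[of "span (insert v U)"] in_U sub v(2) span_base[of v "insert v U"]
  by (auto simp: P_def ad_stable_def subset_iff)
 then have "commutator s br J J \<subseteq> U"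
  unfolding commutator_def using in_U by (intro span_minimal[OF _ sU]) auto
 then show False using perf UJ by auto
qed

subsection \<open>The Killing form\<close>

definition basis :: "'g set" where
 "basis = (SOME B. finite B & independent B & span B = UNIV)"

lemma basis: "finite basis" "independent basis" "span basis = UNIV"
proof -
 have "\<exists>B. finite B & independent B & span B = UNIV"
  using finite_dim_basis[OF finite_dim subspace_UNIV] by auto
 from someI_ex[OF this] show "finite basis" "independent basis" "span basis = UNIV"
  by (auto simp: basis_def)
qed

definition tr :: "('g => 'g) => 'k" where "tr = trace s basis"

definition killing :: "'g => 'g => 'k" where
 "killing x y = tr (\<lambda>v. br x (br y v))"

lemma tr_add: "tr (\<lambda>v. S v + T v) = tr S + tr T"
 and tr_diff: "tr (\<lambda>v. S v - T v) = tr S - tr T"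
 and tr_scale: "tr (\<lambda>v. s c (T v)) = c * tr T"
 unfolding tr_def by (rule trace_add trace_diff trace_scale; simp add: basis)+

lemma tr_commute:
 assumes "linear_on s s UNIV S" "linear_on s s UNIV T"
 shows "tr (\<lambda>v. S (T v)) = tr (\<lambda>v. T (S v))"
 unfolding tr_def
 by (rule trace_commute[OF basis(1,2) basis(1,2)]) (use assms in \<open>auto simp: basis(3)\<close>)

lemma tr_any_basis:
 assumes "finite C" "independent C" "span C = UNIV" "linear_on s s UNIV T"
 shows "tr T = trace s C T"
 unfolding tr_def
 by (rule trace_basis_change) (use assms basis in \<open>auto simp: endo_def\<close>)

lemma tr_locally_nilpotent:
 assumes "linear_on s s UNIV T" "!!v. \<exists>n. (T ^^ n) v = 0" shows "tr T = 0"
 unfolding tr_def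
 by (rule trace_locally_nilpotent) (use assms basis in \<open>auto simp: endo_def\<close>)

lemma linear_on_compose:
 "linear_on s s UNIV S ==> linear_on s s UNIV T ==> linear_on s s UNIV (\<lambda>v. S (T v))"
 by (simp add: linear_on_def)

lemma killing_bilinear:
 "killing (x + y) z = killing x z + killing y z" "killing x (y + z) = killing x y + killing x z"
 "killing (s c x) y = c * killing x y" "killing x (s c y) = c * killing x y"
 by (simp_all add: killing_def tr_add tr_scale)

lemma killing_zero [simp]: "killing 0 x = 0" "killing x 0 = 0"
 using killing_bilinear(3)[of 0 0 x] killing_bilinear(4)[of x 0 0] by auto

lemma killing_diff:
 "killing (x - y) z = killing x z - killing y z" "killing x (y - z) = killing x y - killing x z"
 using killing_bilinear(1)[of "x - y" y z] killing_bilinear(2)[of x "y - z" z]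
 by (auto simp: algebra_simps)

lemma killing_commute: "killing x y = killing y x"
 unfolding killing_def by (rule tr_commute[OF ad_linear ad_linear])

lemma killing_invariant: "killing (br x y) z = killing x (br y z)"
proof -
 have 1: "br (br x y) (br z v) = br x (br y (br z v)) - br y (br x (br z v))" for v
  using br_derivation[of x y "br z v"] by (simp add: algebra_simps)
 have 2: "br x (br (br y z) v) = br x (br y (br z v)) - br x (br z (br y v))" for v
  using br_derivation[of y z v] by (simp add: br_diff[symmetric] algebra_simps)
 have "tr (\<lambda>v. br y (br x (br z v))) = tr (\<lambda>v. br x (br z (br y v)))"
  by (rule tr_commute[OF ad_linear, of "\<lambda>v. br x (br z v)"])
   (rule linear_on_compose[OF ad_linear ad_linear])
 then show ?thesis unfolding killing_def 1 2 tr_diff by simp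
qed

lemma killing_geig_orthogonal:
 assumes "x \<in> geig s (br z) a" "y \<in> geig s (br z) b" "a + b ~= 0"
 shows "killing x y = 0"
proof -
 have "(shift s (br z) a ^^ n) x = 0 ==> (shift s (br z) b ^^ m) y = 0 ==> n + m = N ==>
   killing x y = 0" for n m N x y
 proof (induction N arbitrary: n m x y)
  case (Suc N)
  show ?case
  proof (cases "n = 0 \<or> m = 0")
   case True
   then show ?thesis using Suc.prems by auto
  next
   case False
   then obtain n' m' where nm: "n = Suc n'" "m = Suc m'" by (metis not0_implies_Suc)
   have "killing (shift s (br z) a x) y = 0"
    by (rule Suc.IH[of n' _ m]) (use Suc.prems nm in \<open>auto simp: funpow_swap1\<close>)
   moreover have "killing x (shift s (br z) b y) = 0"
    by (rule Suc.IH[of n _ m']) (use Suc.prems nm in \<open>auto simp: funpow_swap1\<close>)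
   ultimately have "killing (br z x) y + killing x (br z y) - (a + b) * killing x y = 0"
    by (simp add: shift_def killing_diff killing_bilinear algebra_simps)
   moreover have "killing (br z x) y = - killing x (br z y)"
    using killing_invariant[of x z y] br_skew[of z x] killing_diff(1)[of 0 "br x z" y] by simp
   ultimately show ?thesis using assms(3) by simp
  qed
 qed simp
 then show ?thesis using assms by (auto simp: geig_def)
qed

text \<open>
  The core of Cartan's criterion. For a \<open>\<rat>\<close>-linear functional \<open>\<psi>\<close> on the field, the operator \<open>D\<close> acting by
  \<open>\<psi> c\<close> on the \<open>c\<close>-th generalized eigenspace of \<open>ad z\<close> is a derivation, so the trace of \<open>ad z \<circ> D\<close> is a
  sum of values of the Killing form at elements of its radical. On the other hand it is the sum of
  the \<open>c * \<psi> c\<close> with multiplicities; applying \<open>\<psi>\<close> once more turns it into a sum of rational squares.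
\<close>

lemma cartan_criterion_nilpotent:
 assumes R: "!!p x. p \<in> R ==> killing p x = 0"
  and z: "z \<in> span {br p q | p q. p \<in> R & q \<in> R}"
 shows "\<exists>n. (br z ^^ n) v = 0"
proof -
 note vT = vs ad_linear
 obtain C \<kappa> where C: "finite C" "independent C" "span C = UNIV"
   "!!b. b \<in> C ==> b \<in> geig s (br z) (\<kappa> b)"
  using geig_basis[OF vT finite_dim] by metis
 have "\<kappa> b = 0" if b: "b \<in> C" for b
 proof (rule ccontr)
  assume "\<kappa> b ~= 0"
  then obtain \<psi> :: "'k => rat" where \<psi>: "!!x y. \<psi> (x + y) = \<psi> x + \<psi> y"
    "!!q x. \<psi> (of_rat q * x) = q * \<psi> x" "\<psi> (\<kappa> b) = 1"
   using rational_functional by metis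
  obtain D where D: "linear_on s s UNIV D"
    "!!c v. v \<in> geig s (br z) c ==> D v = s (of_rat (\<psi> c)) v"
   using geig_scalar_operator[OF vT C, of "\<lambda>c. of_rat (\<psi> c)"] by metis
  have D_geig: "D (br x y) = br (D x) y + br x (D y)" if "x \<in> C" "y \<in> C" for x y
   using D(2)[OF bracket_geig[OF C(4)[OF that(1)] C(4)[OF that(2)]]]
    D(2)[OF C(4)[OF that(1)]] D(2)[OF C(4)[OF that(2)]]
   by (simp add: \<psi>(1) of_rat_add scale_left_distrib)
  have D1: "D (br x y) = br (D x) y + br x (D y)" if "x \<in> C" for x y
   by (rule ss.linear_on_eq_span[of C "\<lambda>y. D (br x y)" "\<lambda>y. br (D x) y + br x (D y)" y])
    (use D(1) D_geig[OF that] C(3) in \<open>auto simp: linear_on_def algebra_simps\<close>)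
  have der: "D (br x y) = br (D x) y + br x (D y)" for x y
   by (rule ss.linear_on_eq_span[of C "\<lambda>x. D (br x y)" "\<lambda>x. br (D x) y + br x (D y)" x])
    (use D(1) D1 C(3) in \<open>auto simp: linear_on_def algebra_simps\<close>)
  have "tr (\<lambda>v. br z (D v)) = 0"
   using z
  proof (induction rule: span_induct_alt)
   case base
   show ?case using tr_scale[of 0 "\<lambda>v. 0"] by simp
  next
   case (step c x y)
   then obtain p q where x: "x = br p q" "p \<in> R" by auto
   have 1: "br x (D v) = br p (br q (D v)) - br q (br p (D v))" for v
    using br_derivation[of p q "D v"] x by (simp add: algebra_simps)
   have "tr (\<lambda>v. br q (br p (D v))) = tr (\<lambda>v. br p (D (br q v)))"
    by (rule tr_commute[OF ad_linear, of "\<lambda>v. br p (D v)"])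
     (rule linear_on_compose[OF ad_linear D(1)])
   then have "tr (\<lambda>v. br x (D v)) = tr (\<lambda>v. br p (br q (D v))) - tr (\<lambda>v. br p (D (br q v)))"
    unfolding 1 tr_diff by simp
   also have "\<dots> = tr (\<lambda>v. br p (br q (D v)) - br p (D (br q v)))" by (simp add: tr_diff)
   also have "\<dots> = tr (\<lambda>v. s (-1) (br p (br (D q) v)))" by (simp add: der algebra_simps)
   also have "\<dots> = - killing p (D q)" unfolding tr_scale killing_def by simp
   finally have "tr (\<lambda>v. br x (D v)) = 0" using R x by simp
   then show ?case using step by (simp add: tr_add tr_scale)
  qed
  then have "(\<Sum>b\<in>C. \<kappa> b * of_rat (\<psi> (\<kappa> b))) = 0"
   using trace_geig[OF vT C D] tr_any_basis[OF C(1-3) linear_on_compose[OF ad_linear D(1)]] by simp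
  then have "\<psi> (\<Sum>b\<in>C. of_rat (\<psi> (\<kappa> b)) * \<kappa> b) = \<psi> 0" by (simp add: mult.commute)
  moreover have "\<psi> (\<Sum>b\<in>F. of_rat (\<psi> (\<kappa> b)) * \<kappa> b) = (\<Sum>b\<in>F. \<psi> (\<kappa> b) * \<psi> (\<kappa> b))"
   if "finite F" for F
   using that \<psi>(2)[of 0 0] by (induction F) (auto simp: \<psi>)
  moreover have "\<psi> 0 = 0" using \<psi>(2)[of 0 0] by simp
  ultimately have "(\<Sum>b\<in>C. \<psi> (\<kappa> b) * \<psi> (\<kappa> b)) = 0" using C(1) by simp
  then have "\<psi> (\<kappa> b) = 0" using C(1) b by (simp add: sum_nonneg_eq_0_iff)
  then show False using \<psi>(3) by simp
 qed
 then have "span C \<subseteq> geig s (br z) 0"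
  by (intro span_minimal geig_subspace[OF vT]) (use C(4) in force)
 then show ?thesis using C(3) geig_zero_iff by blast
qed

lemma commutator_subspace: "subspace (commutator s br U V)"
 by (simp add: commutator_def)

lemma commutator_mono: "U \<subseteq> U' ==> V \<subseteq> V' ==> commutator s br U V \<subseteq> commutator s br U' V'"
 unfolding commutator_def by (intro span_mono) blast

text \<open>
  The derived series of the radical of the Killing form becomes stationary at a perfect algebra, whose
  elements are ad-nilpotent by Cartan's criterion; by Engel's theorem it is zero. So the radical is a
  solvable ideal.
\<close>

lemma semisimple_killing_nondegenerate:
 assumes ss: "semisimple_lie s br UNIV" and x: "!!y. killing x y = 0"
 shows "x = 0"
proof -
 define R where "R = {x. \<forall>y. killing x y = 0}"
 have sR: "subspace R" by (rule subspaceI) (auto simp: R_def killing_bilinear)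
 have Rbr: "br u v \<in> R" if "v \<in> R" for u v
  using that killing_invariant[of v u] br_skew[of u v] killing_diff(1)[of 0 "br v u"]
  by (auto simp: R_def)
 define D where "D n = ((\<lambda>U. commutator s br U U) ^^ n) R" for n
 have D_Suc: "D (Suc n) = commutator s br (D n) (D n)" for n by (simp add: D_def)
 have D: "subalgebra (D n) & D n \<subseteq> R & D (Suc n) \<subseteq> D n" for n
 proof (induction n)
  case 0
  have "commutator s br R R \<subseteq> R"
   unfolding commutator_def by (rule span_minimal[OF _ sR]) (use Rbr in auto)
  then show ?case using sR Rbr by (auto simp: D_def subalgebra_def)
 next
  case (Suc n)
  then have le: "D (Suc n) \<subseteq> D n" by simp
  have "br u v \<in> D (Suc n)" if "u \<in> D n" "v \<in> D n" for u v
   using that unfolding D_Suc commutator_def by (intro span_base) auto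
  then have "subalgebra (D (Suc n))"
   using le commutator_subspace by (auto simp: subalgebra_def D_def)
  moreover have "D (Suc (Suc n)) \<subseteq> D (Suc n)"
   using commutator_mono[OF le le] by (simp add: D_def)
  ultimately show ?case using le Suc by auto
 qed
 obtain n where n: "!!m. dim (D n) \<le> dim (D m)"
  using ex_has_least_nat[of "\<lambda>_. True" 0 "\<lambda>n. dim (D n)"] by auto
 have "D (Suc n) = D n"
 proof (rule ccontr)
  assume "D (Suc n) ~= D n"
  then have "dim (D (Suc n)) < dim (D n)"
   using finite_dim_dim_less[OF finite_dim_any, of "D n" "D (Suc n)"] D[of n] D[of "Suc n"]
   by (auto simp: subalgebra_def)
  then show False using n[of "Suc n"] by simp
 qed
 then have perf: "commutator s br (D n) (D n) = D n" by (simp add: D_def)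
 have "\<exists>m. (br z ^^ m) v = 0" if "z \<in> D n" for z v
  by (rule cartan_criterion_nilpotent[of "D n"])
   (use D[of n] that perf in \<open>auto simp: R_def commutator_def\<close>)
 then have "D n = {0}" using perfect_ad_nilpotent_zero[OF _ perf] D by blast
 then have "solvable_lie s br R" by (auto simp: solvable_lie_def D_def)
 moreover have "lie_ideal s br UNIV R" using sR Rbr by (auto simp: lie_ideal_def)
 ultimately have "R = {0}" using ss by (auto simp: semisimple_lie_def)
 then show ?thesis using x by (auto simp: R_def)
qed

text \<open>
  A nonzero solvable ideal would be the algebra itself, which equals its derived algebra.
\<close>

lemma simple_imp_semisimple:
 assumes "simple_lie s br UNIV" shows "semisimple_lie s br UNIV"
proof -
 have ideal: "J = {0} \<or> J = UNIV" if "lie_ideal s br UNIV J" for J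
  using assms that by (auto simp: simple_lie_def)
 let ?C = "commutator s br UNIV UNIV"
 obtain u v where uv: "br u v ~= 0" using assms by (auto simp: simple_lie_def)
 have in_C: "br a b \<in> ?C" for a b unfolding commutator_def by (rule span_base) auto
 then have "lie_ideal s br UNIV ?C"
  using commutator_subspace by (auto simp: lie_ideal_def)
 then have C: "?C = UNIV" using ideal in_C[of u v] uv by auto
 have "((\<lambda>U. commutator s br U U) ^^ n) UNIV = UNIV" for n
  using C by (induction n) auto
 then have "\<not> solvable_lie s br UNIV" using uv by (auto simp: solvable_lie_def)
 then show ?thesis using ideal by (auto simp: semisimple_lie_def)
qed

lemma nondegenerate_perp:
 assumes nd: "!!x. (!!y. killing x y = 0) ==> x = 0" and W: "subspace W" "W ~= UNIV"
 obtains v where "v ~= 0" "!!w. w \<in> W ==> killing v w = 0"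
proof -
 interpret fdv: finite_dimensional_vector_space s basis
  by unfold_locales (use basis in auto)
 interpret sk: vector_space_pair s "(*) :: 'k => 'k => 'k" by (rule field_pair)
 obtain C where C: "C \<subseteq> W" "independent C" "W \<subseteq> span C" using maximal_independent_subset by blast
 have spC: "span C = W" using C W(1) span_minimal by blast
 obtain x where x: "x \<notin> W" using W(2) by auto
 have "independent (insert x C)" using independent_insertI[of x C] x C spC by auto
 then obtain l where l: "Vector_Spaces.linear s (*) l" "!!b. b \<in> insert x C ==> l b = (if b = x then 1 else 0)"
  using sk.linear_independent_extend[of "insert x C" "\<lambda>b. if b = x then 1 else 0"] by blast
 have ll: "linear_on s (*) UNIV l" using l(1) by (auto simp: linear_on_def Vector_Spaces.linear_iff)
 define \<Phi> where "\<Phi> x = (\<Sum>b\<in>basis. s (killing x b) b)" for x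
 have lin: "Vector_Spaces.linear s s \<Phi>"
  by (simp add: Vector_Spaces.linear_iff vs \<Phi>_def killing_bilinear scale_left_distrib sum.distrib scale_sum_right)
 have rep: "representation basis (\<Sum>b\<in>basis. s (f b) b) a = f a" if "a \<in> basis" for f a
 proof -
  have "representation basis (\<Sum>b\<in>basis. s (f b) b) a = (\<Sum>b\<in>basis. f b * representation basis b a)"
   by (rule representation_sum_scale[OF basis(2)]) (simp add: span_base)
  also have "\<dots> = f a"
   using that basis by (subst sum.remove[of _ a]) (auto simp: representation_basis split: if_splits intro!: sum.neutral)
  finally show ?thesis .
 qed
 have kill_ext: "killing y = l'" if "linear_on s (*) UNIV l'" "!!b. b \<in> basis ==> killing y b = l' b" for y l'
 proof
  fix v
  show "killing y v = l' v"
   by (rule sk.linear_on_eq_span[of basis "killing y" l' v])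
    (use that in \<open>auto simp: basis(3) linear_on_def killing_bilinear\<close>)
 qed
 have "inj \<Phi>"
 proof (rule injI)
  fix x y assume "\<Phi> x = \<Phi> y"
  then have "killing (x - y) b = 0" if "b \<in> basis" for b
   using rep[OF that, of "killing x"] rep[OF that, of "killing y"]
   by (simp add: \<Phi>_def killing_diff)
  then have "killing (x - y) = (\<lambda>_. 0)" by (intro kill_ext) (auto simp: linear_on_def)
  then show "x = y" using nd[of "x - y"] by simp
 qed
 then have "surj \<Phi>" by (rule fdv.linear_inj_imp_surj[OF lin])
 then obtain v where v: "\<Phi> v = (\<Sum>b\<in>basis. s (l b) b)" by (metis surjD)
 have "killing v b = l b" if "b \<in> basis" for b
  using rep[OF that, of "killing v"] rep[OF that, of l] v by (simp add: \<Phi>_def)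
 then have kv: "killing v = l" by (rule kill_ext[OF ll])
 have "l w = 0" if "w \<in> W" for w
  by (rule sk.linear_on_eq_span[of C l "\<lambda>_. 0" w])
   (use ll l(2) x C that spC in \<open>auto simp: linear_on_def\<close>)
 moreover have "v ~= 0" using l(2)[of x] kv by auto
 ultimately show ?thesis using that kv by auto
qed

text \<open>
  A nonzero vector orthogonal to the commutators exists when these do not fill the space; by invariance
  and nondegeneracy of the Killing form it also commutes with \<open>U\<close>.
\<close>

lemma centralizer_zero_imp_commutator_full:
 assumes nd: "!!x. (!!y. killing x y = 0) ==> x = 0"
  and c: "!!v. (!!u w. u \<in> U ==> killing v (br u w) = 0) ==> (!!u. u \<in> U ==> br u v = 0) ==> v = 0"
 shows "commutator s br U UNIV = UNIV"
proof (rule ccontr)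
 assume "commutator s br U UNIV ~= UNIV"
 then obtain v where v: "v ~= 0" "!!w. w \<in> commutator s br U UNIV ==> killing v w = 0"
  using nondegenerate_perp[OF nd commutator_subspace] by metis
 have "br u w \<in> commutator s br U UNIV" if "u \<in> U" for u w
  unfolding commutator_def by (rule span_base) (use that in auto)
 then have perp: "killing v (br u w) = 0" if "u \<in> U" for u w using v(2) that by blast
 have "br v u = 0" if "u \<in> U" for u
  by (rule nd) (use killing_invariant[of v u] perp[OF that] in auto)
 then have "br u v = 0" if "u \<in> U" for u using br_skew[of u v] that by simp
 then show False using c[of v] perp v(1) by blast
qed

end

section \<open>Cartan subalgebras and Chevalley generators\<close>

lemma independent_functionals_surjective:
 fixes \<alpha> :: "'i => 'v::ab_group_add => 'k::field"
 assumes vs: "vector_space s" and H: "module.subspace s H" and I: "finite I"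
  and lin: "!!i. i \<in> I ==> linear_on s (*) H (\<alpha> i)"
  and ind: "!!c. (!!h. h \<in> H ==> (\<Sum>i\<in>I. c i * \<alpha> i h) = 0) ==> (!!i. i \<in> I ==> c i = 0)"
 shows "\<exists>h\<in>H. \<forall>i\<in>I. \<alpha> i h = c i"
 using I lin ind
proof (induction I arbitrary: c rule: finite_induct)
 case empty
 interpret vector_space s by (rule vs)
 show ?case using subspace_0[OF H] by auto
next
 case (insert j I)
 interpret vector_space s by (rule vs)
 interpret vector_space_pair s "(*) :: 'k => 'k => 'k" by (rule field_pair)
 have indI: "c i = 0" if "!!h. h \<in> H ==> (\<Sum>i\<in>I. c i * \<alpha> i h) = 0" "i \<in> I" for c i
 proof -
  have "(\<Sum>i\<in>insert j I. (c(j := 0)) i * \<alpha> i h) = (\<Sum>i\<in>I. c i * \<alpha> i h)" for h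
   using insert.hyps by (auto intro!: sum.cong)
  then have "(\<Sum>i\<in>insert j I. (c(j := 0)) i * \<alpha> i h) = 0" if "h \<in> H" for h
   using `!!h. h \<in> H ==> (\<Sum>i\<in>I. c i * \<alpha> i h) = 0`[OF that] by (simp only:)
  from insert.prems(2)[of "c(j := 0)", OF this] that(2) have "(c(j := 0)) i = 0" by blast
  then show ?thesis using that(2) insert.hyps by (auto split: if_splits)
 qed
 have IH: "\<exists>h\<in>H. \<forall>i\<in>I. \<alpha> i h = c i" for c
  by (rule insert.IH) (use insert.prems(1) indI in auto)
 then obtain d where d: "!!i. d i \<in> H" "!!i k. i \<in> I ==> \<alpha> i (d k) = (if i = k then 1 else 0)"
  using IH[of "\<lambda>i. if i = k then 1 else 0" for k] by metis
 have "\<exists>y\<in>H. (\<forall>i\<in>I. \<alpha> i y = 0) & \<alpha> j y ~= 0"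
 proof (rule ccontr)
  assume "\<not> ?thesis"
  then have no: "!!y. y \<in> H ==> (!!i. i \<in> I ==> \<alpha> i y = 0) ==> \<alpha> j y = 0" by blast
  let ?c = "\<lambda>i. if i = j then 1 else - \<alpha> j (d i)"
  have "(\<Sum>i\<in>insert j I. ?c i * \<alpha> i x) = 0" if x: "x \<in> H" for x
  proof -
   let ?y = "\<Sum>k\<in>I. s (\<alpha> k x) (d k)"
   have y: "?y \<in> H" using d(1) H by (intro subspace_sum subspace_scale) auto
   have val: "\<alpha> i ?y = (\<Sum>k\<in>I. \<alpha> k x * \<alpha> i (d k))" if "i \<in> insert j I" for i
    using linear_on_sum_scale[OF insert.prems(1)[OF that] H, of I d] d(1) by simp
   have "\<alpha> i (x - ?y) = 0" if i: "i \<in> I" for i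
   proof -
    have "\<alpha> i ?y = \<alpha> i x"
     unfolding val[OF insertI2[OF i]] using i insert.hyps(1) d(2)[OF i]
     by (subst sum.remove[of _ i]) (auto intro!: sum.neutral split: if_splits)
    then show ?thesis using linear_on_diff[OF insert.prems(1) H x y] i by simp
   qed
   then have "\<alpha> j (x - ?y) = 0" using no[OF subspace_diff[OF H x y]] by blast
   then have "\<alpha> j x = \<alpha> j ?y" using linear_on_diff[OF insert.prems(1) H x y, of j] by simp
   then have "\<alpha> j x = (\<Sum>k\<in>I. \<alpha> k x * \<alpha> j (d k))" by (simp add: val)
   moreover have "(\<Sum>i\<in>I. ?c i * \<alpha> i x) = - (\<Sum>k\<in>I. \<alpha> k x * \<alpha> j (d k))"
    unfolding sum_negf[symmetric] using insert.hyps(2) by (intro sum.cong) auto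
   ultimately show ?thesis using insert.hyps by simp
  qed
  from insert.prems(2)[of ?c, OF this] have "?c j = 0" by blast
  then show False by simp
 qed
 then obtain y where y: "y \<in> H" "!!i. i \<in> I ==> \<alpha> i y = 0" "\<alpha> j y ~= 0" by blast
 obtain h where h: "h \<in> H" "!!i. i \<in> I ==> \<alpha> i h = c i" using IH by metis
 let ?t = "(c j - \<alpha> j h) / \<alpha> j y"
 have "\<alpha> i (h + s ?t y) = \<alpha> i h + ?t * \<alpha> i y" if "i \<in> insert j I" for i
  using linear_on_add[OF insert.prems(1)[OF that] h(1) subspace_scale[OF H y(1)]]
   linear_on_scale[OF insert.prems(1)[OF that] y(1)] by simp
 then have "\<forall>i\<in>insert j I. \<alpha> i (h + s ?t y) = c i" using y h by auto
 then show ?case using h(1) y(1) subspace_add[OF H] subspace_scale[OF H] by blast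
qed

context finite_dim_lie_algebra
begin

text \<open>
  Lie's theorem for nilpotent algebras. On a minimal stable subspace, the last term of the lower
  central series acting nontrivially acts by scalars; if it consists of sums of commutators, its
  elements have trace zero there, so the scalars vanish.
\<close>

lemma nilpotent_common_eigenvector:
 assumes H: "subalgebra H" "nilpotent_lie s br H" and V: "ad_stable H V" "V ~= {0}"
 shows "\<exists>\<phi> u. u \<in> V & u ~= 0 & (\<forall>h\<in>H. br h u = s (\<phi> h) u)"
proof -
 have sH: "subspace H" and Hbr: "!!x y. x \<in> H ==> y \<in> H ==> br x y \<in> H"
  using H(1) by (auto simp: subalgebra_def)
 define P where "P U \<longleftrightarrow> ad_stable H U & U ~= {0}" for U
 have sV: "subspace V" using V(1) by (simp add: ad_stable_def)
 obtain W where W: "P W" "W \<subseteq> V" "!!U. P U ==> U \<subseteq> W ==> U = W"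
  using finite_dim_minimal_subspace[OF finite_dim_any[OF sV], of P] V
  by (auto simp: P_def ad_stable_def)
 have sW: "subspace W" and nW: "W ~= {0}" and Wst: "!!h w. h \<in> H ==> w \<in> W ==> br h w \<in> W"
  using W(1) by (auto simp: P_def ad_stable_def)
 define C where "C n = ((\<lambda>U. commutator s br H U) ^^ n) H" for n
 have C_Suc: "C (Suc n) = commutator s br H (C n)" for n by (simp add: C_def)
 have C: "subspace (C n) & C n \<subseteq> H & C (Suc n) \<subseteq> C n" for n
 proof (induction n)
  case 0
  have "commutator s br H H \<subseteq> H"
   unfolding commutator_def by (rule span_minimal[OF _ sH]) (use Hbr in auto)
  then show ?case using sH by (simp add: C_def)
 next
  case (Suc n)
  then show ?case using commutator_subspace commutator_mono[of H H "C (Suc n)" "C n"]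
   by (auto simp: C_Suc)
 qed
 have C_br: "br h c \<in> C (Suc n)" if "h \<in> H" "c \<in> C n" for h c n
  unfolding C_Suc commutator_def by (rule span_base) (use that in auto)
 define Z where "Z n \<longleftrightarrow> (\<forall>c\<in>C n. \<forall>w\<in>W. br c w = 0)" for n
 obtain n0 where "C n0 = {0}" using H(2) by (auto simp: nilpotent_lie_def C_def)
 then have "Z n0" by (simp add: Z_def)
 then obtain n where n: "Z n" "!!m. m < n ==> \<not> Z m"
  using LeastI_ex[of Z] not_less_Least by metis
 have scal: "\<exists>l. \<forall>h\<in>H. \<forall>w\<in>W. br h w = s (l h) w"
 proof (cases n)
  case 0
  then have "\<forall>h\<in>H. \<forall>w\<in>W. br h w = s 0 w" using n(1) by (simp add: Z_def C_def)
  then show ?thesis by (intro exI[of _ "\<lambda>_. 0"]) simp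
 next
  case (Suc m)
  have eW: "endo s W (br h)" if "h \<in> H" for h
   using Wst[OF that] linear_on_subset[OF ad_linear] by (auto simp: endo_def)
  have "\<exists>l. \<forall>j\<in>C m. \<forall>v\<in>W. br j v = s (l j) v"
  proof (rule abelian_ideal_acts_by_scalars[OF vs finite_dim_any[OF sW] nW eW,
     where L = H and J = "C m" and bk = br])
   show "C m \<subseteq> H" using C by blast
   have neg: "br j a = - br a j" for j a by (rule br_skew)
   show "br j a \<in> C m" if "j \<in> C m" "a \<in> H" for j a
    using C_br[OF that(2,1)] C[of m] subspace_neg unfolding neg[of j a] by blast
   show "br (br j a) v = br j (br a v) - br a (br j v)" for j a v
    using br_derivation[of j a v] by simp
   show "br i (br j v) = br j (br i v)" if ij: "i \<in> C m" "j \<in> C m" and v: "v \<in> W" for i j v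
   proof -
    have "i \<in> H" using C[of m] ij by blast
    then have "br (br i j) v = 0" using C_br[OF _ ij(2)] n(1) Suc v by (auto simp: Z_def)
    then show ?thesis using br_derivation[of i j v] by simp
   qed
   show "U = {0} \<or> U = W" if "subspace U" "U \<subseteq> W" "!!a. a \<in> H ==> br a ` U \<subseteq> U" for U
    using W(3)[of U] that by (auto simp: P_def ad_stable_def)
  qed
  then obtain l where l: "!!j v. j \<in> C m ==> v \<in> W ==> br j v = s (l j) v" by blast
  show ?thesis
  proof (cases m)
   case 0
   then show ?thesis using l by (auto simp: C_def)
  next
   case (Suc m')
   have sub: "C m' \<subseteq> H" using C by blast
   obtain B where B: "finite B" "independent B" "span B = W"
    using finite_dim_basis[OF finite_dim_any[OF sW] sW subset_refl] by metis
   have "B ~= {}" using B(3) nW by auto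
   have lin: "linear_on s s H (\<lambda>a. br a v)" for v by (simp add: linear_on_def)
   have "l j = 0" if j: "j \<in> C m" for j
   proof -
    have "trace s B (br j) = 0"
    proof (rule trace_sum_of_commutators[OF vs vs sH, of H "C m'" br, where V = W and \<rho> = br])
     show "br a b \<in> H" if "a \<in> H" "b \<in> C m'" for a b using Hbr that sub by blast
     show "br (br a b) v = br a (br b v) - br b (br a v)" for a b v
      using br_derivation[of a b v] by simp
     show "j \<in> span {br u v | u v. u \<in> H & v \<in> C m'}"
      using j[unfolded Suc C_Suc commutator_def] .
    qed (use sub B eW lin in simp_all)
    moreover have "trace s B (br j) = trace s B (s (l j))"
     using B(3) l[OF j] span_base by (intro trace_cong) auto
    ultimately show ?thesis using trace_scalar[OF B(1,2), of "l j"] `B ~= {}` B(1) by simp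
   qed
   then have "Z m" using l by (simp add: Z_def)
   then show ?thesis using n(2)[of m] `n = Suc m` by simp
  qed
 qed
 obtain u where "u \<in> W" "u ~= 0" using nW subspace_0[OF sW] by auto
 then show ?thesis using scal W(2) by blast
qed

lemma nilpotent_ad_nilpotent:
 assumes "nilpotent_lie s br H" "h \<in> H" "x \<in> H"
 shows "\<exists>n. (br h ^^ n) x = 0"
proof -
 obtain n where n: "((\<lambda>U. commutator s br H U) ^^ n) H = {0}"
  using assms(1) by (auto simp: nilpotent_lie_def)
 have "(br h ^^ m) x \<in> ((\<lambda>U. commutator s br H U) ^^ m) H" for m
 proof (induction m)
  case (Suc m)
  then show ?case using assms(2) by (auto simp: commutator_def intro!: span_base)
 qed (use assms in simp)
 then show ?thesis using n by blast
qed

lemma root_linear: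
 assumes "subspace H" "is_root s br UNIV H \<phi>"
 shows "linear_on s (*) H \<phi>"
  and "x \<in> H ==> y \<in> H ==> br x y \<in> H ==> \<phi> (br x y) = 0"
proof -
 have "subspace (root_space s br UNIV H \<phi>)"
  by (rule subspaceI) (auto simp: root_space_def scale_right_distrib mult.commute)
 then obtain u where u: "u ~= 0" "!!h. h \<in> H ==> br h u = s (\<phi> h) u"
  using assms(2) subspace_0 by (auto simp: is_root_def root_space_def)
 have cancel: "a = b" if "s a u = s b u" for a b using that u(1) by simp
 show "linear_on s (*) H \<phi>"
  unfolding linear_on_def
 proof (intro conjI ballI allI; rule cancel)
  fix x y assume "x \<in> H" "y \<in> H"
  then show "s (\<phi> (x + y)) u = s (\<phi> x + \<phi> y) u"
   using u(2)[of x] u(2)[of y] u(2)[of "x + y"] subspace_add[OF assms(1)]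
   by (simp add: scale_left_distrib)
 next
  fix c x assume "x \<in> H"
  then show "s (\<phi> (s c x)) u = s (c * \<phi> x) u"
   using u(2)[of x] u(2)[of "s c x"] subspace_scale[OF assms(1)] by (metis br_scale(1) scale_scale)
 qed
 show "\<phi> (br x y) = 0" if "x \<in> H" "y \<in> H" "br x y \<in> H"
  by (rule cancel)
   (use that u(2)[of x] u(2)[of y] u(2)[of "br x y"] br_derivation[of x y u] in
    \<open>simp add: mult.commute\<close>)
qed

text \<open>
  An eigenvalue \<open>c \<noteq> 0\<close> of \<open>ad h\<close> is a value of a root: the generalized eigenspace is stable under the
  nilpotent algebra and so contains a common eigenvector.
\<close>

lemma eigenvalue_is_root_value:
 assumes H: "subalgebra H" "nilpotent_lie s br H" and V: "ad_stable H V"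
  and h: "h \<in> H" and w: "w \<in> V" "w ~= 0" "br h w = s c w" "c ~= 0"
 obtains \<phi> u where "is_root s br UNIV H \<phi>" "\<phi> h = c" "u \<in> V" "u ~= 0" "u \<in> root_space s br UNIV H \<phi>"
proof -
 note vT = vs ad_linear
 let ?G = "geig s (br h) c \<inter> V"
 have "ad_stable H ?G"
  unfolding ad_stable_def
 proof (intro conjI ballI)
  show "subspace ?G"
   using subspace_inter[OF geig_subspace[OF vT]] V by (auto simp: ad_stable_def)
  fix x u assume x: "x \<in> H" and u: "u \<in> ?G"
  have "x \<in> geig s (br h) 0" using nilpotent_ad_nilpotent[OF H(2) h x] geig_zero_iff by blast
  then have "br x u \<in> geig s (br h) (0 + c)" using u by (intro bracket_geig) auto
  then show "br x u \<in> ?G" using V x u by (auto simp: ad_stable_def)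
 qed
 moreover have "(shift s (br h) c ^^ 1) w = 0" using w by (simp add: shift_def)
 then have "w \<in> ?G" unfolding geig_def using w by blast
 then have "?G ~= {0}" using w by auto
 ultimately obtain \<phi> u where u: "u \<in> ?G" "u ~= 0" "!!h. h \<in> H ==> br h u = s (\<phi> h) u"
  using nilpotent_common_eigenvector[OF H] by metis
 have "shift s (br h) (\<phi> h) u = 0" using u(3)[OF h] by (simp add: shift_def)
 then have "\<phi> h = c" using geig_shift_inj[OF vT, of u h c "\<phi> h"] u by auto
 moreover have "u \<in> root_space s br UNIV H \<phi>" using u by (auto simp: root_space_def)
 ultimately show ?thesis using that[of \<phi> u] u h w(4) by (auto simp: is_root_def)
qed

text \<open>
  Let \<open>\<rho>\<close> in the Cartan subalgebra take the value 1 at all simple roots. Its centralizer is the Cartan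
  subalgebra, on which the Killing form is nondegenerate. Hence the coroots span it, \<open>\<rho>\<close> is fixed by
  any automorphism permuting the Chevalley generators, and a vector commuting with all fixed points
  lies in the Cartan subalgebra and is killed by the simple roots.
\<close>

lemma chevalley_centralizer_zero:
 fixes e f h :: "'i => 'g"
 assumes nd: "!!x. (!!y. killing x y = 0) ==> x = 0"
  and ch: "chevalley_generators s br UNIV I h e f"
  and G: "!!a. a \<in> G ==> linear_on s s UNIV a" "!!a u v. a \<in> G ==> a (br u v) = br (a u) (a v)"
   "!!a. a \<in> G ==> \<exists>\<pi>. bij_betw \<pi> I I & (\<forall>i\<in>I. a (h i) = h (\<pi> i) & a (e i) = e (\<pi> i))"
  and v: "!!u. (!!a. a \<in> G ==> a u = u) ==> br u v = 0"
 shows "v = 0"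
proof -
 note vT = vs ad_linear
 obtain H \<alpha> where I: "finite I" and cart: "cartan_subalgebra s br UNIV H"
  and base: "is_root_base s br UNIV H I \<alpha>"
  and gens: "!!i. i \<in> I ==> h i \<in> H & \<alpha> i (h i) = 2 & e i \<in> root_space s br UNIV H (\<alpha> i) &
      f i \<in> root_space s br UNIV H (\<lambda>x. - \<alpha> i x) & br (e i) (f i) = h i"
  using ch unfolding chevalley_generators_def by blast
 have sH: "subspace H" and Hsub: "subalgebra H" and Hnil: "nilpotent_lie s br H"
  and Hnorm: "!!u. (!!x. x \<in> H ==> br u x \<in> H) ==> u \<in> H"
  using cart by (auto simp: cartan_subalgebra_def subalgebra_def)
 have Hbr: "br x y \<in> H" if "x \<in> H" "y \<in> H" for x y using Hsub that by (auto simp: subalgebra_def)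
 have hH: "h i \<in> H" and ah: "\<alpha> i (h i) = 2" and ef: "br (e i) (f i) = h i"
  and e: "!!x. x \<in> H ==> br x (e i) = s (\<alpha> i x) (e i)"
  and f: "!!x. x \<in> H ==> br x (f i) = s (- \<alpha> i x) (f i)" if "i \<in> I" for i
  using gens[OF that] by (auto simp: root_space_def)
 have roots: "!!i. i \<in> I ==> is_root s br UNIV H (\<alpha> i)"
  and ind: "!!c. (!!h. h \<in> H ==> (\<Sum>i\<in>I. c i * \<alpha> i h) = 0) ==> (!!i. i \<in> I ==> c i = 0)"
  and expand: "!!\<phi>. is_root s br UNIV H \<phi> ==> \<exists>n :: 'i => nat.
    (\<forall>h\<in>H. \<phi> h = (\<Sum>i\<in>I. of_nat (n i) * \<alpha> i h)) \<or> (\<forall>h\<in>H. \<phi> h = - (\<Sum>i\<in>I. of_nat (n i) * \<alpha> i h))"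
  using base unfolding is_root_base_def by blast+
 note lin\<alpha> = root_linear(1)[OF sH roots]
 have surj: "\<exists>x\<in>H. \<forall>i\<in>I. \<alpha> i x = c i" for c
  by (rule independent_functionals_surjective[OF vs sH I lin\<alpha>]) (use ind in blast)+
 obtain r where r: "r \<in> H" "!!i. i \<in> I ==> \<alpha> i r = 1"
  using surj[of "\<lambda>_. 1"] by auto
 define K where "K = geig s (br r) 0"
 have sK: "subspace K" using geig_subspace[OF vT] by (simp add: K_def)
 have HK: "H \<subseteq> K" using nilpotent_ad_nilpotent[OF Hnil r(1)] geig_zero_iff by (auto simp: K_def)
 have Kst: "ad_stable H K"
  using sK bracket_geig[of _ r 0 _ 0] HK by (auto simp: ad_stable_def K_def)
 have KH: "K = H"
 proof (rule ccontr)
  assume "K ~= H"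
  then have sub: "H \<subset> K" using HK by auto
  have nil: "\<exists>n. (br x ^^ n) w = 0" if x: "x \<in> H" and w: "w \<in> K" for x w
  proof (rule no_eigenvalue_nilpotent[OF vT finite_dim_any[OF sK] _ _ w])
   show "br x ` K \<subseteq> K" using Kst x by (auto simp: ad_stable_def)
   fix c w assume w: "w \<in> K" "br x w = s c w" "w ~= 0"
   show "c = 0"
   proof (rule ccontr)
    assume c: "c ~= 0"
    obtain \<phi> u where \<phi>: "is_root s br UNIV H \<phi>" "\<phi> x = c" "u \<in> K" "u ~= 0"
      "u \<in> root_space s br UNIV H \<phi>"
     using eigenvalue_is_root_value[OF Hsub Hnil Kst x w(1,3,2) c] by blast
    have "shift s (br r) (\<phi> r) u = 0" using \<phi>(5) r(1) by (simp add: shift_def root_space_def)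
    then have "\<phi> r = 0" using geig_shift_inj[OF vT, of u r 0 "\<phi> r"] \<phi> by (auto simp: K_def)
    moreover obtain n :: "'i => nat" where
     n: "(\<forall>h\<in>H. \<phi> h = (\<Sum>i\<in>I. of_nat (n i) * \<alpha> i h)) \<or> (\<forall>h\<in>H. \<phi> h = - (\<Sum>i\<in>I. of_nat (n i) * \<alpha> i h))"
     using expand[OF \<phi>(1)] by blast
    moreover have "(\<Sum>i\<in>I. of_nat (n i) * \<alpha> i r) = of_nat (\<Sum>i\<in>I. n i)" using r(2) by simp
    ultimately have "of_nat (\<Sum>i\<in>I. n i) = (0 :: 'k)" using r(1) by auto
    then have "\<forall>i\<in>I. n i = 0" using I by (simp only: of_nat_eq_0_iff sum_eq_0_iff)
    then have "\<phi> x = 0" using n x by auto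
    then show False using \<phi>(2) c by simp
   qed
  qed
  have "ad_stable H H" using Hsub by (auto simp: ad_stable_def subalgebra_def)
  then obtain w where w: "w \<in> K" "w \<notin> H" "!!z. z \<in> H ==> br z w \<in> H"
   using engel[OF Hsub HK Kst nil _ Kst sub subset_refl] by blast
  have "br w z \<in> H" if "z \<in> H" for z
   using w(3)[OF that] br_skew[of w z] subspace_neg[OF sH] by simp
  then show False using Hnorm w(2) by blast
 qed
 define P where "P = span (\<Union>c\<in>-{0}. geig s (br r) c)"
 have perp: "killing x y = 0" if x: "x \<in> H" and y: "y \<in> P" for x y
  using y unfolding P_def
 proof (induction rule: span_induct_alt)
  case (step c y z)
  then show ?case
   using x KH killing_geig_orthogonal[of x r 0 y] by (auto simp: killing_bilinear K_def)
 qed simp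
 have decomp: "\<exists>x\<in>H. \<exists>y\<in>P. w = x + y" for w
 proof -
  have "w \<in> span (\<Union>c. geig s (br r) c)" using geig_span[OF vT finite_dim, of r] by auto
  then show ?thesis
  proof (induction rule: span_induct_alt)
   case base
   show ?case using subspace_0[OF sH] span_zero by (force simp: P_def)
  next
   case (step c y z)
   then obtain d x p where d: "y \<in> geig s (br r) d" and xp: "x \<in> H" "p \<in> P" "z = x + p" by auto
   show ?case
   proof (cases "d = 0")
    case True
    then have "s c y + x \<in> H"
     using d xp KH subspace_add[OF sH] subspace_scale[OF sH] by (auto simp: K_def)
    then show ?thesis using xp by (metis add.assoc)
   next
    case False
    then have "y \<in> P" using d by (auto simp: P_def intro: span_base)
    then have "s c y + p \<in> P" using xp(2) by (simp add: P_def span_add span_scale)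
    then show ?thesis using xp by (metis add.left_commute)
   qed
  qed
 qed
 have ndH: "x = 0" if "x \<in> H" "!!y. y \<in> H ==> killing x y = 0" for x
 proof (rule nd)
  fix y
  obtain a b where "a \<in> H" "b \<in> P" "y = a + b" using decomp by blast
  then show "killing x y = 0" using that perp by (simp add: killing_bilinear)
 qed
 have root_zero: "x = 0" if x: "x \<in> H" and ax: "!!i. i \<in> I ==> \<alpha> i x = 0" for x
 proof -
  define N where "N = {x \<in> H. \<forall>i\<in>I. \<alpha> i x = 0}"
  have sN: "subspace N"
  proof (rule subspaceI)
   show "0 \<in> N"
    using subspace_0[OF sH] vector_space_pair.linear_on_zero[OF field_pair lin\<alpha> sH]
    by (auto simp: N_def)
  qed (use subspace_add[OF sH] subspace_scale[OF sH] in
    \<open>auto simp: N_def linear_on_add[OF lin\<alpha>] linear_on_scale[OF lin\<alpha>]\<close>)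
  have HN: "br a b \<in> N" if "a \<in> H" "b \<in> H" for a b
   using that Hbr root_linear(2)[OF sH roots] by (auto simp: N_def)
  then have Nsub: "subalgebra N" using sN by (auto simp: subalgebra_def N_def)
  have nil: "\<exists>n. (br z ^^ n) w = 0" if z: "z \<in> N" for z w
  proof (rule no_eigenvalue_nilpotent[OF vT finite_dim])
   fix c w assume w: "br z w = s c w" "w ~= 0"
   show "c = 0"
   proof (rule ccontr)
    assume c: "c ~= 0"
    have st: "ad_stable H UNIV" by (simp add: ad_stable_def)
    have zH: "z \<in> H" using z by (simp add: N_def)
    obtain \<phi> u where \<phi>: "is_root s br UNIV H \<phi>" "\<phi> z = c"
     using eigenvalue_is_root_value[OF Hsub Hnil st zH UNIV_I w(2,1) c] by blast
    then show False using expand[OF \<phi>(1)] z c by (auto simp: N_def)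
   qed
  qed auto
  \<comment> \<open>The product `ad x \<circ> ad y` is nilpotent: it moves each step of a filtration by
   `H`-stable subspaces into the step before, as `x` belongs to the ideal `N` of `H`.\<close>
  have "killing x y = 0" if y: "y \<in> H" for y
  proof -
   let ?T = "\<lambda>w. br x (br y w)"
   have lT: "linear_on s s UNIV ?T" by (rule linear_on_compose[OF ad_linear ad_linear])
   define Q where "Q U \<longleftrightarrow> ad_stable H U & U \<subseteq> geig s ?T 0" for U
   have "Q {0}" using subspace_0[OF geig_subspace[OF vs lT]] by (auto simp: Q_def ad_stable_def)
   then obtain U where U: "Q U" and max: "!!W. Q W ==> U \<subseteq> W ==> W = U"
    using finite_dim_maximal_subspace[OF finite_dim, of Q "{0}"]
    by (auto simp: Q_def ad_stable_def)
   have sU: "subspace U" and Ust: "!!x u. x \<in> H ==> u \<in> U ==> br x u \<in> U"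
    using U by (auto simp: Q_def ad_stable_def)
   have "U = UNIV"
   proof (rule ccontr)
    assume "U ~= UNIV"
    then have UU: "U \<subset> UNIV" by auto
    have st: "ad_stable N U" "ad_stable N UNIV" using sU Ust by (auto simp: ad_stable_def N_def)
    obtain w where w: "w \<notin> U" "!!z. z \<in> N ==> br z w \<in> U"
     using engel[OF Nsub subset_UNIV st(2) nil st UU subset_UNIV] by blast
    define U' where "U' = {w. \<forall>z\<in>N. br z w \<in> U}"
    have st': "ad_stable H U'"
     unfolding ad_stable_def
    proof (intro conjI ballI)
     show "subspace U'"
      by (rule subspaceI) (use subspace_0[OF sU] subspace_add[OF sU] subspace_scale[OF sU] in \<open>auto simp: U'_def\<close>)
     fix a u assume a: "a \<in> H" and u: "u \<in> U'"
     have "br z (br a u) \<in> U" if z: "z \<in> N" for z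
      using br_derivation[of z a u] HN[of z a] a z u subspace_add[OF sU] Ust[OF a]
      by (auto simp: U'_def N_def)
     then show "br a u \<in> U'" by (simp add: U'_def)
    qed
    have "u \<in> geig s ?T 0" if "u \<in> U'" for u
    proof -
     have "?T u \<in> U" using st' that y x ax by (auto simp: ad_stable_def U'_def N_def)
     then have "shift s ?T 0 u \<in> geig s ?T 0" using U by (auto simp: Q_def shift_def)
     then show ?thesis by (rule geigI_shift[OF vs lT])
    qed
    then have "Q U'" using st' by (auto simp: Q_def)
    moreover have "U \<subseteq> U'" using Ust by (auto simp: U'_def N_def)
    ultimately have "U' = U" by (rule max)
    then show False using w by (auto simp: U'_def)
   qed
   then have "\<exists>n. (?T ^^ n) w = 0" for w using U geig_zero_iff by (auto simp: Q_def)
   then show ?thesis unfolding killing_def by (rule tr_locally_nilpotent[OF lT])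
  qed
  then show ?thesis using ndH[OF x] by blast
 qed
 have kh: "killing (h i) x = \<alpha> i x * killing (e i) (f i)" if i: "i \<in> I" and x: "x \<in> H" for i x
 proof -
  have "br (f i) x = s (\<alpha> i x) (f i)" using br_skew[of "f i" x] f[OF i x] by simp
  then show ?thesis using killing_invariant[of "e i" "f i" x] ef[OF i] by (simp add: killing_bilinear)
 qed
 have nz: "killing (e i) (f i) ~= 0" if i: "i \<in> I" for i
 proof
  assume "killing (e i) (f i) = 0"
  then have "h i = 0" using ndH[OF hH[OF i]] kh[OF i] by simp
  then have "\<alpha> i (h i) = 0"
   using vector_space_pair.linear_on_zero[OF field_pair lin\<alpha>[OF i] sH] by simp
  then show False using ah[OF i] by simp
 qed
 have spanH: "H \<subseteq> span (h ` I)"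
 proof -
  define W where "W = {a + b | a b. a \<in> span (h ` I) & b \<in> P}"
  have sW: "subspace W" unfolding W_def by (rule subspace_sums) (simp_all add: P_def)
  have WW: "span (h ` I) \<subseteq> W" "P \<subseteq> W"
   unfolding W_def using span_zero by (force simp: P_def)+
  have "W = UNIV"
  proof (rule ccontr)
   assume "W ~= UNIV"
   then obtain w where w: "w ~= 0" "!!u. u \<in> W ==> killing w u = 0"
    using nondegenerate_perp[OF nd sW] by metis
   obtain a b where ab: "a \<in> H" "b \<in> P" "w = a + b" using decomp by blast
   have "b = 0"
   proof (rule nd)
    fix y
    obtain a' b' where y: "a' \<in> H" "b' \<in> P" "y = a' + b'" using decomp by blast
    have "killing b a' = 0" using perp[OF y(1) ab(2)] killing_commute by metis
    moreover have "killing b b' = killing w b' - killing a b'"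
     using ab(3) by (simp add: killing_bilinear)
    ultimately show "killing b y = 0"
     using y w(2) WW(2) perp[OF ab(1) y(2)] by (auto simp: killing_bilinear)
   qed
   then have wH: "w \<in> H" using ab by simp
   have "\<alpha> i w = 0" if i: "i \<in> I" for i
   proof -
    have "h i \<in> W" using WW(1) i by (auto intro: span_base)
    then have "killing (h i) w = 0" using w(2) killing_commute by metis
    then show ?thesis using kh[OF i wH] nz[OF i] by simp
   qed
   then show False using root_zero[OF wH] w(1) by blast
  qed
  show ?thesis
  proof
   fix x assume x: "x \<in> H"
   have "x \<in> W" using `W = UNIV` by simp
   then obtain a b where ab: "x = a + b" "a \<in> span (h ` I)" "b \<in> P" unfolding W_def by blast
   have aH: "a \<in> H" using ab(2) span_minimal[OF _ sH, of "h ` I"] hH by auto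
   have "x - a = 0"
   proof (rule ndH)
    show "x - a \<in> H" using x aH sH by (simp add: subspace_diff)
    show "killing (x - a) y = 0" if "y \<in> H" for y
     using perp[OF that ab(3)] ab(1) killing_commute by (metis add_diff_cancel_left')
   qed
   then show "x \<in> span (h ` I)" using ab(2) by simp
  qed
 qed
 have e_nz: "e i ~= 0" if "i \<in> I" for i
  using nz[OF that] by auto
 have r_fixed: "a r = r" if a: "a \<in> G" for a
 proof -
  obtain \<pi> where \<pi>: "bij_betw \<pi> I I" "!!i. i \<in> I ==> a (h i) = h (\<pi> i)" "!!i. i \<in> I ==> a (e i) = e (\<pi> i)"
   using G(3)[OF a] by blast
  have in_H: "a x \<in> H" if "x \<in> span (h ` I)" for x
   using that
  proof (induction rule: span_induct_alt)
   case base
   show ?case using ss.linear_on_zero[OF G(1)[OF a] subspace_UNIV] subspace_0[OF sH] by simp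
  next
   case (step c y z)
   then obtain i where i: "i \<in> I" "y = h i" by auto
   then have "a y \<in> H" using \<pi>(1,2) hH by (auto simp: bij_betw_def)
   then show ?case
    using step(2) G(1)[OF a] subspace_add[OF sH] subspace_scale[OF sH] by (simp add: linear_on_def)
  qed
  then have arH: "a r \<in> H" using spanH r(1) by auto
  have "\<alpha> j (a r) = 1" if "j \<in> I" for j
  proof -
   have "j \<in> \<pi> ` I" using bij_betw_imp_surj_on[OF \<pi>(1)] that by simp
   then obtain i where i: "i \<in> I" "j = \<pi> i" by blast
   have "br (a r) (e j) = a (br r (e i))" using G(2)[OF a] \<pi>(3) i by simp
   also have "\<dots> = e j" using e[OF i(1) r(1)] r(2) i \<pi>(3) by simp
   finally have "s (\<alpha> j (a r)) (e j) = s 1 (e j)" using e[OF that arH] by simp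
   then show ?thesis using e_nz[OF that] by (simp only: scale_right_imp_eq scale_cancel_right) simp
  qed
  then have "\<alpha> i (a r - r) = 0" if "i \<in> I" for i
   using that r vector_space_pair.linear_on_diff[OF field_pair lin\<alpha>[OF that] sH arH r(1)] by simp
  then have "a r - r = 0" using root_zero[of "a r - r"] subspace_diff[OF sH arH r(1)] by blast
  then show ?thesis by simp
 qed
 have "br r v = 0" using v r_fixed by blast
 then have "(br r ^^ 1) v = 0" by simp
 then have vH: "v \<in> H" using geig_zero_iff KH unfolding K_def by blast
 let ?E = "\<Sum>i\<in>I. e i"
 have "a ?E = ?E" if a: "a \<in> G" for a
 proof -
  obtain \<pi> where \<pi>: "bij_betw \<pi> I I" "!!i. i \<in> I ==> a (e i) = e (\<pi> i)" using G(3)[OF a] by blast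
  have "a ?E = (\<Sum>i\<in>I. e (\<pi> i))"
   using ss.linear_on_sum[OF G(1)[OF a] subspace_UNIV, of I e] \<pi>(2) by simp
  also have "\<dots> = ?E" using sum.reindex_bij_betw[OF \<pi>(1)] by metis
  finally show ?thesis .
 qed
 then have "br v ?E = 0" using v br_skew[of v ?E] by simp
 then have sum0: "(\<Sum>i\<in>I. s (\<alpha> i v) (e i)) = 0"
  using ss.linear_on_sum[OF ad_linear subspace_UNIV, of I e v] e vH by simp
 have orth: "killing (e i) (f j) = 0" if ij: "i \<in> I" "j \<in> I" "i ~= j" for i j
 proof -
  obtain x where x: "x \<in> H" "\<forall>k\<in>I. \<alpha> k x = (if k = i then 1 else 0)"
   using surj[of "\<lambda>k. if k = i then 1 else 0"] by auto
  have "killing (br x (e i)) (f j) = - killing (e i) (br x (f j))"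
   using killing_invariant[of "e i" x "f j"] br_skew[of x "e i"]
    killing_diff(1)[of 0 "br (e i) x" "f j"] by simp
  then show ?thesis using e[OF ij(1) x(1)] f[OF ij(2) x(1)] x(2) ij by (simp add: killing_bilinear)
 qed
 have "\<alpha> j v = 0" if j: "j \<in> I" for j
 proof -
  have lk: "linear_on s (*) UNIV (\<lambda>w. killing w (f j))"
   by (simp add: linear_on_def killing_bilinear)
  have "0 = killing (\<Sum>i\<in>I. s (\<alpha> i v) (e i)) (f j)" using sum0 by simp
  also have "\<dots> = (\<Sum>i\<in>I. \<alpha> i v * killing (e i) (f j))"
   using vector_space_pair.linear_on_sum_scale[OF field_pair lk subspace_UNIV, of I e] by simp
  also have "\<dots> = \<alpha> j v * killing (e j) (f j)"
   using I j orth by (subst sum.remove[of _ j]) (auto intro!: sum.neutral)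
  finally show ?thesis using nz[OF j] by simp
 qed
 then show ?thesis using root_zero[OF vH] by blast
qed

end

section \<open>Irreducible representations\<close>

interpretation fs: vector_space "fscale :: 'k::field => ('i => 'k) => 'i => 'k"
 by (rule vector_space_fscale)

lemma fs_pair: "vector_space_pair (fscale :: 'k::field => ('i => 'k) => 'i => 'k)
  (fscale :: 'k => ('j => 'k) => 'j => 'k)"
 by unfold_locales

interpretation fsp: vector_space_pair "fscale :: 'k::field => ('i => 'k) => 'i => 'k"
  "fscale :: 'k::field => ('j => 'k) => 'j => 'k"
 by (rule fs_pair)

interpretation fsk: vector_space_pair "fscale :: 'k::field => ('i => 'k) => 'i => 'k" "(*) :: 'k => 'k => 'k"
 by (rule fs.field_pair)

lemma is_rep_iff:
 "is_rep s br L (V, \<rho>) \<longleftrightarrow>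
   finite_dim fscale V & (\<forall>a\<in>L. endo fscale V (\<rho> a)) &
   (\<forall>v\<in>V. linear_on s fscale L (\<lambda>a. \<rho> a v)) &
   (\<forall>a\<in>L. \<forall>b\<in>L. \<forall>v\<in>V. \<rho> (br a b) v = \<rho> a (\<rho> b v) - \<rho> b (\<rho> a v))"
 unfolding is_rep_def finite_dim_def endo_def by (auto simp: Let_def)

lemma is_repD:
 assumes "is_rep s br L R"
 shows "finite_dim fscale (fst R)" "fs.subspace (fst R)" "!!a. a \<in> L ==> endo fscale (fst R) (snd R a)"
  "!!v. v \<in> fst R ==> linear_on s fscale L (\<lambda>a. snd R a v)"
  "!!a b v. a \<in> L ==> b \<in> L ==> v \<in> fst R ==> snd R (br a b) v = snd R a (snd R b v) - snd R b (snd R a v)"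
  "!!a v. a \<in> L ==> v \<in> fst R ==> snd R a v \<in> fst R"
  "!!a. a \<in> L ==> flinear (fst R) (snd R a)"
proof -
 obtain V \<rho> where R: "R = (V, \<rho>)" by (cases R)
 note r = assms[unfolded R is_rep_iff]
 show "finite_dim fscale (fst R)" using r by (simp add: R)
 then show "fs.subspace (fst R)" by (rule fs.finite_dim_subspace)
 show e: "endo fscale (fst R) (snd R a)" if "a \<in> L" for a using r that by (simp add: R)
 show "snd R a v \<in> fst R" if "a \<in> L" "v \<in> fst R" for a v using fs.endo_in[OF e] that by blast
 show "flinear (fst R) (snd R a)" if "a \<in> L" for a
  using fs.endo_linear[OF e] that by blast
qed (use assms in \<open>cases R, auto simp: is_rep_iff\<close>)+

lemma irreducible_repD:
 assumes "irreducible_rep s br L R"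
 shows "is_rep s br L R" "fst R ~= {0}"
  "!!W. fs.subspace W ==> W \<subseteq> fst R ==> (!!a v. a \<in> L ==> v \<in> W ==> snd R a v \<in> W) ==> W = {0} \<or> W = fst R"
 using assms unfolding irreducible_rep_def by (auto simp: image_subset_iff)

lemma subrep:
 assumes "is_rep s br L (V, \<rho>)" "fs.subspace W" "W \<subseteq> V" "!!a v. a \<in> L ==> v \<in> W ==> \<rho> a v \<in> W"
 shows "is_rep s br L (W, \<rho>)"
proof -
 have "endo fscale W (\<rho> a)" if "a \<in> L" for a
  by (rule fs.endo_subset[OF _ assms(3)]) (use assms(1,4) that in \<open>auto simp: is_rep_iff\<close>)
 then show ?thesis
  using assms(1) fs.finite_dim_subset[OF _ assms(2,3)] assms(3) unfolding is_rep_iff by blast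
qed

lemma irreducible_subrep:
 assumes R: "is_rep s br L (V, \<rho>)" and "V ~= {0}"
 obtains W where "W \<subseteq> V" "irreducible_rep s br L (W, \<rho>)"
proof -
 define P where "P W \<longleftrightarrow> fs.subspace W & W \<subseteq> V & W ~= {0} & (\<forall>a\<in>L. \<forall>w\<in>W. \<rho> a w \<in> W)" for W
 note RD = is_repD[OF R, simplified]
 have PV: "P V" using RD assms(2) by (auto simp: P_def)
 have "fs.subspace U" if "P U" for U using that by (simp add: P_def)
 then obtain W where W: "P W" "!!U. P U ==> U \<subseteq> W ==> U = W"
  using fs.finite_dim_minimal_subspace[of V P, OF RD(1) PV] by metis
 have "irreducible_rep s br L (W, \<rho>)"
  unfolding irreducible_rep_def
 proof (intro conjI allI impI)
  show "is_rep s br L (W, \<rho>)" by (rule subrep[OF R]) (use W(1) in \<open>auto simp: P_def\<close>)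
  fix U assume U: "fs.subspace U & U \<subseteq> fst (W, \<rho>) & (\<forall>a\<in>L. snd (W, \<rho>) a ` U \<subseteq> U)"
  then have "P U" if "U ~= {0}" using W(1) that by (auto simp: P_def)
  then show "U = {0} \<or> U = fst (W, \<rho>)" using W(2)[of U] U by auto
 qed (use W in \<open>auto simp: P_def\<close>)
 then show ?thesis using that W(1) by (auto simp: P_def)
qed

lemma rep_iso_refl: "rep_iso L R R"
 unfolding rep_iso_def by (intro exI[of _ id]) (auto simp: linear_on_def)

lemma rep_iso_sym:
 assumes R: "is_rep s br L R" and iso: "rep_iso L R R'"
 shows "rep_iso L R' R"
proof -
 obtain T where T: "flinear (fst R) T" "bij_betw T (fst R) (fst R')"
   "!!a v. a \<in> L ==> v \<in> fst R ==> T (snd R a v) = snd R' a (T v)"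
  using iso by (auto simp: rep_iso_def)
 note RD = is_repD[OF R]
 define S where "S = inv_into (fst R) T"
 have S: "S (T v) = v" if "v \<in> fst R" for v
  using T(2) that by (simp add: S_def bij_betw_def)
 have img: "\<exists>v\<in>fst R. w = T v" if "w \<in> fst R'" for w
  using T(2) that by (auto simp: bij_betw_def)
 have "flinear (fst R') S"
  unfolding linear_on_def
 proof (intro conjI ballI allI)
  fix u v assume "u \<in> fst R'" "v \<in> fst R'"
  then obtain u' v' where "u' \<in> fst R" "u = T u'" "v' \<in> fst R" "v = T v'" using img by blast
  then show "S (u + v) = S u + S v"
   using S fs.subspace_add[OF RD(2)] linear_on_add[OF T(1), symmetric] by simp
 next
  fix c v assume "v \<in> fst R'"
  then obtain v' where "v' \<in> fst R" "v = T v'" using img by blast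
  then show "S (fscale c v) = fscale c (S v)"
   using S fs.subspace_scale[OF RD(2)] linear_on_scale[OF T(1), symmetric] by simp
 qed
 moreover have "bij_betw S (fst R') (fst R)" unfolding S_def by (rule bij_betw_inv_into[OF T(2)])
 moreover have "S (snd R' a v) = snd R a (S v)" if a: "a \<in> L" and v: "v \<in> fst R'" for a v
 proof -
  obtain v' where v': "v' \<in> fst R" "v = T v'" using v img by blast
  then show ?thesis using T(3)[OF a v'(1), symmetric] S RD(6)[OF a] by simp
 qed
 ultimately show ?thesis unfolding rep_iso_def by blast
qed

lemma rep_iso_trans:
 assumes "rep_iso L R R'" "rep_iso L R' R''" shows "rep_iso L R R''"
proof -
 obtain T where T: "flinear (fst R) T" "bij_betw T (fst R) (fst R')"
   "!!a v. a \<in> L ==> v \<in> fst R ==> T (snd R a v) = snd R' a (T v)"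
  using assms(1) by (auto simp: rep_iso_def)
 obtain S where S: "flinear (fst R') S" "bij_betw S (fst R') (fst R'')"
   "!!a v. a \<in> L ==> v \<in> fst R' ==> S (snd R' a v) = snd R'' a (S v)"
  using assms(2) by (auto simp: rep_iso_def)
 have TR: "T v \<in> fst R'" if "v \<in> fst R" for v using T(2) that by (auto simp: bij_betw_def)
 have "flinear (fst R) (S \<circ> T)"
  using T(1) S(1) TR by (simp add: linear_on_def)
 moreover have "bij_betw (S \<circ> T) (fst R) (fst R'')" by (rule bij_betw_trans[OF T(2) S(2)])
 moreover have "(S \<circ> T) (snd R a v) = snd R'' a ((S \<circ> T) v)" if "a \<in> L" "v \<in> fst R" for a v
  using T(3) S(3) TR that by simp
 ultimately show ?thesis unfolding rep_iso_def by blast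
qed

lemma finite_dim_image:
 assumes "finite_dim fscale V" "flinear V T" shows "finite_dim fscale (T ` V)"
proof -
 obtain B where B: "finite B" "fs.span B = V" using assms(1) by (auto simp: finite_dim_def)
 have sV: "fs.subspace V" using assms(1) by (rule fs.finite_dim_subspace)
 have "T ` V \<subseteq> fs.span (T ` B)"
 proof
  fix w assume "w \<in> T ` V"
  then obtain v where v: "v \<in> fs.span B" "w = T v" using B(2) by auto
  have "v \<in> V & T v \<in> fs.span (T ` B)"
   using v(1)
  proof (induction rule: fs.span_induct_alt)
   case base
   show ?case using fsp.linear_on_zero[OF assms(2) sV] fs.subspace_0[OF sV] fs.span_zero by metis
  next
   case (step c x y)
   then have "x \<in> V" using B(2) fs.span_base by blast
   then show ?case
    using step fs.subspace_add[OF sV] fs.subspace_scale[OF sV] fs.span_base[of "T x" "T ` B"]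
    by (simp add: linear_on_add[OF assms(2)] linear_on_scale[OF assms(2)] fs.span_add fs.span_scale
      del: plus_fun_apply)
  qed
  then show "w \<in> fs.span (T ` B)" using v(2) by simp
 qed
 moreover have "fs.subspace (T ` V)" by (rule fsp.linear_on_image_subspace[OF assms(2) sV])
 moreover have "finite_dim fscale (fs.span (T ` B))" using B(1) by (auto simp: finite_dim_def)
 ultimately show ?thesis using fs.finite_dim_subset by blast
qed

lemma rep_transport:
 assumes R: "is_rep s br L (V, \<rho>)" and T: "flinear V T" "inj_on T V"
 defines "R' \<equiv> (T ` V, \<lambda>a w. T (\<rho> a (inv_into V T w)))"
 shows "is_rep s br L R'" "rep_iso L (V, \<rho>) R'"
proof -
 note RD = is_repD[OF R, simplified]
 have inv: "inv_into V T (T v) = v" if "v \<in> V" for v using T(2) that by simp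
 show "is_rep s br L R'"
  unfolding R'_def is_rep_iff
 proof (intro conjI ballI)
  show "finite_dim fscale (T ` V)" by (rule finite_dim_image[OF RD(1) T(1)])
  fix a assume a: "a \<in> L"
  show "endo fscale (T ` V) (\<lambda>w. T (\<rho> a (inv_into V T w)))"
   unfolding endo_def linear_on_def
   using inv RD(6)[OF a] fs.subspace_add[OF RD(2)] fs.subspace_scale[OF RD(2)]
   by (auto simp: linear_on_add[OF T(1), symmetric] linear_on_scale[OF T(1), symmetric]
     linear_on_add[OF RD(7)[OF a]] linear_on_scale[OF RD(7)[OF a]])
  fix b v assume b: "b \<in> L" and "v \<in> T ` V"
  then obtain u where u: "u \<in> V" "v = T u" by auto
  show "T (\<rho> (br a b) (inv_into V T v)) =
    T (\<rho> a (inv_into V T (T (\<rho> b (inv_into V T v))))) - T (\<rho> b (inv_into V T (T (\<rho> a (inv_into V T v)))))"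
   using inv RD(6)[OF a] RD(6)[OF b] RD(5)[OF a b] u
    fsp.linear_on_diff[OF T(1) RD(2)] by simp
 next
  fix v assume "v \<in> T ` V"
  then obtain u where u: "u \<in> V" "v = T u" by auto
  then show "linear_on s fscale L (\<lambda>a. T (\<rho> a (inv_into V T v)))"
   using RD(4)[OF u(1)] inv RD(6)
   by (simp add: linear_on_def linear_on_add[OF T(1)] linear_on_scale[OF T(1)])
 qed
 show "rep_iso L (V, \<rho>) R'"
  unfolding rep_iso_def R'_def using T inv by (intro exI[of _ T]) (auto simp: bij_betw_def)
qed

text \<open>A basis of a finite-dimensional space is countable, so the space embeds into \<open>nat \<Rightarrow> k\<close>.\<close>

lemma rep_on_nat:
 fixes R :: "('l::ab_group_add, 'i, 'k::field) rep"
 assumes R: "is_rep s br L R"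
 obtains R' :: "('l, nat, 'k) rep" where "is_rep s br L R'" "rep_iso L R R'"
proof -
 obtain V \<rho> where RV: "R = (V, \<rho>)" by (cases R)
 note R = R[unfolded RV]
 obtain B where B: "finite B" "fs.independent B" "fs.span B = V"
  using fs.finite_dim_basis[OF is_repD(1,2)[OF R, simplified] subset_refl] by metis
 obtain g where g: "bij_betw g {..<card B} B"
  using ex_bij_betw_nat_finite[OF B(1)] by (metis atLeast0LessThan)
 define T where "T v n = (if n < card B then fs.representation B v (g n) else 0)" for v n
 have "flinear V T"
  unfolding linear_on_def
 proof (intro conjI ballI allI ext)
  fix u v n assume "u \<in> V" "v \<in> V"
  then show "T (u + v) n = (T u + T v) n" using B by (simp add: T_def fs.representation_add)
 next
  fix c v n assume "v \<in> V"
  then show "T (fscale c v) n = fscale c (T v) n"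
   using B by (simp add: T_def fscale_def[of c "T v"] fs.representation_scale)
 qed
 moreover have "inj_on T V"
 proof (rule inj_onI)
  fix u v assume uv: "u \<in> V" "v \<in> V" "T u = T v"
  have "fs.representation B u b = fs.representation B v b" if "b \<in> B" for b
  proof -
   have "b \<in> g ` {..<card B}" using bij_betw_imp_surj_on[OF g] that by simp
   then obtain n where "n < card B" "b = g n" by blast
   then show ?thesis using fun_cong[OF uv(3), of n] by (simp add: T_def)
  qed
  then have "(\<Sum>b\<in>B. fscale (fs.representation B u b) b) = (\<Sum>b\<in>B. fscale (fs.representation B v b) b)"
   by simp
  then show "u = v"
   using fs.sum_representation_eq[OF B(2) _ B(1) subset_refl, of u]
    fs.sum_representation_eq[OF B(2) _ B(1) subset_refl, of v] uv(1,2) B(3) by simp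
 qed
 ultimately show ?thesis using rep_transport[OF R] that RV by blast
qed

lemma irreducible_rep_iso:
 assumes R: "irreducible_rep s br L R" and R': "is_rep s br L R'" and iso: "rep_iso L R R'"
 shows "irreducible_rep s br L R'"
proof -
 note RD = irreducible_repD[OF R]
 obtain T where T: "flinear (fst R) T" "bij_betw T (fst R) (fst R')"
   "!!a v. a \<in> L ==> v \<in> fst R ==> T (snd R a v) = snd R' a (T v)"
  using iso by (auto simp: rep_iso_def)
 have T0: "T 0 = 0" by (rule fsp.linear_on_zero[OF T(1) is_repD(2)[OF RD(1)]])
 note sR = is_repD(2)[OF RD(1)]
 have "fst R' ~= {0}"
 proof
  assume "fst R' = {0}"
  then have "T v = T 0" if "v \<in> fst R" for v using T(2) T0 that by (auto simp: bij_betw_def)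
  then have "v = 0" if "v \<in> fst R" for v
   using T(2) that fs.subspace_0[OF sR] unfolding bij_betw_def inj_on_def by blast
  then show False using RD(2) fs.subspace_0[OF sR] by auto
 qed
 moreover have "W = {0} \<or> W = fst R'"
  if W: "fs.subspace W" "W \<subseteq> fst R'" "\<forall>a\<in>L. snd R' a ` W \<subseteq> W" for W
 proof -
  define U where "U = {v \<in> fst R. T v \<in> W}"
  have "fs.subspace U"
   by (rule fs.subspaceI)
    (use T0 fs.subspace_0[OF sR] fs.subspace_0[OF W(1)] fs.subspace_add[OF sR] fs.subspace_add[OF W(1)]
     fs.subspace_scale[OF sR] fs.subspace_scale[OF W(1)] in
     \<open>auto simp: U_def linear_on_add[OF T(1)] linear_on_scale[OF T(1)]\<close>)
  moreover have "snd R a v \<in> U" if "a \<in> L" "v \<in> U" for a v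
  proof -
   have "snd R' a (T v) \<in> W" using W(3) that by (auto simp: U_def)
   then show ?thesis using that T(3) is_repD(6)[OF RD(1)] by (auto simp: U_def)
  qed
  moreover have "U \<subseteq> fst R" by (auto simp: U_def)
  ultimately have "U = {0} \<or> U = fst R" by (intro RD(3))
  moreover have "W = T ` U"
  proof -
   have "W \<subseteq> T ` fst R" using W(2) bij_betw_imp_surj_on[OF T(2)] by simp
   then show ?thesis by (auto simp: U_def)
  qed
  moreover have "T ` {0} = {0}" using T0 by simp
  ultimately show ?thesis using bij_betw_imp_surj_on[OF T(2)] by metis
 qed
 ultimately show ?thesis using R' unfolding irreducible_rep_def by blast
qed

lemma schur:
 assumes R: "irreducible_rep s br L R" and R': "irreducible_rep s br L R'"
  and T: "flinear (fst R) T" "!!v. v \<in> fst R ==> T v \<in> fst R'"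
   "!!a v. a \<in> L ==> v \<in> fst R ==> T (snd R a v) = snd R' a (T v)"
  and nz: "v \<in> fst R" "T v ~= 0"
 shows "rep_iso L R R'"
proof -
 note RD = irreducible_repD[OF R] and RD' = irreducible_repD[OF R']
 note sR = is_repD(2)[OF RD(1)]
 have "snd R' a 0 = 0" if "a \<in> L" for a
  using fsp.linear_on_zero is_repD(2,7)[OF RD'(1)] that by blast
 then have "{v \<in> fst R. T v = 0} = {0} \<or> {v \<in> fst R. T v = 0} = fst R"
  using RD(3)[OF fsp.linear_on_kernel_subspace[OF T(1) sR]] T(3) is_repD(6)[OF RD(1)] by auto
 then have ker: "!!v. v \<in> fst R ==> T v = 0 ==> v = 0" using nz by blast
 have "inj_on T (fst R)"
 proof (rule inj_onI)
  fix u v assume uv: "u \<in> fst R" "v \<in> fst R" "T u = T v"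
  then have "T (u - v) = 0" using fsp.linear_on_diff[OF T(1) sR] by simp
  then show "u = v" using ker[of "u - v"] fs.subspace_diff[OF sR uv(1,2)] by simp
 qed
 moreover have "T ` fst R = {0} \<or> T ` fst R = fst R'"
  by (rule RD'(3)) (use fsp.linear_on_image_subspace[OF T(1) sR] T(2) T(3)[symmetric] is_repD(6)[OF RD(1)] in auto)
 then have "T ` fst R = fst R'" using nz by blast
 ultimately show ?thesis unfolding rep_iso_def using T by (auto simp: bij_betw_def)
qed

lemma rep_class_eq:
 fixes R :: "('l::ab_group_add, 'i, 'k::field) rep"
 assumes "is_rep s br L R" "rep_iso L R R'"
 shows "rep_class s br L R = rep_class s br L R'"
proof -
 have "rep_iso L R S \<longleftrightarrow> rep_iso L R' S" for S :: "('l, nat, 'k) rep"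
  using rep_iso_trans[OF rep_iso_sym[OF assms], of S] rep_iso_trans[OF assms(2), of S] by auto
 then show ?thesis unfolding rep_class_def by simp
qed

lemma rep_class_eq_iso:
 fixes R :: "('l::ab_group_add, 'i, 'k::field) rep"
 assumes "is_rep s br L R" "is_rep s br L R'" "rep_class s br L R = rep_class s br L R'"
 shows "rep_iso L R R'"
proof -
 obtain S :: "('l, nat, 'k) rep" where S: "is_rep s br L S" "rep_iso L R S"
  by (rule rep_on_nat[OF assms(1)])
 then have "rep_iso L R' S" using assms(3) by (auto simp: rep_class_def)
 then show ?thesis using rep_iso_trans[OF S(2) rep_iso_sym[OF assms(2)]] by blast
qed

lemma irr_classes_memb:
 fixes R :: "('l::ab_group_add, 'i, 'k::field) rep"
 assumes "irreducible_rep s br L R" shows "rep_class s br L R \<in> irr_classes s br L"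
proof -
 note RD = irreducible_repD[OF assms]
 obtain S :: "('l, nat, 'k) rep" where S: "is_rep s br L S" "rep_iso L R S"
  by (rule rep_on_nat[OF RD(1)])
 then show ?thesis
  using irreducible_rep_iso[OF assms S] rep_class_eq[OF RD(1) S(2)] unfolding irr_classes_def by blast
qed

lemma irr_classes_elem:
 fixes R :: "('l::ab_group_add, nat, 'k::field) rep"
 assumes "C \<in> irr_classes s br L" "R \<in> C"
 shows "irreducible_rep s br L R" "C = rep_class s br L R"
proof -
 obtain S :: "('l, nat, 'k) rep" where S: "irreducible_rep s br L S" "C = rep_class s br L S"
  using assms(1) by (auto simp: irr_classes_def)
 then have R: "is_rep s br L R" "rep_iso L S R" using assms(2) by (auto simp: rep_class_def)
 show "irreducible_rep s br L R" by (rule irreducible_rep_iso[OF S(1) R])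
 show "C = rep_class s br L R" using S rep_class_eq[OF _ R(2)] irreducible_repD(1) by blast
qed

lemma irr_classes_nonempty:
 fixes C :: "('l::ab_group_add, nat, 'k::field) rep set"
 assumes "C \<in> irr_classes s br L" obtains R where "R \<in> C"
proof -
 obtain R :: "('l, nat, 'k) rep" where R: "irreducible_rep s br L R" "C = rep_class s br L R"
  using assms by (auto simp: irr_classes_def)
 then have "R \<in> C" using rep_iso_refl[of L R] irreducible_repD(1)[OF R(1)] by (simp add: rep_class_def)
 then show ?thesis by (rule that)
qed

text \<open>
  In an irreducible representation of a perfect Lie algebra, an ideal acting by commuting operators
  acts by scalars; every element has trace zero, so in characteristic zero the scalars vanish.
\<close>

lemma perfect_abelian_ideal_acts_trivially:
 fixes R :: "('l::ab_group_add, 'i, 'k::{alg_closed_field, field_char_0}) rep"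
 assumes s: "vector_space s" and L: "module.subspace s L" "perfect s br L"
   "!!a b. a \<in> L ==> b \<in> L ==> br a b \<in> L"
  and R: "irreducible_rep s br L R"
  and J: "J \<subseteq> L" "!!j a. j \<in> J ==> a \<in> L ==> br j a \<in> J"
  and comm: "!!i j v. i \<in> J ==> j \<in> J ==> v \<in> fst R ==> snd R i (snd R j v) = snd R j (snd R i v)"
  and j: "j \<in> J" and v: "v \<in> fst R"
 shows "snd R j v = 0"
proof -
 note RD = irreducible_repD[OF R]
 note RR = is_repD[OF RD(1)]
 have "\<exists>l. \<forall>j\<in>J. \<forall>v\<in>fst R. snd R j v = fscale (l j) v"
 proof (rule abelian_ideal_acts_by_scalars[OF vector_space_fscale RR(1) RD(2) RR(3) J])
  show "snd R (br j a) v = snd R j (snd R a v) - snd R a (snd R j v)"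
   if "j \<in> J" "a \<in> L" "v \<in> fst R" for j a v using RR(5) that J(1) by blast
  show "W = {0} \<or> W = fst R"
   if "fs.subspace W" "W \<subseteq> fst R" "!!a. a \<in> L ==> snd R a ` W \<subseteq> W" for W
   using RD(3)[of W] that by blast
 qed (use comm in auto)
 then obtain l where l: "!!j v. j \<in> J ==> v \<in> fst R ==> snd R j v = fscale (l j) v" by blast
 obtain B where B: "finite B" "fs.independent B" "fs.span B = fst R"
  using fs.finite_dim_basis[OF RR(1,2) subset_refl] by metis
 have "trace fscale B (snd R j) = 0"
 proof (rule trace_sum_of_commutators[OF vector_space_fscale s L(1) L(3) subset_refl subset_refl
    B(1,3,2) RR(3) RR(4) RR(5)])
  show "j \<in> module.span s {br u v |u v. u \<in> L & v \<in> L}"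
   using j J(1) L(2) by (auto simp: perfect_def commutator_def)
 qed
 moreover have "trace fscale B (snd R j) = trace fscale B (fscale (l j))"
  using l[OF j] B(3) fs.span_base by (intro fs.trace_cong) auto
 moreover have "B ~= {}" using B(3) RD(2) fs.span_empty by metis
 ultimately have "l j = 0" using fs.trace_scalar[OF B(1,2), of "l j"] B(1) by simp
 then show ?thesis using l[OF j v] by simp
qed

subsection \<open>Burnside's theorem\<close>

text \<open>
  A nonzero operator \<open>T\<close> of minimal rank in the algebra has rank one: otherwise some \<open>T A T\<close> is not a
  multiple of \<open>T\<close>, and subtracting from it \<open>c T\<close>, where \<open>c\<close> is an eigenvalue of \<open>T A\<close> on a quotient of the
  image of \<open>T\<close>, lowers the rank. Composing \<open>T\<close> with the algebra on both sides gives all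
  rank-one operators.
\<close>

lemma burnside_rank_one:
 fixes s :: "'k::alg_closed_field => 'v::ab_group_add => 'v"
 assumes vs: "vector_space s" and V: "finite_dim s V" "V ~= {0}"
  and endo: "!!A. A \<in> \<A> ==> endo s V A" and id: "(\<lambda>v. v) \<in> \<A>"
  and comp: "!!A B. A \<in> \<A> ==> B \<in> \<A> ==> (\<lambda>v. A (B v)) \<in> \<A>"
  and add: "!!A B. A \<in> \<A> ==> B \<in> \<A> ==> (\<lambda>v. A v + B v) \<in> \<A>"
  and scale: "!!A c. A \<in> \<A> ==> (\<lambda>v. s c (A v)) \<in> \<A>"
  and irr: "!!W. module.subspace s W ==> W \<subseteq> V ==> (!!A v. A \<in> \<A> ==> v \<in> W ==> A v \<in> W) ==> W = {0} \<or> W = V"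
  and l: "linear_on s (*) V l" and w: "w \<in> V"
 shows "\<exists>A\<in>\<A>. \<forall>v\<in>V. A v = s (l v) w"
proof -
 interpret vector_space s by (rule vs)
 interpret vector_space_pair s s by (rule self_pair)
 interpret sk: vector_space_pair s "(*) :: 'k => 'k => 'k" by (rule field_pair)
 note sV = finite_dim_subspace[OF V(1)]
 note lin = endo_linear[OF endo] and inV = endo_in[OF endo]
 have zero: "A 0 = 0" if "A \<in> \<A>" for A using linear_on_zero[OF lin[OF that] sV] .
 have cyclic: "\<exists>A\<in>\<A>. A u = w" if u: "u \<in> V" "u ~= 0" and w: "w \<in> V" for u w
 proof -
  let ?W = "{A u | A. A \<in> \<A>}"
  have "subspace ?W"
  proof (rule subspaceI)
   have "s 0 \<in> \<A>" using scale[OF id, of 0] .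
   then show "0 \<in> ?W" by (intro CollectI exI[of _ "s 0"]) simp
  next
   fix x y assume "x \<in> ?W" "y \<in> ?W"
   then obtain A B where "A \<in> \<A>" "B \<in> \<A>" "x = A u" "y = B u" by auto
   then show "x + y \<in> ?W" using add[of A B] by (intro CollectI exI[of _ "\<lambda>v. A v + B v"]) simp
  next
   fix c x assume "x \<in> ?W"
   then obtain A where "A \<in> \<A>" "x = A u" by auto
   then show "s c x \<in> ?W" using scale[of A c] by (intro CollectI exI[of _ "\<lambda>v. s c (A v)"]) simp
  qed
  moreover have "?W \<subseteq> V" using inV u(1) by auto
  moreover have "A x \<in> ?W" if "A \<in> \<A>" "x \<in> ?W" for A x using comp[OF that(1)] that(2) by force
  ultimately have "?W = {0} \<or> ?W = V" by (intro irr) auto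
  moreover have "u \<in> ?W" using id by force
  ultimately have "w \<in> ?W" using u w by blast
  then show ?thesis by auto
 qed
 define nz where "nz T \<longleftrightarrow> T \<in> \<A> & (\<exists>v\<in>V. T v ~= 0)" for T
 have "nz (\<lambda>v. v)" using id V subspace_0[OF sV] by (auto simp: nz_def)
 then obtain T where T: "nz T" "!!S. nz S ==> dim (T ` V) \<le> dim (S ` V)"
  using ex_has_least_nat[of nz "\<lambda>v. v" "\<lambda>T. dim (T ` V)"] by auto
 have TA: "T \<in> \<A>" using T(1) by (simp add: nz_def)
 obtain v1 where v1: "v1 \<in> V" "T v1 ~= 0" using T(1) by (auto simp: nz_def)
 let ?w = "T v1"
 have rank1: "T v \<in> span {?w}" if v: "v \<in> V" for v
 proof (rule ccontr)
  assume nin: "T v \<notin> span {?w}"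
  obtain A where A: "A \<in> \<A>" "A ?w = v" using cyclic[of ?w v] v1 inV[OF TA] v by blast
  let ?X = "T ` V" and ?S = "\<lambda>x. T (A x)"
  have sX: "subspace ?X" by (rule linear_on_image_subspace[OF lin[OF TA] sV])
  have XV: "?X \<subseteq> V" using inV[OF TA] by auto
  have fX: "finite_dim s ?X" by (rule finite_dim_subset[OF V(1) sX XV])
  have SA: "?S \<in> \<A>" by (rule comp[OF TA A(1)])
  have eS: "endo s ?X ?S"
   by (rule endo_subset[OF endo[OF SA] XV]) (use inV[OF A(1)] XV in auto)
  define P where "P U \<longleftrightarrow> subspace U & U \<subset> ?X & ?S ` U \<subseteq> U" for U
  have "P {0}" using v1 zero[OF SA] subspace_0[OF sX] by (auto simp: P_def)
  then obtain U where U: "P U" and max: "!!W. P W ==> U \<subseteq> W ==> W = U"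
   using finite_dim_maximal_subspace[OF fX, of P "{0}"] by (auto simp: P_def)
  have sU: "subspace U" and UX: "U \<subset> ?X" and SU: "?S ` U \<subseteq> U" using U by (auto simp: P_def)
  obtain c x where x: "x \<in> ?X" "x \<notin> U" "?S x - s c x \<in> U"
   using finite_dim_eigenvector_modulo[OF vs fX sU UX eS SU] by blast
  have dec: "\<exists>k u. u \<in> U & y = s k x + u" if "y \<in> span (insert x U)" for y
  proof -
   have "\<exists>k. y - s k x \<in> span U" using that by (simp only: span_insert mem_Collect_eq)
   then obtain k where "y - s k x \<in> span U" ..
   moreover have "span U = U" using sU by simp
   ultimately have "y - s k x \<in> U" by simp
   then show ?thesis by (intro exI[of _ k] exI[of _ "y - s k x"]) simp
  qed
  have shiftU: "?S y - s c y \<in> U" if y: "y \<in> span (insert x U)" for y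
  proof -
   obtain k u where u: "u \<in> U" "y = s k x + u" using dec[OF y] by blast
   have uV: "u \<in> V" "x \<in> V" using u UX XV x by auto
   have "?S y - s c y = s k (?S x - s c x) + (?S u - s c u)"
    using u(2) uV subspace_scale[OF sV] linear_on_add[OF lin[OF SA]] linear_on_scale[OF lin[OF SA]]
    by (simp add: algebra_simps)
   moreover have "?S u \<in> U" using SU u(1) by auto
   ultimately show ?thesis
    using x(3) u(1) subspace_add[OF sU] subspace_scale[OF sU] subspace_diff[OF sU] by metis
  qed
  have sub: "U \<subseteq> span (insert x U)" using span_superset[of "insert x U"] by auto
  have "span (insert x U) = ?X"
  proof (rule ccontr)
   assume ne: "span (insert x U) ~= ?X"
   have "span (insert x U) \<subseteq> ?X" using x(1) UX sX by (intro span_minimal) auto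
   moreover have "?S y \<in> span (insert x U)" if "y \<in> span (insert x U)" for y
    using span_add[OF subsetD[OF sub shiftU[OF that]] span_scale[OF that, of c]] by simp
   ultimately have "P (span (insert x U))" using ne by (auto simp: P_def)
   then have "span (insert x U) = U" using max sub by blast
   then show False using x(2) span_base[of x "insert x U"] by simp
  qed
  then have XU: "?S y - s c y \<in> U" if "y \<in> ?X" for y using shiftU that by simp
  let ?T = "\<lambda>v. T (A (T v)) + s (- c) (T v)"
  have TA': "?T \<in> \<A>" by (rule add[OF comp[OF TA comp[OF A(1) TA]] scale[OF TA]])
  have TU: "?T ` V \<subseteq> U" using XU by auto
  have "?T v1 ~= 0"
  proof
   assume "?T v1 = 0"
   then have "T v = s c ?w" using A(2) by (simp add: add_eq_0_iff)
   then show False using nin by (simp add: span_base span_scale)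
  qed
  then have "nz ?T" using TA' v1(1) by (auto simp: nz_def)
  moreover have "dim (?T ` V) \<le> dim U"
   by (rule finite_dim_dim_le[OF _ _ TU])
    (use finite_dim_subset[OF fX sU] UX linear_on_image_subspace[OF lin[OF TA'] sV] in auto)
  moreover have "dim U < dim ?X" by (rule finite_dim_dim_less[OF fX sU UX])
  ultimately show False using T(2)[of ?T] by simp
 qed
 have "\<exists>k. T v = s k ?w" if "v \<in> V" for v
  using rank1[OF that] by (auto simp: span_singleton)
 then obtain m where m: "!!v. v \<in> V ==> T v = s (m v) ?w" by metis
 have cancel: "a = b" if "s a ?w = s b ?w" for a b using that v1(2) by simp
 have m_lin: "linear_on s (*) V m"
  unfolding linear_on_def
 proof (intro conjI ballI allI; rule cancel)
  fix u v assume uv: "u \<in> V" "v \<in> V"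
  then show "s (m (u + v)) ?w = s (m u + m v) ?w"
   using m[OF uv(1)] m[OF uv(2)] m[OF subspace_add[OF sV uv]] linear_on_add[OF lin[OF TA] uv]
   by (simp add: scale_left_distrib)
 next
  fix c v assume v: "v \<in> V"
  show "s (m (s c v)) ?w = s (c * m v) ?w"
   using m[OF v] m[OF subspace_scale[OF sV v]] linear_on_scale[OF lin[OF TA] v, of c]
   by (metis scale_scale)
 qed
 \<comment> \<open>The functionals `m \<circ> B` separate points; finitely many of them that still do, chosen
  minimally, are independent and admit a dual basis.\<close>
 define \<Lambda> where "\<Lambda> = {\<lambda>v. m (B v) | B. B \<in> \<A>}"
 define ker where "ker F = {v \<in> V. \<forall>l\<in>F. l v = 0}" for F :: "('v => 'k) set"
 have \<Lambda>_lin: "linear_on s (*) V l" if l: "l \<in> \<Lambda>" for l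
 proof -
  obtain B where B: "B \<in> \<A>" "l = (\<lambda>v. m (B v))" using l by (auto simp: \<Lambda>_def)
  show ?thesis
   unfolding B(2) linear_on_def
   using inV[OF B(1)] linear_on_add[OF lin[OF B(1)]] linear_on_scale[OF lin[OF B(1)]]
    linear_on_add[OF m_lin] linear_on_scale[OF m_lin] by simp
 qed
 have kerD: "l v = 0" if "v \<in> ker F" "l \<in> F" for v l F using that by (auto simp: ker_def)
 have sker: "subspace (ker F)" if "F \<subseteq> \<Lambda>" for F
 proof -
  have l: "linear_on s (*) V l" if "l \<in> F" for l using \<Lambda>_lin \<open>F \<subseteq> \<Lambda>\<close> that by blast
  show ?thesis
  proof (rule subspaceI)
   show "0 \<in> ker F" using subspace_0[OF sV] sk.linear_on_zero[OF l sV] by (auto simp: ker_def)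
  next
   fix x y assume xy: "x \<in> ker F" "y \<in> ker F"
   then have xyV: "x \<in> V" "y \<in> V" by (auto simp: ker_def)
   have "k (x + y) = 0" if "k \<in> F" for k
    using linear_on_add[OF l[OF that] xyV] kerD[OF xy(1) that] kerD[OF xy(2) that] by simp
   then show "x + y \<in> ker F" using subspace_add[OF sV xyV] by (simp add: ker_def)
  next
   fix c x assume x: "x \<in> ker F"
   then have xV: "x \<in> V" by (auto simp: ker_def)
   have "k (s c x) = 0" if "k \<in> F" for k
    using linear_on_scale[OF l[OF that] xV, of c] kerD[OF x that] by simp
   then show "s c x \<in> ker F" using subspace_scale[OF sV xV] by (simp add: ker_def)
  qed
 qed
 have "ker \<Lambda> = {0} \<or> ker \<Lambda> = V"
 proof (rule irr[OF sker[OF subset_refl]])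
  fix A v assume A: "A \<in> \<A>" and v: "v \<in> ker \<Lambda>"
  have "m (B (A v)) = 0" if "B \<in> \<A>" for B using v comp[OF that A] by (auto simp: ker_def \<Lambda>_def)
  then show "A v \<in> ker \<Lambda>" using v inV[OF A] by (auto simp: ker_def \<Lambda>_def)
 qed (auto simp: ker_def)
 moreover have "m v1 ~= 0" using m[OF v1(1)] v1(2) by auto
 then have "v1 \<notin> ker \<Lambda>" using id by (auto simp: ker_def \<Lambda>_def)
 ultimately have ker\<Lambda>: "ker \<Lambda> = {0}" using v1(1) by blast
 have "\<exists>F. finite F & F \<subseteq> \<Lambda> & ker F = {0}"
 proof -
  define Q where "Q U \<longleftrightarrow> (\<exists>F. finite F & F \<subseteq> \<Lambda> & U = ker F)" for U
  have "Q V" unfolding Q_def by (rule exI[of _ "{}"]) (auto simp: ker_def)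
  moreover have "Q U ==> subspace U" for U using sker by (auto simp: Q_def)
  ultimately obtain U where U: "Q U" "!!W. Q W ==> W \<subseteq> U ==> W = U"
   using finite_dim_minimal_subspace[OF V(1), of Q] by metis
  obtain F where F: "finite F" "F \<subseteq> \<Lambda>" "U = ker F" using U(1) by (auto simp: Q_def)
  have "l v = 0" if l: "l \<in> \<Lambda>" and v: "v \<in> U" for l v
  proof -
   have "Q (ker (insert l F))" unfolding Q_def by (rule exI[of _ "insert l F"]) (use F l in auto)
   then have "ker (insert l F) = U" by (rule U(2)) (use F in \<open>auto simp: ker_def\<close>)
   then show ?thesis using v by (auto simp: ker_def)
  qed
  then have "U \<subseteq> ker \<Lambda>" using F by (auto simp: ker_def)
  then have "U = {0}" using ker\<Lambda> sker[OF F(2)] F(3) subspace_0 by auto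
  then show ?thesis using F by auto
 qed
 then obtain F where F: "finite F & F \<subseteq> \<Lambda> & ker F = {0}"
  and min: "!!F'. finite F' & F' \<subseteq> \<Lambda> & ker F' = {0} ==> card F \<le> card F'"
  using ex_has_least_nat[of "\<lambda>F. finite F & F \<subseteq> \<Lambda> & ker F = {0}" _ card] by metis
 have F_lin: "linear_on s (*) V l" if "l \<in> F" for l using F \<Lambda>_lin that by blast
 have surj: "\<exists>v\<in>V. \<forall>l\<in>F. l v = c l" for c
 proof (rule independent_functionals_surjective[OF vs sV, of F "\<lambda>l. l"])
  fix c l assume c: "!!h. h \<in> V ==> (\<Sum>l\<in>F. c l * l h) = 0" and l: "l \<in> F"
  show "c l = 0"
  proof (rule ccontr)
   assume nz: "c l ~= 0"
   have "v = 0" if v: "v \<in> ker (F - {l})" for v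
   proof -
    have vV: "v \<in> V" using v by (simp add: ker_def)
    have "(\<Sum>k\<in>F - {l}. c k * k v) = 0"
    proof (intro sum.neutral ballI)
     fix k assume "k \<in> F - {l}"
     then show "c k * k v = 0" using kerD[OF v, of k] by simp
    qed
    then have "(\<Sum>l\<in>F. c l * l v) = c l * l v"
     using F l by (subst sum.remove[of _ l]) auto
    then have "l v = 0" using c[OF vV] nz by simp
    then have "v \<in> ker F" using v by (auto simp: ker_def)
    then show ?thesis using F by simp
   qed
   moreover have "0 \<in> ker (F - {l})" using subspace_0[OF sker, of "F - {l}"] F by blast
   ultimately have "ker (F - {l}) = {0}" by auto
   then have "card F \<le> card (F - {l})" using F by (intro min) auto
   then show False using F l by (metis card_Diff1_less not_le)
  qed
 qed (use F F_lin in auto)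
 have "\<exists>d. \<forall>k. d k \<in> V & (\<forall>l\<in>F. l (d k) = (if l = k then 1 else 0))"
 proof (rule choice, rule allI)
  fix k
  show "\<exists>x. x \<in> V & (\<forall>l\<in>F. l x = (if l = k then 1 else 0))"
   using surj[of "\<lambda>l. if l = k then 1 else 0"] by (simp only: Bex_def)
 qed
 then obtain d where d': "\<forall>k. d k \<in> V & (\<forall>l\<in>F. l (d k) = (if l = k then 1 else 0))" ..
 have d: "d k \<in> V" "k \<in> F ==> l \<in> F ==> l (d k) = (if l = k then 1 else 0)" for k l
  using d' by simp_all
 have expand: "v = (\<Sum>k\<in>F. s (k v) (d k))" if v: "v \<in> V" for v
 proof -
  let ?y = "\<Sum>k\<in>F. s (k v) (d k)"
  have y: "?y \<in> V" using d(1) sV by (intro subspace_sum subspace_scale) auto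
  have "l (v - ?y) = 0" if l: "l \<in> F" for l
  proof -
   have "l ?y = (\<Sum>k\<in>F. k v * l (d k))" by (rule sk.linear_on_sum_scale[OF F_lin[OF l] sV d(1)])
   also have "\<dots> = (\<Sum>k\<in>F. if k = l then l v else 0)"
    using d(2)[OF _ l] by (intro sum.cong) auto
   also have "\<dots> = l v" using F l by (simp add: sum.delta)
   finally show ?thesis using sk.linear_on_diff[OF F_lin[OF l] sV v y] by simp
  qed
  then have "v - ?y \<in> ker F" using subspace_diff[OF sV v y] by (auto simp: ker_def)
  then show ?thesis using F by simp
 qed
 have rank_one: "\<exists>A\<in>\<A>. \<forall>v\<in>V. A v = s (k v) w'" if k: "k \<in> F" and w': "w' \<in> V" for k w'
 proof -
  obtain B where B: "B \<in> \<A>" "k = (\<lambda>v. m (B v))" using k F by (auto simp: \<Lambda>_def)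
  obtain A where A: "A \<in> \<A>" "A ?w = w'" using cyclic[of ?w w'] v1 inV[OF TA] w' by blast
  have "A (T (B v)) = s (k v) w'" if "v \<in> V" for v
   using m[OF inV[OF B(1) that]] linear_on_scale[OF lin[OF A(1)] inV[OF TA v1(1)]] A(2) B(2) by simp
  moreover have "(\<lambda>v. A (T (B v))) \<in> \<A>" by (rule comp[OF A(1) comp[OF TA B(1)]])
  ultimately show ?thesis by (intro bexI[of _ "\<lambda>v. A (T (B v))"]) simp_all
 qed
 have "\<exists>A\<in>\<A>. \<forall>v\<in>V. A v = s (\<Sum>k\<in>G. l (d k) * k v) w" if "finite G" "G \<subseteq> F" for G
  using that
 proof (induction G rule: finite_induct)
  case empty
  have "s 0 \<in> \<A>" using scale[OF id, of 0] .
  then show ?case by (intro bexI[of _ "s 0"]) simp_all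
 next
  case (insert k G)
  then obtain A where A: "A \<in> \<A>" "!!v. v \<in> V ==> A v = s (\<Sum>k\<in>G. l (d k) * k v) w" by auto
  have "k \<in> F" using insert.prems by simp
  from rank_one[OF this w] obtain B where B: "B \<in> \<A>" "\<forall>v\<in>V. B v = s (k v) w" by (elim bexE)
  have "s (l (d k)) (B v) + A v = s (\<Sum>k\<in>insert k G. l (d k) * k v) w" if "v \<in> V" for v
   using A(2)[OF that] bspec[OF B(2) that] insert.hyps by (simp add: scale_left_distrib)
  moreover have "(\<lambda>v. s (l (d k)) (B v) + A v) \<in> \<A>" by (rule add[OF scale[OF B(1)] A(1)])
  ultimately show ?case by (intro bexI[of _ "\<lambda>v. s (l (d k)) (B v) + A v"]) simp_all
 qed
 then obtain A where A: "A \<in> \<A>" "!!v. v \<in> V ==> A v = s (\<Sum>k\<in>F. l (d k) * k v) w"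
  using F by (metis order_refl)
 have "l v = (\<Sum>k\<in>F. l (d k) * k v)" if v: "v \<in> V" for v
 proof -
  have "l v = l (\<Sum>k\<in>F. s (k v) (d k))" using expand[OF v] by simp
  also have "\<dots> = (\<Sum>k\<in>F. k v * l (d k))" by (rule sk.linear_on_sum_scale[OF l sV d(1)])
  finally show ?thesis by (simp add: mult.commute)
 qed
 then show ?thesis using A by (intro bexI[of _ A]) auto
qed

section \<open>Tensor products of representations\<close>

definition multilinear ::
 "('k => 'w::plus => 'w) => 'p set => ('p => ('i => 'k::field) set) => (('p => 'i => 'k) => 'w) => bool" where
 "multilinear t P V \<mu> \<longleftrightarrow> (\<forall>v \<in> PiE P V. \<forall>x\<in>P. linear_on fscale t (V x) (\<lambda>w. \<mu> (v(x := w))))"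

lemma PiE_upd: "v \<in> PiE P V ==> x \<in> P ==> w \<in> V x ==> v(x := w) \<in> PiE P V"
 by (auto simp: PiE_iff extensional_def)

lemma linear_functional_nonzero:
 assumes "finite_dim fscale V" "v \<in> V" "v ~= 0"
 obtains l where "linear_on fscale (*) V l" "l v ~= 0"
proof -
 obtain B where B: "finite B" "fs.independent B" "fs.span B = V"
  using fs.finite_dim_basis[OF assms(1) fs.finite_dim_subspace[OF assms(1)] subset_refl] by metis
 have "\<exists>b\<in>B. fs.representation B v b ~= 0"
 proof (rule ccontr)
  assume "\<not> ?thesis"
  then have "(\<Sum>b\<in>B. fscale (fs.representation B v b) b) = 0" by (intro sum.neutral) auto
  then show False
   using fs.sum_representation_eq[OF B(2) _ B(1) subset_refl, of v] assms(2,3) B(3) by simp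
 qed
 then obtain b where b: "b \<in> B" "fs.representation B v b ~= 0" by blast
 have "linear_on fscale (*) V (\<lambda>v. fs.representation B v b)"
  using B by (auto simp: linear_on_def fs.representation_add fs.representation_scale simp del: plus_fun_apply)
 then show ?thesis using that b(2) by blast
qed

lemma pure_tensor_multilinear: "multilinear fscale P V (pure_tensor P V)"
 unfolding multilinear_def linear_on_def
proof (intro ballI conjI allI ext)
 fix v x u w b assume v: "v \<in> PiE P V" "x \<in> P" "u \<in> V x" "w \<in> V x"
 show "pure_tensor P V (v(x := u + w)) b = (pure_tensor P V (v(x := u)) + pure_tensor P V (v(x := w))) b"
  using v by (auto simp: pure_tensor_def multilinear_form_def linear_on_def)
next
 fix v x c w b assume v: "v \<in> PiE P V" "x \<in> P" "w \<in> V x"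
 show "pure_tensor P V (v(x := fscale c w)) b = fscale c (pure_tensor P V (v(x := w))) b"
  using v by (auto simp: pure_tensor_def multilinear_form_def linear_on_def fscale_def[of c "\<lambda>b. if _ b then _ b else _"])
qed

lemma multilinear_add:
 "multilinear t P V \<mu> ==> v \<in> PiE P V ==> x \<in> P ==> u \<in> V x ==> w \<in> V x ==>
   \<mu> (v(x := u + w)) = \<mu> (v(x := u)) + \<mu> (v(x := w))"
 and multilinear_scale:
 "multilinear t P V \<mu> ==> v \<in> PiE P V ==> x \<in> P ==> w \<in> V x ==>
   \<mu> (v(x := fscale c w)) = t c (\<mu> (v(x := w)))"
 by (simp_all add: multilinear_def linear_on_def)

lemma multilinear_zero:
 assumes "multilinear fscale P V \<mu>" "v \<in> PiE P V" "x \<in> P" "fs.subspace (V x)"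
 shows "\<mu> (v(x := 0)) = 0"
 using multilinear_scale[OF assms(1-3) fs.subspace_0[OF assms(4)], of 0] by simp

lemma multilinear_diff:
 assumes "multilinear fscale P V \<mu>" "v \<in> PiE P V" "x \<in> P" "fs.subspace (V x)" "u \<in> V x" "w \<in> V x"
 shows "\<mu> (v(x := u - w)) = \<mu> (v(x := u)) - \<mu> (v(x := w))"
 using fsp.linear_on_diff[of "V x" "\<lambda>w. \<mu> (v(x := w))" u w] assms by (simp add: multilinear_def)

lemma tensor_action_linear: "flinear S (tensor_rep_action P V \<rho> u)"
 by (auto simp: linear_on_def tensor_rep_action_def fscale_def fun_eq_iff)

definition factor_op ::
 "'p set => ('p => ('i => 'k::field) set) => 'p => (('i => 'k) => 'i => 'k) =>
   ((('p => 'i => 'k) => 'k) => 'k) => (('p => 'i => 'k) => 'k) => 'k" where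
 "factor_op P V x A = tensor_rep_action P V (\<lambda>y _. if y = x then A else (\<lambda>_. 0)) (\<lambda>_. ())"

lemma subspace_tensor: "fs.subspace (tensor_product_space P V)"
 by (simp add: tensor_product_space_def)

lemma pure_in_tensor: "v \<in> PiE P V ==> pure_tensor P V v \<in> tensor_product_space P V"
 unfolding tensor_product_space_def by (rule fs.span_base) auto

lemma tensor_subset:
 assumes "fs.subspace U" "!!v. v \<in> PiE P V ==> pure_tensor P V v \<in> U"
 shows "tensor_product_space P V \<subseteq> U"
 unfolding tensor_product_space_def by (rule fs.span_minimal[OF _ assms(1)]) (use assms(2) in auto)

lemma tensor_eqI:
 fixes P :: "'p set" and V :: "'p => ('i => 'k::field) set"
 assumes "vector_space t" "linear_on fscale t (tensor_product_space P V) F"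
  "linear_on fscale t (tensor_product_space P V) G"
  "!!v. v \<in> PiE P V ==> F (pure_tensor P V v) = G (pure_tensor P V v)"
  and "x \<in> tensor_product_space P V"
 shows "F x = G x"
proof -
 have pair: "vector_space_pair (fscale :: 'k => ((('p => 'i => 'k) => 'k) => 'k) => _) t"
  by (intro vector_space_pair.intro vector_space_fscale assms(1))
 show ?thesis
  by (rule vector_space_pair.linear_on_eq_span[OF pair assms(2,3)[unfolded tensor_product_space_def]
     _ assms(5)[unfolded tensor_product_space_def]]) (elim imageE, simp only: assms(4))
qed

context
 fixes P :: "'p set" and V :: "'p => ('i => 'k::field) set"
 assumes P: "finite P" and V: "!!x. x \<in> P ==> finite_dim fscale (V x)"
begin

lemma tensor_factor_subspace: "x \<in> P ==> fs.subspace (V x)"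
 using V fs.finite_dim_subspace by blast

lemma tensor_action_pure:
 assumes "v \<in> PiE P V" "!!x. x \<in> P ==> endo fscale (V x) (\<rho> x (u x))"
 shows "tensor_rep_action P V \<rho> u (pure_tensor P V v) =
      (\<Sum>x\<in>P. pure_tensor P V (v(x := \<rho> x (u x) (v x))))"
 by (rule tensor_rep_action_pure_tensor[OF P assms(1)]) (use assms(2) in \<open>auto simp: endo_def\<close>)

lemma tensor_action_in:
 assumes "t \<in> tensor_product_space P V" "!!x. x \<in> P ==> endo fscale (V x) (\<rho> x (u x))"
 shows "tensor_rep_action P V \<rho> u t \<in> tensor_product_space P V"
 using assms(1) unfolding tensor_product_space_def
proof (induction rule: fs.span_induct_alt)
 case base
 have "tensor_rep_action P V \<rho> u 0 = 0"
  by (rule fsp.linear_on_zero[OF tensor_action_linear fs.subspace_UNIV])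
 then show ?case using fs.span_zero by metis
next
 case (step c x y)
 then obtain v where v: "v \<in> PiE P V" "x = pure_tensor P V v" by auto
 have eq: "tensor_rep_action P V \<rho> u x = (\<Sum>x\<in>P. pure_tensor P V (v(x := \<rho> x (u x) (v x))))"
  unfolding v(2) by (rule tensor_action_pure[OF v(1)]) (use assms(2) in blast)
 have "tensor_rep_action P V \<rho> u x \<in> fs.span (pure_tensor P V ` PiE P V)"
  unfolding eq
 proof (rule fs.span_sum)
  fix y assume y: "y \<in> P"
  have "v(y := \<rho> y (u y) (v y)) \<in> PiE P V"
   using v(1) y fs.endo_in[OF assms(2)[OF y]] by (intro PiE_upd) auto
  then show "pure_tensor P V (v(y := \<rho> y (u y) (v y))) \<in> fs.span (pure_tensor P V ` PiE P V)"
   by (intro fs.span_base) auto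
 qed
 then have "fscale c (tensor_rep_action P V \<rho> u x) + tensor_rep_action P V \<rho> u y
   \<in> fs.span (pure_tensor P V ` PiE P V)"
  using step(2) by (intro fs.span_add fs.span_scale)
 moreover have "tensor_rep_action P V \<rho> u (fscale c x + y) =
   tensor_rep_action P V \<rho> u (fscale c x) + tensor_rep_action P V \<rho> u y"
  by (rule linear_on_add[OF tensor_action_linear UNIV_I UNIV_I])
 moreover have "tensor_rep_action P V \<rho> u (fscale c x) = fscale c (tensor_rep_action P V \<rho> u x)"
  by (rule linear_on_scale[OF tensor_action_linear UNIV_I])
 ultimately show ?case by (simp only:)
qed

lemma factor_op_endo:
 assumes "x \<in> P" "endo fscale (V x) A" "y \<in> P"
 shows "endo fscale (V y) (if y = x then A else (\<lambda>_. 0))"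
 using assms fs.subspace_0[OF tensor_factor_subspace[OF assms(3)]] by (auto simp: endo_def linear_on_def)

lemma factor_op_pure:
 assumes "x \<in> P" "endo fscale (V x) A" "v \<in> PiE P V"
 shows "factor_op P V x A (pure_tensor P V v) = pure_tensor P V (v(x := A (v x)))"
proof -
 have "factor_op P V x A (pure_tensor P V v) =
   (\<Sum>y\<in>P. pure_tensor P V (v(y := (if y = x then A else (\<lambda>_. 0)) (v y))))"
  unfolding factor_op_def by (rule tensor_action_pure[OF assms(3)]) (use factor_op_endo assms(1,2) in auto)
 also have "\<dots> = pure_tensor P V (v(x := A (v x))) +
   (\<Sum>y\<in>P - {x}. pure_tensor P V (v(y := (if y = x then A else (\<lambda>_. 0)) (v y))))"
  using P assms(1) by (subst sum.remove[of _ x]) auto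
 also have "(\<Sum>y\<in>P - {x}. pure_tensor P V (v(y := (if y = x then A else (\<lambda>_. 0)) (v y)))) = 0"
 proof (intro sum.neutral ballI)
  fix y assume y: "y \<in> P - {x}"
  have e: "(if y = x then A else (\<lambda>_. 0)) (v y) = 0" using y by simp
  show "pure_tensor P V (v(y := (if y = x then A else (\<lambda>_. 0)) (v y))) = 0"
   unfolding e
   by (rule multilinear_zero[OF pure_tensor_multilinear assms(3) _ tensor_factor_subspace]) (use y in auto)
 qed
 finally show ?thesis by (simp del: fun_upd_apply)
qed

lemma tensor_basis:
 assumes B: "!!x. x \<in> P ==> fs.span (B x) = V x"
 shows "tensor_product_space P V = fs.span (pure_tensor P V ` PiE P B)"
proof
 let ?S = "fs.span (pure_tensor P V ` PiE P B)"
 have BV: "B x \<subseteq> V x" if "x \<in> P" for x using fs.span_superset[of "B x"] unfolding B[OF that] .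
 have "\<forall>v\<in>PiE P V. (\<forall>x\<in>P - Q. v x \<in> B x) --> pure_tensor P V v \<in> ?S" if "finite Q" "Q \<subseteq> P" for Q
  using that
 proof (induction Q rule: finite_induct)
  case empty
  show ?case
  proof (intro ballI impI)
   fix v assume "v \<in> PiE P V" "\<forall>x\<in>P - {}. v x \<in> B x"
   then have "v \<in> PiE P B" by (simp add: PiE_iff)
   then show "pure_tensor P V v \<in> ?S" by (intro fs.span_base imageI)
  qed
 next
  case (insert x Q)
  show ?case
  proof (intro ballI impI)
   fix v assume v: "v \<in> PiE P V" "\<forall>y\<in>P - insert x Q. v y \<in> B y"
   have x: "x \<in> P" using insert.prems by simp
   have pure: "pure_tensor P V (v(x := w)) \<in> ?S" if "w \<in> B x" for w
   proof -
    have "v(x := w) \<in> PiE P V" using v(1) x BV that by (intro PiE_upd) auto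
    then show ?thesis using insert.IH insert.prems v(2) that by auto
   qed
   have "v x \<in> fs.span (B x)" using v(1) x B by auto
   then have "v x \<in> V x & pure_tensor P V (v(x := v x)) \<in> ?S"
   proof (induction rule: fs.span_induct_alt)
    case base
    show ?case
     using fs.subspace_0[OF tensor_factor_subspace[OF x]] fs.span_zero
      multilinear_zero[OF pure_tensor_multilinear v(1) x tensor_factor_subspace[OF x]] by metis
   next
    case (step c b y)
    have b: "b \<in> V x" using step(1) BV x by auto
    have cb: "fscale c b \<in> V x" by (rule fs.subspace_scale[OF tensor_factor_subspace[OF x] b])
    have "pure_tensor P V (v(x := fscale c b + y)) =
      fscale c (pure_tensor P V (v(x := b))) + pure_tensor P V (v(x := y))"
     by (simp only: multilinear_add[OF pure_tensor_multilinear v(1) x cb conjunct1[OF step(2)]]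
       multilinear_scale[OF pure_tensor_multilinear v(1) x b])
    moreover have "fscale c (pure_tensor P V (v(x := b))) + pure_tensor P V (v(x := y)) \<in> ?S"
     by (rule fs.span_add[OF fs.span_scale[OF pure[OF step(1)]] conjunct2[OF step(2)]])
    moreover have "fscale c b + y \<in> V x"
     using fs.subspace_add[OF tensor_factor_subspace[OF x] cb] step(2) by blast
    ultimately show ?case by (simp only: simp_thms)
   qed
   then show "pure_tensor P V v \<in> ?S" by simp
  qed
 qed
 from this[OF P subset_refl] show "tensor_product_space P V \<subseteq> ?S"
  by (intro tensor_subset[OF fs.subspace_span]) (simp only: Diff_cancel ball_empty simp_thms)
 have "PiE P B \<subseteq> PiE P V" by (rule PiE_mono[OF BV])
 then show "?S \<subseteq> tensor_product_space P V"
  unfolding tensor_product_space_def by (intro fs.span_mono image_mono)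
qed

lemma tensor_factor_bases:
 obtains B where "!!x. x \<in> P ==> finite (B x)" "!!x. x \<in> P ==> fs.independent (B x)"
  "!!x. x \<in> P ==> fs.span (B x) = V x"
proof -
 have "\<exists>B. finite B & fs.independent B & fs.span B = V x" if "x \<in> P" for x
  using fs.finite_dim_basis[OF V[OF that] tensor_factor_subspace[OF that] subset_refl] by metis
 then have "\<exists>B. \<forall>x\<in>P. finite (B x) & fs.independent (B x) & fs.span (B x) = V x" by (intro bchoice) blast
 then show ?thesis using that by blast
qed

lemma tensor_finite_dim: "finite_dim fscale (tensor_product_space P V)"
proof -
 obtain B where B: "!!x. x \<in> P ==> finite (B x)" "!!x. x \<in> P ==> fs.span (B x) = V x"
  using tensor_factor_bases by metis
 have "finite (pure_tensor P V ` PiE P B)" using finite_PiE[OF P] B(1) by auto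
 moreover have "tensor_product_space P V = fs.span (pure_tensor P V ` PiE P B)"
  by (rule tensor_basis[OF B(2)])
 ultimately show ?thesis unfolding finite_dim_def by blast
qed

lemma product_form:
 assumes "!!x. x \<in> P ==> linear_on fscale (*) (V x) (l x)"
 shows "multilinear_form P V (\<lambda>v. \<Prod>x\<in>P. l x (v x))"
 unfolding multilinear_form_def
proof (intro ballI)
 fix v x assume v: "v \<in> PiE P V" and x: "x \<in> P"
 define c where "c = (\<Prod>y\<in>P - {x}. l y (v y))"
 have e: "(\<Prod>y\<in>P. l y ((v(x := w)) y)) = l x w * c" for w
  unfolding c_def using P x by (subst prod.remove[of _ x]) (auto intro!: prod.cong)
 show "linear_on fscale (*) (V x) (\<lambda>w. \<Prod>y\<in>P. l y ((v(x := w)) y))"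
  unfolding linear_on_def
 proof (intro conjI ballI allI)
  fix u w assume "u \<in> V x" "w \<in> V x"
  then show "(\<Prod>y\<in>P. l y ((v(x := u + w)) y)) =
    (\<Prod>y\<in>P. l y ((v(x := u)) y)) + (\<Prod>y\<in>P. l y ((v(x := w)) y))"
   unfolding e by (simp only: linear_on_add[OF assms[OF x]] distrib_right)
 next
  fix k w assume "w \<in> V x"
  then show "(\<Prod>y\<in>P. l y ((v(x := fscale k w)) y)) = k * (\<Prod>y\<in>P. l y ((v(x := w)) y))"
   unfolding e by (simp only: linear_on_scale[OF assms[OF x]] mult.assoc)
 qed
qed

text \<open>Products of coordinate functionals are the dual basis of the pure tensors of basis vectors.\<close>

lemma tensor_separated_by_products:
 assumes t: "t \<in> tensor_product_space P V" "t ~= 0"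
 obtains l where "!!x. x \<in> P ==> linear_on fscale (*) (V x) (l x)" "t (\<lambda>v. \<Prod>x\<in>P. l x (v x)) ~= 0"
proof -
 obtain B where B: "!!x. x \<in> P ==> finite (B x)" "!!x. x \<in> P ==> fs.independent (B x)"
  "!!x. x \<in> P ==> fs.span (B x) = V x"
  using tensor_factor_bases by metis
 define c where "c \<beta> x v = fs.representation (B x) v (\<beta> x)" for \<beta> :: "'p => 'i => 'k" and x v
 have c: "linear_on fscale (*) (V x) (c \<beta> x)" if "x \<in> P" for \<beta> x
  using B(2,3)[OF that]
  by (auto simp: linear_on_def c_def fs.representation_add fs.representation_scale simp del: plus_fun_apply)
 define C where "C \<beta> = (\<lambda>v. \<Prod>x\<in>P. c \<beta> x (v x))" for \<beta>
 have formC: "multilinear_form P V (C \<beta>)" for \<beta> unfolding C_def by (rule product_form[OF c])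
 have delta: "pure_tensor P V \<gamma> (C \<beta>) = (if \<gamma> = \<beta> then 1 else 0)" if g: "\<gamma> \<in> PiE P B" and b: "\<beta> \<in> PiE P B" for \<beta> \<gamma>
 proof -
  have "c \<beta> x (\<gamma> x) = (if \<gamma> x = \<beta> x then 1 else 0)" if "x \<in> P" for x
   using fs.representation_basis[OF B(2)[OF that], of "\<gamma> x"] g that by (auto simp: PiE_iff c_def)
  then have "C \<beta> \<gamma> = (\<Prod>x\<in>P. if \<gamma> x = \<beta> x then 1 else 0)" by (simp add: C_def)
  then have 1: "pure_tensor P V \<gamma> (C \<beta>) = (\<Prod>x\<in>P. if \<gamma> x = \<beta> x then 1 else 0)"
   using formC by (simp add: pure_tensor_def)
  show ?thesis
  proof (cases "\<gamma> = \<beta>")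
   case False
   have "\<exists>x\<in>P. \<gamma> x ~= \<beta> x"
   proof (rule ccontr)
    assume "\<not> ?thesis"
    then have "\<gamma> = \<beta>" by (intro PiE_ext[OF g b]) simp
    then show False using False by simp
   qed
   then obtain x where "x \<in> P" "\<gamma> x ~= \<beta> x" by blast
   then have "(\<Prod>x\<in>P. if \<gamma> x = \<beta> x then 1 else 0 :: 'k) = 0" using P by (intro prod_zero) auto
   then show ?thesis using 1 False by (simp only: if_False)
  next
   case True
   then show ?thesis unfolding 1 by simp
  qed
 qed
 have fin: "finite (PiE P B)" using finite_PiE[OF P] B(1) by auto
 have t_eq: "t = (\<Sum>\<beta>\<in>PiE P B. fscale (t (C \<beta>)) (pure_tensor P V \<beta>))"
  using t(1) unfolding tensor_basis[OF B(3), simplified]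
 proof (induction rule: fs.span_induct_alt)
  case base
  have "fscale ((0 :: (('p => 'i => 'k) => 'k) => 'k) (C \<beta>)) (pure_tensor P V \<beta>) = 0" for \<beta>
   by (simp only: zero_fun_apply fs.scale_zero_left)
  then show ?case by (simp only: sum.neutral_const)
 next
  case (step k y z)
  then obtain \<gamma> where g: "\<gamma> \<in> PiE P B" "y = pure_tensor P V \<gamma>" by auto
  have yeq: "(\<Sum>\<beta>\<in>PiE P B. fscale (y (C \<beta>)) (pure_tensor P V \<beta>)) = y"
  proof -
   have "(\<Sum>\<beta>\<in>PiE P B. fscale (y (C \<beta>)) (pure_tensor P V \<beta>)) =
     (\<Sum>\<beta>\<in>PiE P B. if \<beta> = \<gamma> then pure_tensor P V \<beta> else 0)"
    by (rule sum.cong[OF refl]) (auto simp: delta[OF g(1)] g(2))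
   also have "\<dots> = y" using fin g by (simp add: sum.delta)
   finally show ?thesis .
  qed
  have E: "fscale ((fscale k y + z) (C \<beta>)) (pure_tensor P V \<beta>) =
    fscale k (fscale (y (C \<beta>)) (pure_tensor P V \<beta>)) + fscale (z (C \<beta>)) (pure_tensor P V \<beta>)" for \<beta>
  proof -
   have "(fscale k y + z) (C \<beta>) = k * y (C \<beta>) + z (C \<beta>)" by (simp only: plus_fun_apply fscale_def)
   then show ?thesis by (simp only: fs.scale_left_distrib fs.scale_scale)
  qed
  have "(\<Sum>\<beta>\<in>PiE P B. fscale ((fscale k y + z) (C \<beta>)) (pure_tensor P V \<beta>)) =
    fscale k (\<Sum>\<beta>\<in>PiE P B. fscale (y (C \<beta>)) (pure_tensor P V \<beta>)) +
    (\<Sum>\<beta>\<in>PiE P B. fscale (z (C \<beta>)) (pure_tensor P V \<beta>))"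
   unfolding E sum.distrib fs.scale_sum_right ..
  also have "\<dots> = fscale k y + z" unfolding yeq step(2)[symmetric] ..
  finally show ?case by (rule sym)
 qed
 have "\<exists>\<beta>\<in>PiE P B. t (C \<beta>) ~= 0"
 proof (rule ccontr)
  assume no: "\<not> ?thesis"
  have "(\<Sum>\<beta>\<in>PiE P B. fscale (t (C \<beta>)) (pure_tensor P V \<beta>)) = 0"
  proof (intro sum.neutral ballI)
   fix \<beta> assume "\<beta> \<in> PiE P B"
   then have "t (C \<beta>) = 0" using no by blast
   then show "fscale (t (C \<beta>)) (pure_tensor P V \<beta>) = 0" by (simp only: fs.scale_zero_left)
  qed
  then show False using t_eq t(2) by (simp only:)
 qed
 then obtain \<beta> where "t (C \<beta>) ~= 0" by blast
 then show ?thesis using that[OF c] unfolding C_def by (simp only:)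
qed

lemma pure_tensor_nonzero:
 assumes "v \<in> PiE P V" "!!x. x \<in> P ==> v x ~= 0" shows "pure_tensor P V v ~= 0"
proof -
 have "\<exists>l. linear_on fscale (*) (V x) l & l (v x) ~= 0" if "x \<in> P" for x
  using linear_functional_nonzero[OF V[OF that] PiE_mem[OF assms(1) that] assms(2)[OF that]] by blast
 then obtain l where l: "!!x. x \<in> P ==> linear_on fscale (*) (V x) (l x) & l x (v x) ~= 0"
  using bchoice[of P "\<lambda>x l. linear_on fscale (*) (V x) l & l (v x) ~= 0"] by blast
 have "pure_tensor P V v (\<lambda>v. \<Prod>x\<in>P. l x (v x)) = (\<Prod>x\<in>P. l x (v x))"
  using product_form[of l] l by (simp add: pure_tensor_def)
 moreover have "\<dots> ~= 0" using P l by simp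
 ultimately show ?thesis by auto
qed

end

lemma fscale_apply: "fscale c v i = c * v i"
 by (simp add: fscale_def)

definition tensor_rep ::
 "'p set => ('p => ('l, 'i, 'k::field) rep) => ('l, ('p => 'i => 'k) => 'k, 'k) rep" where
 "tensor_rep P R = (tensor_product_space P (\<lambda>x. fst (R x)),
   \<lambda>a. tensor_rep_action P (\<lambda>x. fst (R x)) (\<lambda>x. snd (R x)) (\<lambda>_. a))"

lemma tensor_rep_linear: "flinear S (snd (tensor_rep P R) a)"
 unfolding tensor_rep_def snd_conv by (rule tensor_action_linear)

lemma factor_op_in:
 assumes "finite P" "!!x. x \<in> P ==> finite_dim fscale (V x)" "x \<in> P" "endo fscale (V x) A"
  and "t \<in> tensor_product_space P V"
 shows "factor_op P V x A t \<in> tensor_product_space P V"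
 unfolding factor_op_def
proof (rule tensor_action_in[OF assms(1,2,5)])
 fix y assume "y \<in> P"
 then show "endo fscale (V y) (if y = x then A else (\<lambda>_. 0))"
  using factor_op_endo[where V = V, OF assms(1,2,3,4)] by blast
qed

text \<open>The factors can be acted on one at a time.\<close>

definition separated :: "'l set => 'p set => ('p => ('l, 'i, 'k::field) rep) => bool" where
 "separated L P R \<longleftrightarrow> (\<forall>x\<in>P. \<forall>a\<in>L. \<exists>a'\<in>L. (\<forall>v\<in>fst (R x). snd (R x) a' v = snd (R x) a v) &
   (\<forall>y\<in>P - {x}. \<forall>v\<in>fst (R y). snd (R y) a' v = 0))"

context
 fixes s :: "'k::field => 'l::ab_group_add => 'l" and br L and P :: "'p set"
  and R :: "'p => ('l, 'i, 'k) rep"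
 assumes P: "finite P" and R: "!!x. x \<in> P ==> is_rep s br L (R x)"
begin

lemma tensor_rep_factors: "x \<in> P ==> finite_dim fscale (fst (R x))"
 using is_repD(1)[OF R] .

lemma tensor_rep_pure:
 assumes a: "a \<in> L" and v: "v \<in> PiE P (\<lambda>x. fst (R x))"
 shows "snd (tensor_rep P R) a (pure_tensor P (\<lambda>x. fst (R x)) v) =
  (\<Sum>x\<in>P. pure_tensor P (\<lambda>x. fst (R x)) (v(x := snd (R x) a (v x))))"
 unfolding tensor_rep_def snd_conv
 by (rule tensor_action_pure[where V = "\<lambda>x. fst (R x)", OF P _ v]) (rule tensor_rep_factors is_repD(3)[OF R a], assumption)+

lemma tensor_rep_upd:
 assumes "a \<in> L" "v \<in> PiE P (\<lambda>x. fst (R x))" "x \<in> P"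
 shows "v(x := snd (R x) a (v x)) \<in> PiE P (\<lambda>x. fst (R x))"
 by (rule PiE_upd[OF assms(2,3) is_repD(6)[OF R[OF assms(3)] assms(1) PiE_mem[OF assms(2,3)]]])

lemma tensor_rep_in:
 assumes "a \<in> L" "t \<in> tensor_product_space P (\<lambda>x. fst (R x))"
 shows "snd (tensor_rep P R) a t \<in> tensor_product_space P (\<lambda>x. fst (R x))"
 unfolding tensor_rep_def snd_conv
 by (rule tensor_action_in[where V = "\<lambda>x. fst (R x)", OF P _ assms(2)])
  (rule tensor_rep_factors is_repD(3)[OF R assms(1)], assumption)+

lemma tensor_rep_separated_action:
 assumes a: "a \<in> L" and x: "x \<in> P" and v: "v \<in> PiE P (\<lambda>x. fst (R x))"
  and zero: "!!y w. y \<in> P - {x} ==> w \<in> fst (R y) ==> snd (R y) a w = 0"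
 shows "snd (tensor_rep P R) a (pure_tensor P (\<lambda>x. fst (R x)) v) =
  pure_tensor P (\<lambda>x. fst (R x)) (v(x := snd (R x) a (v x)))"
proof -
 let ?p = "pure_tensor P (\<lambda>x. fst (R x))"
 have "?p (v(y := snd (R y) a (v y))) = 0" if y: "y \<in> P - {x}" for y
 proof -
  have yP: "y \<in> P" using y by simp
  have "snd (R y) a (v y) = 0" by (rule zero[OF y PiE_mem[OF v yP]])
  then show ?thesis
   using multilinear_zero[OF pure_tensor_multilinear v yP is_repD(2)[OF R[OF yP]]] by (simp only:)
 qed
 then have "(\<Sum>y\<in>P - {x}. ?p (v(y := snd (R y) a (v y)))) = 0" by (intro sum.neutral) blast
 then show ?thesis
  unfolding tensor_rep_pure[OF a v] sum.remove[OF P x] by (simp only: add_0_right)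
qed

lemma tensor_rep_is_rep:
 assumes s: "vector_space s" and L: "module.subspace s L" "!!a b. a \<in> L ==> b \<in> L ==> br a b \<in> L"
 shows "is_rep s br L (tensor_rep P R)"
proof -
 interpret l: vector_space s by (rule s)
 let ?V = "\<lambda>x. fst (R x)"
 let ?T = "tensor_product_space P ?V" and ?p = "pure_tensor P ?V" and ?r = "snd (tensor_rep P R)"
 have lin0: "flinear ?T (?r a)" for a by (rule tensor_rep_linear)
 have sT: "fs.subspace ?T" by (rule subspace_tensor)
 have "is_rep s br L (?T, ?r)"
  unfolding is_rep_iff
 proof (intro conjI ballI)
  show "finite_dim fscale ?T" by (rule tensor_finite_dim[OF P tensor_rep_factors])
  fix a assume a: "a \<in> L"
  show "endo fscale ?T (?r a)"
   unfolding endo_def using tensor_rep_in[OF a] lin0 by blast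
  fix b t assume b: "b \<in> L" and t: "t \<in> ?T"
  note ab = L(2)[OF a b]
  have lin2: "flinear ?T (\<lambda>t. ?r a (?r b t) - ?r b (?r a t))"
   unfolding linear_on_def
   by (simp add: linear_on_add[OF tensor_rep_linear[of UNIV]] linear_on_scale[OF tensor_rep_linear[of UNIV]]
     fs.scale_right_diff_distrib del: plus_fun_apply)
  show "?r (br a b) t = ?r a (?r b t) - ?r b (?r a t)"
  proof (rule tensor_eqI[OF vector_space_fscale lin0 lin2 _ t])
   fix v assume v: "v \<in> PiE P ?V"
   define d where "d a y = v(y := snd (R y) a (v y))" for a y
   have d: "d a y \<in> PiE P ?V" if "a \<in> L" "y \<in> P" for a y
    unfolding d_def by (rule tensor_rep_upd[OF that(1) v that(2)])
   define g where "g a b x y = ?p ((d b y)(x := snd (R x) a (d b y x)))" for a b x y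
   have lin_p: "?r c (\<Sum>y\<in>P. f y) = (\<Sum>y\<in>P. ?r c (f y))" for c f
    by (rule fsp.linear_on_sum[OF tensor_rep_linear fs.subspace_UNIV]) simp
   have rab: "?r a (?r b (?p v)) = (\<Sum>y\<in>P. \<Sum>x\<in>P. g a b x y)" if a: "a \<in> L" and b: "b \<in> L" for a b
   proof -
    have "?r a (?r b (?p v)) = (\<Sum>y\<in>P. ?r a (?p (d b y)))"
     unfolding tensor_rep_pure[OF b v] lin_p d_def ..
    also have "\<dots> = (\<Sum>y\<in>P. \<Sum>x\<in>P. g a b x y)"
     unfolding g_def by (rule sum.cong[OF refl]) (rule tensor_rep_pure[OF a d[OF b]])
    finally show ?thesis .
   qed
   have "?r b (?r a (?p v)) = (\<Sum>y\<in>P. \<Sum>x\<in>P. g b a y x)"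
    unfolding rab[OF b a] by (rule sum.swap)
   then have "?r a (?r b (?p v)) - ?r b (?r a (?p v)) = (\<Sum>y\<in>P. \<Sum>x\<in>P. g a b x y - g b a y x)"
    unfolding rab[OF a b] by (simp only: sum_subtractf)
   also have "\<dots> = (\<Sum>y\<in>P. g a b y y - g b a y y)"
   proof (rule sum.cong[OF refl])
    fix y assume y: "y \<in> P"
    have "g a b x y - g b a y x = 0" if "x \<in> P - {y}" for x
    proof -
     have "(d b y)(x := snd (R x) a (d b y x)) = (d a x)(y := snd (R y) b (d a x y))"
      using that by (auto simp: d_def)
     then show ?thesis by (simp only: g_def diff_self)
    qed
    then have "(\<Sum>x\<in>P - {y}. g a b x y - g b a y x) = 0" by (intro sum.neutral) blast
    then show "(\<Sum>x\<in>P. g a b x y - g b a y x) = g a b y y - g b a y y"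
     unfolding sum.remove[OF P y] by (simp only: add_0_right)
   qed
   also have "\<dots> = (\<Sum>y\<in>P. ?p (v(y := snd (R y) (br a b) (v y))))"
   proof (rule sum.cong[OF refl])
    fix y assume y: "y \<in> P"
    have vy: "v y \<in> fst (R y)" by (rule PiE_mem[OF v y])
    have gd: "g a b y y = ?p (v(y := snd (R y) a (snd (R y) b (v y))))" for a b
     by (simp only: g_def d_def fun_upd_same fun_upd_upd)
    have in1: "snd (R y) a (snd (R y) b (v y)) \<in> fst (R y)" if "a \<in> L" "b \<in> L" for a b
     by (rule is_repD(6)[OF R[OF y] that(1) is_repD(6)[OF R[OF y] that(2) vy]])
    show "g a b y y - g b a y y = ?p (v(y := snd (R y) (br a b) (v y)))"
     unfolding gd is_repD(5)[OF R[OF y] a b vy]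
     by (rule multilinear_diff[OF pure_tensor_multilinear v y is_repD(2)[OF R[OF y]] in1[OF a b] in1[OF b a], symmetric])
   qed
   also have "\<dots> = ?r (br a b) (?p v)" by (rule tensor_rep_pure[OF ab v, symmetric])
   finally show "?r (br a b) (?p v) = ?r a (?r b (?p v)) - ?r b (?r a (?p v))" by (rule sym)
  qed
 next
  fix t assume t: "t \<in> ?T"
  show "linear_on s fscale L (\<lambda>a. ?r a t)"
   unfolding linear_on_def
  proof (intro conjI ballI allI)
   fix a b assume a: "a \<in> L" and b: "b \<in> L"
   have ab: "a + b \<in> L" by (rule l.subspace_add[OF L(1) a b])
   have lin2: "flinear ?T (\<lambda>t. ?r a t + ?r b t)"
    unfolding linear_on_def
    by (simp add: linear_on_add[OF tensor_rep_linear[of UNIV]] linear_on_scale[OF tensor_rep_linear[of UNIV]]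
      fs.scale_right_distrib add_ac del: plus_fun_apply)
   show "?r (a + b) t = ?r a t + ?r b t"
   proof (rule tensor_eqI[OF vector_space_fscale lin0 lin2 _ t])
    fix v assume v: "v \<in> PiE P ?V"
    have "?p (v(y := snd (R y) (a + b) (v y))) = ?p (v(y := snd (R y) a (v y))) + ?p (v(y := snd (R y) b (v y)))"
     if y: "y \<in> P" for y
    proof -
     have vy: "v y \<in> fst (R y)" by (rule PiE_mem[OF v y])
     show ?thesis
      unfolding linear_on_add[OF is_repD(4)[OF R[OF y] vy] a b]
      by (rule multilinear_add[OF pure_tensor_multilinear v y is_repD(6)[OF R[OF y] a vy] is_repD(6)[OF R[OF y] b vy]])
    qed
    then show "?r (a + b) (?p v) = ?r a (?p v) + ?r b (?p v)"
     unfolding tensor_rep_pure[OF ab v] tensor_rep_pure[OF a v] tensor_rep_pure[OF b v] sum.distrib[symmetric]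
     by (rule sum.cong[OF refl])
   qed
  next
   fix c a assume a: "a \<in> L"
   have ca: "s c a \<in> L" by (rule l.subspace_scale[OF L(1) a])
   have lin2: "flinear ?T (\<lambda>t. fscale c (?r a t))"
    unfolding linear_on_def
    by (simp add: linear_on_add[OF tensor_rep_linear[of UNIV]] linear_on_scale[OF tensor_rep_linear[of UNIV]]
      fs.scale_right_distrib mult.commute del: plus_fun_apply)
   show "?r (s c a) t = fscale c (?r a t)"
   proof (rule tensor_eqI[OF vector_space_fscale lin0 lin2 _ t])
    fix v assume v: "v \<in> PiE P ?V"
    have "?p (v(y := snd (R y) (s c a) (v y))) = fscale c (?p (v(y := snd (R y) a (v y))))"
     if y: "y \<in> P" for y
    proof -
     have vy: "v y \<in> fst (R y)" by (rule PiE_mem[OF v y])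
     show ?thesis
      unfolding linear_on_scale[OF is_repD(4)[OF R[OF y] vy] a]
      by (rule multilinear_scale[OF pure_tensor_multilinear v y is_repD(6)[OF R[OF y] a vy]])
    qed
    then show "?r (s c a) (?p v) = fscale c (?r a (?p v))"
     unfolding tensor_rep_pure[OF ca v] tensor_rep_pure[OF a v] fs.scale_sum_right
     by (rule sum.cong[OF refl])
   qed
  qed
 qed
 then show ?thesis by (simp add: tensor_rep_def)
qed

end

text \<open>
  A nonzero submodule is stable under every operator on a single factor that belongs to the
  associative algebra generated by the action, hence by Burnside's theorem under all rank-one
  operators there. Applying one in each factor turns a nonzero tensor into any given pure tensor.
\<close>

theorem tensor_rep_irreducible:
 fixes R :: "'p => ('l::ab_group_add, 'i, 'k::alg_closed_field) rep"
 assumes s: "vector_space s" and L: "module.subspace s L" "!!a b. a \<in> L ==> b \<in> L ==> br a b \<in> L"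
  and P: "finite P" and R: "!!x. x \<in> P ==> irreducible_rep s br L (R x)" and sep: "separated L P R"
 shows "irreducible_rep s br L (tensor_rep P R)"
proof -
 note RD = irreducible_repD[OF R]
 have rep: "is_rep s br L (R x)" if "x \<in> P" for x by (rule RD(1)[OF that])
 let ?V = "\<lambda>x. fst (R x)"
 let ?T = "tensor_product_space P ?V" and ?p = "pure_tensor P ?V" and ?r = "snd (tensor_rep P R)"
 have fd: "finite_dim fscale (?V x)" if "x \<in> P" for x by (rule is_repD(1)[OF rep[OF that]])
 have fstT: "fst (tensor_rep P R) = ?T" by (simp add: tensor_rep_def)
 have "\<exists>v. v \<in> fst (R x) & v ~= 0" if "x \<in> P" for x
  using RD(2)[OF that] fs.subspace_0[OF is_repD(2)[OF rep[OF that]]] by blast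
 then obtain v0 where v0: "!!x. x \<in> P ==> v0 x \<in> fst (R x) & v0 x ~= 0" by metis
 have v0r: "restrict v0 P \<in> PiE P ?V" using v0 by (intro restrict_PiE_iff[THEN iffD2]) blast
 have "?p (restrict v0 P) ~= 0"
  by (rule pure_tensor_nonzero[OF P fd v0r]) (use v0 in simp_all)
 then have nz: "?T ~= {0}" using pure_in_tensor[OF v0r] by blast
 have claim: "U = {0} \<or> U = ?T"
  if U: "fs.subspace U" "U \<subseteq> ?T" "\<forall>a\<in>L. ?r a ` U \<subseteq> U" for U
 proof (cases "U = {0}")
  case False
  then obtain t where t: "t \<in> U" "t ~= 0" using fs.subspace_0[OF U(1)] by blast
  have tT: "t \<in> ?T" using t U(2) by blast
  obtain l where l: "!!x. x \<in> P ==> linear_on fscale (*) (?V x) (l x)"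
   and lt: "t (\<lambda>v. \<Prod>x\<in>P. l x (v x)) ~= 0"
   using tensor_separated_by_products[OF P fd tT t(2)] by blast
  have rank1: "\<exists>A. endo fscale (?V x) A & (\<forall>u\<in>U. factor_op P ?V x A u \<in> U) & (\<forall>v\<in>?V x. A v = fscale (l x v) w)"
   if x: "x \<in> P" and w: "w \<in> ?V x" for x w
  proof -
   define \<A> where "\<A> = {A. endo fscale (?V x) A & (\<forall>u\<in>U. factor_op P ?V x A u \<in> U)}"
   note sV = is_repD(2)[OF rep[OF x]]
   have lop: "flinear ?T (factor_op P ?V x A)" for A
    unfolding factor_op_def by (rule tensor_action_linear)
   have opT: "factor_op P ?V x A u \<in> ?T" if "endo fscale (?V x) A" "u \<in> ?T" for A u
    by (rule factor_op_in[where V = ?V, OF P fd x that])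
   have fop: "factor_op P ?V x A (?p v) = ?p (v(x := A (v x)))" if "endo fscale (?V x) A" "v \<in> PiE P ?V" for A v
    by (rule factor_op_pure[where V = ?V, OF P fd x that])
   have AvP: "v(x := A (v x)) \<in> PiE P ?V" if "endo fscale (?V x) A" "v \<in> PiE P ?V" for A v
    by (rule PiE_upd[OF that(2) x fs.endo_in[OF that(1) PiE_mem[OF that(2) x]]])
   have Aid: "(\<lambda>v. v) \<in> \<A>"
   proof -
    have e: "endo fscale (?V x) (\<lambda>v. v)" by (simp add: endo_def linear_on_def)
    have "factor_op P ?V x (\<lambda>v. v) u = u" if "u \<in> ?T" for u
    proof (rule tensor_eqI[OF vector_space_fscale lop _ _ that])
     show "flinear ?T (\<lambda>u. u)" by (simp add: linear_on_def)
     show "factor_op P ?V x (\<lambda>v. v) (?p v) = ?p v" if "v \<in> PiE P ?V" for v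
      unfolding fop[OF e that] by (simp only: fun_upd_triv)
    qed
    then show ?thesis unfolding \<A>_def using e U(2) by auto
   qed
   have Acomp: "(\<lambda>v. A (B v)) \<in> \<A>" if A: "A \<in> \<A>" and B: "B \<in> \<A>" for A B
   proof -
    have eA: "endo fscale (?V x) A" and eB: "endo fscale (?V x) B" using A B by (auto simp: \<A>_def)
    have e: "endo fscale (?V x) (\<lambda>v. A (B v))"
     using eA eB unfolding endo_def linear_on_def image_subset_iff by simp
    have "factor_op P ?V x (\<lambda>v. A (B v)) u = factor_op P ?V x A (factor_op P ?V x B u)" if "u \<in> ?T" for u
    proof (rule tensor_eqI[OF vector_space_fscale lop _ _ that])
     show "flinear ?T (\<lambda>u. factor_op P ?V x A (factor_op P ?V x B u))"
      unfolding linear_on_def using lop opT[OF eB]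
      by (simp add: linear_on_add[OF lop] linear_on_scale[OF lop] del: plus_fun_apply)
     show "factor_op P ?V x (\<lambda>v. A (B v)) (?p v) = factor_op P ?V x A (factor_op P ?V x B (?p v))"
      if "v \<in> PiE P ?V" for v
      unfolding fop[OF e that] fop[OF eB that] fop[OF eA AvP[OF eB that]]
      by (simp only: fun_upd_same fun_upd_upd)
    qed
    then show ?thesis using A B e U(2) unfolding \<A>_def by auto
   qed
   have Aadd: "(\<lambda>v. A v + B v) \<in> \<A>" if A: "A \<in> \<A>" and B: "B \<in> \<A>" for A B
   proof -
    have eA: "endo fscale (?V x) A" and eB: "endo fscale (?V x) B" using A B by (auto simp: \<A>_def)
    have e: "endo fscale (?V x) (\<lambda>v. A v + B v)"
     using eA eB fs.subspace_add[OF sV] unfolding endo_def linear_on_def image_subset_iff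
     by (simp add: fs.scale_right_distrib add_ac del: plus_fun_apply)
    have "factor_op P ?V x (\<lambda>v. A v + B v) u = factor_op P ?V x A u + factor_op P ?V x B u" if "u \<in> ?T" for u
    proof (rule tensor_eqI[OF vector_space_fscale lop _ _ that])
     show "flinear ?T (\<lambda>u. factor_op P ?V x A u + factor_op P ?V x B u)"
      unfolding linear_on_def
      by (simp add: linear_on_add[OF lop] linear_on_scale[OF lop] fs.scale_right_distrib add_ac del: plus_fun_apply)
     show "factor_op P ?V x (\<lambda>v. A v + B v) (?p v) = factor_op P ?V x A (?p v) + factor_op P ?V x B (?p v)"
      if v: "v \<in> PiE P ?V" for v
      unfolding fop[OF e v] fop[OF eB v] fop[OF eA v]
      by (rule multilinear_add[OF pure_tensor_multilinear v x fs.endo_in[OF eA PiE_mem[OF v x]] fs.endo_in[OF eB PiE_mem[OF v x]]])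
    qed
    then show ?thesis using A B e U(2) fs.subspace_add[OF U(1)] unfolding \<A>_def by auto
   qed
   have Ascale: "(\<lambda>v. fscale c (A v)) \<in> \<A>" if A: "A \<in> \<A>" for A c
   proof -
    have eA: "endo fscale (?V x) A" using A by (auto simp: \<A>_def)
    have e: "endo fscale (?V x) (\<lambda>v. fscale c (A v))"
     using eA fs.subspace_scale[OF sV] unfolding endo_def linear_on_def image_subset_iff
     by (simp add: fs.scale_right_distrib mult.commute del: plus_fun_apply)
    have "factor_op P ?V x (\<lambda>v. fscale c (A v)) u = fscale c (factor_op P ?V x A u)" if "u \<in> ?T" for u
    proof (rule tensor_eqI[OF vector_space_fscale lop _ _ that])
     show "flinear ?T (\<lambda>u. fscale c (factor_op P ?V x A u))"
      unfolding linear_on_def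
      by (simp add: linear_on_add[OF lop] linear_on_scale[OF lop] fs.scale_right_distrib mult.commute del: plus_fun_apply)
     show "factor_op P ?V x (\<lambda>v. fscale c (A v)) (?p v) = fscale c (factor_op P ?V x A (?p v))"
      if v: "v \<in> PiE P ?V" for v
      unfolding fop[OF e v] fop[OF eA v]
      by (rule multilinear_scale[OF pure_tensor_multilinear v x fs.endo_in[OF eA PiE_mem[OF v x]]])
    qed
    then show ?thesis using A e U(2) fs.subspace_scale[OF U(1)] unfolding \<A>_def by auto
   qed
   have AL: "snd (R x) a \<in> \<A>" if a: "a \<in> L" for a
   proof -
    obtain a' where a': "a' \<in> L" "!!v. v \<in> ?V x ==> snd (R x) a' v = snd (R x) a v"
      "!!y v. y \<in> P - {x} ==> v \<in> ?V y ==> snd (R y) a' v = 0"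
     using sep x a unfolding separated_def by blast
    have e: "endo fscale (?V x) (snd (R x) a)" by (rule is_repD(3)[OF rep[OF x] a])
    have "factor_op P ?V x (snd (R x) a) u = ?r a' u" if "u \<in> ?T" for u
    proof (rule tensor_eqI[OF vector_space_fscale lop tensor_rep_linear _ that])
     fix v assume v: "v \<in> PiE P ?V"
     have 1: "?r a' (?p v) = ?p (v(x := snd (R x) a' (v x)))"
      by (rule tensor_rep_separated_action[where R = R, OF P rep a'(1) x v a'(3)])
     show "factor_op P ?V x (snd (R x) a) (?p v) = ?r a' (?p v)"
      unfolding fop[OF e v] 1 a'(2)[OF PiE_mem[OF v x]] ..
    qed
    note eq = this
    have "factor_op P ?V x (snd (R x) a) u \<in> U" if u: "u \<in> U" for u
    proof -
     have "?r a' u \<in> U" using U(3) a'(1) u by blast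
     then show ?thesis unfolding eq[OF subsetD[OF U(2) u]] .
    qed
    then show ?thesis using e unfolding \<A>_def by blast
   qed
   have "\<exists>A\<in>\<A>. \<forall>v\<in>?V x. A v = fscale (l x v) w"
   proof (rule burnside_rank_one[where s = fscale and V = "?V x" and \<A> = \<A> and l = "l x" and w = w,
      OF vector_space_fscale fd[OF x] RD(2)[OF x]])
    show "(\<lambda>v. A (B v)) \<in> \<A>" if "A \<in> \<A>" "B \<in> \<A>" for A B by (rule Acomp[OF that])
    show "(\<lambda>v. A v + B v) \<in> \<A>" if "A \<in> \<A>" "B \<in> \<A>" for A B by (rule Aadd[OF that])
    show "(\<lambda>v. fscale c (A v)) \<in> \<A>" if "A \<in> \<A>" for A c by (rule Ascale[OF that])
    show "endo fscale (?V x) A" if "A \<in> \<A>" for A using that by (simp add: \<A>_def)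
    show "W = {0} \<or> W = ?V x"
     if "fs.subspace W" "W \<subseteq> ?V x" "!!A v. A \<in> \<A> ==> v \<in> W ==> A v \<in> W" for W
     using RD(3)[OF x that(1,2)] that(3)[OF AL] by blast
   qed (fact Aid l[OF x] w)+
   then show ?thesis unfolding \<A>_def by blast
  qed
  have pure_U: "?p w \<in> U" if w: "w \<in> PiE P ?V" for w
  proof -
   define good where "good Q \<longleftrightarrow> (\<exists>\<Phi>. flinear ?T \<Phi> & \<Phi> ` ?T \<subseteq> ?T & \<Phi> ` U \<subseteq> U &
     (\<forall>v\<in>PiE P ?V. \<Phi> (?p v) = fscale (\<Prod>x\<in>Q. l x (v x)) (?p (override_on v w Q))))" for Q
   have goodI: "Q \<subseteq> P --> good Q" if "finite Q" for Q
    using that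
   proof (induction Q rule: finite_induct)
    case empty
    have "good {}" unfolding good_def
     by (rule exI[of _ "\<lambda>t. t"]) (simp add: linear_on_def)
    then show ?case by blast
   next
    case (insert x Q)
    show ?case
    proof
    assume sub: "insert x Q \<subseteq> P"
    then have "good Q" using insert.IH by blast
    then obtain \<Phi> where \<Phi>': "flinear ?T \<Phi> & \<Phi> ` ?T \<subseteq> ?T & \<Phi> ` U \<subseteq> U &
     (\<forall>v\<in>PiE P ?V. \<Phi> (?p v) = fscale (\<Prod>x\<in>Q. l x (v x)) (?p (override_on v w Q)))"
     unfolding good_def by (elim exE)
    note \<Phi> = conjunct1[OF \<Phi>'] conjunct1[OF conjunct2[OF \<Phi>']] conjunct1[OF conjunct2[OF conjunct2[OF \<Phi>']]]
     bspec[OF conjunct2[OF conjunct2[OF conjunct2[OF \<Phi>']]]]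
    have x: "x \<in> P" using sub by simp
    obtain A where A: "endo fscale (?V x) A" "!!u. u \<in> U ==> factor_op P ?V x A u \<in> U"
      "!!v. v \<in> ?V x ==> A v = fscale (l x v) (w x)"
     using rank1[OF x PiE_mem[OF w x]] by blast
    let ?F = "factor_op P ?V x A"
    have lop: "flinear UNIV ?F" unfolding factor_op_def by (rule tensor_action_linear)
    have 1: "flinear ?T (\<lambda>t. ?F (\<Phi> t))"
     unfolding linear_on_def
     by (simp add: linear_on_add[OF lop] linear_on_scale[OF lop] linear_on_add[OF \<Phi>(1)] linear_on_scale[OF \<Phi>(1)]
       del: plus_fun_apply)
    have 2: "?F u \<in> ?T" if "u \<in> ?T" for u
     by (rule factor_op_in[where V = ?V, OF P fd x A(1) that])
    have 3: "?F (\<Phi> (?p v)) = fscale (\<Prod>x\<in>insert x Q. l x (v x)) (?p (override_on v w (insert x Q)))"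
     if v: "v \<in> PiE P ?V" for v
    proof -
     have ov: "override_on v w Q \<in> PiE P ?V"
      using v w sub by (auto simp: PiE_iff override_on_def extensional_def)
     have vx: "override_on v w Q x = v x" using insert.hyps by simp
     have wx: "w x \<in> ?V x" by (rule PiE_mem[OF w x])
     have f1: "?F (?p (override_on v w Q)) = ?p ((override_on v w Q)(x := A (override_on v w Q x)))"
      by (rule factor_op_pure[where V = ?V, OF P fd x A(1) ov])
     have "?F (\<Phi> (?p v)) = fscale (\<Prod>x\<in>Q. l x (v x)) (?F (?p (override_on v w Q)))"
      unfolding \<Phi>(4)[OF v] by (rule linear_on_scale[OF lop]) simp
     also have "?F (?p (override_on v w Q)) = ?p ((override_on v w Q)(x := fscale (l x (v x)) (w x)))"
      unfolding f1 vx A(3)[OF PiE_mem[OF v x]] ..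
     also have "\<dots> = fscale (l x (v x)) (?p ((override_on v w Q)(x := w x)))"
      by (rule multilinear_scale[OF pure_tensor_multilinear ov x wx])
     also have "(override_on v w Q)(x := w x) = override_on v w (insert x Q)"
      by (auto simp: override_on_def)
     finally show ?thesis using insert.hyps by (simp add: mult.commute)
    qed
    have 4: "(\<lambda>t. ?F (\<Phi> t)) ` ?T \<subseteq> ?T" using \<Phi>(2) 2 by blast
    have 5: "(\<lambda>t. ?F (\<Phi> t)) ` U \<subseteq> U" using \<Phi>(3) A(2) by blast
    show "good (insert x Q)"
     unfolding good_def by (rule exI[of _ "\<lambda>t. ?F (\<Phi> t)"]) (intro conjI ballI 1 4 5 3)
    qed
   qed
   have "good P" using goodI[OF P] by blast
   then obtain \<Phi> where \<Phi>': "flinear ?T \<Phi> & \<Phi> ` ?T \<subseteq> ?T & \<Phi> ` U \<subseteq> U &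
     (\<forall>v\<in>PiE P ?V. \<Phi> (?p v) = fscale (\<Prod>x\<in>P. l x (v x)) (?p (override_on v w P)))"
     unfolding good_def by (elim exE)
    note \<Phi> = conjunct1[OF \<Phi>'] conjunct1[OF conjunct2[OF \<Phi>']] conjunct1[OF conjunct2[OF conjunct2[OF \<Phi>']]]
     bspec[OF conjunct2[OF conjunct2[OF conjunct2[OF \<Phi>']]]]
   define b where "b = (\<lambda>v. \<Prod>x\<in>P. l x (v x))"
   have form: "multilinear_form P ?V b" unfolding b_def by (rule product_form[OF P fd l])
   have \<Phi>t: "\<Phi> t = fscale (t b) (?p w)"
   proof (rule tensor_eqI[OF vector_space_fscale \<Phi>(1) _ _ tT])
    show "flinear ?T (\<lambda>t. fscale (t b) (?p w))"
     unfolding linear_on_def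
     by (intro conjI ballI allI) (simp_all only: plus_fun_apply fscale_apply fs.scale_left_distrib fs.scale_scale)
    show "\<Phi> (?p v) = fscale (?p v b) (?p w)" if v: "v \<in> PiE P ?V" for v
    proof -
     have "override_on v w P = w"
      using v w by (auto simp: override_on_def PiE_iff extensional_def fun_eq_iff)
     moreover have "?p v b = (\<Prod>x\<in>P. l x (v x))" using form by (simp add: pure_tensor_def b_def)
     ultimately show ?thesis using \<Phi>(4)[OF v] by (simp only:)
    qed
   qed
   have "fscale (t b) (?p w) \<in> U" unfolding \<Phi>t[symmetric] by (rule subsetD[OF \<Phi>(3) imageI[OF t(1)]])
   then show ?thesis by (rule fs.subspace_scale_cancel[OF U(1)]) (simp only: b_def lt not_False_eq_True)
  qed
  then have "?T \<subseteq> U" by (rule tensor_subset[OF U(1)])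
  with U(2) have "U = ?T" by (rule subset_antisym)
  then show ?thesis ..
 qed simp
 then show ?thesis
  unfolding irreducible_rep_def fstT
 proof (intro conjI allI impI)
  show "is_rep s br L (tensor_rep P R)" by (rule tensor_rep_is_rep[OF P rep s L])
  show "?T ~= {0}" by (rule nz)
 qed (elim conjE, rule claim)
qed

text \<open>A nonzero equivariant multilinear map identifies an irreducible module as the tensor product.\<close>

lemma tensor_rep_universal:
 fixes R :: "'p => ('l::ab_group_add, 'i, 'k::field) rep" and W :: "('l, 'j, 'k) rep"
 assumes P: "finite P" and R: "!!x. x \<in> P ==> is_rep s br L (R x)"
  and irr: "irreducible_rep s br L (tensor_rep P R)" "irreducible_rep s br L W"
  and ml: "multilinear fscale P (\<lambda>x. fst (R x)) \<mu>"
  and W: "!!v. v \<in> PiE P (\<lambda>x. fst (R x)) ==> \<mu> v \<in> fst W"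
  and eq: "!!a v. a \<in> L ==> v \<in> PiE P (\<lambda>x. fst (R x)) ==>
    snd W a (\<mu> v) = (\<Sum>x\<in>P. \<mu> (v(x := snd (R x) a (v x))))"
  and nz: "v0 \<in> PiE P (\<lambda>x. fst (R x))" "\<mu> v0 ~= 0"
 shows "rep_iso L (tensor_rep P R) W"
proof -
 let ?V = "\<lambda>x. fst (R x)"
 let ?T = "tensor_product_space P ?V" and ?p = "pure_tensor P ?V" and ?r = "snd (tensor_rep P R)"
 have fstT: "fst (tensor_rep P R) = ?T" by (simp add: tensor_rep_def)
 note WD = irreducible_repD(1)[OF irr(2)]
 define \<Phi> where "\<Phi> t j = t (\<lambda>v. \<mu> v j)" for t :: "(('p => 'i => 'k) => 'k) => 'k" and j
 have form: "multilinear_form P ?V (\<lambda>v. \<mu> v j)" for j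
  unfolding multilinear_form_def linear_on_def
 proof (intro ballI conjI allI)
  fix v x u w assume v: "v \<in> PiE P ?V" "x \<in> P" "u \<in> ?V x" "w \<in> ?V x"
  show "\<mu> (v(x := u + w)) j = \<mu> (v(x := u)) j + \<mu> (v(x := w)) j"
   unfolding multilinear_add[OF ml v] by (rule plus_fun_apply)
 next
  fix v x c w assume v: "v \<in> PiE P ?V" "x \<in> P" "w \<in> ?V x"
  show "\<mu> (v(x := fscale c w)) j = c * \<mu> (v(x := w)) j"
   unfolding multilinear_scale[OF ml v] by (rule fscale_apply)
 qed
 have pure: "\<Phi> (?p v) = \<mu> v" for v
  by (rule ext) (simp only: \<Phi>_def pure_tensor_def form if_True)
 have lin: "flinear S \<Phi>" for S
  unfolding linear_on_def
  by (intro conjI ballI allI ext) (simp_all only: \<Phi>_def plus_fun_apply fscale_apply)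
 have inW: "\<Phi> t \<in> fst W" if "t \<in> ?T" for t
 proof -
  have sW: "fs.subspace (fst W)" by (rule is_repD(2)[OF WD])
  have "fs.subspace {t. \<Phi> t \<in> fst W}"
  proof (rule fs.subspaceI)
   show "0 \<in> {t. \<Phi> t \<in> fst W}"
    using fsp.linear_on_zero[OF lin fs.subspace_UNIV] fs.subspace_0[OF sW] by (simp only: mem_Collect_eq)
   show "x + y \<in> {t. \<Phi> t \<in> fst W}" if "x \<in> {t. \<Phi> t \<in> fst W}" "y \<in> {t. \<Phi> t \<in> fst W}" for x y
    using that fs.subspace_add[OF sW] by (simp only: mem_Collect_eq linear_on_add[OF lin[of UNIV]] UNIV_I)
   show "fscale c x \<in> {t. \<Phi> t \<in> fst W}" if "x \<in> {t. \<Phi> t \<in> fst W}" for c x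
    using that fs.subspace_scale[OF sW] by (simp only: mem_Collect_eq linear_on_scale[OF lin[of UNIV]] UNIV_I)
  qed
  moreover have "?p v \<in> {t. \<Phi> t \<in> fst W}" if "v \<in> PiE P ?V" for v
   unfolding mem_Collect_eq pure by (rule W[OF that])
  ultimately have "?T \<subseteq> {t. \<Phi> t \<in> fst W}" by (rule tensor_subset)
  then show ?thesis using that by blast
 qed
 have equiv: "\<Phi> (?r a t) = snd W a (\<Phi> t)" if a: "a \<in> L" and t: "t \<in> ?T" for a t
 proof (rule tensor_eqI[OF vector_space_fscale _ _ _ t])
  show "flinear ?T (\<lambda>t. \<Phi> (?r a t))"
   unfolding linear_on_def
   by (intro conjI ballI allI) (simp_all only: linear_on_add[OF tensor_rep_linear[of UNIV]] linear_on_scale[OF tensor_rep_linear[of UNIV]]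
     linear_on_add[OF lin[of UNIV]] linear_on_scale[OF lin[of UNIV]] UNIV_I)
  show "flinear ?T (\<lambda>t. snd W a (\<Phi> t))"
   unfolding linear_on_def
   by (intro conjI ballI allI) (simp_all only: linear_on_add[OF lin[of UNIV]] linear_on_scale[OF lin[of UNIV]] UNIV_I inW
     linear_on_add[OF is_repD(7)[OF WD a]] linear_on_scale[OF is_repD(7)[OF WD a]])
  fix v assume v: "v \<in> PiE P ?V"
  have tp: "?r a (?p v) = (\<Sum>x\<in>P. ?p (v(x := snd (R x) a (v x))))"
   by (rule tensor_rep_pure[where R = R, OF P R a v])
  have "\<Phi> (?r a (?p v)) = (\<Sum>x\<in>P. \<Phi> (?p (v(x := snd (R x) a (v x)))))"
   unfolding tp by (rule fsp.linear_on_sum[OF lin fs.subspace_UNIV]) simp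
  then show "\<Phi> (?r a (?p v)) = snd W a (\<Phi> (?p v))"
   unfolding pure eq[OF a v] .
 qed
 show ?thesis
  by (rule schur[OF irr, of \<Phi> "?p v0"]) (simp_all only: fstT lin inW equiv pure pure_in_tensor nz not_False_eq_True)
qed

text \<open>
  Contracting a tensor with functionals in all factors but one gives a nonzero homomorphism onto the
  remaining factor for the elements acting only there.
\<close>

lemma tensor_rep_factors_unique:
 fixes R R' :: "'p => ('l::ab_group_add, 'i, 'k::field) rep"
 assumes P: "finite P"
  and R: "!!x. x \<in> P ==> irreducible_rep s br L (R x)" "!!x. x \<in> P ==> irreducible_rep s br L (R' x)"
  and sep: "!!x a. x \<in> P ==> a \<in> L ==> \<exists>a'\<in>L.
    (\<forall>v\<in>fst (R x). snd (R x) a' v = snd (R x) a v) & (\<forall>v\<in>fst (R' x). snd (R' x) a' v = snd (R' x) a v) &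
    (\<forall>y\<in>P - {x}. (\<forall>v\<in>fst (R y). snd (R y) a' v = 0) & (\<forall>v\<in>fst (R' y). snd (R' y) a' v = 0))"
  and iso: "rep_iso L (tensor_rep P R) (tensor_rep P R')" and x: "x \<in> P"
 shows "rep_iso L (R x) (R' x)"
proof -
 have rep: "is_rep s br L (R x)" "is_rep s br L (R' x)" if "x \<in> P" for x
  using R(1)[OF that] R(2)[OF that] by (auto dest: irreducible_repD(1))
 let ?V = "\<lambda>x. fst (R x)" and ?V' = "\<lambda>x. fst (R' x)"
 let ?T = "tensor_product_space P ?V" and ?p = "pure_tensor P ?V" and ?r = "snd (tensor_rep P R)"
 let ?T' = "tensor_product_space P ?V'" and ?p' = "pure_tensor P ?V'" and ?r' = "snd (tensor_rep P R')"
 have fd: "finite_dim fscale (?V x)" "finite_dim fscale (?V' x)" if "x \<in> P" for x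
  using is_repD(1) rep that by blast+
 obtain F where F: "flinear ?T F" "bij_betw F ?T ?T'" "!!a t. a \<in> L ==> t \<in> ?T ==> F (?r a t) = ?r' a (F t)"
  using iso unfolding rep_iso_def by (auto simp: tensor_rep_def)
 have "\<exists>v. v \<in> fst (R x) & v ~= 0" if "x \<in> P" for x
  using irreducible_repD(2)[OF R(1)[OF that]] fs.subspace_0[OF is_repD(2)[OF rep(1)[OF that]]] by blast
 then obtain v0 where v0: "!!x. x \<in> P ==> v0 x \<in> fst (R x) & v0 x ~= 0" by metis
 define v where "v = restrict v0 P"
 have v: "v \<in> PiE P ?V" unfolding v_def using v0 by (intro restrict_PiE_iff[THEN iffD2]) blast
 have pT: "?p v \<in> ?T" by (rule pure_in_tensor[OF v])
 have "?p v ~= 0"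
  by (rule pure_tensor_nonzero[OF P fd(1) v]) (use v0 in \<open>simp_all add: v_def\<close>)
 moreover have F0: "F 0 = 0" by (rule fsp.linear_on_zero[OF F(1) subspace_tensor])
 ultimately have Fp: "F (?p v) ~= 0"
  using F(2) pT fs.subspace_0[OF subspace_tensor, of P ?V] unfolding bij_betw_def inj_on_def by metis
 have FT: "F t \<in> ?T'" if "t \<in> ?T" for t using F(2) that by (rule bij_betwE[THEN bspec])
 obtain l where l: "!!x. x \<in> P ==> linear_on fscale (*) (?V' x) (l x)"
  and lt: "F (?p v) (\<lambda>v. \<Prod>x\<in>P. l x (v x)) ~= 0"
  using tensor_separated_by_products[where V = ?V', OF P fd(2) FT[OF pT] Fp] by blast
 define c where "c w = (\<Prod>y\<in>P - {x}. l y (w y))" for w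
 define \<Psi> where "\<Psi> t j = t (\<lambda>w. c w * w x j)" for t :: "(('p => 'i => 'k) => 'k) => 'k" and j
 have c_upd: "c (w(x := u)) = c w" for w u
  unfolding c_def by (rule prod.cong) simp_all
 have form: "multilinear_form P ?V' (\<lambda>w. c w * w x j)" for j
  unfolding multilinear_form_def
 proof (intro ballI)
  fix w y assume w: "w \<in> PiE P ?V'" and y: "y \<in> P"
  show "linear_on fscale (*) (?V' y) (\<lambda>u. c (w(y := u)) * (w(y := u)) x j)"
  proof (cases "y = x")
   case True
   show ?thesis unfolding True c_upd fun_upd_same linear_on_def
    by (intro conjI ballI allI) (simp_all only: plus_fun_apply fscale_apply distrib_left mult.left_commute)
  next
   case False
   have yx: "y \<in> P - {x}" using y False by simp
   have fin: "finite (P - {x})" using P by simp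
   define d where "d = (\<Prod>z\<in>P - {x} - {y}. l z (w z))"
   have "c (w(y := u)) = l y u * d" for u
    unfolding c_def d_def prod.remove[OF fin yx] by (intro arg_cong2[of _ _ _ _ "(*)"] prod.cong) simp_all
   moreover have "(w(y := u)) x = w x" for u using False by simp
   ultimately show ?thesis
    unfolding linear_on_def
    by (intro conjI ballI allI) (simp_all only: linear_on_add[OF l[OF y]] linear_on_scale[OF l[OF y]] distrib_right mult.assoc)
  qed
 qed
 have pure: "\<Psi> (?p' w) = fscale (c w) (w x)" for w
  by (rule ext) (simp only: \<Psi>_def pure_tensor_def form if_True fscale_apply)
 have lin: "flinear S \<Psi>" for S
  unfolding linear_on_def
  by (intro conjI ballI allI ext) (simp_all only: \<Psi>_def plus_fun_apply fscale_apply)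
 have sV': "fs.subspace (?V' x)" by (rule is_repD(2)[OF rep(2)[OF x]])
 have inV': "\<Psi> t \<in> ?V' x" if "t \<in> ?T'" for t
 proof -
  have "fs.subspace {t. \<Psi> t \<in> ?V' x}"
  proof (rule fs.subspaceI)
   show "0 \<in> {t. \<Psi> t \<in> ?V' x}"
    using fsp.linear_on_zero[OF lin fs.subspace_UNIV] fs.subspace_0[OF sV'] by (simp only: mem_Collect_eq)
   show "a + b \<in> {t. \<Psi> t \<in> ?V' x}" if "a \<in> {t. \<Psi> t \<in> ?V' x}" "b \<in> {t. \<Psi> t \<in> ?V' x}" for a b
    using that fs.subspace_add[OF sV'] by (simp only: mem_Collect_eq linear_on_add[OF lin[of UNIV]] UNIV_I)
   show "fscale k a \<in> {t. \<Psi> t \<in> ?V' x}" if "a \<in> {t. \<Psi> t \<in> ?V' x}" for k a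
    using that fs.subspace_scale[OF sV'] by (simp only: mem_Collect_eq linear_on_scale[OF lin[of UNIV]] UNIV_I)
  qed
  moreover have "?p' w \<in> {t. \<Psi> t \<in> ?V' x}" if "w \<in> PiE P ?V'" for w
   unfolding mem_Collect_eq pure by (rule fs.subspace_scale[OF sV' PiE_mem[OF that x]])
  ultimately have "?T' \<subseteq> {t. \<Psi> t \<in> ?V' x}" by (rule tensor_subset)
  then show ?thesis using that by blast
 qed
 have val: "l x (\<Psi> t) = t (\<lambda>v. \<Prod>x\<in>P. l x (v x))" if t: "t \<in> ?T'" for t
 proof (rule tensor_eqI[OF vector_space_mult _ _ _ t])
  show "linear_on fscale (*) ?T' (\<lambda>t. l x (\<Psi> t))"
   unfolding linear_on_def
   by (intro conjI ballI allI) (simp_all only: linear_on_add[OF lin[of UNIV]] linear_on_scale[OF lin[of UNIV]] UNIV_I inV'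
     linear_on_add[OF l[OF x]] linear_on_scale[OF l[OF x]])
  show "linear_on fscale (*) ?T' (\<lambda>t. t (\<lambda>v. \<Prod>x\<in>P. l x (v x)))"
   unfolding linear_on_def by (intro conjI ballI allI) (simp_all only: plus_fun_apply fscale_apply)
  fix w assume w: "w \<in> PiE P ?V'"
  have "l x (\<Psi> (?p' w)) = c w * l x (w x)"
   unfolding pure by (rule linear_on_scale[OF l[OF x] PiE_mem[OF w x]])
  moreover have "multilinear_form P ?V' (\<lambda>v. \<Prod>x\<in>P. l x (v x))"
   by (rule product_form[where V = ?V', OF P fd(2) l])
  ultimately show "l x (\<Psi> (?p' w)) = ?p' w (\<lambda>v. \<Prod>x\<in>P. l x (v x))"
   unfolding c_def by (simp only: pure_tensor_def if_True prod.remove[OF P x] mult.commute)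
 qed
 define \<theta> where "\<theta> w = \<Psi> (F (?p (v(x := w))))" for w
 have upd: "v(x := w) \<in> PiE P ?V" if "w \<in> ?V x" for w by (rule PiE_upd[OF v x that])
 have pu: "?p (v(x := w)) \<in> ?T" if "w \<in> ?V x" for w by (rule pure_in_tensor[OF upd[OF that]])
 have sV: "fs.subspace (?V x)" by (rule is_repD(2)[OF rep(1)[OF x]])
 have sc: "fscale k t \<in> ?T" if "t \<in> ?T" for k t by (rule fs.subspace_scale[OF subspace_tensor that])
 have \<theta>_lin: "flinear (?V x) \<theta>"
  unfolding linear_on_def
 proof (intro conjI ballI allI)
  fix u w assume u: "u \<in> ?V x" and w: "w \<in> ?V x"
  show "\<theta> (u + w) = \<theta> u + \<theta> w"
   unfolding \<theta>_def multilinear_add[OF pure_tensor_multilinear v x u w]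
   by (simp only: linear_on_add[OF F(1) pu[OF u] pu[OF w]] linear_on_add[OF lin[of UNIV]] UNIV_I)
 next
  fix k w assume w: "w \<in> ?V x"
  show "\<theta> (fscale k w) = fscale k (\<theta> w)"
   unfolding \<theta>_def multilinear_scale[OF pure_tensor_multilinear v x w]
   by (simp only: linear_on_scale[OF F(1) pu[OF w]] linear_on_scale[OF lin[of UNIV]] UNIV_I)
 qed
 have \<theta>_equiv: "\<theta> (snd (R x) a w) = snd (R' x) a (\<theta> w)" if a: "a \<in> L" and w: "w \<in> ?V x" for a w
 proof -
  obtain a' where a': "a' \<in> L" "!!v. v \<in> ?V x ==> snd (R x) a' v = snd (R x) a v"
   "!!v. v \<in> ?V' x ==> snd (R' x) a' v = snd (R' x) a v"
   "!!y v. y \<in> P - {x} ==> v \<in> ?V y ==> snd (R y) a' v = 0"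
   "!!y v. y \<in> P - {x} ==> v \<in> ?V' y ==> snd (R' y) a' v = 0"
   using sep[OF x a] by blast
  have 1: "?r a' (?p (v(x := w))) = ?p (v(x := snd (R x) a w))"
   using tensor_rep_separated_action[where R = R, OF P rep(1) a'(1) x upd[OF w] a'(4)]
   by (simp only: fun_upd_same fun_upd_upd a'(2)[OF w])
  have 2: "\<Psi> (?r' a' t) = snd (R' x) a (\<Psi> t)" if t: "t \<in> ?T'" for t
  proof (rule tensor_eqI[OF vector_space_fscale _ _ _ t])
   show "flinear ?T' (\<lambda>t. \<Psi> (?r' a' t))"
    unfolding linear_on_def
    by (intro conjI ballI allI) (simp_all only: linear_on_add[OF tensor_rep_linear[of UNIV]] linear_on_scale[OF tensor_rep_linear[of UNIV]]
      linear_on_add[OF lin[of UNIV]] linear_on_scale[OF lin[of UNIV]] UNIV_I)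
   show "flinear ?T' (\<lambda>t. snd (R' x) a (\<Psi> t))"
    unfolding linear_on_def
    by (intro conjI ballI allI) (simp_all only: linear_on_add[OF lin[of UNIV]] linear_on_scale[OF lin[of UNIV]] UNIV_I inV'
      linear_on_add[OF is_repD(7)[OF rep(2)[OF x] a]] linear_on_scale[OF is_repD(7)[OF rep(2)[OF x] a]])
   fix u assume u: "u \<in> PiE P ?V'"
   have 3: "?r' a' (?p' u) = ?p' (u(x := snd (R' x) a' (u x)))"
    by (rule tensor_rep_separated_action[where R = R', OF P rep(2) a'(1) x u a'(5)])
   show "\<Psi> (?r' a' (?p' u)) = snd (R' x) a (\<Psi> (?p' u))"
    unfolding 3 pure c_upd fun_upd_same a'(3)[OF PiE_mem[OF u x]]
    by (rule linear_on_scale[OF is_repD(7)[OF rep(2)[OF x] a] PiE_mem[OF u x], symmetric])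
  qed
  show ?thesis
   unfolding \<theta>_def 1[symmetric] F(3)[OF a'(1) pu[OF w]] by (rule 2[OF FT[OF pu[OF w]]])
 qed
 have "\<theta> (v x) ~= 0"
 proof
  assume "\<theta> (v x) = 0"
  then have "\<Psi> (F (?p v)) = 0" unfolding \<theta>_def by (simp only: fun_upd_triv)
  then have "l x (\<Psi> (F (?p v))) = 0" using fsk.linear_on_zero[OF l[OF x] sV'] by (simp only:)
  then show False using lt val[OF FT[OF pT]] by (simp only:)
 qed
 then show ?thesis
  by (intro schur[OF R(1)[OF x] R(2)[OF x] \<theta>_lin _ \<theta>_equiv PiE_mem[OF v x]])
   (simp only: \<theta>_def inV' FT pu)
qed


text \<open>
  Split off an irreducible \<open>L x\<close>-submodule \<open>V\<close> of \<open>W\<close>. A homomorphism from \<open>V\<close> to \<open>W\<close> is determined by its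
  value at a fixed \<open>v0 \<noteq> 0\<close>, so the space of these homomorphisms is realized as the subspace \<open>W0\<close> of
  their values at \<open>v0\<close>, on which the other algebras act.
\<close>

lemma commuting_reps_factor:
 fixes \<tau> :: "'p => 'l::ab_group_add => ('i => 'k::field) => 'i => 'k"
 assumes P: "finite P" and rep: "!!x. x \<in> P ==> is_rep s br (L x) (W, \<tau> x)"
  and W: "fs.subspace W" "W ~= {0}"
  and comm: "!!x y a b w. x \<in> P ==> y \<in> P ==> x ~= y ==> a \<in> L x ==> b \<in> L y ==> w \<in> W ==>
    \<tau> x a (\<tau> y b w) = \<tau> y b (\<tau> x a w)"
 shows "\<exists>V \<mu>. (\<forall>x\<in>P. irreducible_rep s br (L x) (V x, \<tau> x)) & multilinear fscale P V \<mu> &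
  (\<forall>v\<in>PiE P V. \<mu> v \<in> W) &
  (\<forall>x\<in>P. \<forall>a\<in>L x. \<forall>v\<in>PiE P V. \<tau> x a (\<mu> v) = \<mu> (v(x := \<tau> x a (v x)))) &
  (\<exists>v\<in>PiE P V. \<mu> v ~= 0)"
 using P rep W comm
proof (induction P arbitrary: W rule: finite_induct)
 case empty
 obtain w where w: "w \<in> W" "w ~= 0" using empty fs.subspace_0[OF empty.prems(2)] by blast
 define V :: "'p => ('i => 'k) set" where "V = (\<lambda>_. {})"
 have "multilinear fscale {} V (\<lambda>_. w)" by (simp add: multilinear_def)
 moreover have "\<exists>v\<in>PiE {} V. w ~= 0" using w(2) by (intro bexI[of _ "\<lambda>_. undefined"]) (assumption, simp)
 ultimately show ?case
  by (intro exI[of _ V] exI[of _ "\<lambda>_. w"] conjI) (use w(1) in blast)+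
next
 case (insert x P)
 note repx = insert.prems(1)[OF insertI1]
 note sW = insert.prems(2)
 obtain Vx where Vx: "Vx \<subseteq> W" "irreducible_rep s br (L x) (Vx, \<tau> x)"
  using irreducible_subrep[OF repx insert.prems(3)] by blast
 note ID = irreducible_repD[OF Vx(2), unfolded fst_conv snd_conv]
 note VD = is_repD[OF ID(1), unfolded fst_conv snd_conv]
 note WD = is_repD[OF repx, unfolded fst_conv snd_conv]
 obtain v0 where v0: "v0 \<in> Vx" "v0 ~= 0" using ID(2) fs.subspace_0[OF VD(2)] by blast
 define Hm where "Hm \<phi> \<longleftrightarrow> flinear Vx \<phi> & (\<forall>v\<in>Vx. \<phi> v \<in> W) &
   (\<forall>a\<in>L x. \<forall>v\<in>Vx. \<phi> (\<tau> x a v) = \<tau> x a (\<phi> v))" for \<phi>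
 have HmD: "flinear Vx \<phi>" "!!v. v \<in> Vx ==> \<phi> v \<in> W"
  "!!a v. a \<in> L x ==> v \<in> Vx ==> \<phi> (\<tau> x a v) = \<tau> x a (\<phi> v)" if "Hm \<phi>" for \<phi>
  using that unfolding Hm_def by blast+
 have HmI: "Hm \<phi>" if "flinear Vx \<phi>" "!!v. v \<in> Vx ==> \<phi> v \<in> W"
  "!!a v. a \<in> L x ==> v \<in> Vx ==> \<phi> (\<tau> x a v) = \<tau> x a (\<phi> v)" for \<phi>
  unfolding Hm_def by (intro conjI ballI that)
 have Hm_add: "Hm (\<lambda>v. \<phi> v + \<psi> v)" if \<phi>: "Hm \<phi>" and \<psi>: "Hm \<psi>" for \<phi> \<psi>
 proof (rule HmI)
  show "flinear Vx (\<lambda>v. \<phi> v + \<psi> v)"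
   unfolding linear_on_def by (intro conjI ballI allI)
    (simp_all only: linear_on_add[OF HmD(1)[OF \<phi>]] linear_on_scale[OF HmD(1)[OF \<phi>]]
     linear_on_add[OF HmD(1)[OF \<psi>]] linear_on_scale[OF HmD(1)[OF \<psi>]] fs.scale_right_distrib add_ac)
  show "\<phi> v + \<psi> v \<in> W" if "v \<in> Vx" for v
   by (rule fs.subspace_add[OF sW HmD(2)[OF \<phi> that] HmD(2)[OF \<psi> that]])
  show "\<phi> (\<tau> x a v) + \<psi> (\<tau> x a v) = \<tau> x a (\<phi> v + \<psi> v)" if a: "a \<in> L x" and v: "v \<in> Vx" for a v
   unfolding HmD(3)[OF \<phi> a v] HmD(3)[OF \<psi> a v]
   by (rule linear_on_add[OF WD(7)[OF a] HmD(2)[OF \<phi> v] HmD(2)[OF \<psi> v], symmetric])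
 qed
 have Hm_scale: "Hm (\<lambda>v. fscale c (\<phi> v))" if \<phi>: "Hm \<phi>" for \<phi> c
 proof (rule HmI)
  show "flinear Vx (\<lambda>v. fscale c (\<phi> v))"
   unfolding linear_on_def by (intro conjI ballI allI)
    (simp_all only: linear_on_add[OF HmD(1)[OF \<phi>]] linear_on_scale[OF HmD(1)[OF \<phi>]]
     fs.scale_right_distrib fs.scale_scale mult.commute)
  show "fscale c (\<phi> v) \<in> W" if "v \<in> Vx" for v
   by (rule fs.subspace_scale[OF sW HmD(2)[OF \<phi> that]])
  show "fscale c (\<phi> (\<tau> x a v)) = \<tau> x a (fscale c (\<phi> v))" if a: "a \<in> L x" and v: "v \<in> Vx" for a v
   unfolding HmD(3)[OF \<phi> a v] by (rule linear_on_scale[OF WD(7)[OF a] HmD(2)[OF \<phi> v], symmetric])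
 qed
 have Hm_eq: "\<phi> v = \<psi> v" if \<phi>: "Hm \<phi>" and \<psi>: "Hm \<psi>" and eq: "\<phi> v0 = \<psi> v0" and v: "v \<in> Vx" for \<phi> \<psi> v
 proof -
  define \<delta> where "\<delta> v = \<phi> v + fscale (-1) (\<psi> v)" for v
  have \<delta>: "Hm \<delta>" unfolding \<delta>_def by (rule Hm_add[OF \<phi> Hm_scale[OF \<psi>]])
  let ?K = "{v \<in> Vx. \<delta> v = 0}"
  have "?K = {0} \<or> ?K = Vx"
  proof (rule ID(3))
   show "fs.subspace ?K" by (rule fsp.linear_on_kernel_subspace[OF HmD(1)[OF \<delta>] VD(2)])
   fix a v assume a: "a \<in> L x" and v: "v \<in> ?K"
   have "\<delta> (\<tau> x a v) = \<tau> x a 0" using HmD(3)[OF \<delta> a] v by (simp only: mem_Collect_eq)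
   also have "\<dots> = 0" by (rule fsp.linear_on_zero[OF WD(7)[OF a] sW])
   finally show "\<tau> x a v \<in> ?K" using VD(6)[OF a] v by (simp only: mem_Collect_eq)
  qed blast
  moreover have "v0 \<in> ?K" using v0(1) eq by (simp add: \<delta>_def)
  ultimately have "v \<in> ?K" using v v0(2) by blast
  then have "\<phi> v + fscale (-1) (\<psi> v) = 0" by (simp only: mem_Collect_eq \<delta>_def)
  then show ?thesis by simp
 qed
 define W0 where "W0 = {\<phi> v0 | \<phi>. Hm \<phi>}"
 have W0I: "\<phi> v0 \<in> W0" if "Hm \<phi>" for \<phi> using that unfolding W0_def by blast
 have id: "Hm (\<lambda>v. v)"
  by (rule HmI) (use Vx(1) in \<open>auto simp: linear_on_def\<close>)
 have sW0: "fs.subspace W0"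
 proof (rule fs.subspaceI)
  show "0 \<in> W0" using W0I[OF Hm_scale[OF id, of 0]] by (simp only: fs.scale_zero_left)
 next
  fix u w assume "u \<in> W0" "w \<in> W0"
  then obtain \<phi> \<psi> where "Hm \<phi>" "u = \<phi> v0" "Hm \<psi>" "w = \<psi> v0" unfolding W0_def by blast
  then show "u + w \<in> W0" using W0I[OF Hm_add, of \<phi> \<psi>] by (simp only:)
 next
  fix c w assume "w \<in> W0"
  then obtain \<phi> where "Hm \<phi>" "w = \<phi> v0" unfolding W0_def by blast
  then show "fscale c w \<in> W0" using W0I[OF Hm_scale, of \<phi> c] by (simp only:)
 qed
 have W0W: "W0 \<subseteq> W" unfolding W0_def using HmD(2) v0(1) by blast
 define ext where "ext w = (SOME \<phi>. Hm \<phi> & \<phi> v0 = w)" for w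
 have ext: "Hm (ext w)" "ext w v0 = w" if w: "w \<in> W0" for w
 proof -
  have "\<exists>\<phi>. Hm \<phi> & \<phi> v0 = w" using w unfolding W0_def by blast
  then have "Hm (ext w) & ext w v0 = w" unfolding ext_def by (rule someI_ex)
  then show "Hm (ext w)" "ext w v0 = w" by blast+
 qed
 have ext_eq: "ext w v = \<phi> v" if \<phi>: "Hm \<phi>" and w: "\<phi> v0 = w" and v: "v \<in> Vx" for \<phi> w v
 proof -
  have w0: "w \<in> W0" using W0I[OF \<phi>] unfolding w .
  show ?thesis by (rule Hm_eq[OF ext(1)[OF w0] \<phi> _ v]) (simp only: ext(2)[OF w0] w)
 qed
 have stab: "Hm (\<lambda>v. \<tau> y b (\<phi> v))" if y: "y \<in> P" and b: "b \<in> L y" and \<phi>: "Hm \<phi>" for y b \<phi>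
 proof (rule HmI)
  note YD = is_repD[OF insert.prems(1)[OF insertI2[OF y]], unfolded fst_conv snd_conv]
  show "flinear Vx (\<lambda>v. \<tau> y b (\<phi> v))"
   unfolding linear_on_def by (intro conjI ballI allI)
    (simp_all only: linear_on_add[OF HmD(1)[OF \<phi>]] linear_on_scale[OF HmD(1)[OF \<phi>]] HmD(2)[OF \<phi>]
     linear_on_add[OF YD(7)[OF b]] linear_on_scale[OF YD(7)[OF b]])
  show "\<tau> y b (\<phi> v) \<in> W" if "v \<in> Vx" for v by (rule YD(6)[OF b HmD(2)[OF \<phi> that]])
  show "\<tau> y b (\<phi> (\<tau> x a v)) = \<tau> x a (\<tau> y b (\<phi> v))" if a: "a \<in> L x" and v: "v \<in> Vx" for a v
  proof -
   have xy: "x ~= y" using y insert.hyps by blast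
   show ?thesis unfolding HmD(3)[OF \<phi> a v]
    by (rule insert.prems(4)[OF insertI1 insertI2[OF y] xy a b HmD(2)[OF \<phi> v], symmetric])
  qed
 qed
 have sub0: "is_rep s br (L y) (W0, \<tau> y)" if y: "y \<in> P" for y
 proof (rule subrep[OF insert.prems(1)[OF insertI2[OF y]] sW0 W0W])
  fix b w assume b: "b \<in> L y" and "w \<in> W0"
  then obtain \<phi> where \<phi>: "Hm \<phi>" "w = \<phi> v0" unfolding W0_def by blast
  show "\<tau> y b w \<in> W0" unfolding \<phi>(2) by (rule W0I[OF stab[OF y b \<phi>(1)]])
 qed
 have nz0: "W0 ~= {0}" using W0I[OF id] v0(2) by blast
 have "\<exists>V \<mu>. (\<forall>x\<in>P. irreducible_rep s br (L x) (V x, \<tau> x)) & multilinear fscale P V \<mu> &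
  (\<forall>v\<in>PiE P V. \<mu> v \<in> W0) &
  (\<forall>x\<in>P. \<forall>a\<in>L x. \<forall>v\<in>PiE P V. \<tau> x a (\<mu> v) = \<mu> (v(x := \<tau> x a (v x)))) &
  (\<exists>v\<in>PiE P V. \<mu> v ~= 0)"
 proof (rule insert.IH[OF sub0 sW0 nz0])
  fix y z a b w assume h: "y \<in> P" "z \<in> P" "y ~= z" "a \<in> L y" "b \<in> L z" "w \<in> W0"
  show "\<tau> y a (\<tau> z b w) = \<tau> z b (\<tau> y a w)"
   by (rule insert.prems(4)[OF insertI2[OF h(1)] insertI2[OF h(2)] h(3,4,5) subsetD[OF W0W h(6)]])
 qed
 then obtain V \<mu> where IH: "\<forall>x\<in>P. irreducible_rep s br (L x) (V x, \<tau> x)" "multilinear fscale P V \<mu>"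
  "\<forall>v\<in>PiE P V. \<mu> v \<in> W0"
  "\<forall>x\<in>P. \<forall>a\<in>L x. \<forall>v\<in>PiE P V. \<tau> x a (\<mu> v) = \<mu> (v(x := \<tau> x a (v x)))"
  "\<exists>v\<in>PiE P V. \<mu> v ~= 0" by (elim exE conjE)
 define V' where "V' = V(x := Vx)"
 define \<mu>' where "\<mu>' v = ext (\<mu> (restrict v P)) (v x)" for v
 have xP: "x \<notin> P" by (rule insert.hyps(2))
 have V'x: "V' x = Vx" and V'y: "V' y = V y" if "y \<in> P" for y
  using that xP by (auto simp: V'_def)
 have V'x: "V' x = Vx" by (simp add: V'_def)
 have res: "restrict v P \<in> PiE P V" if v: "v \<in> PiE (insert x P) V'" for v
 proof -
  have "v y \<in> V y" if "y \<in> P" for y using PiE_mem[OF v insertI2[OF that]] V'y[OF that] by (simp only:)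
  then show ?thesis by (intro restrict_PiE_iff[THEN iffD2]) blast
 qed
 have vx: "v x \<in> Vx" if v: "v \<in> PiE (insert x P) V'" for v
  using PiE_mem[OF v insertI1] V'x by (simp only:)
 have \<mu>W0: "\<mu> (restrict v P) \<in> W0" if v: "v \<in> PiE (insert x P) V'" for v
  by (rule bspec[OF IH(3) res[OF v]])
 have resx: "restrict (v(x := w)) P = restrict v P" for v w
  using xP by (auto simp: restrict_def fun_eq_iff)
 have resy: "restrict (v(y := w)) P = (restrict v P)(y := w)" if "y \<in> P" for v y w
  using that by (auto simp: restrict_def fun_eq_iff)
 have \<mu>_upd_x: "\<mu>' (v(x := w)) = ext (\<mu> (restrict v P)) w" for v w
  unfolding \<mu>'_def resx fun_upd_same ..
 have \<mu>_upd_y: "\<mu>' (v(y := w)) = ext (\<mu> ((restrict v P)(y := w))) (v x)" if y: "y \<in> P" for v y w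
 proof -
  have "(v(y := w)) x = v x" using y xP by auto
  then show ?thesis unfolding \<mu>'_def resy[OF y] by (simp only:)
 qed
 have ml: "multilinear fscale (insert x P) V' \<mu>'"
  unfolding multilinear_def
 proof (intro ballI)
  fix v y assume v: "v \<in> PiE (insert x P) V'" and y: "y \<in> insert x P"
  show "flinear (V' y) (\<lambda>w. \<mu>' (v(y := w)))"
  proof (cases "y = x")
   case True
   show ?thesis unfolding True \<mu>_upd_x V'x by (rule HmD(1)[OF ext(1)[OF \<mu>W0[OF v]]])
  next
   case False
   then have yP: "y \<in> P" using y by simp
   have u0: "\<mu> ((restrict v P)(y := u)) \<in> W0" if "u \<in> V y" for u
    by (rule bspec[OF IH(3) PiE_upd[OF res[OF v] yP that]])
   show ?thesis
    unfolding \<mu>_upd_y[OF yP] V'y[OF yP] linear_on_def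
   proof (intro conjI ballI allI)
    fix u w assume u: "u \<in> V y" and w: "w \<in> V y"
    show "ext (\<mu> ((restrict v P)(y := u + w))) (v x) =
      ext (\<mu> ((restrict v P)(y := u))) (v x) + ext (\<mu> ((restrict v P)(y := w))) (v x)"
     unfolding multilinear_add[OF IH(2) res[OF v] yP u w]
     by (rule ext_eq[OF Hm_add[OF ext(1)[OF u0[OF u]] ext(1)[OF u0[OF w]]] _ vx[OF v]])
      (simp only: ext(2)[OF u0[OF u]] ext(2)[OF u0[OF w]])
   next
    fix c w assume w: "w \<in> V y"
    show "ext (\<mu> ((restrict v P)(y := fscale c w))) (v x) = fscale c (ext (\<mu> ((restrict v P)(y := w))) (v x))"
     unfolding multilinear_scale[OF IH(2) res[OF v] yP w]
     by (rule ext_eq[OF Hm_scale[OF ext(1)[OF u0[OF w]]] _ vx[OF v]]) (simp only: ext(2)[OF u0[OF w]])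
   qed
  qed
 qed
 have irrV': "irreducible_rep s br (L y) (V' y, \<tau> y)" if y: "y \<in> insert x P" for y
 proof (cases "y = x")
  case True
  show ?thesis unfolding True V'x by (rule Vx(2))
 next
  case False
  then have yP: "y \<in> P" using y by simp
  show ?thesis unfolding V'y[OF yP] by (rule bspec[OF IH(1) yP])
 qed
 have equiv: "\<tau> y a (\<mu>' v) = \<mu>' (v(y := \<tau> y a (v y)))"
  if y: "y \<in> insert x P" and a: "a \<in> L y" and v: "v \<in> PiE (insert x P) V'" for y a v
 proof (cases "y = x")
  case True
  have a': "a \<in> L x" using a True by simp
  show ?thesis
   unfolding True \<mu>_upd_x by (simp only: \<mu>'_def HmD(3)[OF ext(1)[OF \<mu>W0[OF v]] a' vx[OF v]])
 next
  case False
  then have yP: "y \<in> P" using y by simp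
  have ry: "restrict v P y = v y" using yP by simp
  have "\<mu> ((restrict v P)(y := \<tau> y a (v y))) = \<tau> y a (\<mu> (restrict v P))"
   using bspec[OF bspec[OF bspec[OF IH(4) yP] a] res[OF v]] unfolding ry by (rule sym)
  then have "ext (\<mu> ((restrict v P)(y := \<tau> y a (v y)))) (v x) = \<tau> y a (ext (\<mu> (restrict v P)) (v x))"
   by (intro ext_eq[OF stab[OF yP a ext(1)[OF \<mu>W0[OF v]]] _ vx[OF v]]) (simp only: ext(2)[OF \<mu>W0[OF v]])
  then show ?thesis by (simp only: \<mu>_upd_y[OF yP] \<mu>'_def[of v])
 qed
 have inW: "\<mu>' v \<in> W" if v: "v \<in> PiE (insert x P) V'" for v
  unfolding \<mu>'_def by (rule HmD(2)[OF ext(1)[OF \<mu>W0[OF v]] vx[OF v]])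
 obtain u where u: "u \<in> PiE P V" "\<mu> u ~= 0" using IH(5) by blast
 have uv: "u(x := v0) \<in> PiE (insert x P) V'"
 proof (rule PiE_I)
  fix y assume "y \<in> insert x P"
  then show "(u(x := v0)) y \<in> V' y"
   using v0(1) V'x V'y PiE_mem[OF u(1)] by (cases "y = x") auto
 next
  fix y assume "y \<notin> insert x P"
  then show "(u(x := v0)) y = undefined" using PiE_arb[OF u(1)] by auto
 qed
 have "restrict u P = u" by (rule PiE_restrict[OF u(1)])
 then have "\<mu>' (u(x := v0)) = \<mu> u"
  unfolding \<mu>_upd_x using ext(2)[OF bspec[OF IH(3) u(1)]] by (simp only:)
 then have "\<exists>v\<in>PiE (insert x P) V'. \<mu>' v ~= 0" using uv u(2) by (intro bexI[of _ "u(x := v0)"]) (simp_all only: not_False_eq_True)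
 then show ?case
  by (intro exI[of _ V'] exI[of _ \<mu>'] conjI ballI irrV' ml inW equiv)
qed

section \<open>The algebra of equivariant maps\<close>

context equivariant_maps
begin

abbreviation grp :: "'c set" where "grp \<equiv> carrier \<Gamma>"

abbreviation orb :: "('a => 'k) => ('a => 'k) set" where "orb \<equiv> orbit \<Gamma> point_act"

abbreviation stab :: "('a => 'k) => 'c set" where "stab \<equiv> stabilizer \<Gamma> point_act"

abbreviation rep_at :: "('a => 'k) => ('g, 'i, 'k) rep => bool" where
 "rep_at x \<equiv> is_rep sg br (isotropy_algebra x)"

abbreviation irreducible_at :: "('a => 'k) => ('g, 'i, 'k) rep => bool" where
 "irreducible_at x \<equiv> irreducible_rep sg br (isotropy_algebra x)"

abbreviation rep_of_maps :: "(('g => 'a => 'k) => 'k, 'i, 'k) rep => bool" where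
 "rep_of_maps \<equiv> is_rep fscale tensor_bracket map_algebra"

abbreviation irreducible_on_maps :: "(('g => 'a => 'k) => 'k, 'i, 'k) rep => bool" where
 "irreducible_on_maps \<equiv> irreducible_rep fscale tensor_bracket map_algebra"

sublocale finite_dim_lie_algebra sg br
 by unfold_locales (use g_finite_dim in \<open>simp add: finite_dim_def\<close>)

subsection \<open>Operations on the tensor product of the Lie algebra and the coordinate ring\<close>

lemma group_act_one: "actg \<one> u = u" "actA \<one> f = f"
 using fun_cong[OF group_action.id_eq_one[OF actg], of u] fun_cong[OF group_action.id_eq_one[OF actA], of f]
 by (simp_all only: restrict_apply UNIV_I if_True)

lemma group_act_mult:
 assumes "g \<in> grp" "h \<in> grp"
 shows "actg (g \<otimes> h) u = actg g (actg h u)" "actA (g \<otimes> h) f = actA g (actA h f)"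
 using group_action.composition_rule[OF actg UNIV_I assms] group_action.composition_rule[OF actA UNIV_I assms]
 by simp_all

lemma actg_hom:
 assumes "g \<in> grp"
 shows "actg g (u + v) = actg g u + actg g v" "actg g (sg c u) = sg c (actg g u)"
 using actg_linear[OF assms] by (auto simp: Vector_Spaces.linear_iff)

lemma actA_hom:
 assumes "g \<in> grp"
 shows "actA g (f + f') = actA g f + actA g f'" "actA g (sA c f) = sA c (actA g f)"
 using actA_linear[OF assms] by (auto simp: Vector_Spaces.linear_iff)

lemma A_one [simp]: "oneA * f = f" "f * oneA = f"
 using oneA by (simp_all add: mult.commute)

lemma actA_one:
 assumes g: "g \<in> grp" shows "actA g oneA = oneA"
proof -
 have "actA g oneA * actA g (actA (inv g) oneA) = actA g (actA (inv g) oneA)"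
  using actA_mult[OF g, of oneA "actA (inv g) oneA"] by simp
 moreover have "actA g (actA (inv g) oneA) = oneA"
  using group_act_mult(2)[of g "inv g" oneA] g by (simp add: group_act_one)
 ultimately show ?thesis by simp
qed

lemma tens_bilinear:
 "tens (u + v) f = tens u f + tens v f" "tens (sg c u) f = fscale c (tens u f)"
 "tens u (f + f') = tens u f + tens u f'" "tens u (sA c f) = fscale c (tens u f)"
 by (rule ext; simp add: tens_def bilinear_formD fscale_apply)+

lemma tensor_space_subspace: "fs.subspace tensor_space"
 by (simp add: tensor_space_def)

lemma tens_in: "tens u f \<in> tensor_space"
 unfolding tensor_space_def by (rule fs.span_base) blast

lemma tensor_space_induct [consumes 1, case_names tens add scale]:
 assumes \<alpha>: "\<alpha> \<in> tensor_space" and "!!u f. Q (tens u f)"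
  and "!!\<alpha> \<beta>. \<alpha> \<in> tensor_space ==> \<beta> \<in> tensor_space ==> Q \<alpha> ==> Q \<beta> ==> Q (\<alpha> + \<beta>)"
  and "!!c \<alpha>. \<alpha> \<in> tensor_space ==> Q \<alpha> ==> Q (fscale c \<alpha>)"
 shows "Q \<alpha>"
proof -
 have "\<alpha> \<in> tensor_space & Q \<alpha>"
  using \<alpha> unfolding tensor_space_def
 proof (induction rule: fs.span_induct_alt)
  case base
  have "Q (fscale 0 (tens 0 0))" by (rule assms(4)[OF tens_in assms(2)])
  then show ?case by (intro conjI fs.span_zero) (simp only: fs.scale_zero_left)
 next
  case (step c x y)
  then obtain u f where x: "x = tens u f" by blast
  have y: "y \<in> tensor_space" "Q y" using step(2) by (simp_all only: tensor_space_def)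
  have cx: "fscale c x \<in> tensor_space" "Q (fscale c x)"
   unfolding x by (rule fs.subspace_scale[OF tensor_space_subspace tens_in] assms(4)[OF tens_in assms(2)])+
  show ?case
   using fs.subspace_add[OF tensor_space_subspace cx(1) y(1)] assms(3)[OF cx(1) y(1) cx(2) y(2)]
   by (simp only: tensor_space_def)
 qed
 then show ?thesis ..
qed

lemma tensor_linear_in_form:
 assumes "\<alpha> \<in> tensor_space" "bilinear_form b" "bilinear_form b'"
 shows "\<alpha> (\<lambda>u f. b u f + b' u f) = \<alpha> b + \<alpha> b'" "\<alpha> (\<lambda>u f. c * b u f) = c * \<alpha> b"
proof -
 have 1: "bilinear_form (\<lambda>u f. b u f + b' u f)" "bilinear_form (\<lambda>u f. c * b u f)"
  by (rule bilinear_formI; simp only: bilinear_formD[OF assms(2)] bilinear_formD[OF assms(3)]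
    distrib_left add_ac mult.left_commute)+
 show "\<alpha> (\<lambda>u f. b u f + b' u f) = \<alpha> b + \<alpha> b'"
  using assms(1)
  by (induction rule: tensor_space_induct)
   (simp_all only: tens_def assms(2,3) 1 if_True plus_fun_apply fscale_apply add_ac distrib_left)
 show "\<alpha> (\<lambda>u f. c * b u f) = c * \<alpha> b"
  using assms(1)
  by (induction rule: tensor_space_induct)
   (simp_all only: tens_def assms(2,3) 1 if_True plus_fun_apply fscale_apply mult_ac distrib_left)
qed

lemma bracket_linear_left: "flinear S (\<lambda>\<alpha>. tensor_bracket \<alpha> \<beta>)"
 unfolding linear_on_def
 by (intro conjI ballI allI ext; simp add: tensor_bracket_def fscale_apply)

lemma bracket_form_bilinear:
 assumes "bilinear_form b" shows "bilinear_form (\<lambda>v f'. b (br u v) (f * f'))"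
 by (rule bilinear_formI; simp add: bilinear_formD[OF assms] distrib_left A_mult_scale)

lemma bracket_tens_left:
 assumes \<beta>: "\<beta> \<in> tensor_space" and b: "bilinear_form b"
 shows "tensor_bracket (tens u f) \<beta> b = \<beta> (\<lambda>v f'. b (br u v) (f * f'))"
proof -
 note B = bracket_form_bilinear[OF b]
 have "bilinear_form (\<lambda>u f. \<beta> (\<lambda>v f'. b (br u v) (f * f')))"
  by (rule bilinear_formI)
   (simp_all only: tensor_linear_in_form[OF \<beta> B B, symmetric] br_add br_scale bilinear_formD[OF b]
    distrib_right A_scale_mult)
 then show ?thesis using b by (simp add: tensor_bracket_def tens_def)
qed

lemma bracket_linear_right:
 assumes "\<alpha> \<in> tensor_space" shows "flinear tensor_space (tensor_bracket \<alpha>)"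
proof -
 have "(\<forall>\<beta>\<in>tensor_space. \<forall>\<gamma>\<in>tensor_space. tensor_bracket \<alpha> (\<beta> + \<gamma>) = tensor_bracket \<alpha> \<beta> + tensor_bracket \<alpha> \<gamma>)
  & (\<forall>c. \<forall>\<beta>\<in>tensor_space. tensor_bracket \<alpha> (fscale c \<beta>) = fscale c (tensor_bracket \<alpha> \<beta>))"
  using assms
 proof (induction rule: tensor_space_induct)
  case (tens u f)
  show ?case
  proof (intro conjI ballI allI ext)
   fix \<beta> \<gamma> b assume bg: "\<beta> \<in> tensor_space" "\<gamma> \<in> tensor_space"
   show "tensor_bracket (tens u f) (\<beta> + \<gamma>) b = (tensor_bracket (tens u f) \<beta> + tensor_bracket (tens u f) \<gamma>) b"
   proof (cases "bilinear_form b")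
    case True
    note B = bracket_tens_left[OF _ True]
    show ?thesis by (simp only: plus_fun_apply B[OF bg(1)] B[OF bg(2)] B[OF fs.subspace_add[OF tensor_space_subspace bg]])
   qed (simp only: tensor_bracket_def if_False plus_fun_apply add_0_left)
  next
   fix c \<beta> b assume bg: "\<beta> \<in> tensor_space"
   show "tensor_bracket (tens u f) (fscale c \<beta>) b = fscale c (tensor_bracket (tens u f) \<beta>) b"
   proof (cases "bilinear_form b")
    case True
    note B = bracket_tens_left[OF _ True]
    show ?thesis by (simp only: fscale_apply B[OF bg] B[OF fs.subspace_scale[OF tensor_space_subspace bg]])
   qed (simp only: tensor_bracket_def if_False fscale_apply mult_zero_right)
  qed
 next
  case (add \<alpha> \<alpha>')
  note A = linear_on_add[OF bracket_linear_left[of UNIV] UNIV_I UNIV_I]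
  show ?case
   unfolding A using add(3,4) by (intro conjI ballI allI) (simp_all only: fs.scale_right_distrib add_ac)
 next
  case (scale c \<alpha>)
  note A = linear_on_scale[OF bracket_linear_left[of UNIV] UNIV_I]
  show ?case
   unfolding A using scale(2) by (intro conjI ballI allI) (simp_all only: fs.scale_right_distrib fs.scale_scale mult.commute)
 qed
 then show ?thesis by (simp only: linear_on_def)
qed

lemma bracket_in:
 assumes "\<alpha> \<in> tensor_space" "\<beta> \<in> tensor_space" shows "tensor_bracket \<alpha> \<beta> \<in> tensor_space"
 using assms(1)
proof (induction rule: tensor_space_induct)
 case (tens u f)
 show ?case using assms(2)
 proof (induction rule: tensor_space_induct)
  case (tens v f')
  show ?case unfolding tensor_bracket_tens by (rule tens_in)
 qed (simp_all only: linear_on_add[OF bracket_linear_right[OF tens_in]] linear_on_scale[OF bracket_linear_right[OF tens_in]]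
   fs.subspace_add[OF tensor_space_subspace] fs.subspace_scale[OF tensor_space_subspace])
qed (simp_all only: linear_on_add[OF bracket_linear_left[of UNIV]] linear_on_scale[OF bracket_linear_left[of UNIV]] UNIV_I
   fs.subspace_add[OF tensor_space_subspace] fs.subspace_scale[OF tensor_space_subspace])

lemma act_linear: "flinear S (tensor_act g)"
 unfolding linear_on_def
 by (intro conjI ballI allI ext; simp add: tensor_act_def fscale_apply)

lemmas act_add = linear_on_add[OF act_linear[of UNIV] UNIV_I UNIV_I]
 and act_scale = linear_on_scale[OF act_linear[of UNIV] UNIV_I]

lemma act_in:
 assumes "g \<in> grp" "\<alpha> \<in> tensor_space" shows "tensor_act g \<alpha> \<in> tensor_space"
 using assms(2)
 by (induction rule: tensor_space_induct)
  (simp_all only: tensor_act_tens[OF assms(1)] tens_in act_add act_scale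
   fs.subspace_add[OF tensor_space_subspace] fs.subspace_scale[OF tensor_space_subspace])

lemma act_mult:
 assumes g: "g \<in> grp" "h \<in> grp" and "\<alpha> \<in> tensor_space"
 shows "tensor_act (g \<otimes> h) \<alpha> = tensor_act g (tensor_act h \<alpha>)"
 using assms(3)
 by (induction rule: tensor_space_induct)
  (simp_all only: tensor_act_tens g m_closed group_act_mult act_add act_scale)

lemma act_bracket:
 assumes g: "g \<in> grp" and \<alpha>: "\<alpha> \<in> tensor_space" and \<beta>: "\<beta> \<in> tensor_space"
 shows "tensor_act g (tensor_bracket \<alpha> \<beta>) = tensor_bracket (tensor_act g \<alpha>) (tensor_act g \<beta>)"
 using \<alpha>
proof (induction rule: tensor_space_induct)
 case (tens u f)
 note R = bracket_linear_right[OF tens_in]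
 show ?case using \<beta>
  by (induction rule: tensor_space_induct)
   (simp_all only: tensor_act_tens[OF g] tensor_bracket_tens actg_br[OF g] actA_mult[OF g] act_add act_scale
    linear_on_add[OF R] linear_on_scale[OF R] act_in[OF g])
qed (simp_all only: linear_on_add[OF bracket_linear_left[of UNIV]] linear_on_scale[OF bracket_linear_left[of UNIV]] UNIV_I
   act_add act_scale)

text \<open>Multiplication by a function, on the second factor.\<close>

definition amul :: "'a => (('g => 'a => 'k) => 'k) => ('g => 'a => 'k) => 'k" where
 "amul a \<alpha> = (\<lambda>b. if bilinear_form b then \<alpha> (\<lambda>u f. b u (a * f)) else 0)"

lemma amul_tens: "amul a (tens u f) = tens u (a * f)"
proof
 fix b
 have "bilinear_form (\<lambda>u f. b u (a * f))" if b: "bilinear_form b"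
  by (rule bilinear_formI; simp add: bilinear_formD[OF b] distrib_left A_mult_scale)
 then show "amul a (tens u f) b = tens u (a * f) b" by (simp add: amul_def tens_def)
qed

lemma amul_linear: "flinear S (amul a)"
 unfolding linear_on_def by (intro conjI ballI allI ext; simp add: amul_def fscale_apply)

lemmas amul_add = linear_on_add[OF amul_linear[of UNIV] UNIV_I UNIV_I]
 and amul_scale = linear_on_scale[OF amul_linear[of UNIV] UNIV_I]

lemma amul_in: "\<alpha> \<in> tensor_space ==> amul a \<alpha> \<in> tensor_space"
 by (induction rule: tensor_space_induct)
  (simp_all only: amul_tens tens_in amul_add amul_scale
   fs.subspace_add[OF tensor_space_subspace] fs.subspace_scale[OF tensor_space_subspace])

lemma amul_left:
 assumes "\<alpha> \<in> tensor_space"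
 shows "amul (a + a') \<alpha> = amul a \<alpha> + amul a' \<alpha>" "amul (sA c a) \<alpha> = fscale c (amul a \<alpha>)"
  "amul (a * a') \<alpha> = amul a (amul a' \<alpha>)"
proof -
 show "amul (a + a') \<alpha> = amul a \<alpha> + amul a' \<alpha>"
  using assms
  by (induction rule: tensor_space_induct)
   (simp_all only: amul_tens distrib_right distrib_left tens_bilinear A_scale_mult
    amul_add amul_scale fs.scale_right_distrib fs.scale_scale mult_ac add_ac)
 show "amul (sA c a) \<alpha> = fscale c (amul a \<alpha>)"
  using assms
  by (induction rule: tensor_space_induct)
   (simp_all only: amul_tens distrib_right distrib_left tens_bilinear A_scale_mult
    amul_add amul_scale fs.scale_right_distrib fs.scale_scale mult.commute[of c])
 show "amul (a * a') \<alpha> = amul a (amul a' \<alpha>)"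
  using assms
  by (induction rule: tensor_space_induct)
   (simp_all only: amul_tens distrib_right distrib_left tens_bilinear A_scale_mult
    amul_add amul_scale fs.scale_right_distrib fs.scale_scale mult_ac add_ac)
qed

lemma act_amul:
 assumes g: "g \<in> grp" and \<alpha>: "\<alpha> \<in> tensor_space"
 shows "tensor_act g (amul a \<alpha>) = amul (actA g a) (tensor_act g \<alpha>)"
 using \<alpha>
 by (induction rule: tensor_space_induct)
  (simp_all only: amul_tens tensor_act_tens[OF g] actA_mult[OF g] amul_add amul_scale act_add act_scale)

lemma amul_bracket:
 assumes \<alpha>: "\<alpha> \<in> tensor_space" and \<beta>: "\<beta> \<in> tensor_space"
 shows "tensor_bracket (amul a \<alpha>) \<beta> = amul a (tensor_bracket \<alpha> \<beta>)"
  "tensor_bracket \<alpha> (amul a \<beta>) = amul a (tensor_bracket \<alpha> \<beta>)"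
proof -
 show "tensor_bracket (amul a \<alpha>) \<beta> = amul a (tensor_bracket \<alpha> \<beta>)"
  using \<alpha>
 proof (induction rule: tensor_space_induct)
  case (tens u f)
  note R = bracket_linear_right[OF tens_in]
  show ?case using \<beta>
   by (induction rule: tensor_space_induct)
    (simp_all only: amul_tens tensor_bracket_tens amul_add amul_scale mult.assoc linear_on_add[OF R] linear_on_scale[OF R])
 qed (simp_all only: linear_on_add[OF bracket_linear_left[of UNIV]] linear_on_scale[OF bracket_linear_left[of UNIV]] UNIV_I
   amul_add amul_scale)
 show "tensor_bracket \<alpha> (amul a \<beta>) = amul a (tensor_bracket \<alpha> \<beta>)"
  using \<alpha>
 proof (induction rule: tensor_space_induct)
  case (tens u f)
  note R = bracket_linear_right[OF tens_in]
  show ?case using \<beta>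
   by (induction rule: tensor_space_induct)
    (simp_all only: amul_tens tensor_bracket_tens amul_add amul_scale mult.left_commute linear_on_add[OF R] linear_on_scale[OF R] amul_in)
 qed (simp_all only: linear_on_add[OF bracket_linear_left[of UNIV]] linear_on_scale[OF bracket_linear_left[of UNIV]] UNIV_I
   amul_add amul_scale)
qed

lemma tensor_expansion:
 assumes "\<alpha> \<in> tensor_space"
 obtains F where "\<alpha> = (\<Sum>b\<in>basis. tens b (F b))"
proof -
 have "\<exists>F. \<alpha> = (\<Sum>b\<in>basis. tens b (F b))"
  using assms
 proof (induction rule: tensor_space_induct)
  case (tens u f)
  have lin: "linear_on sg fscale UNIV (\<lambda>u. tens u f)" by (simp only: linear_on_def tens_bilinear ball_simps simp_thms)
  have pair: "vector_space_pair sg (fscale :: 'k => (('g => 'a => 'k) => 'k) => _)"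
   by (intro vector_space_pair.intro vector_space_fscale vs)
  have "u = (\<Sum>b\<in>basis. sg (representation basis u b) b)"
   using sum_representation_eq[OF basis(2) _ basis(1) subset_refl, of u] basis(3) by simp
  then have "tens u f = tens (\<Sum>b\<in>basis. sg (representation basis u b) b) f" by simp
  also have "\<dots> = (\<Sum>b\<in>basis. fscale (representation basis u b) (tens b f))"
   by (rule vector_space_pair.linear_on_sum_scale[OF pair lin subspace_UNIV]) simp
  also have "\<dots> = (\<Sum>b\<in>basis. tens b (sA (representation basis u b) f))" by (simp only: tens_bilinear)
  finally show ?case by (rule exI[of _ "\<lambda>b. sA (representation basis u b) f"])
 next
  case (add \<alpha> \<beta>)
  then obtain F G where "\<alpha> = (\<Sum>b\<in>basis. tens b (F b))" "\<beta> = (\<Sum>b\<in>basis. tens b (G b))" by blast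
  then have "\<alpha> + \<beta> = (\<Sum>b\<in>basis. tens b (F b + G b))" by (simp only: tens_bilinear sum.distrib)
  then show ?case by (rule exI[of _ "\<lambda>b. F b + G b"])
 next
  case (scale c \<alpha>)
  then obtain F where "\<alpha> = (\<Sum>b\<in>basis. tens b (F b))" by blast
  then have "fscale c \<alpha> = (\<Sum>b\<in>basis. tens b (sA c (F b)))" by (simp only: tens_bilinear fs.scale_sum_right)
  then show ?case by (rule exI[of _ "\<lambda>b. sA c (F b)"])
 qed
 then show ?thesis using that by blast
qed

subsection \<open>The Reynolds operator\<close>

text \<open>
  Averaging over the group projects the tensor product onto the invariants, and commutes with brackets
  and products with invariant elements.
\<close>

definition rey :: "(('g => 'a => 'k) => 'k) => ('g => 'a => 'k) => 'k" where
 "rey \<alpha> = fscale (1 / of_nat (card grp)) (\<Sum>g\<in>grp. tensor_act g \<alpha>)"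

lemma card_group_nonzero: "of_nat (card grp) ~= (0 :: 'k)"
 using finite_\<Gamma> one_closed by auto

lemma map_algebraD: "\<alpha> \<in> map_algebra ==> \<alpha> \<in> tensor_space"
 "\<alpha> \<in> map_algebra ==> g \<in> grp ==> tensor_act g \<alpha> = \<alpha>"
 by (auto simp: map_algebra_def)

lemma act_sum: "tensor_act g (\<Sum>i\<in>I. f i) = (\<Sum>i\<in>I. tensor_act g (f i))"
 by (rule fsp.linear_on_sum[OF act_linear fs.subspace_UNIV]) simp

lemma sum_left_translate:
 assumes "g \<in> grp" shows "(\<Sum>h\<in>grp. f (g \<otimes> h)) = (\<Sum>h\<in>grp. f h)"
proof (rule sum.reindex_bij_witness[of _ "\<lambda>h. inv g \<otimes> h" "\<lambda>h. g \<otimes> h"])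
 fix h assume "h \<in> grp"
 then show "inv g \<otimes> (g \<otimes> h) = h" "g \<otimes> (inv g \<otimes> h) = h"
  using assms by (simp_all add: m_assoc[symmetric])
qed (use assms in auto)

lemma sum_right_translate:
 assumes "g \<in> grp" shows "(\<Sum>h\<in>grp. f (h \<otimes> g)) = (\<Sum>h\<in>grp. f h)"
proof (rule sum.reindex_bij_witness[of _ "\<lambda>h. h \<otimes> inv g" "\<lambda>h. h \<otimes> g"])
 fix h assume "h \<in> grp"
 then show "h \<otimes> g \<otimes> inv g = h" "h \<otimes> inv g \<otimes> g = h"
  using assms by (simp_all add: m_assoc)
qed (use assms in auto)

lemma sum_orbit_in:
 assumes \<alpha>: "\<alpha> \<in> tensor_space" shows "(\<Sum>g\<in>grp. tensor_act g \<alpha>) \<in> map_algebra"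
proof -
 have "tensor_act g (\<Sum>h\<in>grp. tensor_act h \<alpha>) = (\<Sum>h\<in>grp. tensor_act h \<alpha>)" if g: "g \<in> grp" for g
 proof -
  have "tensor_act g (\<Sum>h\<in>grp. tensor_act h \<alpha>) = (\<Sum>h\<in>grp. tensor_act (g \<otimes> h) \<alpha>)"
   unfolding act_sum by (rule sum.cong[OF refl]) (simp only: act_mult[OF g _ \<alpha>])
  then show ?thesis unfolding sum_left_translate[OF g, of "\<lambda>h. tensor_act h \<alpha>"] .
 qed
 moreover have "(\<Sum>h\<in>grp. tensor_act h \<alpha>) \<in> tensor_space"
  by (intro fs.subspace_sum[OF tensor_space_subspace] act_in \<alpha>)
 ultimately show ?thesis unfolding map_algebra_def by (intro CollectI conjI ballI)
qed

lemma map_algebra_subspace: "fs.subspace map_algebra"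
proof (rule fs.subspaceI)
 have "tensor_act g 0 = 0" for g by (rule fsp.linear_on_zero[OF act_linear fs.subspace_UNIV])
 then show "0 \<in> map_algebra" using fs.subspace_0[OF tensor_space_subspace] by (simp add: map_algebra_def)
qed (simp_all add: map_algebra_def act_add act_scale fs.subspace_add[OF tensor_space_subspace]
  fs.subspace_scale[OF tensor_space_subspace] del: plus_fun_apply)

lemma rey_in: "\<alpha> \<in> tensor_space ==> rey \<alpha> \<in> map_algebra"
 unfolding rey_def by (rule fs.subspace_scale[OF map_algebra_subspace sum_orbit_in])

lemma rey_fixed:
 assumes "\<alpha> \<in> map_algebra" shows "rey \<alpha> = \<alpha>"
proof -
 have "(\<Sum>g\<in>grp. tensor_act g \<alpha>) = fscale (of_nat (card grp)) \<alpha>"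
  using map_algebraD(2)[OF assms] by (simp only: fs.sum_constant_scale cong: sum.cong)
 then show ?thesis
  by (simp only: rey_def fs.scale_scale times_divide_eq_left
   mult_1_left divide_self[OF card_group_nonzero] fs.scale_one)
qed

lemma rey_linear: "flinear S rey"
 unfolding linear_on_def
 by (intro conjI ballI allI) (simp_all only: rey_def act_add act_scale sum.distrib fs.scale_right_distrib
   fs.scale_sum_right fs.scale_scale mult.commute)

lemmas rey_add = linear_on_add[OF rey_linear[of UNIV] UNIV_I UNIV_I]
 and rey_scale = linear_on_scale[OF rey_linear[of UNIV] UNIV_I]

lemma rey_sum: "rey (\<Sum>i\<in>I. f i) = (\<Sum>i\<in>I. rey (f i))"
 by (rule fsp.linear_on_sum[OF rey_linear fs.subspace_UNIV]) simp

lemma rey_act: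
 assumes g: "g \<in> grp" and \<alpha>: "\<alpha> \<in> tensor_space" shows "rey (tensor_act g \<alpha>) = rey \<alpha>"
proof -
 have "(\<Sum>h\<in>grp. tensor_act h (tensor_act g \<alpha>)) = (\<Sum>h\<in>grp. tensor_act (h \<otimes> g) \<alpha>)"
  by (rule sum.cong[OF refl]) (simp only: act_mult[OF _ g \<alpha>])
 then show ?thesis unfolding rey_def sum_right_translate[OF g, of "\<lambda>h. tensor_act h \<alpha>"] by (rule arg_cong)
qed

lemma rey_bracket:
 assumes m: "m \<in> map_algebra" and \<alpha>: "\<alpha> \<in> tensor_space"
 shows "tensor_bracket m (rey \<alpha>) = rey (tensor_bracket m \<alpha>)" "tensor_bracket (rey \<alpha>) m = rey (tensor_bracket \<alpha> m)"
proof -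
 note mT = map_algebraD(1)[OF m]
 note R = bracket_linear_right[OF mT] and L = bracket_linear_left[of UNIV m]
 have s: "(\<Sum>g\<in>grp. tensor_act g \<alpha>) \<in> tensor_space" by (rule map_algebraD(1)[OF sum_orbit_in[OF \<alpha>]])
 have "tensor_bracket m (\<Sum>g\<in>grp. tensor_act g \<alpha>) = (\<Sum>g\<in>grp. tensor_bracket m (tensor_act g \<alpha>))"
  by (rule fsp.linear_on_sum[OF R tensor_space_subspace act_in[OF _ \<alpha>]])
 also have "\<dots> = (\<Sum>g\<in>grp. tensor_act g (tensor_bracket m \<alpha>))"
  by (rule sum.cong[OF refl]) (simp only: act_bracket[OF _ mT \<alpha>] map_algebraD(2)[OF m])
 finally show "tensor_bracket m (rey \<alpha>) = rey (tensor_bracket m \<alpha>)"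
  by (simp only: rey_def linear_on_scale[OF R s])
 have "tensor_bracket (\<Sum>g\<in>grp. tensor_act g \<alpha>) m = (\<Sum>g\<in>grp. tensor_bracket (tensor_act g \<alpha>) m)"
  by (rule fsp.linear_on_sum[OF L fs.subspace_UNIV]) simp
 also have "\<dots> = (\<Sum>g\<in>grp. tensor_act g (tensor_bracket \<alpha> m))"
  by (rule sum.cong[OF refl]) (simp only: act_bracket[OF _ \<alpha> mT] map_algebraD(2)[OF m])
 finally show "tensor_bracket (rey \<alpha>) m = rey (tensor_bracket \<alpha> m)"
  by (simp only: rey_def linear_on_scale[OF L UNIV_I])
qed

lemma map_algebra_bracket:
 assumes "\<alpha> \<in> map_algebra" "\<beta> \<in> map_algebra" shows "tensor_bracket \<alpha> \<beta> \<in> map_algebra"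
proof -
 note T = map_algebraD(1)[OF assms(1)] map_algebraD(1)[OF assms(2)]
 have "tensor_act g (tensor_bracket \<alpha> \<beta>) = tensor_bracket \<alpha> \<beta>" if "g \<in> grp" for g
  by (simp only: act_bracket[OF that T] map_algebraD(2)[OF assms(1) that] map_algebraD(2)[OF assms(2) that])
 then show ?thesis using bracket_in[OF T] by (simp add: map_algebra_def)
qed

definition invA :: "'a set" where "invA = {a. \<forall>g\<in>grp. actA g a = a}"

lemma invAD: "a \<in> invA ==> g \<in> grp ==> actA g a = a"
 by (simp add: invA_def)

lemma amul_map_algebra:
 assumes "a \<in> invA" "\<alpha> \<in> map_algebra" shows "amul a \<alpha> \<in> map_algebra"
 using assms amul_in act_amul invAD by (simp add: map_algebra_def)

lemma rey_amul:
 assumes a: "a \<in> invA" and \<alpha>: "\<alpha> \<in> tensor_space" shows "rey (amul a \<alpha>) = amul a (rey \<alpha>)"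
proof -
 have "(\<Sum>g\<in>grp. tensor_act g (amul a \<alpha>)) = (\<Sum>g\<in>grp. amul a (tensor_act g \<alpha>))"
  by (rule sum.cong[OF refl]) (simp only: act_amul[OF _ \<alpha>] invAD[OF a])
 also have "\<dots> = amul a (\<Sum>g\<in>grp. tensor_act g \<alpha>)"
  by (rule fsp.linear_on_sum[OF amul_linear fs.subspace_UNIV, symmetric]) simp
 finally show ?thesis by (simp only: rey_def amul_scale)
qed

text \<open>Writing \<open>u\<close> as a sum of brackets with fixed vectors writes the average of \<open>u \<otimes> f\<close> as a sum of brackets.\<close>

lemma perfect_if_commutator_full:
 assumes full: "commutator sg br (fixed_subalgebra grp) UNIV = UNIV"
 shows "perfect fscale tensor_bracket map_algebra"
proof -
 let ?C = "commutator fscale tensor_bracket map_algebra map_algebra"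
 have sC: "fs.subspace ?C" by (simp add: commutator_def)
 have br_C: "tensor_bracket \<alpha> \<beta> \<in> ?C" if "\<alpha> \<in> map_algebra" "\<beta> \<in> map_algebra" for \<alpha> \<beta>
  unfolding commutator_def by (rule fs.span_base) (use that in blast)
 have tensC: "rey (tens u f) \<in> ?C" for u f
 proof -
  have "u \<in> commutator sg br (fixed_subalgebra grp) UNIV" using full by simp
  then show ?thesis
   unfolding commutator_def[of sg]
  proof (induction rule: span_induct_alt)
   case base
   have "tens 0 f = fscale 0 (tens 0 f)" using tens_bilinear(2)[of 0 0 f] by simp
   then have "rey (tens 0 f) = fscale 0 (rey (tens 0 f))" using rey_scale by metis
   then show ?case using fs.subspace_0[OF sC] by (simp only: fs.scale_zero_left)
  next
   case (step c x y)
   then obtain a w where x: "x = br a w" "a \<in> fixed_subalgebra grp" by blast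
   have a1: "tens a oneA \<in> map_algebra"
    using x(2) by (simp add: map_algebra_def tens_in tensor_act_tens actA_one fixed_subalgebra_def)
   have "rey (tens x f) = tensor_bracket (tens a oneA) (rey (tens w f))"
    unfolding rey_bracket(1)[OF a1 tens_in] tensor_bracket_tens x(1) A_one ..
   then have "rey (tens x f) \<in> ?C" using br_C[OF a1 rey_in[OF tens_in]] by (simp only:)
   then show ?case
    using step(2) by (simp only: tens_bilinear rey_add rey_scale fs.subspace_add[OF sC] fs.subspace_scale[OF sC])
  qed
 qed
 have reyC: "rey \<alpha> \<in> ?C" if "\<alpha> \<in> tensor_space" for \<alpha>
  using that by (induction rule: tensor_space_induct)
   (simp_all only: tensC rey_add rey_scale fs.subspace_add[OF sC] fs.subspace_scale[OF sC])
 have "map_algebra \<subseteq> ?C"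
 proof
  fix \<alpha> assume \<alpha>: "\<alpha> \<in> map_algebra"
  show "\<alpha> \<in> ?C" using reyC[OF map_algebraD(1)[OF \<alpha>]] unfolding rey_fixed[OF \<alpha>] .
 qed
 moreover have "?C \<subseteq> map_algebra"
  unfolding commutator_def
 proof (rule fs.span_minimal[OF subsetI map_algebra_subspace])
  fix x assume "x \<in> {tensor_bracket u v |u v. u \<in> map_algebra & v \<in> map_algebra}"
  then obtain u v where x: "x = tensor_bracket u v" "u \<in> map_algebra" "v \<in> map_algebra" by (elim CollectE exE conjE)
  show "x \<in> map_algebra" unfolding x(1) by (rule map_algebra_bracket[OF x(2,3)])
 qed
 ultimately show ?thesis unfolding perfect_def by (rule subset_antisym[rotated])
qed

end

section \<open>Rational points and evaluation\<close>

context equivariant_maps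
begin

lemma ratD:
 assumes "x \<in> rational_points"
 shows "x (f + f') = x f + x f'" "x (sA c f) = c * x f" "x (f * f') = x f * x f'" "x oneA = 1"
  "x 0 = 0" "x (f - f') = x f - x f'"
proof -
 have l: "module_hom sA (*) x"
  using assms by (simp add: rational_points_def module_hom_iff_linear)
 show "x (f + f') = x f + x f'" "x (sA c f) = c * x f" "x 0 = 0" "x (f - f') = x f - x f'"
  by (rule module_hom.add[OF l] module_hom.scale[OF l] module_hom.zero[OF l] module_hom.diff[OF l])+
 show "x (f * f') = x f * x f'" "x oneA = 1" using assms by (auto simp: rational_points_def)
qed

lemma actA_inv: "g \<in> grp ==> actA (inv g) (actA g f) = f"
 using group_act_mult(2)[of "inv g" g f] by (simp add: group_act_one)

lemma actg_inv: "g \<in> grp ==> actg (inv g) (actg g u) = u" "g \<in> grp ==> actg g (actg (inv g) u) = u"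
 using group_act_mult(1)[of "inv g" g u] group_act_mult(1)[of g "inv g" u] by (simp_all add: group_act_one)

lemma point_act_one: "point_act \<one> x = x"
 by (simp add: point_act_def group_act_one)

lemma point_act_mult:
 assumes "g \<in> grp" "h \<in> grp"
 shows "point_act (g \<otimes> h) x = point_act g (point_act h x)"
 using assms by (simp add: point_act_def inv_mult_group group_act_mult)

lemma point_act_inv: "g \<in> grp ==> point_act (inv g) (point_act g x) = x"
 "g \<in> grp ==> point_act g (point_act (inv g) x) = x"
 by (simp_all add: point_act_mult[symmetric] point_act_one)

lemma point_act_rational:
 assumes g: "g \<in> grp" and x: "x \<in> rational_points"
 shows "point_act g x \<in> rational_points"
proof -
 have i: "inv g \<in> grp" using g by simp
 have "Vector_Spaces.linear sA (*) (point_act g x)"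
  using x actA_linear[OF i] unfolding rational_points_def Vector_Spaces.linear_iff point_act_def by simp
 then show ?thesis
  using ratD[OF x] by (simp add: rational_points_def point_act_def actA_mult[OF i] actA_one[OF i])
qed

lemma orbitI: "g \<in> grp ==> point_act g x \<in> orb x"
 unfolding orbit_def by blast

lemma orbitE:
 assumes "y \<in> orb x"
 obtains g where "g \<in> grp" "y = point_act g x"
 using assms unfolding orbit_def by (elim CollectE exE conjE)

lemma orbit_refl: "x \<in> orb x"
 using orbitI[OF one_closed, of x] by (simp only: point_act_one)

lemma orbit_sym:
 assumes "y \<in> orb x" shows "x \<in> orb y"
proof -
 obtain g where g: "g \<in> grp" "y = point_act g x" by (rule orbitE[OF assms])
 show ?thesis using orbitI[of "inv g" y] g(1) by (simp add: g(2) point_act_inv)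
qed

lemma orbit_trans:
 assumes "y \<in> orb x" "z \<in> orb y" shows "z \<in> orb x"
proof -
 obtain g where g: "g \<in> grp" "y = point_act g x" by (rule orbitE[OF assms(1)])
 obtain h where h: "h \<in> grp" "z = point_act h y" by (rule orbitE[OF assms(2)])
 show ?thesis using orbitI[of "h \<otimes> g" x] g(1) h(1) by (simp add: g(2) h(2) point_act_mult)
qed

lemma eval_expansion:
 assumes x: "x \<in> rational_points" and B: "finite B"
 shows "eval_at x (\<Sum>b\<in>B. tens b (F b)) = (\<Sum>b\<in>B. sg (x (F b)) b)"
proof -
 obtain e where e: "bij_betw e {0..<card B} B" using ex_bij_betw_nat_finite[OF B] by blast
 have "(\<Sum>b\<in>B. tens b (F b)) = (\<Sum>i<card B. tens (e i) (F (e i)))"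
  using sum.reindex_bij_betw[OF e, of "\<lambda>b. tens b (F b)"] by (simp only: atLeast0LessThan)
 moreover have "(\<Sum>b\<in>B. sg (x (F b)) b) = (\<Sum>i<card B. sg (x (F (e i))) (e i))"
  using sum.reindex_bij_betw[OF e, of "\<lambda>b. sg (x (F b)) b"] by (simp only: atLeast0LessThan)
 ultimately show ?thesis by (simp only: eval_at_sum_tens[OF x])
qed

lemma eval_tens: "x \<in> rational_points ==> eval_at x (tens u f) = sg (x f) u"
 using eval_at_sum_tens[of x "\<lambda>_. u" "\<lambda>_. f" 1] by (simp add: lessThan_Suc)

lemma eval_linear:
 assumes x: "x \<in> rational_points" shows "linear_on fscale sg tensor_space (eval_at x)"
 unfolding linear_on_def
proof (intro conjI ballI allI)
 note E = eval_expansion[OF x basis(1)]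
 fix \<alpha> \<beta> assume ab: "\<alpha> \<in> tensor_space" "\<beta> \<in> tensor_space"
 obtain F where \<alpha>: "\<alpha> = (\<Sum>b\<in>basis. tens b (F b))" by (rule tensor_expansion[OF ab(1)])
 obtain G where \<beta>: "\<beta> = (\<Sum>b\<in>basis. tens b (G b))" by (rule tensor_expansion[OF ab(2)])
 have s: "\<alpha> + \<beta> = (\<Sum>b\<in>basis. tens b (F b + G b))" by (simp only: \<alpha> \<beta> tens_bilinear sum.distrib)
 show "eval_at x (\<alpha> + \<beta>) = eval_at x \<alpha> + eval_at x \<beta>"
  unfolding s unfolding \<alpha> \<beta> E by (simp add: ratD[OF x] scale_left_distrib sum.distrib)
next
 note E = eval_expansion[OF x basis(1)]
 fix c \<alpha> assume ab: "\<alpha> \<in> tensor_space"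
 obtain F where \<alpha>: "\<alpha> = (\<Sum>b\<in>basis. tens b (F b))" by (rule tensor_expansion[OF ab])
 have s: "fscale c \<alpha> = (\<Sum>b\<in>basis. tens b (sA c (F b)))" by (simp only: \<alpha> tens_bilinear fs.scale_sum_right)
 show "eval_at x (fscale c \<alpha>) = sg c (eval_at x \<alpha>)"
  unfolding s unfolding \<alpha> E by (simp add: ratD[OF x] scale_sum_right)
qed

lemma eval_zero_coeffs:
 assumes x: "x \<in> rational_points" and 0: "eval_at x (\<Sum>b\<in>basis. tens b (F b)) = 0" and b: "b \<in> basis"
 shows "x (F b) = 0"
 using 0 independentD[OF basis(2) basis(1) subset_refl _ b, of "\<lambda>b. x (F b)"]
 by (simp only: eval_expansion[OF x basis(1)])

lemma eval_bracket:
 assumes x: "x \<in> rational_points" and \<alpha>: "\<alpha> \<in> tensor_space" and \<beta>: "\<beta> \<in> tensor_space"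
 shows "eval_at x (tensor_bracket \<alpha> \<beta>) = br (eval_at x \<alpha>) (eval_at x \<beta>)"
 using \<alpha>
proof (induction rule: tensor_space_induct)
 case (tens u f)
 note R = bracket_linear_right[OF tens_in[of u f]]
 show ?case using \<beta>
  by (induction rule: tensor_space_induct)
   (simp_all only: tensor_bracket_tens eval_tens[OF x] linear_on_add[OF R] linear_on_scale[OF R]
    bracket_in[OF tens_in] linear_on_add[OF eval_linear[OF x]] linear_on_scale[OF eval_linear[OF x]]
    ratD[OF x] br_add br_scale scale_scale mult.commute)
next
 case (add \<alpha> \<alpha>')
 note L = linear_on_add[OF bracket_linear_left[of UNIV \<beta>] UNIV_I UNIV_I]
 show ?case
  by (simp only: L add bracket_in[OF _ \<beta>] linear_on_add[OF eval_linear[OF x]] br_add)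
next
 case (scale c \<alpha>)
 note L = linear_on_scale[OF bracket_linear_left[of UNIV \<beta>] UNIV_I]
 show ?case
  by (simp only: L scale bracket_in[OF _ \<beta>] linear_on_scale[OF eval_linear[OF x]] br_scale)
qed

lemma eval_act:
 assumes g: "g \<in> grp" and x: "x \<in> rational_points" and \<alpha>: "\<alpha> \<in> tensor_space"
 shows "eval_at (point_act g x) (tensor_act g \<alpha>) = actg g (eval_at x \<alpha>)"
 using \<alpha>
proof (induction rule: tensor_space_induct)
 case (tens u f)
 show ?case
  unfolding tensor_act_tens[OF g] eval_tens[OF point_act_rational[OF g x]] eval_tens[OF x] actg_hom[OF g]
  by (simp only: point_act_def actA_inv[OF g])
qed (simp_all only: act_add act_scale act_in[OF g] linear_on_add[OF eval_linear[OF x]] linear_on_scale[OF eval_linear[OF x]]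
  linear_on_add[OF eval_linear[OF point_act_rational[OF g x]]]
  linear_on_scale[OF eval_linear[OF point_act_rational[OF g x]]] actg_hom[OF g])

lemma eval_equivariant:
 assumes "g \<in> grp" "x \<in> rational_points" "\<alpha> \<in> map_algebra"
 shows "eval_at (point_act g x) \<alpha> = actg g (eval_at x \<alpha>)"
 using eval_act[OF assms(1,2) map_algebraD(1)[OF assms(3)]] by (simp only: map_algebraD(2)[OF assms(3,1)])

lemma eval_in_isotropy:
 assumes "x \<in> rational_points" "\<alpha> \<in> map_algebra" shows "eval_at x \<alpha> \<in> isotropy_algebra x"
proof -
 have "actg g (eval_at x \<alpha>) = eval_at x \<alpha>" if "g \<in> stab x" for g
 proof -
  have g: "g \<in> grp" "point_act g x = x" using that by (auto simp: stabilizer_def)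
  show ?thesis using eval_equivariant[OF g(1) assms] unfolding g(2) by (rule sym)
 qed
 then show ?thesis by (simp add: isotropy_algebra_def fixed_subalgebra_def)
qed

lemma actg_zero: "g \<in> grp ==> actg g 0 = 0"
 using actg_hom(2)[of g 0 0] by simp

lemma isotropy_subspace: "subspace (isotropy_algebra x)"
 unfolding isotropy_algebra_def fixed_subalgebra_def stabilizer_def
 by (rule subspaceI) (auto simp: actg_hom actg_zero)

lemma isotropy_bracket: "u \<in> isotropy_algebra x ==> v \<in> isotropy_algebra x ==> br u v \<in> isotropy_algebra x"
 unfolding isotropy_algebra_def fixed_subalgebra_def stabilizer_def by (auto simp: actg_br)

subsection \<open>Interpolation\<close>

lemma interpolation:
 assumes "finite P" "P \<subseteq> rational_points" "y \<in> rational_points" "y \<notin> P"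
 shows "\<exists>f. y f = 1 & (\<forall>z\<in>P. z f = 0)"
 using assms
proof (induction P rule: finite_induct)
 case empty
 then show ?case using ratD(4)[OF `y \<in> rational_points`] by blast
next
 case (insert z P)
 then obtain f where f: "y f = 1" "\<forall>z\<in>P. z f = 0" by auto
 have z: "z \<in> rational_points" using insert by simp
 obtain a where a: "y a ~= z a" using insert.prems(3) by (metis insertI1 ext)
 let ?a = "sA (1 / (y a - z a)) (a - sA (z a) oneA)"
 have "y (f * ?a) = 1" "z (f * ?a) = 0"
  using a f by (simp_all add: ratD[OF insert.prems(2)] ratD[OF z])
 moreover have "w (f * ?a) = 0" if "w \<in> P" for w
  using f that insert.prems(1) by (simp add: ratD[of w] subset_iff)
 ultimately show ?case by blast
qed

definition orbit_distinct :: "('a => 'k) set => bool" where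
 "orbit_distinct xs \<longleftrightarrow> (\<forall>x\<in>xs. \<forall>y\<in>xs. y \<in> orb x --> y = x)"

lemma orbit_distinctD: "orbit_distinct xs ==> x \<in> xs ==> y \<in> xs ==> y \<in> orb x ==> y = x"
 by (simp add: orbit_distinct_def)

text \<open>
  A function that is \<open>1\<close> at \<open>x\<close> and \<open>0\<close> at the finitely many other points in the orbits of \<open>xs\<close>
  separates the translates of \<open>x\<close>, hence lets sums over the group be computed pointwise.
\<close>

lemma orbit_interpolation:
 assumes xs: "finite xs" "xs \<subseteq> rational_points" "orbit_distinct xs" and x: "x \<in> xs"
 shows "\<exists>f. \<forall>g y. g \<in> grp --> y \<in> xs --> y (actA g f) = (if y = x & g \<in> stab x then 1 else 0)"
proof -
 let ?P = "(\<lambda>(g, y). point_act g y) ` (grp \<times> xs)"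
 have "\<exists>f. x f = 1 & (\<forall>z\<in>?P - {x}. z f = 0)"
  by (rule interpolation) (use xs x finite_\<Gamma> point_act_rational in auto)
 then obtain f where f: "x f = 1" "!!z. z \<in> ?P ==> z ~= x ==> z f = 0" by blast
 have "y (actA g f) = (if y = x & g \<in> stab x then 1 else 0)"
  if g: "g \<in> grp" and y: "y \<in> xs" for g y
 proof -
  have e: "y (actA g f) = point_act (inv g) y f" using g by (simp add: point_act_def)
  have ig: "inv g \<in> grp" using g by simp
  have "point_act (inv g) y = x \<longleftrightarrow> y = x & g \<in> stab x"
  proof
   assume a: "point_act (inv g) y = x"
   have "x \<in> orb y" using orbitI[OF ig, of y] unfolding a .
   then have "y = x" by (rule orbit_distinctD[OF xs(3) y x, symmetric])
   moreover have "point_act g x = y" unfolding a[symmetric] by (rule point_act_inv(2)[OF g])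
   ultimately show "y = x & g \<in> stab x" using g by (simp add: stabilizer_def)
  next
   assume "y = x & g \<in> stab x"
   then have "y = x" "point_act g x = x" by (simp_all add: stabilizer_def)
   then show "point_act (inv g) y = x" using point_act_inv(1)[OF g, of x] by simp
  qed
  moreover have "point_act (inv g) y \<in> ?P" using ig y by auto
  ultimately show ?thesis using f e by auto
 qed
 then show ?thesis by blast
qed

lemma stabilizer_facts: "stab x \<subseteq> grp" "finite (stab x)"
 "of_nat (card (stab x)) ~= (0 :: 'k)"
proof -
 show s: "stab x \<subseteq> grp" by (auto simp: stabilizer_def)
 show f: "finite (stab x)" by (rule finite_subset[OF s finite_\<Gamma>])
 have "\<one> \<in> stab x" by (simp add: stabilizer_def point_act_one)
 then show "of_nat (card (stab x)) ~= (0 :: 'k)" using f by auto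
qed

text \<open>
  The sum over the group of the translates of \<open>u \<otimes> f\<close>, with \<open>f\<close> separating the translates of \<open>x\<close>, has at \<open>x\<close>
  one summand \<open>u\<close> for each element of the stabilizer.
\<close>

lemma evaluation_surjective:
 assumes xs: "finite xs" "xs \<subseteq> rational_points" "orbit_distinct xs" and x: "x \<in> xs"
  and u: "u \<in> isotropy_algebra x"
 shows "\<exists>\<alpha>\<in>map_algebra. eval_at x \<alpha> = u & (\<forall>y\<in>xs. y ~= x --> eval_at y \<alpha> = 0)"
proof -
 obtain f where f': "\<forall>g y. g \<in> grp --> y \<in> xs -->
   y (actA g f) = (if y = x & g \<in> stab x then 1 else 0)"
  using orbit_interpolation[OF xs x] by (elim exE)
 note f = f'[rule_format]
 let ?S = "stab x"
 let ?c = "1 / of_nat (card ?S) :: 'k"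
 let ?s = "\<Sum>g\<in>grp. tensor_act g (tens u f)"
 let ?\<alpha> = "fscale ?c ?s"
 have s: "?s \<in> map_algebra" by (rule sum_orbit_in[OF tens_in])
 have ev: "eval_at y ?\<alpha> = sg ?c (\<Sum>g\<in>grp. if y = x & g \<in> ?S then u else 0)" if y: "y \<in> xs" for y
 proof -
  have yr: "y \<in> rational_points" using y xs(2) by blast
  have pair: "vector_space_pair (fscale :: 'k => (('g => 'a => 'k) => 'k) => _) sg"
   by (intro vector_space_pair.intro vector_space_fscale vs)
  have "eval_at y ?s = (\<Sum>g\<in>grp. eval_at y (tensor_act g (tens u f)))"
   by (rule vector_space_pair.linear_on_sum[OF pair eval_linear[OF yr] tensor_space_subspace act_in[OF _ tens_in]])
  also have "\<dots> = (\<Sum>g\<in>grp. if y = x & g \<in> ?S then u else 0)"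
  proof (rule sum.cong[OF refl])
   fix g assume g: "g \<in> grp"
   have "actg g u = u" if "g \<in> ?S" using that u by (simp add: isotropy_algebra_def fixed_subalgebra_def)
   then show "eval_at y (tensor_act g (tens u f)) = (if y = x & g \<in> ?S then u else 0)"
    unfolding tensor_act_tens[OF g] eval_tens[OF yr] f[OF g y] by simp
  qed
  finally show ?thesis by (simp only: linear_on_scale[OF eval_linear[OF yr] map_algebraD(1)[OF s]])
 qed
 have i: "grp \<inter> ?S = ?S" using stabilizer_facts(1) by blast
 have "(\<Sum>g\<in>grp. if x = x & g \<in> ?S then u else 0) = sg (of_nat (card ?S)) u"
  using finite_\<Gamma> i by (simp add: sum.If_cases sum_constant_scale)
 then have "eval_at x ?\<alpha> = u" using ev[OF x] stabilizer_facts(3)[of x] by (simp del: of_nat_eq_0_iff)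
 moreover have "eval_at y ?\<alpha> = 0" if "y \<in> xs" "y ~= x" for y using ev[OF that(1)] that(2) by simp
 moreover have "?\<alpha> \<in> map_algebra" by (rule fs.subspace_scale[OF map_algebra_subspace s])
 ultimately show ?thesis by blast
qed

lemma invariant_interpolation:
 assumes xs: "finite xs" "xs \<subseteq> rational_points" "orbit_distinct xs" and x: "x \<in> xs"
 shows "\<exists>a\<in>invA. x a ~= 0 & (\<forall>y\<in>xs. y ~= x --> y a = 0)"
proof -
 obtain f where f': "\<forall>g y. g \<in> grp --> y \<in> xs -->
   y (actA g f) = (if y = x & g \<in> stab x then 1 else 0)"
  using orbit_interpolation[OF xs x] by (elim exE)
 note f = f'[rule_format]
 let ?a = "\<Sum>h\<in>grp. actA h f"
 have "actA g ?a = ?a" if g: "g \<in> grp" for g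
 proof -
  have "actA g ?a = (\<Sum>h\<in>grp. actA g (actA h f))"
   using module_hom.sum[of sA sA "actA g"] actA_linear[OF g] by (simp add: module_hom_iff_linear)
  also have "\<dots> = (\<Sum>h\<in>grp. actA (g \<otimes> h) f)"
   using g by (simp add: group_act_mult cong: sum.cong)
  finally show ?thesis by (simp add: sum_left_translate[OF g, of "\<lambda>h. actA h f"])
 qed
 then have "?a \<in> invA" by (simp add: invA_def)
 moreover have ev: "y ?a = (\<Sum>g\<in>grp. if y = x & g \<in> stab x then 1 else 0)"
  if y: "y \<in> xs" for y
 proof -
  have "Vector_Spaces.linear sA (*) y" using y xs(2) by (auto simp: rational_points_def)
  then have "y ?a = (\<Sum>g\<in>grp. y (actA g f))"
   using module_hom.sum[of sA "(*)" y] by (simp add: module_hom_iff_linear)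
  then show ?thesis using f[OF _ y] by (simp cong: sum.cong)
 qed
 moreover have "grp \<inter> stab x = stab x" using stabilizer_facts(1) by blast
 then have "x ?a = of_nat (card (stab x))"
  using ev[OF x] finite_\<Gamma> by (simp add: sum.If_cases)
 then have "x ?a ~= 0" using stabilizer_facts(3) by metis
 moreover have "y ?a = 0" if "y \<in> xs" "y ~= x" for y using ev[OF that(1)] that(2) by simp
 ultimately show ?thesis by blast
qed

end

section \<open>The annihilator ideal of an irreducible representation\<close>

context vector_space_pair
begin

lemma finite_codim_kernel:
 assumes X: "vs1.subspace X" and \<phi>: "linear_on s1 s2 X \<phi>" and V: "finite_dim s2 V" "\<phi> ` X \<subseteq> V"
 shows "\<exists>F. finite F & F \<subseteq> X & (\<forall>x\<in>X. \<exists>y\<in>vs1.span F. \<phi> (x - y) = 0)"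
proof -
 obtain B where B: "finite B" "vs2.span B = \<phi> ` X"
  using vs2.finite_dim_basis[OF V(1) linear_on_image_subspace[OF \<phi> X] V(2)] by metis
 then have "B \<subseteq> \<phi> ` X" using vs2.span_superset by metis
 then obtain F where F: "F \<subseteq> X" "finite F" "B = \<phi> ` F" using finite_subset_image[OF B(1)] by metis
 have sF: "vs1.span F \<subseteq> X" by (rule vs1.span_minimal[OF F(1) X])
 have \<phi>F: "linear_on s1 s2 (vs1.span F) \<phi>" by (rule linear_on_subset[OF \<phi> sF])
 have le: "\<phi> ` X \<subseteq> \<phi> ` vs1.span F"
  unfolding B(2)[symmetric] F(3)
  by (rule vs2.span_minimal[OF image_mono[OF vs1.span_superset] linear_on_image_subspace[OF \<phi>F vs1.subspace_span]])
 have "\<exists>y\<in>vs1.span F. \<phi> (x - y) = 0" if x: "x \<in> X" for x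
 proof -
  have "\<phi> x \<in> \<phi> ` vs1.span F" using le imageI[OF x] by (rule subsetD)
  then obtain y where y: "\<phi> x = \<phi> y" "y \<in> vs1.span F" by (elim imageE)
  show ?thesis
   by (rule bexI[OF _ y(2)]) (simp only: linear_on_diff[OF \<phi> X x subsetD[OF sF y(2)]] y(1) diff_self)
 qed
 then show ?thesis using F(1,2) by (intro exI[of _ F] conjI ballI)
qed

lemma finite_codim_common_kernel:
 assumes "finite J" "vs1.subspace X" "!!j. j \<in> J ==> linear_on s1 s2 X (\<phi> j)"
  and V: "finite_dim s2 V" and "!!j. j \<in> J ==> \<phi> j ` X \<subseteq> V"
 shows "\<exists>F. finite F & F \<subseteq> X & (\<forall>x\<in>X. \<exists>y\<in>vs1.span F. \<forall>j\<in>J. \<phi> j (x - y) = 0)"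
 using assms
proof (induction J arbitrary: X rule: finite_induct)
 case empty
 then show ?case by (intro exI[of _ "{}"]) auto
next
 case (insert j J)
 note X = insert.prems(1)
 obtain F where F: "finite F" "F \<subseteq> X" "!!x. x \<in> X ==> \<exists>y\<in>vs1.span F. \<phi> j (x - y) = 0"
  using finite_codim_kernel[OF X insert.prems(2)[OF insertI1] V insert.prems(4)[OF insertI1]] by blast
 let ?Y = "{v \<in> X. \<phi> j v = 0}"
 have Y: "vs1.subspace ?Y" by (rule linear_on_kernel_subspace[OF insert.prems(2)[OF insertI1] X])
 have "\<exists>F. finite F & F \<subseteq> ?Y & (\<forall>x\<in>?Y. \<exists>y\<in>vs1.span F. \<forall>j\<in>J. \<phi> j (x - y) = 0)"
  by (rule insert.IH[OF Y linear_on_subset[OF insert.prems(2)] V]) (use insert.prems(4) in blast)+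
 then obtain G where G: "finite G" "G \<subseteq> ?Y" "!!x. x \<in> ?Y ==> \<exists>y\<in>vs1.span G. \<forall>j\<in>J. \<phi> j (x - y) = 0" by blast
 have "\<exists>y\<in>vs1.span (F \<union> G). \<forall>i\<in>insert j J. \<phi> i (x - y) = 0" if x: "x \<in> X" for x
 proof -
  obtain y where y: "y \<in> vs1.span F" "\<phi> j (x - y) = 0" using F(3)[OF x] by blast
  have "y \<in> X" using y(1) vs1.span_minimal[OF F(2) X] by blast
  then have "x - y \<in> ?Y" using y(2) vs1.subspace_diff[OF X x] by simp
  then obtain z where z: "z \<in> vs1.span G" "!!i. i \<in> J ==> \<phi> i (x - y - z) = 0" using G(3) by blast
  have "z \<in> ?Y" using z(1) vs1.span_minimal[OF G(2) Y] by blast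
  then have "x - y - z \<in> ?Y" using vs1.subspace_diff[OF Y `x - y \<in> ?Y`] by blast
  then have "\<phi> i (x - (y + z)) = 0" if "i \<in> insert j J" for i
   using that z(2)[of i] by (auto simp: algebra_simps)
  moreover have "y + z \<in> vs1.span (F \<union> G)"
   using y(1) z(1) vs1.span_mono[of F "F \<union> G"] vs1.span_mono[of G "F \<union> G"] by (blast intro: vs1.span_add)
  ultimately show ?thesis by blast
 qed
 then show ?case using F(1,2) G(1,2) by (intro exI[of _ "F \<union> G"]) auto
qed

end

context equivariant_maps
begin

definition tspan :: "'a set => (('g => 'a => 'k) => 'k) set" where
 "tspan S = module.span fscale {tens u s | u s. s \<in> S}"

lemma tspan_base: "s \<in> S ==> tens u s \<in> tspan S"
 unfolding tspan_def by (rule fs.span_base) blast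

lemma tspan_subspace: "fs.subspace (tspan S)"
 unfolding tspan_def by (rule fs.subspace_span)

lemma tspan_UNIV: "tspan UNIV = tensor_space"
 by (simp add: tspan_def tensor_space_def)

lemma tspan_induct [consumes 1, case_names base add scale zero]:
 assumes q: "q \<in> tspan S" and "!!u s. s \<in> S ==> Q (tens u s)"
  and "!!\<alpha> \<beta>. \<alpha> \<in> tensor_space ==> \<beta> \<in> tensor_space ==> Q \<alpha> ==> Q \<beta> ==> Q (\<alpha> + \<beta>)"
  and "!!c \<alpha>. \<alpha> \<in> tensor_space ==> Q \<alpha> ==> Q (fscale c \<alpha>)" and "Q 0"
 shows "Q q"
proof -
 have "q \<in> tensor_space & Q q"
  using q unfolding tspan_def
 proof (induction rule: fs.span_induct_alt)
  case base
  then show ?case using fs.subspace_0[OF tensor_space_subspace] assms(5) by (intro conjI)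
 next
  case (step c x y)
  then obtain u s where x: "x = tens u s" "s \<in> S" by blast
  have cx: "fscale c x \<in> tensor_space" "Q (fscale c x)"
   unfolding x(1) by (rule fs.subspace_scale[OF tensor_space_subspace tens_in] assms(4)[OF tens_in assms(2)[OF x(2)]])+
  show ?case
   using fs.subspace_add[OF tensor_space_subspace cx(1) conjunct1[OF step(2)]]
    assms(3)[OF cx(1) conjunct1[OF step(2)] cx(2) conjunct2[OF step(2)]] by (rule conjI)
 qed
 then show ?thesis ..
qed

lemma tspan_in_tensor: "q \<in> tspan S ==> q \<in> tensor_space"
 by (induction rule: tspan_induct) (simp_all only: tens_in fs.subspace_add[OF tensor_space_subspace]
   fs.subspace_scale[OF tensor_space_subspace] fs.subspace_0[OF tensor_space_subspace])

lemma tspan_bracket: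
 assumes S: "!!s t. s \<in> S ==> t \<in> S' ==> s * t \<in> S''"
  and q: "q \<in> tspan S" and q': "q' \<in> tspan S'"
 shows "tensor_bracket q q' \<in> tspan S''"
 using q
proof (induction rule: tspan_induct)
 case (base u s)
 note R = bracket_linear_right[OF tens_in[of u s]]
 show ?case using q'
 proof (induction rule: tspan_induct)
  case (base v t)
  show ?case unfolding tensor_bracket_tens by (rule tspan_base[OF S]) fact+
 next
  case zero
  show ?case unfolding fsp.linear_on_zero[OF R tensor_space_subspace] by (rule fs.subspace_0[OF tspan_subspace])
 qed (simp_all only: linear_on_add[OF R] linear_on_scale[OF R] fs.subspace_add[OF tspan_subspace] fs.subspace_scale[OF tspan_subspace])
next
 note L = bracket_linear_left[of UNIV q']
 case zero
 show ?case unfolding fsp.linear_on_zero[OF L fs.subspace_UNIV] by (rule fs.subspace_0[OF tspan_subspace])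
qed (simp_all only: linear_on_add[OF bracket_linear_left[of UNIV]] linear_on_scale[OF bracket_linear_left[of UNIV]] UNIV_I
   fs.subspace_add[OF tspan_subspace] fs.subspace_scale[OF tspan_subspace])

lemma tspan_rey:
 assumes S: "!!g s. g \<in> grp ==> s \<in> S ==> actA g s \<in> S" and q: "q \<in> tspan S"
 shows "rey q \<in> tspan S"
proof -
 have "tensor_act g q \<in> tspan S" if g: "g \<in> grp" for g
  using q
 proof (induction rule: tspan_induct)
  case (base u s)
  show ?case unfolding tensor_act_tens[OF g] by (rule tspan_base[OF S[OF g base]])
 next
  case zero
  show ?case unfolding fsp.linear_on_zero[OF act_linear fs.subspace_UNIV] by (rule fs.subspace_0[OF tspan_subspace])
 qed (simp_all only: act_add act_scale fs.subspace_add[OF tspan_subspace] fs.subspace_scale[OF tspan_subspace])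
 then show ?thesis unfolding rey_def by (intro fs.subspace_scale[OF tspan_subspace] fs.subspace_sum[OF tspan_subspace])
qed

sublocale mu: comm_monoid_set "(*) :: 'a => 'a => 'a" oneA
 by standard (simp_all add: mult_ac)

lemma actA_sum: "g \<in> grp ==> actA g (\<Sum>i\<in>I. f i) = (\<Sum>i\<in>I. actA g (f i))"
 using module_hom.sum[of sA sA "actA g"] actA_linear by (simp add: module_hom_iff_linear)

lemma actA_zero: "g \<in> grp ==> actA g 0 = 0"
 using actA_hom(2)[of g 0 0] by simp

lemma actA_minus: "g \<in> grp ==> actA g (- f) = - actA g f"
 using module_hom.neg[of sA sA "actA g"] actA_linear by (simp add: module_hom_iff_linear)

lemma actA_prod:
 assumes "g \<in> grp" "finite D"
 shows "actA g (mu.F h D) = mu.F (\<lambda>x. actA g (h x)) D"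
 using assms(2) by (induction D rule: finite_induct) (simp_all add: actA_one actA_mult assms(1))

definition aideal :: "'a set => bool" where
 "aideal P \<longleftrightarrow> A.subspace P & (\<forall>a. \<forall>p\<in>P. a * p \<in> P)"

lemma aidealD:
 assumes "aideal P"
 shows "0 \<in> P" "p \<in> P ==> q \<in> P ==> p + q \<in> P" "p \<in> P ==> q \<in> P ==> p - q \<in> P" "p \<in> P ==> sA c p \<in> P"
  "p \<in> P ==> a * p \<in> P" "p \<in> P ==> p * a \<in> P" "A.subspace P"
 using assms A.subspace_0 A.subspace_add A.subspace_diff A.subspace_scale
 unfolding aideal_def by (auto simp: mult.commute[of _ a])

text \<open>
  If powers of \<open>h\<close> are dependent modulo \<open>P\<close>, multiplication by \<open>h\<close> has an eigenvector modulo \<open>P\<close>, and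
  primeness cancels this eigenvector.
\<close>

lemma algebraic_modulo_prime:
 assumes P: "aideal P" "oneA \<notin> P" "!!a b. a * b \<in> P ==> a \<in> P \<or> b \<in> P"
  and c: "(\<Sum>i<N. sA (c i) (((*) h ^^ i) oneA)) \<in> P" "i0 < N" "c i0 ~= 0"
 shows "\<exists>d. h - sA d oneA \<in> P"
proof -
 let ?q = "\<Sum>i<N. monom (c i) i"
 have co: "coeff ?q i = (if i < N then c i else 0)" for i
  by (simp add: coeff_sum coeff_monom)
 have "coeff ?q i0 ~= 0" using c(2,3) co by simp
 then have q0: "?q ~= 0" by (metis coeff_0)
 have dq: "degree ?q < N" using c(2) co q0 by (metis leading_coeff_0_iff)
 have "(\<Sum>i\<le>degree ?q. sA (coeff ?q i) (((*) h ^^ i) oneA)) = (\<Sum>i<N. sA (c i) (((*) h ^^ i) oneA))"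
 proof (rule sum.mono_neutral_cong_left)
  show "\<forall>i\<in>{..<N} - {..degree ?q}. sA (c i) (((*) h ^^ i) oneA) = 0"
  proof
   fix i assume i: "i \<in> {..<N} - {..degree ?q}"
   then have "coeff ?q i = 0" by (intro coeff_eq_0) simp
   then show "sA (c i) (((*) h ^^ i) oneA) = 0" using co[of i] i by simp
  qed
 qed (use dq co in auto)
 then have qP: "(\<Sum>i\<le>degree ?q. sA (coeff ?q i) (((*) h ^^ i) oneA)) \<in> P" using c(1) by simp
 have e: "endo sA UNIV ((*) h)" by (simp add: endo_def linear_on_def distrib_left A_mult_scale)
 have hP: "(*) h ` P \<subseteq> P" using aidealD(5)[OF P(1)] by auto
 obtain d w where w: "w \<notin> P" "h * w - sA d w \<in> P"
  using eigenvector_modulo[OF A.vector_space_axioms A.subspace_UNIV aidealD(7)[OF P(1)] e hP UNIV_I P(2) q0 qP] by blast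
 have "(h - sA d oneA) * w \<in> P" using w(2) by (simp add: left_diff_distrib A_scale_mult)
 then show ?thesis using P(3) w(1) by blast
qed

lemma poly_via_powers:
 "degree Q < N ==> poly Q h = (\<Sum>i<N. coeff Q i * ((*) h ^^ i) oneA)"
proof (induction Q arbitrary: N)
 case (pCons a Q)
 obtain M where M: "N = Suc M" using pCons.prems by (cases N) auto
 have "poly Q h = (\<Sum>i<M. coeff Q i * ((*) h ^^ i) oneA)"
 proof (cases "Q = 0")
  case False
  then show ?thesis using pCons.prems M pCons.IH[of M] by (simp add: degree_pCons_eq)
 qed simp
 then show ?case
  by (simp add: M sum.lessThan_Suc_shift sum_distrib_left mult.left_commute del: sum.lessThan_Suc)
qed simp

text \<open>
  The polynomial \<open>\<Prod>g. (t - g \<cdot> h)\<close> is monic with invariant coefficients and has the root \<open>h\<close>.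
\<close>

lemma invariant_equation:
 "\<exists>a N. (\<forall>i. a i \<in> invA) & a N = oneA & (\<Sum>i<Suc N. a i * ((*) h ^^ i) oneA) = 0"
proof -
 have u: "[:oneA:] * p = p" for p
  by (rule poly_eqI) simp
 interpret pm: comm_monoid_set "(*) :: 'a poly => 'a poly => 'a poly" "[:oneA:]"
  by standard (simp_all only: u[unfolded mult.commute[of "[:oneA:]"]] mult_ac)
 let ?f = "\<lambda>g. [:- actA g h, oneA:]"
 let ?Q = "pm.F ?f grp"
 have monic: "coeff (pm.F ?f D) (card D) = oneA & (\<forall>i>card D. coeff (pm.F ?f D) i = 0)" if "finite D" for D
  using that
 proof (induction D rule: finite_induct)
  case empty
  then show ?case by (auto simp: coeff_pCons split: nat.split)
 next
  case (insert g D)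
  have "coeff (?f g * q) (Suc i) = - actA g h * coeff q (Suc i) + coeff q i" for q i
   by simp
  moreover have "coeff (pm.F ?f D) (Suc i) = 0" if "card D \<le> i" for i using insert.IH that by simp
  ultimately show ?case using insert by (auto simp: less_Suc_eq_0_disj Suc_less_eq2)
 qed
 have inv: "coeff ?Q i \<in> invA" for i
 proof -
  have "actA k (coeff ?Q i) = coeff ?Q i" if k: "k \<in> grp" for k
  proof -
   have hom: "map_poly (actA k) (p * q) = map_poly (actA k) p * map_poly (actA k) q" for p q
    by (rule poly_eqI) (simp add: coeff_map_poly actA_zero[OF k] coeff_mult actA_sum[OF k] actA_mult[OF k])
   have one: "map_poly (actA k) [:oneA:] = [:oneA:]"
    by (rule poly_eqI) (auto simp: coeff_map_poly actA_zero[OF k] actA_one[OF k] coeff_pCons split: nat.split)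
   have fac: "map_poly (actA k) (?f g) = ?f (k \<otimes> g)" if "g \<in> grp" for g
    using that by (intro poly_eqI) (auto simp: coeff_map_poly actA_zero[OF k] actA_one[OF k] actA_minus[OF k]
      group_act_mult[OF k] coeff_pCons split: nat.split)
   have "map_poly (actA k) (pm.F ?f D) = pm.F (\<lambda>g. ?f (k \<otimes> g)) D" if "finite D" "D \<subseteq> grp" for D
    using that
   proof (induction D rule: finite_induct)
    case (insert g D)
    then have gD: "g \<in> grp" "D \<subseteq> grp" by simp_all
    show ?case by (simp only: pm.insert[OF insert(1,2)] hom fac[OF gD(1)] insert.IH[OF gD(2)])
   qed (simp only: pm.empty one)
   then have "map_poly (actA k) ?Q = pm.F (\<lambda>g. ?f (k \<otimes> g)) grp" using finite_\<Gamma> by blast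
   also have "\<dots> = ?Q"
    by (rule pm.reindex_bij_witness[of _ "\<lambda>g. inv k \<otimes> g" "\<lambda>g. k \<otimes> g"]) (use k in \<open>simp_all add: m_assoc[symmetric]\<close>)
   finally show ?thesis using coeff_map_poly[of "actA k" ?Q i] by (simp only: actA_zero[OF k])
  qed
  then show ?thesis by (simp add: invA_def)
 qed
 let ?N = "card grp"
 have "degree ?Q \<le> ?N" using monic[OF finite_\<Gamma>] by (intro degree_le) blast
 then have "(\<Sum>i<Suc ?N. coeff ?Q i * ((*) h ^^ i) oneA) = poly ?Q h" using poly_via_powers[of ?Q "Suc ?N" h] by simp
 also have "\<dots> = 0"
  using pm.remove[OF finite_\<Gamma> one_closed, of ?f] by (simp add: group_act_one)
 finally show ?thesis using monic[OF finite_\<Gamma>] inv by blast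
qed

end

locale irreducible_map_rep =
 equivariant_maps sg br sA oneA \<Gamma> actg actA
 for sg :: "'k::{alg_closed_field, field_char_0} => 'g::ab_group_add => 'g"
  and br :: "'g => 'g => 'g"
  and sA :: "'k => 'a::comm_ring => 'a"
  and oneA :: 'a
  and \<Gamma> :: "('c, 'd) monoid_scheme" (structure)
  and actg :: "'c => 'g => 'g"
  and actA :: "'c => 'a => 'a" +
 fixes W :: "(('g => 'a => 'k) => 'k, 'i, 'k) rep"
 assumes perf: "perfect fscale tensor_bracket map_algebra"
  and irr: "irreducible_on_maps W"
begin

lemmas W_rep = is_repD[OF irreducible_repD(1)[OF irr]]

definition ker :: "(('g => 'a => 'k) => 'k) set" where
 "ker = {\<alpha> \<in> map_algebra. \<forall>v\<in>fst W. snd W \<alpha> v = 0}"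

lemma kerI: "\<alpha> \<in> map_algebra ==> (!!v. v \<in> fst W ==> snd W \<alpha> v = 0) ==> \<alpha> \<in> ker"
 unfolding ker_def by (intro CollectI conjI ballI)

lemma kerD: "\<alpha> \<in> ker ==> \<alpha> \<in> map_algebra" "\<alpha> \<in> ker ==> v \<in> fst W ==> snd W \<alpha> v = 0"
 by (simp_all add: ker_def)

lemma ker_subspace: "fs.subspace ker"
proof (rule fs.subspaceI)
 note M = map_algebra_subspace
 show "0 \<in> ker" by (rule kerI[OF fs.subspace_0[OF M] fsp.linear_on_zero[OF W_rep(4) M]])
 show "\<alpha> + \<beta> \<in> ker" if "\<alpha> \<in> ker" "\<beta> \<in> ker" for \<alpha> \<beta>
 proof (rule kerI)
  note m = kerD(1)[OF that(1)] kerD(1)[OF that(2)]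
  show "\<alpha> + \<beta> \<in> map_algebra" by (rule fs.subspace_add[OF M m])
  fix v assume v: "v \<in> fst W"
  show "snd W (\<alpha> + \<beta>) v = 0"
   by (simp only: linear_on_add[OF W_rep(4)[OF v] m] kerD(2)[OF that(1) v] kerD(2)[OF that(2) v] add_0_left)
 qed
 show "fscale c \<alpha> \<in> ker" if "\<alpha> \<in> ker" for c \<alpha>
 proof (rule kerI)
  note m = kerD(1)[OF that(1)]
  show "fscale c \<alpha> \<in> map_algebra" by (rule fs.subspace_scale[OF M m])
  fix v assume v: "v \<in> fst W"
  show "snd W (fscale c \<alpha>) v = 0"
   by (simp only: linear_on_scale[OF W_rep(4)[OF v] m] kerD(2)[OF that(1) v] fs.scale_zero_right)
 qed
qed

lemma ker_bracket:
 assumes \<alpha>: "\<alpha> \<in> ker" and \<beta>: "\<beta> \<in> map_algebra"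
 shows "tensor_bracket \<alpha> \<beta> \<in> ker"
proof (rule kerI[OF map_algebra_bracket[OF kerD(1)[OF \<alpha>] \<beta>]])
 fix v assume v: "v \<in> fst W"
 show "snd W (tensor_bracket \<alpha> \<beta>) v = 0"
  by (simp only: W_rep(5)[OF kerD(1)[OF \<alpha>] \<beta> v] kerD(2)[OF \<alpha> v] kerD(2)[OF \<alpha> W_rep(6)[OF \<beta> v]]
    fsp.linear_on_zero[OF W_rep(7)[OF \<beta>] W_rep(2)] diff_zero)
qed

text \<open>The commutators being in the kernel, the ideal acts by commuting operators.\<close>

lemma ideal_in_ker:
 assumes J: "J \<subseteq> map_algebra" "!!j a. j \<in> J ==> a \<in> map_algebra ==> tensor_bracket j a \<in> J"
  and comm: "!!i j. i \<in> J ==> j \<in> J ==> tensor_bracket i j \<in> ker"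
 shows "J \<subseteq> ker"
proof
 fix j assume j: "j \<in> J"
 have c: "snd W i (snd W j v) = snd W j (snd W i v)" if "i \<in> J" "j \<in> J" "v \<in> fst W" for i j v
 proof -
  have "i \<in> map_algebra" "j \<in> map_algebra" using J(1) that by (auto dest: subsetD)
  then have "snd W i (snd W j v) - snd W j (snd W i v) = 0"
   by (simp only: W_rep(5)[OF _ _ that(3), symmetric] kerD(2)[OF comm[OF that(1,2)] that(3)])
  then show ?thesis by (simp only: right_minus_eq)
 qed
 show "j \<in> ker"
 proof (rule kerI)
  show "j \<in> map_algebra" using J(1) j by (rule subsetD)
  fix v assume v: "v \<in> fst W"
  show "snd W j v = 0"
   by (rule perfect_abelian_ideal_acts_trivially[OF vector_space_fscale map_algebra_subspace perf map_algebra_bracket irr J c j v])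
 qed
qed

text \<open>
  The products of kernel elements with an invariant function form an ideal whose commutators with the
  whole algebra lie in the kernel, because the function can be moved to the other entry of a bracket.
\<close>

lemma ker_amul:
 assumes a: "a \<in> invA" and \<alpha>: "\<alpha> \<in> ker" shows "amul a \<alpha> \<in> ker"
proof -
 have "amul a ` ker \<subseteq> ker"
 proof (rule ideal_in_ker)
  show "amul a ` ker \<subseteq> map_algebra"
  proof (rule image_subsetI)
   fix \<beta> assume "\<beta> \<in> ker"
   then show "amul a \<beta> \<in> map_algebra" by (rule amul_map_algebra[OF a kerD(1)])
  qed
  fix j m assume "j \<in> amul a ` ker" and m: "m \<in> map_algebra"
  then obtain \<beta> where j: "j = amul a \<beta>" and \<beta>: "\<beta> \<in> ker" by (elim imageE)
  note T = map_algebraD(1)[OF kerD(1)[OF \<beta>]] map_algebraD(1)[OF m]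
  show "tensor_bracket j m \<in> amul a ` ker"
   unfolding j amul_bracket(1)[OF T] by (rule imageI[OF ker_bracket[OF \<beta> m]])
 next
  fix i j assume "i \<in> amul a ` ker" "j \<in> amul a ` ker"
  then obtain \<beta> \<gamma> where i: "i = amul a \<beta>" "\<beta> \<in> ker" and j: "j = amul a \<gamma>" "\<gamma> \<in> ker" by (elim imageE)
  have m: "amul a \<gamma> \<in> map_algebra" by (rule amul_map_algebra[OF a kerD(1)[OF j(2)]])
  note T = map_algebraD(1)[OF kerD(1)[OF i(2)]] map_algebraD(1)[OF m]
  show "tensor_bracket i j \<in> ker"
   unfolding i(1) j(1) amul_bracket(1)[OF T] amul_bracket(2)[OF T, symmetric]
   by (rule ker_bracket[OF i(2) amul_map_algebra[OF a m]])
 qed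
 then show ?thesis using imageI[OF \<alpha>, of "amul a"] by (rule subsetD)
qed

text \<open>
  The largest ideal of functions \<open>f\<close> such that all averages of \<open>u \<otimes> f\<close> act by zero. It is introduced
  because the kernel itself need not be a module over all functions.
\<close>

definition ann :: "'a set" where
 "ann = {f. \<forall>u a. rey (tens u (a * f)) \<in> ker}"

lemma annI: "(!!u a. rey (tens u (a * f)) \<in> ker) ==> f \<in> ann"
 unfolding ann_def by (intro CollectI allI)

lemma annD: "f \<in> ann ==> rey (tens u (a * f)) \<in> ker" "f \<in> ann ==> rey (tens u f) \<in> ker"
 unfolding ann_def by (elim CollectE allE, assumption) (metis (mono_tags) A_one(1) mem_Collect_eq)

lemma ann_ideal: "aideal ann"
 unfolding aideal_def
proof (intro conjI allI ballI A.subspaceI)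
 have "rey (tens u (a * 0)) \<in> ker" for u a
 proof -
  have e: "tens u (a * 0) = fscale 0 (tens u 0)" using tens_bilinear(4)[of u 0 0] by simp
  show ?thesis unfolding e rey_scale by (simp only: fs.scale_zero_left fs.subspace_0[OF ker_subspace])
 qed
 then show "0 \<in> ann" by (rule annI)
 show "f + f' \<in> ann" if "f \<in> ann" "f' \<in> ann" for f f'
  by (rule annI) (simp only: distrib_left tens_bilinear rey_add fs.subspace_add[OF ker_subspace] annD(1)[OF that(1)] annD(1)[OF that(2)])
 show "sA c f \<in> ann" if "f \<in> ann" for c f
  by (rule annI) (simp only: A_mult_scale tens_bilinear rey_scale fs.subspace_scale[OF ker_subspace] annD(1)[OF that])
 show "a * f \<in> ann" if "f \<in> ann" for a f
  by (rule annI) (simp only: mult.assoc[symmetric] annD(1)[OF that])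
qed

lemma ann_act:
 assumes g: "g \<in> grp" and f: "f \<in> ann" shows "actA g f \<in> ann"
proof (rule annI)
 fix u a
 have e: "tensor_act g (tens (actg (inv g) u) (actA (inv g) a * f)) = tens u (a * actA g f)"
  using g group_act_mult(2)[of g "inv g" a] by (simp add: tensor_act_tens actg_inv actA_mult group_act_one)
 show "rey (tens u (a * actA g f)) \<in> ker"
  using annD(1)[OF f] rey_act[OF g tens_in, of "actg (inv g) u" "actA (inv g) a * f"] unfolding e by metis
qed

lemma rey_tspan_ann: "q \<in> tspan ann ==> rey q \<in> ker"
 by (induction rule: tspan_induct)
  (simp_all only: annD(2) rey_add rey_scale fs.subspace_add[OF ker_subspace] fs.subspace_scale[OF ker_subspace]
   fsp.linear_on_zero[OF rey_linear fs.subspace_UNIV] fs.subspace_0[OF ker_subspace])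

text \<open>
  The averages of the \<open>u \<otimes> s\<close> span an ideal, and the bracket of two of them is a sum of averages of
  \<open>[u, v] \<otimes> s (g \<cdot> t)\<close>, which act by zero.
\<close>

lemma ann_absorb:
 assumes S: "!!a s. s \<in> S ==> a * s \<in> S" "!!g s. g \<in> grp ==> s \<in> S ==> actA g s \<in> S"
  and sq: "!!s t. s \<in> S ==> t \<in> S ==> s * t \<in> ann"
 shows "S \<subseteq> ann"
proof -
 have "rey ` tspan S \<subseteq> ker"
 proof (rule ideal_in_ker)
  show "rey ` tspan S \<subseteq> map_algebra"
  proof (rule image_subsetI)
   fix q assume "q \<in> tspan S"
   then show "rey q \<in> map_algebra" by (rule rey_in[OF tspan_in_tensor])
  qed
  fix j m assume "j \<in> rey ` tspan S" and m: "m \<in> map_algebra"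
  then obtain q where j: "j = rey q" and q: "q \<in> tspan S" by (elim imageE)
  have S': "s * t \<in> S" if "s \<in> S" for s t using S(1)[OF that, of t] by (simp only: mult.commute)
  have "tensor_bracket q m \<in> tspan S"
   by (rule tspan_bracket[OF _ q, where S' = UNIV]) (simp_all only: S' tspan_UNIV map_algebraD(1)[OF m])
  then show "tensor_bracket j m \<in> rey ` tspan S"
   unfolding j rey_bracket(2)[OF m tspan_in_tensor[OF q]] by (rule imageI)
 next
  fix i j assume "i \<in> rey ` tspan S" "j \<in> rey ` tspan S"
  then obtain q q' where i: "i = rey q" "q \<in> tspan S" and j: "j = rey q'" "q' \<in> tspan S" by (elim imageE)
  show "tensor_bracket i j \<in> ker"
   unfolding i(1) j(1) rey_bracket(2)[OF rey_in[OF tspan_in_tensor[OF j(2)]] tspan_in_tensor[OF i(2)]]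
   by (rule rey_tspan_ann[OF tspan_bracket[OF sq i(2) tspan_rey[OF S(2) j(2)]]])
 qed
 then have k: "rey (tens u s) \<in> ker" if "s \<in> S" for u s using imageI[OF tspan_base[OF that], of rey] by (rule subsetD)
 show ?thesis
 proof
  fix s assume "s \<in> S"
  then show "s \<in> ann" by (intro annI k S(1))
 qed
qed

text \<open>
  The products of the translates of \<open>f\<close> over a nonempty set \<open>D\<close> of group elements lie in the annihilator,
  by downward induction on the size of \<open>D\<close>: two such products over different sets of the same size have
  a product divisible by one over a larger set, and over the same set by the square of a translate.
\<close>

lemma ann_square:
 assumes f: "f * f \<in> ann" shows "f \<in> ann"
proof -
 define p where "p D = mu.F (\<lambda>g. actA g f) D" for D
 have p_act: "actA k (p D) = p ((\<lambda>g. k \<otimes> g) ` D)" if k: "k \<in> grp" and D: "D \<subseteq> grp" for k D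
 proof -
  have "inj_on (\<lambda>g. k \<otimes> g) D" using k D by (auto simp: inj_on_def subset_iff)
  then have "p ((\<lambda>g. k \<otimes> g) ` D) = mu.F (\<lambda>g. actA (k \<otimes> g) f) D" by (simp add: p_def mu.reindex o_def)
  also have "\<dots> = mu.F (\<lambda>g. actA k (actA g f)) D"
   by (rule mu.cong[OF refl]) (use k D in \<open>auto simp: group_act_mult\<close>)
  finally show ?thesis using actA_prod[OF k finite_subset[OF D finite_\<Gamma>]] by (simp add: p_def)
 qed
 have "p D \<in> ann" if "D \<subseteq> grp" "D ~= {}" for D
  using that
 proof (induction "card grp - card D" arbitrary: D rule: less_induct)
  case less
  let ?t = "\<lambda>g. (\<lambda>h. g \<otimes> h) ` D"
  define S where "S = {a * p (?t g) | a g. g \<in> grp}"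
  have t: "?t g \<subseteq> grp" "card (?t g) = card D" "?t g ~= {}" "finite (?t g)" if "g \<in> grp" for g
   using that less.prems by (auto simp: inj_on_def subset_iff intro!: card_image intro: finite_subset[OF _ finite_\<Gamma>])
  have "S \<subseteq> ann"
  proof (rule ann_absorb)
   show "a * s \<in> S" if "s \<in> S" for a s
   proof -
    obtain b g where "g \<in> grp" "s = b * p (?t g)" using `s \<in> S` unfolding S_def by blast
    then show ?thesis unfolding S_def by (intro CollectI exI[of _ "a * b"] exI[of _ g]) (simp add: mult.assoc)
   qed
   show "actA k s \<in> S" if k: "k \<in> grp" and "s \<in> S" for k s
   proof -
    obtain a g where g: "g \<in> grp" "s = a * p (?t g)" using `s \<in> S` unfolding S_def by blast
    have "(\<lambda>h. k \<otimes> h) ` ?t g = ?t (k \<otimes> g)"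
     unfolding image_image using k g(1) less.prems(1) by (intro image_cong refl) (auto simp: m_assoc)
    then have "actA k s = actA k a * p (?t (k \<otimes> g))"
     using p_act[OF k t(1)[OF g(1)]] by (simp add: g(2) actA_mult[OF k])
    then show ?thesis unfolding S_def using m_closed[OF k g(1)] by blast
   qed
   fix s s' assume "s \<in> S" "s' \<in> S"
   then obtain a g a' g' where g: "g \<in> grp" "s = a * p (?t g)" and g': "g' \<in> grp" "s' = a' * p (?t g')"
    unfolding S_def by blast
   have "p (?t g) * p (?t g') \<in> ann"
   proof (cases "?t g = ?t g'")
    case True
    obtain e where e: "e \<in> ?t g" using t(3)[OF g(1)] by blast
    have "p (?t g) = actA e f * mu.F (\<lambda>g. actA g f) (?t g - {e})"
     unfolding p_def by (rule mu.remove[OF t(4)[OF g(1)] e])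
    then have eq: "p (?t g) * p (?t g') = (mu.F (\<lambda>g. actA g f) (?t g - {e}) * mu.F (\<lambda>g. actA g f) (?t g - {e})) * actA e (f * f)"
     using e t(1)[OF g(1)] unfolding True[symmetric] by (simp add: actA_mult subset_iff mult_ac)
    show ?thesis
     unfolding eq by (rule aidealD(5)[OF ann_ideal ann_act[OF _ f]]) (use e t(1)[OF g(1)] in blast)
   next
    case False
    have "card (?t g) < card (?t g \<union> ?t g')"
    proof (rule psubset_card_mono)
     show "finite (?t g \<union> ?t g')" using t(4) g(1) g'(1) by blast
     have "\<not> ?t g' \<subseteq> ?t g"
      using False card_subset_eq[OF t(4)[OF g(1)], of "?t g'"] t(2)[OF g(1)] t(2)[OF g'(1)] by metis
     then show "?t g \<subset> ?t g \<union> ?t g'" by blast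
    qed
    moreover have "card (?t g \<union> ?t g') \<le> card grp"
     by (rule card_mono[OF finite_\<Gamma>]) (use t(1)[OF g(1)] t(1)[OF g'(1)] in blast)
    ultimately have "p (?t g \<union> ?t g') \<in> ann"
     using less.prems t(1)[OF g(1)] t(1)[OF g'(1)] t(2)[OF g(1)] by (intro less.hyps) auto
    moreover have "p (?t g) * p (?t g') = p (?t g \<inter> ?t g') * p (?t g \<union> ?t g')"
     using mu.union_inter[OF t(4)[OF g(1)] t(4)[OF g'(1)], of "\<lambda>g. actA g f"] by (simp add: p_def mult.commute)
    ultimately show ?thesis by (simp add: aidealD(5)[OF ann_ideal])
   qed
   moreover have "s * s' = (a * a') * (p (?t g) * p (?t g'))" by (simp add: g(2) g'(2) mult_ac)
   ultimately show "s * s' \<in> ann" by (simp only: aidealD(5)[OF ann_ideal])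
  qed
  moreover have "?t \<one> = D" using less.prems(1) by (force simp: subset_iff)
  then have "oneA * p D \<in> S" unfolding S_def by (intro CollectI exI[of _ oneA] exI[of _ \<one>]) simp
  ultimately show ?case by auto
 qed
 from this[of "{\<one>}"] show ?thesis by (simp add: p_def group_act_one)
qed

lemma ker_if_spanning:
 assumes B: "fs.span B = fst W" and \<alpha>: "\<alpha> \<in> map_algebra" "!!v. v \<in> B ==> snd W \<alpha> v = 0"
 shows "\<alpha> \<in> ker"
proof (rule kerI[OF \<alpha>(1)])
 have "fs.span B \<subseteq> {v \<in> fst W. snd W \<alpha> v = 0}"
 proof (rule fs.span_minimal[OF subsetI fsp.linear_on_kernel_subspace[OF W_rep(7)[OF \<alpha>(1)] W_rep(2)]])
  fix v assume v: "v \<in> B"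
  show "v \<in> {v \<in> fst W. snd W \<alpha> v = 0}" using fs.span_base[OF v] \<alpha>(2)[OF v] unfolding B by (intro CollectI conjI)
 qed
 then show "snd W \<alpha> v = 0" if "v \<in> fst W" for v using that unfolding B by (blast dest: subsetD)
qed

lemma invA_subspace: "A.subspace invA"
 by (rule A.subspaceI) (auto simp: invA_def actA_hom actA_zero)

text \<open>
  Modulo the annihilator there are only finitely many linearly independent invariant functions: they
  act on the finite-dimensional quotient by the kernel, and those acting as \<open>0\<close> are in the annihilator.
\<close>

lemma ann_finite_codim:
 "\<exists>G. finite G & G \<subseteq> invA & (\<forall>a\<in>invA. \<exists>y\<in>A.span G. a - y \<in> ann)"
proof -
 obtain B where B: "finite B" "fs.span B = fst W" using W_rep(1) unfolding finite_dim_def by blast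
 have BW: "v \<in> fst W" if "v \<in> B" for v using fs.span_base[OF that] unfolding B(2) .
 have "\<exists>F. finite F & F \<subseteq> map_algebra & (\<forall>\<alpha>\<in>map_algebra. \<exists>\<beta>\<in>fs.span F. \<forall>v\<in>B. snd W (\<alpha> - \<beta>) v = 0)"
 proof (rule fsp.finite_codim_common_kernel[OF B(1) map_algebra_subspace _ W_rep(1), of "\<lambda>v \<alpha>. snd W \<alpha> v"])
  fix v assume v: "v \<in> B"
  show "flinear map_algebra (\<lambda>\<alpha>. snd W \<alpha> v)" by (rule W_rep(4)[OF BW[OF v]])
  show "(\<lambda>\<alpha>. snd W \<alpha> v) ` map_algebra \<subseteq> fst W" by (rule image_subsetI) (rule W_rep(6)[OF _ BW[OF v]])
 qed
 then obtain F where F: "finite F" "F \<subseteq> map_algebra"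
  and F': "\<forall>\<alpha>\<in>map_algebra. \<exists>\<beta>\<in>fs.span F. \<forall>v\<in>B. snd W (\<alpha> - \<beta>) v = 0" by (elim exE conjE)
 have FM: "fs.span F \<subseteq> map_algebra" by (rule fs.span_minimal[OF F(2) map_algebra_subspace])
 interpret Ap: vector_space_pair sA "fscale :: 'k => ('i => 'k) => _"
  by (intro vector_space_pair.intro vector_space_fscale A.vector_space_axioms)
 let ?\<phi> = "\<lambda>(m, v) a. snd W (amul a m) v"
 have "\<exists>G. finite G & G \<subseteq> invA & (\<forall>a\<in>invA. \<exists>y\<in>A.span G. \<forall>j\<in>F \<times> B. ?\<phi> j (a - y) = 0)"
 proof (rule Ap.finite_codim_common_kernel[OF finite_cartesian_product[OF F(1) B(1)] invA_subspace _ W_rep(1), of ?\<phi>])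
  fix j assume "j \<in> F \<times> B"
  then obtain m v where j: "j = (m, v)" and m: "m \<in> map_algebra" and v: "v \<in> fst W" using F(2) BW by blast
  note mT = map_algebraD(1)[OF m]
  show "linear_on sA fscale invA (?\<phi> j)"
   unfolding linear_on_def j prod.case
   by (intro conjI ballI allI) (simp_all only: amul_left[OF mT] linear_on_add[OF W_rep(4)[OF v]]
     linear_on_scale[OF W_rep(4)[OF v]] amul_map_algebra[OF _ m])
  show "?\<phi> j ` invA \<subseteq> fst W"
   unfolding j prod.case by (rule image_subsetI) (rule W_rep(6)[OF amul_map_algebra[OF _ m] v])
 qed
 then obtain G where G: "finite G" "G \<subseteq> invA"
  and G': "\<forall>a\<in>invA. \<exists>y\<in>A.span G. \<forall>j\<in>F \<times> B. ?\<phi> j (a - y) = 0" by (elim exE conjE)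
 have "\<exists>y\<in>A.span G. a - y \<in> ann" if a: "a \<in> invA" for a
 proof -
  obtain y where y: "y \<in> A.span G" and y': "\<forall>j\<in>F \<times> B. ?\<phi> j (a - y) = 0" using bspec[OF G' a] by (elim bexE)
  have "y \<in> invA" using A.span_minimal[OF G(2) invA_subspace] y by (rule subsetD)
  then have c: "a - y \<in> invA" by (rule A.subspace_diff[OF invA_subspace a])
  let ?c = "a - y"
  have cF: "F \<subseteq> {m \<in> map_algebra. amul ?c m \<in> ker}"
  proof
   fix m assume m: "m \<in> F"
   have mM: "m \<in> map_algebra" using F(2) m by (rule subsetD)
   have "amul ?c m \<in> ker"
   proof (rule ker_if_spanning[OF B(2) amul_map_algebra[OF c mM]])
    fix v assume "v \<in> B"
    then show "snd W (amul ?c m) v = 0" using bspec[OF y', of "(m, v)"] m by simp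
   qed
   then show "m \<in> {m \<in> map_algebra. amul ?c m \<in> ker}" using mM by blast
  qed
  have "fs.subspace {m \<in> map_algebra. amul ?c m \<in> ker}"
  proof (rule fs.subspaceI)
   have "amul ?c 0 = 0" by (rule fsp.linear_on_zero[OF amul_linear fs.subspace_UNIV])
   then show "0 \<in> {m \<in> map_algebra. amul ?c m \<in> ker}"
    using fs.subspace_0[OF map_algebra_subspace] fs.subspace_0[OF ker_subspace] by (simp only: mem_Collect_eq simp_thms)
  qed (simp_all only: mem_Collect_eq amul_add amul_scale fs.subspace_add[OF map_algebra_subspace] fs.subspace_add[OF ker_subspace]
    fs.subspace_scale[OF map_algebra_subspace] fs.subspace_scale[OF ker_subspace] simp_thms)
  note cS = subsetD[OF fs.span_minimal[OF cF this]]
  have "?c \<in> ann"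
  proof (rule annI)
   fix u b
   have m: "rey (tens u b) \<in> map_algebra" by (rule rey_in[OF tens_in])
   obtain \<beta> where \<beta>: "\<beta> \<in> fs.span F" and z: "\<forall>v\<in>B. snd W (rey (tens u b) - \<beta>) v = 0"
    using bspec[OF F' m] by (elim bexE)
   note d = fs.subspace_diff[OF map_algebra_subspace m subsetD[OF FM \<beta>]]
   have "amul ?c (rey (tens u b) - \<beta>) \<in> ker" by (rule ker_amul[OF c ker_if_spanning[OF B(2) d bspec[OF z]]])
   moreover have "amul ?c \<beta> \<in> ker" using cS[OF \<beta>] by blast
   ultimately have "amul ?c (rey (tens u b) - \<beta>) + amul ?c \<beta> \<in> ker" by (rule fs.subspace_add[OF ker_subspace])
   then have "amul ?c (rey (tens u b)) \<in> ker" by (simp only: amul_add[symmetric] diff_add_cancel)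
   then show "rey (tens u (b * ?c)) \<in> ker"
    by (simp only: rey_amul[OF c tens_in, symmetric] amul_tens mult.commute)
  qed
  then show ?thesis using y by blast
 qed
 then show ?thesis using G by blast
qed

text \<open>
  The annihilator contains no power of \<open>f\<close>, and an ideal maximal with this property is prime.
\<close>

lemma prime_ideal_avoiding:
 assumes f: "f \<notin> ann"
 shows "\<exists>P. aideal P & ann \<subseteq> P & f \<notin> P & oneA \<notin> P & (\<forall>a b. a * b \<in> P --> a \<in> P \<or> b \<in> P)"
proof -
 define pw where "pw n = ((*) f ^^ n) oneA" for n
 have pw0: "pw 0 = oneA" and pwS: "pw (Suc n) = f * pw n" for n by (simp_all add: pw_def)
 have pw_add: "pw (m + n) = pw m * pw n" for m n by (induction m) (simp_all add: pw0 pwS mult.assoc)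
 have pw_ann: "pw n \<notin> ann" for n
 proof (induction n)
  case 0
  then show ?case using f aidealD(5)[OF ann_ideal, of oneA f] by (auto simp: pw0)
 next
  case (Suc n)
  show ?case
  proof (cases n)
   case 0
   then show ?thesis using f by (simp add: pwS pw0)
  next
   case (Suc k)
   have "pw n * pw n = pw k * pw (Suc n)" by (simp add: Suc pwS mult_ac)
   then show ?thesis using Suc.IH ann_square[of "pw n"] aidealD(5)[OF ann_ideal] by metis
  qed
 qed
 let ?\<A> = "{P. aideal P & ann \<subseteq> P & (\<forall>n. pw n \<notin> P)}"
 have "\<exists>M\<in>?\<A>. \<forall>X\<in>?\<A>. M \<subseteq> X --> X = M"
 proof (rule subset_Zorn_nonempty)
  show "?\<A> ~= {}" using ann_ideal pw_ann by blast
  fix \<C> assume C: "\<C> ~= {}" "subset.chain ?\<A> \<C>"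
  have C1: "!!X. X \<in> \<C> ==> X \<in> ?\<A>" and C2: "!!X Y. X \<in> \<C> ==> Y \<in> \<C> ==> X \<subseteq> Y \<or> Y \<subseteq> X"
   using C(2) unfolding subset.chain_def by blast+
  obtain X0 where X0: "X0 \<in> \<C>" using C(1) by blast
  have "aideal (\<Union>\<C>)"
   unfolding aideal_def
  proof (intro conjI allI ballI A.subspaceI)
   show "0 \<in> \<Union>\<C>" using X0 C1 aidealD(1) by blast
   show "p + q \<in> \<Union>\<C>" if pq: "p \<in> \<Union>\<C>" "q \<in> \<Union>\<C>" for p q
   proof -
    obtain X Y where XY: "X \<in> \<C>" "p \<in> X" "Y \<in> \<C>" "q \<in> Y" using pq by blast
    then obtain Z where Z: "Z \<in> \<C>" "p \<in> Z" "q \<in> Z" using C2[OF XY(1,3)] by blast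
    then show ?thesis using C1[OF Z(1)] aidealD(2) by blast
   qed
   show "sA c p \<in> \<Union>\<C>" if "p \<in> \<Union>\<C>" for c p using that C1 aidealD(4) by blast
   show "a * p \<in> \<Union>\<C>" if "p \<in> \<Union>\<C>" for a p using that C1 aidealD(5) by blast
  qed
  then show "\<Union>\<C> \<in> ?\<A>" using C1 X0 by blast
 qed
 then obtain P where P: "aideal P" "ann \<subseteq> P" "!!n. pw n \<notin> P"
  and max: "!!X. aideal X ==> ann \<subseteq> X ==> (!!n. pw n \<notin> X) ==> P \<subseteq> X ==> X = P" by auto
 have ext: "\<exists>n p r. p \<in> P & pw n = p + r * a" if a: "a \<notin> P" for a
 proof (rule ccontr)
  assume no: "\<not> ?thesis"
  let ?X = "{p + r * a | p r. p \<in> P}"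
  have "aideal ?X"
   unfolding aideal_def
  proof (intro conjI allI ballI A.subspaceI)
   have "0 = 0 + 0 * a" by simp
   then show "0 \<in> ?X" using aidealD(1)[OF P(1)] by blast
   show "y + z \<in> ?X" if "y \<in> ?X" "z \<in> ?X" for y z
   proof -
    obtain p r q t where "y = p + r * a" "z = q + t * a" "p \<in> P" "q \<in> P" using `y \<in> ?X` `z \<in> ?X` by blast
    then have "y + z = (p + q) + (r + t) * a" "p + q \<in> P"
     using aidealD(2)[OF P(1)] by (simp_all add: distrib_right add_ac)
    then show ?thesis by blast
   qed
   show "sA c y \<in> ?X" if "y \<in> ?X" for c y
   proof -
    obtain p r where "y = p + r * a" "p \<in> P" using `y \<in> ?X` by blast
    then have "sA c y = sA c p + sA c r * a" "sA c p \<in> P"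
     using aidealD(4)[OF P(1)] by (simp_all add: A.scale_right_distrib A_scale_mult)
    then show ?thesis by blast
   qed
   show "b * y \<in> ?X" if "y \<in> ?X" for b y
   proof -
    obtain p r where "y = p + r * a" "p \<in> P" using `y \<in> ?X` by blast
    then have "b * y = b * p + (b * r) * a" "b * p \<in> P"
     using aidealD(5)[OF P(1)] by (simp_all add: distrib_left mult.assoc)
    then show ?thesis by blast
   qed
  qed
  moreover have PX: "P \<subseteq> ?X"
  proof
   fix p assume "p \<in> P"
   moreover have "p = p + 0 * a" by simp
   ultimately show "p \<in> ?X" by blast
  qed
  ultimately have "?X = P" using no P(2) by (intro max) blast+
  moreover have "a = 0 + oneA * a" by simp
  then have "a \<in> ?X" using aidealD(1)[OF P(1)] by blast
  ultimately show False using a by blast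
 qed
 have prime: "a \<in> P \<or> b \<in> P" if ab: "a * b \<in> P" for a b
 proof (rule ccontr)
  assume "\<not> ?thesis"
  then obtain n p r m q t where n: "p \<in> P" "pw n = p + r * a" and m: "q \<in> P" "pw m = q + t * b"
   using ext[of a] ext[of b] by blast
  have "pw (n + m) = p * pw m + (r * a * q + (r * t) * (a * b))"
   unfolding pw_add by (simp add: n(2) m(2) distrib_left distrib_right mult_ac add_ac)
  then show False
   using P(3)[of "n + m"] aidealD(2,5,6)[OF P(1)] n(1) m(1) ab by metis
 qed
 have "f \<notin> P" using P(3)[of 1] by (simp add: pwS pw0)
 then show ?thesis using P prime P(3)[of 0] by (auto simp: pw0)
qed

text \<open>
  Such a prime ideal has residue field \<open>k\<close>: first the invariants become scalars, since they span a
  finite-dimensional space, and then every function does, being integral over the invariants.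
\<close>

lemma rational_point_avoiding:
 assumes f: "f \<notin> ann"
 shows "\<exists>x\<in>rational_points. (\<forall>h\<in>ann. x h = 0) & x f ~= 0"
proof -
 obtain P where P: "aideal P" "ann \<subseteq> P" "f \<notin> P" "oneA \<notin> P" and prime: "!!a b. a * b \<in> P ==> a \<in> P \<or> b \<in> P"
  using prime_ideal_avoiding[OF f] by blast
 note PD = aidealD[OF P(1)]
 obtain G where G: "finite G" "G \<subseteq> invA" "!!a. a \<in> invA ==> \<exists>y\<in>A.span G. a - y \<in> ann"
  using ann_finite_codim by blast
 have invP: "\<exists>c. a - sA c oneA \<in> P" if a: "a \<in> invA" for a
 proof -
  have "((*) a ^^ i) oneA \<in> invA" for i
   by (induction i) (use a in \<open>auto simp: invA_def actA_one actA_mult\<close>)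
  then have "\<forall>i. \<exists>y. y \<in> A.span G & ((*) a ^^ i) oneA - y \<in> ann" using G(3) by blast
  then obtain y where y: "!!i. y i \<in> A.span G" "!!i. ((*) a ^^ i) oneA - y i \<in> ann" by metis
  obtain n where "y n \<in> A.span (y ` {..<n})"
   using A.finite_dim_chain_dependent[of "A.span G" y] y(1) G(1) unfolding finite_dim_def by blast
  then obtain c where c: "y n = (\<Sum>i<n. sA (c i) (y i))" by (rule A.span_image_lessThan)
  let ?c = "\<lambda>i. if i < n then c i else - 1"
  have "(\<Sum>i<Suc n. sA (?c i) (((*) a ^^ i) oneA)) =
    (\<Sum>i<n. sA (c i) (((*) a ^^ i) oneA - y i)) - (((*) a ^^ n) oneA - y n)"
   by (simp add: c A.scale_right_diff_distrib sum_subtractf)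
  also have "\<dots> \<in> ann"
   by (intro aidealD(3)[OF ann_ideal] A.subspace_sum[OF aidealD(7)[OF ann_ideal]] aidealD(4)[OF ann_ideal] y(2))
  finally show ?thesis
   using P(2) by (intro algebraic_modulo_prime[OF P(1,4) prime, of ?c a "Suc n" n]) auto
 qed
 have "\<exists>c. h - sA c oneA \<in> P" for h
 proof -
  obtain a N where a: "!!i. a i \<in> invA" "a N = oneA" "(\<Sum>i<Suc N. a i * ((*) h ^^ i) oneA) = 0"
   using invariant_equation by blast
  obtain d where d: "!!i. a i - sA (d i) oneA \<in> P" using invP[OF a(1)] by metis
  define c where "c = d(N := 1)"
  have c: "a i - sA (c i) oneA \<in> P" for i using d a(2) PD(1) by (simp add: c_def)
  have "(\<Sum>i<Suc N. sA (c i) (((*) h ^^ i) oneA)) =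
    (\<Sum>i<Suc N. a i * ((*) h ^^ i) oneA) - (\<Sum>i<Suc N. (a i - sA (c i) oneA) * ((*) h ^^ i) oneA)"
   unfolding sum_subtractf[symmetric] by (rule sum.cong[OF refl]) (simp add: left_diff_distrib A_scale_mult)
  also have "\<dots> \<in> P" unfolding a(3) by (intro PD(3) PD(1) A.subspace_sum[OF PD(7)] PD(6) c)
  finally show ?thesis
   by (intro algebraic_modulo_prime[OF P(1,4) prime, of c h "Suc N" N]) (auto simp: c_def)
 qed
 then obtain x where x: "!!h. h - sA (x h) oneA \<in> P" by metis
 have uniq: "x h = c" if h: "h - sA c oneA \<in> P" for h c
 proof (rule ccontr)
  assume "x h ~= c"
  moreover have "sA (c - x h) oneA \<in> P"
   using PD(3)[OF x[of h] h] by (simp add: A.scale_left_diff_distrib)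
  then have "sA (1 / (c - x h)) (sA (c - x h) oneA) \<in> P" by (rule PD(4))
  ultimately show False using P(4) by simp
 qed
 have "x (h + h') = x h + x h'" for h h'
  by (rule uniq) (use PD(2)[OF x[of h] x[of h']] in \<open>simp add: A.scale_left_distrib algebra_simps\<close>)
 moreover have "x (sA c h) = c * x h" for c h
  by (rule uniq) (use PD(4)[OF x[of h], of c] in \<open>simp add: A.scale_right_diff_distrib\<close>)
 ultimately have lin: "Vector_Spaces.linear sA (*) x"
  unfolding Vector_Spaces.linear_iff using A.vector_space_axioms vector_space_mult by blast
 have mult: "x (h * h') = x h * x h'" for h h'
 proof (rule uniq)
  have "h * h' - sA (x h * x h') oneA = (h - sA (x h) oneA) * h' + sA (x h) (h' - sA (x h') oneA)"
   by (simp add: left_diff_distrib A_scale_mult A.scale_right_diff_distrib)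
  then show "h * h' - sA (x h * x h') oneA \<in> P" using PD(2)[OF PD(6)[OF x] PD(4)[OF x]] by simp
 qed
 have "x oneA = 1" by (rule uniq) (simp add: PD(1))
 then have "x \<in> rational_points" using lin mult by (simp add: rational_points_def)
 moreover have "x h = 0" if "h \<in> ann" for h by (rule uniq) (use that P(2) in auto)
 moreover have "x f ~= 0" using x[of f] P(3) by auto
 ultimately show ?thesis by blast
qed

text \<open>
  The annihilator consists of the functions that vanish at all rational points where it vanishes itself.
  Such points are in finitely many orbits, since they separate a finite-dimensional space of invariants;
  and a map vanishing at them has its coefficients in the annihilator.
\<close>

theorem kernel_determined_at_points:
 "\<exists>xs. finite xs & xs \<subseteq> rational_points & orbit_distinct xs &
   (\<forall>\<alpha>\<in>map_algebra. (\<forall>x\<in>xs. eval_at x \<alpha> = 0) --> \<alpha> \<in> ker)"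
proof -
 define X0 where "X0 = {x \<in> rational_points. \<forall>h\<in>ann. x h = 0}"
 obtain G where G: "finite G" "G \<subseteq> invA" "!!a. a \<in> invA ==> \<exists>y\<in>A.span G. a - y \<in> ann"
  using ann_finite_codim by blast
 let ?Q = "\<lambda>xs. finite xs & xs \<subseteq> X0 & orbit_distinct xs"
 \<comment> \<open>Invariants separating the orbits of `xs` are linearly independent modulo the annihilator.\<close>
 have bound: "card xs \<le> card G" if xs: "?Q xs" for xs
 proof -
  have r: "xs \<subseteq> rational_points" using xs by (auto simp: X0_def)
  have "\<exists>y. y \<in> A.span G & x y ~= 0 & (\<forall>z\<in>xs. z ~= x --> z y = 0)" if x: "x \<in> xs" for x
  proof -
   obtain a where a: "a \<in> invA" "x a ~= 0" "!!z. z \<in> xs ==> z ~= x ==> z a = 0"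
    using invariant_interpolation[OF _ r _ x] xs by blast
   obtain y where y: "y \<in> A.span G" "a - y \<in> ann" using G(3)[OF a(1)] by blast
   have "z y = z a" if z: "z \<in> xs" for z
    using xs z y(2) ratD(6)[of z a y] unfolding X0_def by auto
   then show ?thesis using a x y(1) by metis
  qed
  then obtain y where y: "!!x. x \<in> xs ==> y x \<in> A.span G" "!!x. x \<in> xs ==> x (y x) ~= 0"
   "!!x z. x \<in> xs ==> z \<in> xs ==> z ~= x ==> z (y x) = 0" by metis
  have inj: "inj_on y xs" using y(2,3) by (metis inj_onI)
  have "\<not> A.dependent (y ` xs)"
  proof
   assume "A.dependent (y ` xs)"
   then obtain x where x: "x \<in> xs" "y x \<in> A.span (y ` xs - {y x})" unfolding A.dependent_def by blast
   have xr: "x \<in> rational_points" using x(1) r by blast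
   have "A.span (y ` xs - {y x}) \<subseteq> {h. x h = 0}"
    by (rule A.span_minimal[OF _ A.subspaceI]) (use y(3) x(1) in \<open>auto simp: ratD[OF xr]\<close>)
   then show False using x y(2) by blast
  qed
  then have "card (y ` xs) \<le> card G" using A.independent_span_bound[OF G(1), of "y ` xs"] y(1) by blast
  then show ?thesis by (simp add: card_image[OF inj])
 qed
 have "?Q {}" by (simp add: orbit_distinct_def)
 moreover have "\<forall>ys. ?Q ys --> card ys < Suc (card G)"
 proof (intro allI impI)
  fix ys assume "?Q ys"
  then show "card ys < Suc (card G)" using bound[of ys] by (simp only: less_Suc_eq_le)
 qed
 ultimately have "\<exists>xs. ?Q xs & (\<forall>ys. ?Q ys --> card ys \<le> card xs)" by (rule ex_has_greatest_nat)
 then obtain xs where xs: "?Q xs" and max: "!!ys. ?Q ys ==> card ys \<le> card xs" by blast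
 have cover: "\<exists>y\<in>xs. x \<in> orb y" if x: "x \<in> X0" for x
 proof (rule ccontr)
  assume no: "\<not> ?thesis"
  then have xn: "x \<notin> xs" using orbit_refl by blast
  have "?Q (insert x xs)" using xs x no orbit_sym unfolding orbit_distinct_def by blast
  then show False using max[of "insert x xs"] xs xn by simp
 qed
 have r: "xs \<subseteq> rational_points" using xs by (auto simp: X0_def)
 have "\<alpha> \<in> ker" if \<alpha>: "\<alpha> \<in> map_algebra" and 0: "\<forall>x\<in>xs. eval_at x \<alpha> = 0" for \<alpha>
 proof -
  obtain F where F: "\<alpha> = (\<Sum>b\<in>basis. tens b (F b))" by (rule tensor_expansion[OF map_algebraD(1)[OF \<alpha>]])
  have "F b \<in> ann" if b: "b \<in> basis" for b
  proof (rule ccontr)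
   assume "F b \<notin> ann"
   then obtain x where x: "x \<in> rational_points" "\<forall>h\<in>ann. x h = 0" "x (F b) ~= 0"
    using rational_point_avoiding by blast
   then obtain y where y: "y \<in> xs" "x \<in> orb y" using cover by (auto simp: X0_def)
   obtain g where g: "g \<in> grp" "x = point_act g y" by (rule orbitE[OF y(2)])
   have yr: "y \<in> rational_points" using r y(1) by blast
   have "eval_at x \<alpha> = 0"
    unfolding g(2) eval_equivariant[OF g(1) yr \<alpha>] using 0 y(1) by (simp add: actg_zero[OF g(1)])
   then show False using eval_zero_coeffs[OF x(1) _ b] x(3) unfolding F by blast
  qed
  then have "(\<Sum>b\<in>basis. rey (tens b (F b))) \<in> ker" by (intro fs.subspace_sum[OF ker_subspace] annD(2))
  then show ?thesis using rey_fixed[OF \<alpha>] unfolding rey_sum[symmetric] F[symmetric] by simp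
 qed
 then show ?thesis using xs r by blast
qed

end

section \<open>Changing the factors of a tensor product\<close>

lemma sum_fun_upd_reindex:
 assumes \<sigma>: "bij_betw \<sigma> zs ys" shows "(\<Sum>x\<in>ys. F x) = (\<Sum>z\<in>zs. F (\<sigma> z))"
 using sum.reindex_bij_betw[OF \<sigma>, of F] by simp

lemma tensor_rep_reindex:
 fixes R S :: "'p => ('l::ab_group_add, 'i, 'k::field) rep"
 assumes fin: "finite ys" and \<sigma>: "bij_betw \<sigma> zs ys"
  and R: "!!x. x \<in> ys ==> irreducible_rep s br L (R x)" and S: "!!z. z \<in> zs ==> irreducible_rep s br L (S z)"
  and irr: "irreducible_rep s br L (tensor_rep ys R)" "irreducible_rep s br L (tensor_rep zs S)"
  and iso: "!!z. z \<in> zs ==> rep_iso L (R (\<sigma> z)) (S z)"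
 shows "rep_iso L (tensor_rep ys R) (tensor_rep zs S)"
proof -
 have finz: "finite zs" using bij_betw_finite[OF \<sigma>] fin by simp
 have \<sigma>y: "\<sigma> z \<in> ys" if "z \<in> zs" for z using \<sigma> that by (auto simp: bij_betw_def)
 have repR: "is_rep s br L (R x)" if "x \<in> ys" for x by (rule irreducible_repD(1)[OF R[OF that]])
 have repS: "is_rep s br L (S z)" if "z \<in> zs" for z by (rule irreducible_repD(1)[OF S[OF that]])
 let ?V = "\<lambda>z. fst (S z)" and ?p = "pure_tensor zs (\<lambda>z. fst (S z))"
 have "\<forall>z\<in>zs. \<exists>T. flinear (fst (R (\<sigma> z))) T & bij_betw T (fst (R (\<sigma> z))) (fst (S z)) &
   (\<forall>a\<in>L. \<forall>v\<in>fst (R (\<sigma> z)). T (snd (R (\<sigma> z)) a v) = snd (S z) a (T v))"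
  using iso unfolding rep_iso_def by (intro ballI)
 then obtain T where T0: "\<forall>z\<in>zs. flinear (fst (R (\<sigma> z))) (T z) &
   bij_betw (T z) (fst (R (\<sigma> z))) (fst (S z)) &
   (\<forall>a\<in>L. \<forall>v\<in>fst (R (\<sigma> z)). T z (snd (R (\<sigma> z)) a v) = snd (S z) a (T z v))"
  unfolding bchoice_iff by (elim exE)
 have T: "flinear (fst (R (\<sigma> z))) (T z)" "bij_betw (T z) (fst (R (\<sigma> z))) (fst (S z))"
   "!!a v. a \<in> L ==> v \<in> fst (R (\<sigma> z)) ==> T z (snd (R (\<sigma> z)) a v) = snd (S z) a (T z v)" if "z \<in> zs" for z
  using bspec[OF T0 that] by (elim conjE; assumption | elim conjE ballE; blast)+
 have TV: "T z v \<in> ?V z" if "z \<in> zs" "v \<in> fst (R (\<sigma> z))" for z v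
  using T(2)[OF that(1)] that(2) unfolding bij_betw_def by (blast dest: imageI)
 define w where "w v = (\<lambda>z\<in>zs. T z (v (\<sigma> z)))" for v :: "'p => 'i => 'k"
 have wz: "w v z = T z (v (\<sigma> z))" if "z \<in> zs" for v z using that by (simp only: w_def restrict_apply if_True)
 have w: "w v \<in> PiE zs ?V" if "v \<in> PiE ys (\<lambda>x. fst (R x))" for v
  unfolding w_def by (rule restrict_PiE_iff[THEN iffD2]) (intro ballI TV PiE_mem[OF that \<sigma>y])
 have upd: "w (v(\<sigma> z := u)) = (w v)(z := T z u)" if z: "z \<in> zs" for v z u
 proof
  fix z'
  have "\<sigma> z' = \<sigma> z \<longleftrightarrow> z' = z" if "z' \<in> zs"
   using \<sigma> z that by (auto simp: bij_betw_def inj_on_def)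
  then show "w (v(\<sigma> z := u)) z' = ((w v)(z := T z u)) z'"
   using z by (cases "z' \<in> zs") (auto simp: w_def)
 qed
 have "\<exists>u. u \<in> fst (R x) & u ~= 0" if "x \<in> ys" for x
   using irreducible_repD(2)[OF R[OF that]] fs.subspace_0[OF is_repD(2)[OF repR[OF that]]] by blast
 then obtain u where u: "!!x. x \<in> ys ==> u x \<in> fst (R x)" "!!x. x \<in> ys ==> u x ~= 0" by metis
 show ?thesis
 proof (rule tensor_rep_universal[OF fin repR irr, where \<mu> = "\<lambda>v. ?p (w v)"])
  show "multilinear fscale ys (\<lambda>x. fst (R x)) (\<lambda>v. ?p (w v))"
   unfolding multilinear_def
  proof (intro ballI)
   fix v x assume v: "v \<in> PiE ys (\<lambda>x. fst (R x))" and x: "x \<in> ys"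
   obtain z where z: "z \<in> zs" "x = \<sigma> z" using \<sigma> x by (auto simp: bij_betw_def)
   note pm = pure_tensor_multilinear[of zs ?V]
   show "flinear (fst (R x)) (\<lambda>u. ?p (w (v(x := u))))"
    unfolding z(2) upd[OF z(1)] linear_on_def
    by (intro conjI ballI allI) (simp_all only: linear_on_add[OF T(1)[OF z(1)]] linear_on_scale[OF T(1)[OF z(1)]]
      multilinear_add[OF pm w[OF v] z(1) TV[OF z(1)] TV[OF z(1)]] multilinear_scale[OF pm w[OF v] z(1) TV[OF z(1)]])
  qed
  show "?p (w v) \<in> fst (tensor_rep zs S)" if "v \<in> PiE ys (\<lambda>x. fst (R x))" for v
   unfolding tensor_rep_def fst_conv by (rule pure_in_tensor[OF w[OF that]])
  show "snd (tensor_rep zs S) a (?p (w v)) = (\<Sum>x\<in>ys. ?p (w (v(x := snd (R x) a (v x)))))"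
   if a: "a \<in> L" and v: "v \<in> PiE ys (\<lambda>x. fst (R x))" for a v
  proof -
   have "snd (tensor_rep zs S) a (?p (w v)) = (\<Sum>z\<in>zs. ?p ((w v)(z := snd (S z) a (w v z))))"
    by (rule tensor_rep_pure[OF finz _ a w[OF v]]) (rule repS)
   also have "\<dots> = (\<Sum>z\<in>zs. ?p (w (v(\<sigma> z := snd (R (\<sigma> z)) a (v (\<sigma> z))))))"
    by (rule sum.cong[OF refl]) (simp only: upd wz T(3)[OF _ a PiE_mem[OF v \<sigma>y]])
   finally show ?thesis unfolding sum_fun_upd_reindex[OF \<sigma>] .
  qed
  let ?u = "\<lambda>x\<in>ys. u x"
  show u': "?u \<in> PiE ys (\<lambda>x. fst (R x))" by (rule restrict_PiE_iff[THEN iffD2]) (intro ballI u(1))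
  show "?p (w ?u) ~= 0"
  proof (rule pure_tensor_nonzero[OF finz _ w[OF u']])
   show "finite_dim fscale (fst (S z))" if "z \<in> zs" for z by (rule is_repD(1)[OF repS[OF that]])
   fix z assume z: "z \<in> zs"
   have "T z 0 = 0" by (rule fsp.linear_on_zero[OF T(1)[OF z] is_repD(2)[OF repR[OF \<sigma>y[OF z]]]])
   then have "T z (u (\<sigma> z)) ~= 0"
    using inj_onD[OF bij_betw_imp_inj_on[OF T(2)[OF z]], of "u (\<sigma> z)" 0] u[OF \<sigma>y[OF z]]
     fs.subspace_0[OF is_repD(2)[OF repR[OF \<sigma>y[OF z]]]] by metis
   then show "w ?u z ~= 0" using \<sigma>y[OF z] unfolding wz[OF z] by simp
  qed
 qed
qed

text \<open>
  Functionals on the trivial factors give a multilinear map to the tensor product of the others. It is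
  equivariant because an element acting in a trivial factor produces a zero argument.
\<close>

lemma tensor_rep_drop_trivial:
 fixes R :: "'p => ('l::ab_group_add, 'i, 'k::field) rep"
 assumes fin: "finite xs" and ys: "ys \<subseteq> xs"
  and R: "!!x. x \<in> xs ==> irreducible_rep s br L (R x)"
  and triv: "!!x a v. x \<in> xs - ys ==> a \<in> L ==> v \<in> fst (R x) ==> snd (R x) a v = 0"
  and irr: "irreducible_rep s br L (tensor_rep xs R)" "irreducible_rep s br L (tensor_rep ys R)"
 shows "rep_iso L (tensor_rep xs R) (tensor_rep ys R)"
proof -
 have finy: "finite ys" by (rule finite_subset[OF ys fin])
 have rep: "is_rep s br L (R x)" if "x \<in> xs" for x by (rule irreducible_repD(1)[OF R[OF that]])
 have repy: "is_rep s br L (R x)" if "x \<in> ys" for x using rep ys that by blast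
 have "\<exists>u. u \<in> fst (R x) & u ~= 0" if "x \<in> xs" for x
  using irreducible_repD(2)[OF R[OF that]] fs.subspace_0[OF is_repD(2)[OF rep[OF that]]] by blast
 then obtain u where u: "!!x. x \<in> xs ==> u x \<in> fst (R x)" "!!x. x \<in> xs ==> u x ~= 0" by metis
 have "\<exists>l. linear_on fscale (*) (fst (R x)) l & l (u x) ~= 0" if "x \<in> xs" for x
  by (rule linear_functional_nonzero[OF is_repD(1)[OF rep[OF that]] u[OF that]]) (rule exI, rule conjI)
 then have "\<forall>x\<in>xs. \<exists>l. linear_on fscale (*) (fst (R x)) l & l (u x) ~= 0" by (intro ballI)
 then obtain l where l0: "\<forall>x\<in>xs. linear_on fscale (*) (fst (R x)) (l x) & l x (u x) ~= 0"
  unfolding bchoice_iff by (elim exE)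
 note l = bspec[OF l0, THEN conjunct1] bspec[OF l0, THEN conjunct2]
 let ?V = "\<lambda>x. fst (R x)" and ?p = "pure_tensor ys (\<lambda>x. fst (R x))"
 define c where "c v = (\<Prod>x\<in>xs - ys. l x (v x))" for v
 define \<mu> where "\<mu> v = fscale (c v) (?p (restrict v ys))" for v
 have r: "restrict v ys \<in> PiE ys ?V" if v: "v \<in> PiE xs ?V" for v
  by (rule restrict_PiE_iff[THEN iffD2], rule ballI, rule PiE_mem[OF v subsetD[OF ys]])
 have c_in: "c (v(x := w)) = c v" if "x \<in> ys" for v x w
  unfolding c_def by (rule prod.cong[OF refl]) (use that in auto)
 have r_in: "restrict (v(x := w)) ys = (restrict v ys)(x := w)" if "x \<in> ys" for v x w
  using that by (auto simp: restrict_def fun_eq_iff)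
 have c_out: "c (v(x := w)) = l x w * (\<Prod>y\<in>xs - ys - {x}. l y (v y))" if x: "x \<in> xs - ys" for v x w
 proof -
  have "c (v(x := w)) = l x w * (\<Prod>y\<in>xs - ys - {x}. l y ((v(x := w)) y))"
   unfolding c_def using prod.remove[of "xs - ys" x "\<lambda>y. l y ((v(x := w)) y)"] fin x by simp
  also have "(\<Prod>y\<in>xs - ys - {x}. l y ((v(x := w)) y)) = (\<Prod>y\<in>xs - ys - {x}. l y (v y))"
   by (rule prod.cong[OF refl]) simp
  finally show ?thesis .
 qed
 have r_out: "restrict (v(x := w)) ys = restrict v ys" if "x \<in> xs - ys" for v x w
  using that by (auto simp: restrict_def fun_eq_iff)
 note pm = pure_tensor_multilinear[of ys ?V]
 have ml: "multilinear fscale xs ?V \<mu>"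
  unfolding multilinear_def
 proof (intro ballI)
  fix v x assume v: "v \<in> PiE xs ?V" and x: "x \<in> xs"
  show "flinear (?V x) (\<lambda>w. \<mu> (v(x := w)))"
  proof (cases "x \<in> ys")
   case True
   show ?thesis
    unfolding \<mu>_def c_in[OF True] r_in[OF True] linear_on_def
    by (intro conjI ballI allI) (simp_all only: multilinear_add[OF pm r[OF v] True] multilinear_scale[OF pm r[OF v] True]
      fs.scale_right_distrib fs.scale_scale mult.commute)
  next
   case False
   then have x': "x \<in> xs - ys" using x by blast
   show ?thesis
    unfolding \<mu>_def c_out[OF x'] r_out[OF x'] linear_on_def
    by (intro conjI ballI allI) (simp_all only: linear_on_add[OF l(1)[OF x]] linear_on_scale[OF l(1)[OF x]]
      distrib_right fs.scale_left_distrib fs.scale_scale mult.assoc)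
  qed
 qed
 show ?thesis
 proof (rule tensor_rep_universal[OF fin rep irr ml])
  show "\<mu> v \<in> fst (tensor_rep ys R)" if "v \<in> PiE xs ?V" for v
   unfolding tensor_rep_def fst_conv \<mu>_def by (rule fs.subspace_scale[OF subspace_tensor pure_in_tensor[OF r[OF that]]])
  show "snd (tensor_rep ys R) a (\<mu> v) = (\<Sum>x\<in>xs. \<mu> (v(x := snd (R x) a (v x))))"
   if a: "a \<in> L" and v: "v \<in> PiE xs ?V" for a v
  proof -
   have out: "\<mu> (v(x := snd (R x) a (v x))) = 0" if x: "x \<in> xs - ys" for x
   proof -
    have xx: "x \<in> xs" using x by blast
    show ?thesis unfolding triv[OF x a PiE_mem[OF v xx]] by (rule multilinear_zero[OF ml v xx is_repD(2)[OF rep[OF xx]]])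
   qed
   have "(\<Sum>x\<in>xs. \<mu> (v(x := snd (R x) a (v x)))) = (\<Sum>x\<in>ys. \<mu> (v(x := snd (R x) a (v x))))"
    by (rule sum.mono_neutral_right[OF fin ys]) (intro ballI out)
   also have "\<dots> = (\<Sum>x\<in>ys. fscale (c v) (?p ((restrict v ys)(x := snd (R x) a (restrict v ys x)))))"
    by (rule sum.cong[OF refl]) (simp only: \<mu>_def c_in r_in restrict_apply if_True)
   also have "\<dots> = snd (tensor_rep ys R) a (\<mu> v)"
   proof -
    have "snd (tensor_rep ys R) a (?p (restrict v ys)) = (\<Sum>x\<in>ys. ?p ((restrict v ys)(x := snd (R x) a (restrict v ys x))))"
     by (rule tensor_rep_pure[OF finy _ a r[OF v]]) (rule repy)
    then show ?thesis by (simp only: \<mu>_def linear_on_scale[OF tensor_rep_linear[of UNIV] UNIV_I] fs.scale_sum_right)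
   qed
   finally show ?thesis by (rule sym)
  qed
  let ?u = "\<lambda>x\<in>xs. u x"
  show u': "?u \<in> PiE xs ?V" by (rule restrict_PiE_iff[THEN iffD2]) (intro ballI u(1))
  have uy: "restrict ?u ys x = u x" if "x \<in> ys" for x using that ys by (auto simp: restrict_def)
  have "?p (restrict ?u ys) ~= 0"
   by (rule pure_tensor_nonzero[OF finy is_repD(1)[OF repy] r[OF u']]) (use u(2) uy ys in auto)
  moreover have "c ?u ~= 0" unfolding c_def using fin l(2) by (auto simp: prod_zero_iff)
  ultimately show "\<mu> ?u ~= 0" unfolding \<mu>_def by (simp only: fs.scale_eq_0_iff simp_thms)
 qed
qed

lemma trivial_irreducible:
 assumes "vector_space s"
 shows "irreducible_rep s br L (UNIV :: (unit => 'k::field) set, \<lambda>_ _. 0)"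
proof -
 have z: "w = fscale (w ()) (\<lambda>_. 1)" for w :: "unit => 'k" by (simp add: fscale_apply fun_eq_iff)
 have sp: "fs.span {\<lambda>_::unit. 1 :: 'k} = UNIV"
 proof (rule UNIV_eq_I[symmetric])
  fix v :: "unit => 'k"
  have "fscale (v ()) (\<lambda>_::unit. 1 :: 'k) \<in> fs.span {\<lambda>_::unit. 1 :: 'k}" by (rule fs.span_scale[OF fs.span_base[OF singletonI]])
  then show "v \<in> fs.span {\<lambda>_::unit. 1 :: 'k}" by (simp only: z[of v, symmetric])
 qed
 have "is_rep s br L (UNIV :: (unit => 'k) set, \<lambda>_ _. 0)"
  unfolding is_rep_iff
 proof (intro conjI ballI)
  show "finite_dim fscale (UNIV :: (unit => 'k) set)" unfolding finite_dim_def using sp by (intro exI[of _ "{\<lambda>_. 1}"]) simp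
  show "endo fscale (UNIV :: (unit => 'k) set) (\<lambda>_. 0)"
   unfolding endo_def linear_on_def by (intro conjI ballI allI subset_UNIV) (simp_all only: fs.scale_zero_right add_0_left)
  show "linear_on s fscale L (\<lambda>a. 0 :: unit => 'k)"
   unfolding linear_on_def by (intro conjI ballI allI) (simp_all only: fs.scale_zero_right add_0_left)
 qed (simp only: diff_self)
 moreover have "(UNIV :: (unit => 'k) set) ~= {0}"
 proof
  assume "(UNIV :: (unit => 'k) set) = {0}"
  then have "(\<lambda>_::unit. 1 :: 'k) = 0" by blast
  then have "(1 :: 'k) = 0" using fun_cong[of "\<lambda>_::unit. 1 :: 'k" 0 "()"] by (simp only: zero_fun_apply)
  then show False by simp
 qed
 moreover have "W = {0} \<or> W = UNIV" if W: "fs.subspace W" for W :: "(unit => 'k) set"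
 proof (rule disjCI)
  assume "W ~= UNIV"
  have "w = 0" if w: "w \<in> W" for w
  proof (rule ccontr)
   assume "w ~= 0"
   then have nz: "w () ~= 0" by (auto simp: fun_eq_iff)
   have "v \<in> W" for v
   proof -
    have "v = fscale (v () / w ()) w" using nz by (simp add: fscale_apply fun_eq_iff)
    then show ?thesis using fs.subspace_scale[OF W w] by metis
   qed
   then show False using `W ~= UNIV` by blast
  qed
  then show "W = {0}" using fs.subspace_0[OF W] by blast
 qed
 ultimately show ?thesis unfolding irreducible_rep_def fst_conv by blast
qed

lemma rep_iso_cong:
 assumes "fst R = fst S" "!!a v. a \<in> L ==> v \<in> fst R ==> snd R a v = snd S a v"
 shows "rep_iso L R S"
 unfolding rep_iso_def
 by (rule exI[of _ "\<lambda>v. v"]) (use assms in \<open>simp add: linear_on_def bij_betw_def\<close>)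

section \<open>Evaluation representations\<close>

context equivariant_maps
begin

definition pullback :: "('a => 'k) => ('g, 'i, 'k) rep => (('g => 'a => 'k) => 'k, 'i, 'k) rep" where
 "pullback x R = (fst R, \<lambda>\<alpha>. snd R (eval_at x \<alpha>))"

lemma eval_rep_eq: "eval_rep xs R = tensor_rep xs (\<lambda>x. pullback x (R x))"
 unfolding eval_rep_def tensor_rep_def pullback_def fst_conv snd_conv
 by (intro arg_cong2[where f = Pair] refl ext) (simp only: tensor_rep_action_def)

lemma pullback_simps: "fst (pullback x R) = fst R" "snd (pullback x R) \<alpha> = snd R (eval_at x \<alpha>)"
 by (simp_all add: pullback_def)

lemma pullback_is_rep:
 assumes x: "x \<in> rational_points" and R: "rep_at x R"
 shows "rep_of_maps (pullback x R)"
proof -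
 note RD = is_repD[OF R]
 note E = eval_in_isotropy[OF x] and T = map_algebraD(1)
 show ?thesis
  unfolding pullback_def is_rep_iff
 proof (intro conjI ballI)
  show "finite_dim fscale (fst R)" by (rule RD(1))
  show "endo fscale (fst R) (snd R (eval_at x \<alpha>))" if "\<alpha> \<in> map_algebra" for \<alpha> by (rule RD(3)[OF E[OF that]])
  show "flinear map_algebra (\<lambda>\<alpha>. snd R (eval_at x \<alpha>) v)" if v: "v \<in> fst R" for v
   unfolding linear_on_def
   by (intro conjI ballI allI) (simp_all only: linear_on_add[OF eval_linear[OF x] T T] linear_on_scale[OF eval_linear[OF x] T]
     linear_on_add[OF RD(4)[OF v] E E] linear_on_scale[OF RD(4)[OF v] E])
  show "snd R (eval_at x (tensor_bracket \<alpha> \<beta>)) v =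
    snd R (eval_at x \<alpha>) (snd R (eval_at x \<beta>) v) - snd R (eval_at x \<beta>) (snd R (eval_at x \<alpha>) v)"
   if "\<alpha> \<in> map_algebra" "\<beta> \<in> map_algebra" "v \<in> fst R" for \<alpha> \<beta> v
   unfolding eval_bracket[OF x T[OF that(1)] T[OF that(2)]] by (rule RD(5)[OF E[OF that(1)] E[OF that(2)] that(3)])
 qed
qed

lemma eval_onto:
 assumes x: "x \<in> rational_points" and u: "u \<in> isotropy_algebra x"
 obtains \<alpha> where "\<alpha> \<in> map_algebra" "eval_at x \<alpha> = u"
 using evaluation_surjective[of "{x}" x u] x u by (auto simp: orbit_distinct_def)

lemma pullback_irreducible:
 assumes x: "x \<in> rational_points" and R: "irreducible_at x R"
 shows "irreducible_on_maps (pullback x R)"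
 unfolding irreducible_rep_def
proof (intro conjI allI impI)
 note RD = irreducible_repD[OF R]
 show "rep_of_maps (pullback x R)" by (rule pullback_is_rep[OF x RD(1)])
 show "fst (pullback x R) ~= {0}" unfolding pullback_simps by (rule RD(2))
 fix W assume W: "fs.subspace W & W \<subseteq> fst (pullback x R) & (\<forall>a\<in>map_algebra. snd (pullback x R) a ` W \<subseteq> W)"
 show "W = {0} \<or> W = fst (pullback x R)"
  unfolding pullback_simps
 proof (rule RD(3))
  show "fs.subspace W" "W \<subseteq> fst R" using W by (auto simp: pullback_simps)
  fix u v assume u: "u \<in> isotropy_algebra x" and v: "v \<in> W"
  obtain \<alpha> where \<alpha>: "\<alpha> \<in> map_algebra" "eval_at x \<alpha> = u" by (rule eval_onto[OF x u])
  show "snd R u v \<in> W" using W \<alpha> v by (auto simp: pullback_simps)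
 qed
qed

lemma pullback_iso_iff:
 assumes x: "x \<in> rational_points"
 shows "rep_iso map_algebra (pullback x R) (pullback x R') \<longleftrightarrow> rep_iso (isotropy_algebra x) R R'"
proof -
 have "(\<forall>a\<in>map_algebra. \<forall>v\<in>fst R. T (snd R (eval_at x a) v) = snd R' (eval_at x a) (T v)) \<longleftrightarrow>
   (\<forall>u\<in>isotropy_algebra x. \<forall>v\<in>fst R. T (snd R u v) = snd R' u (T v))" for T
  using eval_in_isotropy[OF x] eval_onto[OF x] by metis
 then show ?thesis by (simp only: rep_iso_def pullback_simps)
qed

lemma rep_zero:
 assumes "rep_at x R" "v \<in> fst R" shows "snd R 0 v = 0"
proof -
 have pair: "vector_space_pair sg (fscale :: 'k => ('e => 'k) => _)"
  by (intro vector_space_pair.intro vector_space_fscale vs)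
 show ?thesis by (rule vector_space_pair.linear_on_zero[OF pair is_repD(4)[OF assms] isotropy_subspace])
qed

lemma pullback_separated:
 assumes xs: "finite xs" "xs \<subseteq> rational_points" "orbit_distinct xs" and x: "x \<in> xs" and \<alpha>: "\<alpha> \<in> map_algebra"
 shows "\<exists>\<beta>\<in>map_algebra. eval_at x \<beta> = eval_at x \<alpha> & (\<forall>y\<in>xs - {x}. eval_at y \<beta> = 0)"
 using evaluation_surjective[OF xs x eval_in_isotropy[OF subsetD[OF xs(2) x] \<alpha>]] by blast

lemma eval_rep_irreducible:
 assumes xs: "finite xs" "xs \<subseteq> rational_points" "orbit_distinct xs"
  and R: "!!x. x \<in> xs ==> irreducible_at x (R x)"
 shows "irreducible_on_maps (eval_rep xs R)"
 unfolding eval_rep_eq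
proof (rule tensor_rep_irreducible[OF vector_space_fscale map_algebra_subspace map_algebra_bracket xs(1)])
 show "irreducible_on_maps (pullback x (R x))" if "x \<in> xs" for x
  by (rule pullback_irreducible[OF subsetD[OF xs(2) that] R[OF that]])
 show "separated map_algebra xs (\<lambda>x. pullback x (R x))"
  unfolding separated_def pullback_simps
 proof (intro ballI)
  fix x \<alpha> assume "x \<in> xs" "\<alpha> \<in> map_algebra"
  then obtain \<beta> where b: "\<beta> \<in> map_algebra" "eval_at x \<beta> = eval_at x \<alpha>" "\<forall>y\<in>xs - {x}. eval_at y \<beta> = 0"
   using pullback_separated[OF xs] by blast
  have "snd (R y) (eval_at y \<beta>) v = 0" if y: "y \<in> xs - {x}" and v: "v \<in> fst (R y)" for y v
   unfolding bspec[OF b(3) y] by (rule rep_zero[OF irreducible_repD(1)[OF R] v]) (use y in blast)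
  then show "\<exists>a'\<in>map_algebra. (\<forall>v\<in>fst (R x). snd (R x) (eval_at x a') v = snd (R x) (eval_at x \<alpha>) v) &
    (\<forall>y\<in>xs - {x}. \<forall>v\<in>fst (R y). snd (R y) (eval_at y a') v = 0)"
   by (intro bexI[OF _ b(1)] conjI ballI) (simp_all only: b(2))
 qed
qed

subsection \<open>The group action on classes\<close>

text \<open>
  The class action on representatives: precomposition with the inverse turns a representation of the
  isotropy algebra at \<open>x\<close> into one at \<open>g \<cdot> x\<close>.
\<close>

definition twist :: "'c => ('g, 'i, 'k) rep => ('g, 'i, 'k) rep" where
 "twist g R = (fst R, \<lambda>u. snd R (actg (inv g) u))"

lemma twist_simps: "fst (twist g R) = fst R" "snd (twist g R) u = snd R (actg (inv g) u)"
 by (simp_all add: twist_def)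

lemma class_act_eq: "class_act g C = twist g ` C"
 by (simp add: class_act_def twist_def case_prod_unfold)

lemma twist_mult: "g \<in> grp ==> h \<in> grp ==> twist (g \<otimes> h) R = twist g (twist h R)"
 by (simp add: twist_def inv_mult_group group_act_mult)

lemma twist_one: "twist \<one> R = R"
 by (simp add: twist_def group_act_one)

lemma isotropy_act:
 assumes g: "g \<in> grp" and u: "u \<in> isotropy_algebra x"
 shows "actg g u \<in> isotropy_algebra (point_act g x)"
proof -
 have "actg h (actg g u) = actg g u" if h: "h \<in> stab (point_act g x)" for h
 proof -
  have hc: "h \<in> grp" and hx: "point_act h (point_act g x) = point_act g x"
   using h by (auto simp: stabilizer_def)
  let ?k = "inv g \<otimes> (h \<otimes> g)"
  have "point_act ?k x = x" using g hc hx by (simp add: point_act_mult point_act_inv)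
  then have "?k \<in> stab x" using g hc by (simp add: stabilizer_def)
  then have "actg ?k u = u" using u by (simp add: isotropy_algebra_def fixed_subalgebra_def)
  then have "actg g (actg ?k u) = actg g u" by simp
  then show ?thesis using g hc by (simp add: group_act_mult actg_inv)
 qed
 then show ?thesis by (simp add: isotropy_algebra_def fixed_subalgebra_def)
qed

lemma isotropy_act_inv:
 assumes g: "g \<in> grp" and u: "u \<in> isotropy_algebra (point_act g x)"
 shows "actg (inv g) u \<in> isotropy_algebra x"
 using isotropy_act[of "inv g" u "point_act g x"] g u by (simp add: point_act_inv)

lemma twist_is_rep:
 assumes g: "g \<in> grp" and R: "rep_at x R"
 shows "rep_at (point_act g x) (twist g R)"
proof -
 note RD = is_repD[OF R] and E = isotropy_act_inv[OF g]
 have i: "inv g \<in> grp" using g by simp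
 show ?thesis
  unfolding twist_def is_rep_iff
 proof (intro conjI ballI)
  show "finite_dim fscale (fst R)" by (rule RD(1))
  show "endo fscale (fst R) (snd R (actg (inv g) u))" if "u \<in> isotropy_algebra (point_act g x)" for u
   by (rule RD(3)[OF E[OF that]])
  show "linear_on sg fscale (isotropy_algebra (point_act g x)) (\<lambda>u. snd R (actg (inv g) u) v)" if v: "v \<in> fst R" for v
   unfolding linear_on_def
   by (intro conjI ballI allI) (simp_all only: actg_hom[OF i] linear_on_add[OF RD(4)[OF v] E E] linear_on_scale[OF RD(4)[OF v] E])
  show "snd R (actg (inv g) (br a b)) v =
    snd R (actg (inv g) a) (snd R (actg (inv g) b) v) - snd R (actg (inv g) b) (snd R (actg (inv g) a) v)"
   if "a \<in> isotropy_algebra (point_act g x)" "b \<in> isotropy_algebra (point_act g x)" "v \<in> fst R" for a b v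
   unfolding actg_br[OF i] by (rule RD(5)[OF E[OF that(1)] E[OF that(2)] that(3)])
 qed
qed

lemma twist_iso:
 assumes g: "g \<in> grp" and R: "rep_iso (isotropy_algebra x) R R'"
 shows "rep_iso (isotropy_algebra (point_act g x)) (twist g R) (twist g R')"
proof -
 obtain T where T: "flinear (fst R) T" "bij_betw T (fst R) (fst R')"
   "\<forall>u\<in>isotropy_algebra x. \<forall>v\<in>fst R. T (snd R u v) = snd R' u (T v)" using R unfolding rep_iso_def by (elim exE conjE)
 show ?thesis
  unfolding rep_iso_def twist_simps
  by (intro exI[of _ T] conjI ballI T(1,2)) (rule bspec[OF bspec[OF T(3) isotropy_act_inv[OF g]]])
qed

lemma twist_inv: "g \<in> grp ==> twist (inv g) (twist g R) = R" "g \<in> grp ==> twist g (twist (inv g) R) = R"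
 by (simp_all add: twist_mult[symmetric] twist_one)

lemma twist_irreducible:
 assumes g: "g \<in> grp" and R: "irreducible_at x R"
 shows "irreducible_at (point_act g x) (twist g R)"
 unfolding irreducible_rep_def
proof (intro conjI allI impI)
 note RD = irreducible_repD[OF R]
 show "rep_at (point_act g x) (twist g R)" by (rule twist_is_rep[OF g RD(1)])
 show "fst (twist g R) ~= {0}" unfolding twist_simps by (rule RD(2))
 fix W assume W: "fs.subspace W & W \<subseteq> fst (twist g R) & (\<forall>a\<in>isotropy_algebra (point_act g x). snd (twist g R) a ` W \<subseteq> W)"
 show "W = {0} \<or> W = fst (twist g R)"
  unfolding twist_simps
 proof (rule RD(3))
  show "fs.subspace W" "W \<subseteq> fst R" using W by (auto simp: twist_simps)
  fix u v assume u: "u \<in> isotropy_algebra x" and v: "v \<in> W"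
  have "snd (twist g R) (actg g u) v \<in> W" using W isotropy_act[OF g u] v by blast
  then show "snd R u v \<in> W" using g by (simp add: twist_simps actg_inv)
 qed
qed

lemma class_act_rep_class:
 assumes g: "g \<in> grp"
 shows "class_act g (rep_class sg br (isotropy_algebra x) R) = rep_class sg br (isotropy_algebra (point_act g x)) (twist g R)"
proof (rule Set.set_eqI)
 fix S
 have i: "inv g \<in> grp" using g by simp
 show "S \<in> class_act g (rep_class sg br (isotropy_algebra x) R) \<longleftrightarrow>
   S \<in> rep_class sg br (isotropy_algebra (point_act g x)) (twist g R)"
 proof
  assume "S \<in> class_act g (rep_class sg br (isotropy_algebra x) R)"
  then show "S \<in> rep_class sg br (isotropy_algebra (point_act g x)) (twist g R)"
   unfolding class_act_eq rep_class_def using twist_is_rep[OF g] twist_iso[OF g] by blast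
 next
  assume S: "S \<in> rep_class sg br (isotropy_algebra (point_act g x)) (twist g R)"
  have "twist (inv g) S \<in> rep_class sg br (isotropy_algebra x) R"
   using S twist_is_rep[OF i, of "point_act g x" S] twist_iso[OF i, of "point_act g x" "twist g R" S]
   unfolding rep_class_def by (simp add: point_act_inv[OF g] twist_inv[OF g])
  then show "S \<in> class_act g (rep_class sg br (isotropy_algebra x) R)"
   unfolding class_act_eq using twist_inv(2)[OF g, of S] by (metis imageI)
 qed
qed

lemma class_act_trivial:
 assumes "g \<in> grp"
 shows "class_act g (trivial_class sg br (isotropy_algebra x)) = trivial_class sg br (isotropy_algebra (point_act g x))"
 unfolding trivial_class_def class_act_rep_class[OF assms] by (simp add: twist_def)

subsection \<open>Equivariant class functions\<close>

lemma class_functionD: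
 assumes "\<Psi> \<in> equivariant_class_functions"
 shows "!!x. x \<in> rational_points ==> \<Psi> x \<in> irr_classes sg br (isotropy_algebra x)" "finite (class_support \<Psi>)"
  "!!g x. g \<in> grp ==> x \<in> rational_points ==> \<Psi> (point_act g x) = class_act g (\<Psi> x)"
  "!!x. x \<notin> rational_points ==> \<Psi> x = undefined"
 using assms unfolding equivariant_class_functions_def point_classes_def by (auto simp: PiE_iff extensional_def)

lemma support_orbit:
 assumes \<Psi>: "\<Psi> \<in> equivariant_class_functions" and y: "y \<in> class_support \<Psi>" and o: "y \<in> orb x" and x: "x \<in> rational_points"
 shows "x \<in> class_support \<Psi>"
proof -
 obtain g where g: "g \<in> grp" "y = point_act g x" by (rule orbitE[OF o])
 show ?thesis
 proof (rule ccontr)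
  assume "x \<notin> class_support \<Psi>"
  then have "\<Psi> x = trivial_class sg br (isotropy_algebra x)" using x by (simp add: class_support_def)
  then have "\<Psi> y = trivial_class sg br (isotropy_algebra y)"
   by (simp only: g(2) class_functionD(3)[OF \<Psi> g(1) x] class_act_trivial[OF g(1)])
  then show False using y by (simp add: class_support_def)
 qed
qed

text \<open>
  By equivariance, evaluating at \<open>g \<cdot> x\<close> and applying \<open>g\<inverse>\<close> is evaluating at \<open>x\<close>.
\<close>

lemma pullback_orbit_iso:
 assumes \<Psi>: "\<Psi> \<in> equivariant_class_functions" and x: "x \<in> rational_points" and g: "g \<in> grp"
  and R: "R \<in> \<Psi> x" and S: "S \<in> \<Psi> (point_act g x)"
 shows "rep_iso map_algebra (pullback x R) (pullback (point_act g x) S)"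
proof -
 note gx = point_act_rational[OF g x]
 note C = class_functionD(1)[OF \<Psi> gx]
 have T: "twist g R \<in> \<Psi> (point_act g x)" unfolding class_functionD(3)[OF \<Psi> g x] class_act_eq by (rule imageI[OF R])
 have "rep_iso (isotropy_algebra (point_act g x)) (twist g R) S"
  using S irr_classes_elem(2)[OF C T] by (simp add: rep_class_def)
 then have "rep_iso map_algebra (pullback (point_act g x) (twist g R)) (pullback (point_act g x) S)"
  unfolding pullback_iso_iff[OF gx] .
 moreover have "rep_iso map_algebra (pullback x R) (pullback (point_act g x) (twist g R))"
  by (rule rep_iso_cong) (simp_all only: pullback_simps twist_simps eval_equivariant[OF g x] actg_inv[OF g])
 ultimately show ?thesis by (rule rep_iso_trans[rotated])
qed

text \<open>An isomorphism with the trivial representation transports the zero action.\<close>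

lemma trivial_class_acts_zero:
 assumes "R \<in> trivial_class sg br (isotropy_algebra x)" "u \<in> isotropy_algebra x" "v \<in> fst R"
 shows "snd R u v = 0"
proof -
 obtain T where T: "flinear (UNIV :: (unit => 'k) set) T" "bij_betw T (UNIV :: (unit => 'k) set) (fst R)"
   "\<forall>a\<in>isotropy_algebra x. \<forall>v\<in>UNIV. T 0 = snd R a (T v)"
  using assms(1) unfolding trivial_class_def rep_class_def rep_iso_def fst_conv snd_conv by blast
 obtain w where w: "v = T w" using T(2) assms(3) unfolding bij_betw_def by blast
 have "T 0 = 0" by (rule fsp.linear_on_zero[OF T(1) fs.subspace_UNIV])
 then show ?thesis using T(3) assms(2) unfolding w by (metis UNIV_I)
qed

text \<open>
  The class attached to \<open>\<Psi>\<close> can be computed from any orbit-distinct set of points that meets all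
  orbits in the support: further points contribute tensor factors on which the algebra acts by \<open>0\<close>.
\<close>

theorem ev_class_cover:
 assumes \<Psi>: "\<Psi> \<in> equivariant_class_functions"
  and xs: "finite xs" "xs \<subseteq> rational_points" "orbit_distinct xs"
  and cover: "!!y. y \<in> class_support \<Psi> ==> \<exists>x\<in>xs. y \<in> orb x"
  and R: "!!x. x \<in> xs ==> R x \<in> \<Psi> x"
 shows "ev_class \<Psi> = rep_class fscale tensor_bracket map_algebra (eval_rep xs R)"
proof -
 let ?Y = "class_support \<Psi>"
 have Yr: "?Y \<subseteq> rational_points" by (auto simp: class_support_def)
 have irrR: "irreducible_at x S" if "S \<in> \<Psi> x" "x \<in> rational_points" for S x
  by (rule irr_classes_elem(1)[OF class_functionD(1)[OF \<Psi> that(2)] that(1)])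
 define ys where "ys = xs \<inter> ?Y"
 have ys: "finite ys" "ys \<subseteq> xs" "ys \<subseteq> ?Y" "ys \<subseteq> rational_points" using xs(1) Yr by (auto simp: ys_def)
 have ysd: "orbit_distinct ys" using xs(3) ys(2) unfolding orbit_distinct_def by blast
 have cover_y: "\<exists>x\<in>ys. y \<in> orb x" if y: "y \<in> ?Y" for y
 proof -
  obtain x where x: "x \<in> xs" "y \<in> orb x" using cover[OF y] by blast
  then have "x \<in> ?Y" using support_orbit[OF \<Psi> y x(2)] xs(2) by blast
  then show ?thesis using x by (auto simp: ys_def)
 qed
 have irrx: "irreducible_on_maps (eval_rep xs R)"
  by (rule eval_rep_irreducible[OF xs irrR[OF R]]) (use xs(2) in blast)+
 have irry: "irreducible_on_maps (eval_rep ys R)"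
  by (rule eval_rep_irreducible[OF ys(1,4) ysd irrR[OF R]]) (use ys in blast)+
 have iso1: "rep_iso map_algebra (eval_rep xs R) (eval_rep ys R)"
  unfolding eval_rep_eq
 proof (rule tensor_rep_drop_trivial[OF xs(1) ys(2) _ _ irrx[unfolded eval_rep_eq] irry[unfolded eval_rep_eq]])
  show "irreducible_on_maps (pullback x (R x))" if "x \<in> xs" for x
   by (rule pullback_irreducible[OF _ irrR[OF R[OF that]]]) (use that xs(2) in blast)+
  fix x \<alpha> v assume x: "x \<in> xs - ys" and \<alpha>: "\<alpha> \<in> map_algebra" and v: "v \<in> fst (pullback x (R x))"
  have xr: "x \<in> rational_points" using x xs(2) by blast
  have "\<Psi> x = trivial_class sg br (isotropy_algebra x)" using x xr by (auto simp: ys_def class_support_def)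
  then have "R x \<in> trivial_class sg br (isotropy_algebra x)" using R[of x] x by blast
  then show "snd (pullback x (R x)) \<alpha> v = 0"
   using trivial_class_acts_zero[OF _ eval_in_isotropy[OF xr \<alpha>]] v unfolding pullback_simps by blast
 qed
 have key: "rep_class fscale tensor_bracket map_algebra (eval_rep zs S) =
   rep_class fscale tensor_bracket map_algebra (eval_rep xs R)"
  if tr: "orbit_transversal ?Y zs" and S: "\<forall>z\<in>zs. S z \<in> \<Psi> z" for zs S
 proof -
  have zs: "zs \<subseteq> ?Y" and uniq: "!!y. y \<in> ?Y ==> \<exists>!z. z \<in> zs & z \<in> orb y"
   using tr unfolding orbit_transversal_def by blast+
  have zr: "zs \<subseteq> rational_points" using zs Yr by blast
  have zfin: "finite zs" by (rule finite_subset[OF zs class_functionD(2)[OF \<Psi>]])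
  have zd: "orbit_distinct zs"
   unfolding orbit_distinct_def using uniq zs orbit_refl by (metis subsetD)
  have irrz: "irreducible_on_maps (eval_rep zs S)"
   by (rule eval_rep_irreducible[OF zfin zr zd irrR]) (use S zr in blast)+
  have "\<forall>z\<in>zs. \<exists>x. x \<in> ys & z \<in> orb x" using cover_y zs by blast
  then obtain \<sigma> where \<sigma>0: "\<forall>z\<in>zs. \<sigma> z \<in> ys & z \<in> orb (\<sigma> z)" unfolding bchoice_iff by (elim exE)
  note \<sigma> = bspec[OF \<sigma>0, THEN conjunct1] bspec[OF \<sigma>0, THEN conjunct2]
  have "inj_on \<sigma> zs"
  proof (rule inj_onI)
   fix z z' assume z: "z \<in> zs" "z' \<in> zs" "\<sigma> z = \<sigma> z'"
   have "z' \<in> orb z" by (rule orbit_trans[OF orbit_sym[OF \<sigma>(2)[OF z(1)]]]) (use \<sigma>(2)[OF z(2)] z(3) in simp)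
   then show "z = z'" by (rule orbit_distinctD[OF zd z(1,2), symmetric])
  qed
  moreover have "ys \<subseteq> \<sigma> ` zs"
  proof
   fix y assume y: "y \<in> ys"
   then obtain z where z: "z \<in> zs" "z \<in> orb y" using uniq ys(3) by blast
   have "\<sigma> z \<in> orb y" by (rule orbit_trans[OF z(2) orbit_sym[OF \<sigma>(2)[OF z(1)]]])
   then have "\<sigma> z = y" by (rule orbit_distinctD[OF ysd y \<sigma>(1)[OF z(1)]])
   then show "y \<in> \<sigma> ` zs" using z(1) by blast
  qed
  ultimately have bij: "bij_betw \<sigma> zs ys" using \<sigma>(1) unfolding bij_betw_def by blast
  have iso2: "rep_iso map_algebra (eval_rep ys R) (eval_rep zs S)"
   unfolding eval_rep_eq
  proof (rule tensor_rep_reindex[OF ys(1) bij _ _ irry[unfolded eval_rep_eq] irrz[unfolded eval_rep_eq]])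
   show "irreducible_on_maps (pullback x (R x))" if "x \<in> ys" for x
    by (rule pullback_irreducible[OF _ irrR[OF R]]) (use that ys in blast)+
   show "irreducible_on_maps (pullback z (S z))" if "z \<in> zs" for z
    by (rule pullback_irreducible[OF _ irrR]) (use that zr S in blast)+
   fix z assume z: "z \<in> zs"
   obtain g where g: "g \<in> grp" "z = point_act g (\<sigma> z)" by (rule orbitE[OF \<sigma>(2)[OF z]])
   have sx: "\<sigma> z \<in> rational_points" "\<sigma> z \<in> xs" using \<sigma>(1)[OF z] ys by blast+
   have "S z \<in> \<Psi> (point_act g (\<sigma> z))" unfolding g(2)[symmetric] by (rule bspec[OF S z])
   from pullback_orbit_iso[OF \<Psi> sx(1) g(1) R[OF sx(2)] this]
   show "rep_iso map_algebra (pullback (\<sigma> z) (R (\<sigma> z))) (pullback z (S z))" unfolding g(2)[symmetric] .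
  qed
  show ?thesis
   by (rule rep_class_eq[OF irreducible_repD(1)[OF irrx] rep_iso_trans[OF iso1 iso2], symmetric])
 qed
 have "orbit_transversal ?Y ys"
  unfolding orbit_transversal_def
 proof (intro conjI ballI ex_ex1I ys(3))
  fix y assume y: "y \<in> ?Y"
  show "\<exists>z. z \<in> ys & z \<in> orb y" using cover_y[OF y] orbit_sym by blast
  fix z z' assume "z \<in> ys & z \<in> orb y" "z' \<in> ys & z' \<in> orb y"
  then show "z = z'" using orbit_distinctD[OF ysd, of z' z] orbit_trans[OF orbit_sym, of z' y z] by blast
 qed
 moreover have "\<forall>x\<in>ys. R x \<in> \<Psi> x" using R ys(2) by blast
 ultimately show ?thesis
  unfolding ev_class_def using key by (intro the_equality) (metis, blast)
qed

end

section \<open>Classification of the irreducible representations\<close>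

context equivariant_maps
begin

lemma orbit_representatives:
 assumes "finite Y" "Y \<subseteq> rational_points"
 shows "\<exists>xs. xs \<subseteq> Y & orbit_distinct xs & (\<forall>y\<in>Y. \<exists>x\<in>xs. y \<in> orb x)"
 using assms
proof (induction Y rule: finite_induct)
 case empty
 then show ?case by (auto simp: orbit_distinct_def)
next
 case (insert y Y)
 then obtain xs where xs: "xs \<subseteq> Y" "orbit_distinct xs" "\<forall>y\<in>Y. \<exists>x\<in>xs. y \<in> orb x" by auto
 show ?case
 proof (cases "\<exists>x\<in>xs. y \<in> orb x")
  case True
  then show ?thesis using xs by (intro exI[of _ xs]) blast
 next
  case False
  have "orbit_distinct (insert y xs)" using xs(2) False orbit_sym unfolding orbit_distinct_def by blast
  then show ?thesis using xs orbit_refl by (intro exI[of _ "insert y xs"]) blast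
 qed
qed

lemma ev_class_representatives:
 assumes \<Psi>: "\<Psi> \<in> equivariant_class_functions" and xs: "xs \<subseteq> rational_points"
 shows "\<exists>R. (\<forall>x\<in>xs. R x \<in> \<Psi> x) & (\<forall>x\<in>xs. irreducible_at x (R x))"
proof -
 have "\<forall>x\<in>xs. \<exists>R. R \<in> \<Psi> x"
 proof
  fix x assume "x \<in> xs"
  then have "\<Psi> x \<in> irr_classes sg br (isotropy_algebra x)" using class_functionD(1)[OF \<Psi>] xs by blast
  then show "\<exists>R. R \<in> \<Psi> x" by (rule irr_classes_nonempty) (rule exI)
 qed
 then obtain R where R: "\<forall>x\<in>xs. R x \<in> \<Psi> x" unfolding bchoice_iff by (elim exE)
 have irr: "irreducible_at x (R x)" if x: "x \<in> xs" for x
  by (rule irr_classes_elem(1)[OF class_functionD(1)[OF \<Psi> subsetD[OF xs x]] bspec[OF R x]])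
 show ?thesis by (rule exI[of _ R], rule conjI[OF R], rule ballI, rule irr)
qed

lemma ev_class_in:
 assumes \<Psi>: "\<Psi> \<in> equivariant_class_functions" shows "ev_class \<Psi> \<in> map_algebra_classes"
proof -
 have Y: "finite (class_support \<Psi>)" "class_support \<Psi> \<subseteq> rational_points"
  using class_functionD(2)[OF \<Psi>] by (auto simp: class_support_def)
 obtain xs where xs: "xs \<subseteq> class_support \<Psi>" "orbit_distinct xs"
   "!!y. y \<in> class_support \<Psi> ==> \<exists>x\<in>xs. y \<in> orb x"
  using orbit_representatives[OF Y] by blast
 have x: "finite xs" "xs \<subseteq> rational_points" using xs(1) Y finite_subset by blast+
 obtain R where R0: "\<forall>x\<in>xs. R x \<in> \<Psi> x" "\<forall>x\<in>xs. irreducible_at x (R x)"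
  using ev_class_representatives[OF \<Psi> x(2)] by (elim exE conjE)
 note R = bspec[OF R0(1)] bspec[OF R0(2)]
 have "ev_class \<Psi> = rep_class fscale tensor_bracket map_algebra (eval_rep xs R)"
  by (rule ev_class_cover[OF \<Psi> x xs(2,3) R(1)])
 then show ?thesis
  unfolding map_algebra_classes_def
  using irr_classes_memb[OF eval_rep_irreducible[where R = R, OF x xs(2) R(2)]] by (simp only:)
qed

text \<open>
  Both classes are computed on common orbit representatives of the two supports, where the factors are
  determined by the tensor product; equivariance extends the agreement to the orbits.
\<close>

theorem ev_class_injective: "inj_on ev_class equivariant_class_functions"
proof (rule inj_onI)
 fix \<Psi> \<Psi>' assume \<Psi>: "\<Psi> \<in> equivariant_class_functions" and \<Psi>': "\<Psi>' \<in> equivariant_class_functions"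
  and eq: "ev_class \<Psi> = ev_class \<Psi>'"
 let ?Y = "class_support \<Psi> \<union> class_support \<Psi>'"
 have Y: "finite ?Y" "?Y \<subseteq> rational_points"
  using class_functionD(2)[OF \<Psi>] class_functionD(2)[OF \<Psi>'] by (auto simp: class_support_def)
 obtain xs where xs: "xs \<subseteq> ?Y" "orbit_distinct xs" "\<forall>y\<in>?Y. \<exists>x\<in>xs. y \<in> orb x"
  using orbit_representatives[OF Y] by blast
 have x: "finite xs" "xs \<subseteq> rational_points" using xs(1) Y finite_subset by blast+
 obtain R where R0: "\<forall>x\<in>xs. R x \<in> \<Psi> x" "\<forall>x\<in>xs. irreducible_at x (R x)"
  using ev_class_representatives[OF \<Psi> x(2)] by (elim exE conjE)
 note R = bspec[OF R0(1)] bspec[OF R0(2)]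
 obtain S where S0: "\<forall>x\<in>xs. S x \<in> \<Psi>' x" "\<forall>x\<in>xs. irreducible_at x (S x)"
  using ev_class_representatives[OF \<Psi>' x(2)] by (elim exE conjE)
 note S = bspec[OF S0(1)] bspec[OF S0(2)]
 have evR: "ev_class \<Psi> = rep_class fscale tensor_bracket map_algebra (eval_rep xs R)"
  by (rule ev_class_cover[OF \<Psi> x xs(2) _ R(1)]) (use xs(3) in blast)
 have evS: "ev_class \<Psi>' = rep_class fscale tensor_bracket map_algebra (eval_rep xs S)"
  by (rule ev_class_cover[OF \<Psi>' x xs(2) _ S(1)]) (use xs(3) in blast)
 note irrR = eval_rep_irreducible[where R = R, OF x xs(2) R(2)]
 note irrS = eval_rep_irreducible[where R = S, OF x xs(2) S(2)]
 have iso: "rep_iso map_algebra (eval_rep xs R) (eval_rep xs S)"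
  by (rule rep_class_eq_iso[OF irreducible_repD(1)[OF irrR] irreducible_repD(1)[OF irrS]]) (simp_all only: evR[symmetric] evS[symmetric] eq)
 have same: "\<Psi> y = \<Psi>' y" if y: "y \<in> xs" for y
 proof -
  have yr: "y \<in> rational_points" using y x(2) by blast
  have "rep_iso map_algebra (pullback y (R y)) (pullback y (S y))"
  proof (rule tensor_rep_factors_unique[where R = "\<lambda>x. pullback x (R x)" and R' = "\<lambda>x. pullback x (S x)",
     OF x(1) _ _ _ iso[unfolded eval_rep_eq] y])
   show "irreducible_on_maps (pullback z (R z))" if "z \<in> xs" for z
    by (rule pullback_irreducible[OF subsetD[OF x(2) that] R(2)[OF that]])
   show "irreducible_on_maps (pullback z (S z))" if "z \<in> xs" for z
    by (rule pullback_irreducible[OF subsetD[OF x(2) that] S(2)[OF that]])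
   fix z \<alpha> assume "z \<in> xs" "\<alpha> \<in> map_algebra"
   then obtain \<beta> where b: "\<beta> \<in> map_algebra" "eval_at z \<beta> = eval_at z \<alpha>" "\<forall>y\<in>xs - {z}. eval_at y \<beta> = 0"
    using pullback_separated[OF x xs(2)] by blast
   have zR: "snd (R w) (eval_at w \<beta>) v = 0" if w: "w \<in> xs - {z}" and v: "v \<in> fst (R w)" for w v
    unfolding bspec[OF b(3) w] by (rule rep_zero[OF irreducible_repD(1)[OF R(2)] v]) (use w in blast)
   have zS: "snd (S w) (eval_at w \<beta>) v = 0" if w: "w \<in> xs - {z}" and v: "v \<in> fst (S w)" for w v
    unfolding bspec[OF b(3) w] by (rule rep_zero[OF irreducible_repD(1)[OF S(2)] v]) (use w in blast)
   show "\<exists>a'\<in>map_algebra. (\<forall>v\<in>fst (pullback z (R z)). snd (pullback z (R z)) a' v = snd (pullback z (R z)) \<alpha> v) &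
     (\<forall>v\<in>fst (pullback z (S z)). snd (pullback z (S z)) a' v = snd (pullback z (S z)) \<alpha> v) &
     (\<forall>w\<in>xs - {z}. (\<forall>v\<in>fst (pullback w (R w)). snd (pullback w (R w)) a' v = 0) &
      (\<forall>v\<in>fst (pullback w (S w)). snd (pullback w (S w)) a' v = 0))"
    unfolding pullback_simps
    by (intro bexI[OF _ b(1)] conjI ballI) (simp_all only: b(2) zR zS)
  qed
  then have i: "rep_iso (isotropy_algebra y) (R y) (S y)" unfolding pullback_iso_iff[OF yr] .
  have "\<Psi> y = rep_class sg br (isotropy_algebra y) (R y)"
   by (rule irr_classes_elem(2)[OF class_functionD(1)[OF \<Psi> yr] R(1)[OF y]])
  also have "\<dots> = rep_class sg br (isotropy_algebra y) (S y)" by (rule rep_class_eq[OF irreducible_repD(1)[OF R(2)[OF y]] i])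
  also have "\<dots> = \<Psi>' y"
   by (rule irr_classes_elem(2)[OF class_functionD(1)[OF \<Psi>' yr] S(1)[OF y], symmetric])
  finally show ?thesis .
 qed
 show "\<Psi> = \<Psi>'"
 proof
  fix y
  show "\<Psi> y = \<Psi>' y"
  proof (cases "y \<in> ?Y")
   case True
   then obtain z where z: "z \<in> xs" "y \<in> orb z" using xs(3) by blast
   obtain g where g: "g \<in> grp" "y = point_act g z" by (rule orbitE[OF z(2)])
   have zr: "z \<in> rational_points" using z(1) x(2) by blast
   show ?thesis
    by (simp only: g(2) class_functionD(3)[OF \<Psi> g(1) zr] class_functionD(3)[OF \<Psi>' g(1) zr] same[OF z(1)])
  next
   case False
   then show ?thesis using class_functionD(4)[OF \<Psi>] class_functionD(4)[OF \<Psi>']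
    by (cases "y \<in> rational_points") (simp_all add: class_support_def)
  qed
 qed
qed

text \<open>Every choice of irreducible representations at orbit-distinct points extends to \<open>\<E>\<close>, by the trivial class elsewhere.\<close>

lemma class_function_extending:
 fixes R :: "('a => 'k) => ('g, nat, 'k) rep"
 assumes xs: "finite xs" "xs \<subseteq> rational_points" "orbit_distinct xs"
  and R: "!!x. x \<in> xs ==> irreducible_at x (R x)"
 obtains \<Psi> where "\<Psi> \<in> equivariant_class_functions" "!!x. x \<in> xs ==> R x \<in> \<Psi> x"
  "!!y. y \<in> class_support \<Psi> ==> \<exists>x\<in>xs. y \<in> orb x"
proof -
 let ?c = "\<lambda>y. rep_class sg br (isotropy_algebra y)"
 let ?Q = "\<lambda>y C. \<exists>x g. x \<in> xs & g \<in> grp & y = point_act g x & C = ?c y (twist g (R x))"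
 have unique: "?c y (twist g (R x)) = ?c y (twist g' (R x'))"
  if x: "x \<in> xs" "x' \<in> xs" and g: "g \<in> grp" "g' \<in> grp" and y: "y = point_act g x" "y = point_act g' x'" for x x' g g' y
 proof -
  have "x' = point_act (inv g') y" unfolding y(2) by (rule point_act_inv(1)[OF g(2), symmetric])
  also have "\<dots> = point_act (inv g' \<otimes> g) x" unfolding y(1) by (rule point_act_mult[symmetric]) (use g in simp_all)
  finally have x'k: "x' = point_act (inv g' \<otimes> g) x" .
  have kc: "inv g' \<otimes> g \<in> grp" using g by simp
  have "x' = x" by (rule orbit_distinctD[OF xs(3) x]) (use orbitI[OF kc, of x] x'k in simp)
  then have k: "inv g' \<otimes> g \<in> stab x" using x'k kc by (simp add: stabilizer_def)
  have "rep_iso (isotropy_algebra y) (twist g (R x)) (twist g' (R x))"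
  proof (rule rep_iso_cong)
   show "fst (twist g (R x)) = fst (twist g' (R x))" by (simp only: twist_simps)
   fix u v assume u: "u \<in> isotropy_algebra y"
   have "actg (inv g) u \<in> isotropy_algebra x" using isotropy_act_inv[OF g(1)] u unfolding y(1) .
   then have "actg (inv g' \<otimes> g) (actg (inv g) u) = actg (inv g) u"
    using k by (simp add: isotropy_algebra_def fixed_subalgebra_def)
   then have "actg (inv g') u = actg (inv g) u" using g by (simp add: group_act_mult actg_inv)
   then show "snd (twist g (R x)) u v = snd (twist g' (R x)) u v" by (simp only: twist_simps)
  qed
  moreover have "rep_at y (twist g (R x))"
   unfolding y(1) by (rule twist_is_rep[OF g(1) irreducible_repD(1)[OF R[OF x(1)]]])
  ultimately show ?thesis unfolding `x' = x` by (rule rep_class_eq[rotated])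
 qed
 define \<Psi> where "\<Psi> y = (if y \<in> rational_points then
   (if \<exists>x\<in>xs. y \<in> orb x then (SOME C. ?Q y C) else trivial_class sg br (isotropy_algebra y)) else undefined)" for y
 have val: "\<Psi> (point_act g x) = ?c (point_act g x) (twist g (R x))" if x: "x \<in> xs" and g: "g \<in> grp" for x g
 proof -
  have r: "point_act g x \<in> rational_points" by (rule point_act_rational[OF g subsetD[OF xs(2) x]])
  have "\<exists>z\<in>xs. point_act g x \<in> orb z" by (rule bexI[OF orbitI[OF g] x])
  then have "\<Psi> (point_act g x) = (SOME C. ?Q (point_act g x) C)" using r by (simp only: \<Psi>_def if_True)
  also have "\<dots> = ?c (point_act g x) (twist g (R x))"
  proof (rule some_equality)
   show "?Q (point_act g x) (?c (point_act g x) (twist g (R x)))" using x g by blast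
   fix C assume "?Q (point_act g x) C"
   then show "C = ?c (point_act g x) (twist g (R x))" using unique[OF x _ g] by blast
  qed
  finally show ?thesis .
 qed
 have triv: "\<Psi> y = trivial_class sg br (isotropy_algebra y)"
  if "y \<in> rational_points" "\<not> (\<exists>x\<in>xs. y \<in> orb x)" for y
  using that by (simp only: \<Psi>_def if_True if_False)
 have supp: "\<exists>x\<in>xs. y \<in> orb x" if "y \<in> class_support \<Psi>" for y
  using that triv[of y] unfolding class_support_def by blast
 have "\<Psi> \<in> equivariant_class_functions"
  unfolding equivariant_class_functions_def
 proof (intro CollectI conjI ballI PiE_I)
  fix y assume y: "y \<in> rational_points"
  show "\<Psi> y \<in> point_classes y"
  proof (cases "\<exists>x\<in>xs. y \<in> orb x")
   case True
   then obtain x where x: "x \<in> xs" "y \<in> orb x" by blast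
   obtain g where g: "g \<in> grp" "y = point_act g x" by (rule orbitE[OF x(2)])
   show ?thesis
    unfolding g(2) val[OF x(1) g(1)] point_classes_def by (rule irr_classes_memb[OF twist_irreducible[OF g(1) R[OF x(1)]]])
  next
   case False
   show ?thesis
    unfolding triv[OF y False] point_classes_def trivial_class_def by (rule irr_classes_memb[OF trivial_irreducible[OF vs]])
  qed
 next
  fix y assume "y \<notin> rational_points"
  then show "\<Psi> y = undefined" by (simp only: \<Psi>_def if_False)
 next
  have "class_support \<Psi> \<subseteq> (\<lambda>(g, x). point_act g x) ` (grp \<times> xs)"
  proof
   fix y assume "y \<in> class_support \<Psi>"
   then obtain x where x: "x \<in> xs" "y \<in> orb x" using supp by blast
   obtain g where g: "g \<in> grp" "y = point_act g x" by (rule orbitE[OF x(2)])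
   show "y \<in> (\<lambda>(g, x). point_act g x) ` (grp \<times> xs)"
    by (rule image_eqI[of _ _ "(g, x)"]) (use g x in simp_all)
  qed
  then show "finite (class_support \<Psi>)" by (rule finite_subset) (intro finite_imageI finite_cartesian_product finite_\<Gamma> xs(1))
 next
  fix h y assume h: "h \<in> grp" and y: "y \<in> rational_points"
  show "\<Psi> (point_act h y) = class_act h (\<Psi> y)"
  proof (cases "\<exists>x\<in>xs. y \<in> orb x")
   case True
   then obtain x where x: "x \<in> xs" "y \<in> orb x" by blast
   obtain g where g: "g \<in> grp" "y = point_act g x" by (rule orbitE[OF x(2)])
   show ?thesis
    unfolding g(2) val[OF x(1) g(1)] class_act_rep_class[OF h] point_act_mult[OF h g(1), symmetric] twist_mult[OF h g(1), symmetric]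
    by (rule val[OF x(1) m_closed[OF h g(1)]])
  next
   case False
   have no: "\<not> (\<exists>x\<in>xs. point_act h y \<in> orb x)"
    using False orbit_trans[OF _ orbit_sym[OF orbitI[OF h, of y]]] by blast
   show ?thesis
    by (simp only: triv[OF y False] triv[OF point_act_rational[OF h y] no] class_act_trivial[OF h])
  qed
 qed
 moreover have "R x \<in> \<Psi> x" if x: "x \<in> xs" for x
 proof -
  have "\<Psi> x = ?c x (R x)" using val[OF x one_closed] unfolding point_act_one twist_one .
  moreover have "R x \<in> ?c x (R x)"
   unfolding rep_class_def by (intro CollectI conjI rep_iso_refl irreducible_repD(1)[OF R[OF x]])
  ultimately show ?thesis by (simp only:)
 qed
 ultimately show ?thesis using that supp by blast
qed

text \<open>
  The isotropy algebra at a point \<open>x\<close> of a finite set of orbit representatives acts on \<open>W\<close> through any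
  lift that vanishes at the other points. These actions commute, and the action of the whole algebra is
  their sum.
\<close>

theorem ev_class_surjective:
 assumes perf: "perfect fscale tensor_bracket map_algebra" and C: "C \<in> map_algebra_classes"
 shows "\<exists>\<Psi>\<in>equivariant_class_functions. ev_class \<Psi> = C"
proof -
 obtain W where WC: "W \<in> C" by (rule irr_classes_nonempty[OF C[unfolded map_algebra_classes_def]])
 have irr: "irreducible_on_maps W"
  and CW: "C = rep_class fscale tensor_bracket map_algebra W"
  by (rule irr_classes_elem[OF C[unfolded map_algebra_classes_def] WC])+
 interpret W: irreducible_map_rep sg br sA oneA \<Gamma> actg actA W
  by (rule irreducible_map_rep.intro[OF equivariant_maps_axioms irreducible_map_rep_axioms.intro[OF perf irr]])
 note WD = W.W_rep
 note M = map_algebra_subspace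
 obtain xs where xs: "finite xs" "xs \<subseteq> rational_points" "orbit_distinct xs"
  and ker: "\<forall>\<alpha>\<in>map_algebra. (\<forall>x\<in>xs. eval_at x \<alpha> = 0) --> \<alpha> \<in> W.ker"
  using W.kernel_determined_at_points by (elim exE conjE)
 have xr: "x \<in> rational_points" if "x \<in> xs" for x using xs(2) that by (rule subsetD)
 have eval_diff: "eval_at x (\<alpha> - \<beta>) = eval_at x \<alpha> - eval_at x \<beta>"
  if "x \<in> xs" "\<alpha> \<in> map_algebra" "\<beta> \<in> map_algebra" for x \<alpha> \<beta>
 proof -
  have pair: "vector_space_pair (fscale :: 'k => (('g => 'a => 'k) => 'k) => _) sg"
   by (intro vector_space_pair.intro vector_space_fscale vs)
  show ?thesis
   by (rule vector_space_pair.linear_on_diff[OF pair eval_linear[OF xr[OF that(1)]] tensor_space_subspace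
      map_algebraD(1)[OF that(2)] map_algebraD(1)[OF that(3)]])
 qed
 \<comment> \<open>The action depends only on the values at `xs`.\<close>
 have same: "snd W \<alpha> v = snd W \<beta> v"
  if ab: "\<alpha> \<in> map_algebra" "\<beta> \<in> map_algebra" and eq: "!!x. x \<in> xs ==> eval_at x \<alpha> = eval_at x \<beta>" and v: "v \<in> fst W" for \<alpha> \<beta> v
 proof -
  have d: "\<alpha> - \<beta> \<in> map_algebra" by (rule fs.subspace_diff[OF M ab])
  have "\<forall>x\<in>xs. eval_at x (\<alpha> - \<beta>) = 0" by (intro ballI) (simp only: eval_diff[OF _ ab] eq diff_self)
  then have "\<alpha> - \<beta> \<in> W.ker" using ker d by blast
  then have "snd W (\<alpha> - \<beta>) v = 0" by (rule W.kerD(2)[OF _ v])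
  then show ?thesis by (simp only: fsp.linear_on_diff[OF WD(4)[OF v] M ab] right_minus_eq)
 qed
 define lift where "lift x u = (SOME \<alpha>. \<alpha> \<in> map_algebra & eval_at x \<alpha> = u & (\<forall>y\<in>xs. y ~= x --> eval_at y \<alpha> = 0))" for x u
 have lift: "lift x u \<in> map_algebra & eval_at x (lift x u) = u & (\<forall>y\<in>xs. y ~= x --> eval_at y (lift x u) = 0)"
  if "x \<in> xs" "u \<in> isotropy_algebra x" for x u
 proof -
  have "\<exists>\<alpha>. \<alpha> \<in> map_algebra & eval_at x \<alpha> = u & (\<forall>y\<in>xs. y ~= x --> eval_at y \<alpha> = 0)"
   using evaluation_surjective[OF xs that] by (simp only: bex_simps Bex_def)
  from someI_ex[OF this] show ?thesis unfolding lift_def .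
 qed
 note liftD = lift[THEN conjunct1] lift[THEN conjunct2, THEN conjunct1] lift[THEN conjunct2, THEN conjunct2, rule_format]
 define \<tau> where "\<tau> x u = snd W (lift x u)" for x u
 have \<tau>: "\<tau> x u v = snd W \<alpha> v"
  if x: "x \<in> xs" and u: "u \<in> isotropy_algebra x" and \<alpha>: "\<alpha> \<in> map_algebra" "eval_at x \<alpha> = u" "!!y. y \<in> xs ==> y ~= x ==> eval_at y \<alpha> = 0"
   and v: "v \<in> fst W" for x u \<alpha> v
  unfolding \<tau>_def
 proof (rule same[OF liftD(1)[OF x u] \<alpha>(1) _ v])
  fix y assume "y \<in> xs"
  then show "eval_at y (lift x u) = eval_at y \<alpha>"
   using liftD(2)[OF x u] liftD(3)[OF x u] \<alpha>(2,3) by (cases "y = x") simp_all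
 qed
 have \<tau>_rep: "rep_at x (fst W, \<tau> x)" if x: "x \<in> xs" for x
  unfolding is_rep_iff
 proof (intro conjI ballI)
  note L = liftD[OF x] and T = map_algebraD(1) and sI = isotropy_subspace[of x]
  show "finite_dim fscale (fst W)" by (rule WD(1))
  show "endo fscale (fst W) (\<tau> x u)" if "u \<in> isotropy_algebra x" for u unfolding \<tau>_def by (rule WD(3)[OF L(1)[OF that]])
  show "linear_on sg fscale (isotropy_algebra x) (\<lambda>u. \<tau> x u v)" if v: "v \<in> fst W" for v
   unfolding linear_on_def
  proof (intro conjI ballI allI)
   fix u u' assume u: "u \<in> isotropy_algebra x" and u': "u' \<in> isotropy_algebra x"
   have "\<tau> x (u + u') v = snd W (lift x u + lift x u') v"
    by (rule \<tau>[OF x subspace_add[OF sI u u'] fs.subspace_add[OF M L(1)[OF u] L(1)[OF u']] _ _ v])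
     (simp_all only: linear_on_add[OF eval_linear[OF xr] T[OF L(1)[OF u]] T[OF L(1)[OF u']]] x L(2)[OF u] L(2)[OF u'] L(3)[OF u] L(3)[OF u'] add_0_left not_False_eq_True)
   then show "\<tau> x (u + u') v = \<tau> x u v + \<tau> x u' v"
    by (simp only: linear_on_add[OF WD(4)[OF v] L(1)[OF u] L(1)[OF u']] \<tau>_def)
  next
   fix c u assume u: "u \<in> isotropy_algebra x"
   have "\<tau> x (sg c u) v = snd W (fscale c (lift x u)) v"
    by (rule \<tau>[OF x subspace_scale[OF sI u] fs.subspace_scale[OF M L(1)[OF u]] _ _ v])
     (simp_all only: linear_on_scale[OF eval_linear[OF xr] T[OF L(1)[OF u]]] x L(2)[OF u] L(3)[OF u] scale_zero_right not_False_eq_True)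
   then show "\<tau> x (sg c u) v = fscale c (\<tau> x u v)"
    by (simp only: linear_on_scale[OF WD(4)[OF v] L(1)[OF u]] \<tau>_def)
  qed
  fix u u' v assume u: "u \<in> isotropy_algebra x" and u': "u' \<in> isotropy_algebra x" and v: "v \<in> fst W"
  have "\<tau> x (br u u') v = snd W (tensor_bracket (lift x u) (lift x u')) v"
   by (rule \<tau>[OF x isotropy_bracket[OF u u'] map_algebra_bracket[OF L(1)[OF u] L(1)[OF u']] _ _ v])
    (simp_all only: eval_bracket[OF xr T[OF L(1)[OF u]] T[OF L(1)[OF u']]] x L(2)[OF u] L(2)[OF u'] L(3)[OF u] L(3)[OF u'] br_zero not_False_eq_True)
  then show "\<tau> x (br u u') v = \<tau> x u (\<tau> x u' v) - \<tau> x u' (\<tau> x u v)"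
   by (simp only: WD(5)[OF L(1)[OF u] L(1)[OF u'] v] \<tau>_def)
 qed
 have comm: "\<tau> x u (\<tau> y u' v) = \<tau> y u' (\<tau> x u v)"
  if x: "x \<in> xs" and y: "y \<in> xs" and xy: "x ~= y" and u: "u \<in> isotropy_algebra x" and u': "u' \<in> isotropy_algebra y" and v: "v \<in> fst W"
  for x y u u' v
 proof -
  note a = liftD(1)[OF x u] and b = liftD(1)[OF y u']
  let ?b = "tensor_bracket (lift x u) (lift y u')"
  have "eval_at z ?b = 0" if z: "z \<in> xs" for z
  proof (cases "z = x")
   case True
   show ?thesis
    unfolding eval_bracket[OF xr[OF z] map_algebraD(1)[OF a] map_algebraD(1)[OF b]]
    using liftD(3)[OF y u' x xy] by (simp only: True br_zero)
  next
   case False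
   show ?thesis
    unfolding eval_bracket[OF xr[OF z] map_algebraD(1)[OF a] map_algebraD(1)[OF b]]
    using liftD(3)[OF x u z False] by (simp only: br_zero)
  qed
  then have "?b \<in> W.ker" using ker map_algebra_bracket[OF a b] by blast
  then have "snd W ?b v = 0" by (rule W.kerD(2)[OF _ v])
  then show ?thesis by (simp only: WD(5)[OF a b v] \<tau>_def right_minus_eq)
 qed
 have "\<exists>V \<mu>. (\<forall>x\<in>xs. irreducible_at x (V x, \<tau> x)) & multilinear fscale xs V \<mu> &
  (\<forall>v\<in>PiE xs V. \<mu> v \<in> fst W) &
  (\<forall>x\<in>xs. \<forall>a\<in>isotropy_algebra x. \<forall>v\<in>PiE xs V. \<tau> x a (\<mu> v) = \<mu> (v(x := \<tau> x a (v x)))) &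
  (\<exists>v\<in>PiE xs V. \<mu> v ~= 0)"
  by (rule commuting_reps_factor[where L = isotropy_algebra and \<tau> = \<tau>, OF xs(1) \<tau>_rep WD(2) irreducible_repD(2)[OF irr] comm])
 then obtain V \<mu> where V: "\<forall>x\<in>xs. irreducible_at x (V x, \<tau> x)"
  and \<mu>: "multilinear fscale xs V \<mu>" "\<forall>v\<in>PiE xs V. \<mu> v \<in> fst W"
   "\<forall>x\<in>xs. \<forall>a\<in>isotropy_algebra x. \<forall>v\<in>PiE xs V. \<tau> x a (\<mu> v) = \<mu> (v(x := \<tau> x a (v x)))"
  and nz: "\<exists>v\<in>PiE xs V. \<mu> v ~= 0" by (elim exE conjE)
 obtain v0 where v0: "v0 \<in> PiE xs V" "\<mu> v0 ~= 0" using nz by (elim bexE)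
 let ?R = "\<lambda>x. (V x, \<tau> x)"
 have irrR: "irreducible_at x (?R x)" if "x \<in> xs" for x by (rule bspec[OF V that])
 note irrE = eval_rep_irreducible[where R = ?R, OF xs irrR]
 have fp: "fst (pullback x (?R x)) = V x" for x by (simp only: pullback_simps fst_conv)
 have iso: "rep_iso map_algebra (eval_rep xs ?R) W"
  unfolding eval_rep_eq
 proof (rule tensor_rep_universal[where R = "\<lambda>x. pullback x (?R x)" and \<mu> = \<mu>,
    OF xs(1) _ irrE[unfolded eval_rep_eq] irr])
  show "multilinear fscale xs (\<lambda>x. fst (pullback x (?R x))) \<mu>" unfolding fp by (rule \<mu>(1))
  show "v0 \<in> PiE xs (\<lambda>x. fst (pullback x (?R x)))" unfolding fp by (rule v0(1))
  show "\<mu> v0 ~= 0" by (rule v0(2))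
  show "rep_of_maps (pullback x (?R x))" if "x \<in> xs" for x
   by (rule pullback_is_rep[OF xr[OF that] irreducible_repD(1)[OF irrR[OF that]]])
  show "\<mu> v \<in> fst W" if "v \<in> PiE xs (\<lambda>x. fst (pullback x (?R x)))" for v
   by (rule bspec[OF \<mu>(2) that[unfolded fp]])
  fix \<alpha> v assume \<alpha>: "\<alpha> \<in> map_algebra" and v': "v \<in> PiE xs (\<lambda>x. fst (pullback x (?R x)))"
  note v = v'[unfolded fp]
  let ?l = "\<lambda>x. lift x (eval_at x \<alpha>)"
  note I = eval_in_isotropy[OF xr \<alpha>]
  note wv = bspec[OF \<mu>(2) v]
  have l: "?l x \<in> map_algebra" if "x \<in> xs" for x by (rule liftD(1)[OF that I[OF that]])
  have s: "(\<Sum>x\<in>xs. ?l x) \<in> map_algebra" by (rule fs.subspace_sum[OF M l])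
  have "snd W \<alpha> (\<mu> v) = snd W (\<Sum>x\<in>xs. ?l x) (\<mu> v)"
  proof (rule same[OF \<alpha> s _ wv])
   fix z assume z: "z \<in> xs"
   have pair: "vector_space_pair (fscale :: 'k => (('g => 'a => 'k) => 'k) => _) sg"
    by (intro vector_space_pair.intro vector_space_fscale vs)
   have "eval_at z (\<Sum>x\<in>xs. ?l x) = (\<Sum>x\<in>xs. eval_at z (?l x))"
    by (rule vector_space_pair.linear_on_sum[OF pair eval_linear[OF xr[OF z]] tensor_space_subspace map_algebraD(1)[OF l]])
   also have "\<dots> = (\<Sum>x\<in>xs. if x = z then eval_at z \<alpha> else 0)"
   proof (rule sum.cong[OF refl])
    fix x assume x: "x \<in> xs"
    show "eval_at z (?l x) = (if x = z then eval_at z \<alpha> else 0)"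
     using liftD(2)[OF x I[OF x]] liftD(3)[OF x I[OF x] z] by (cases "x = z") simp_all
   qed
   also have "\<dots> = eval_at z \<alpha>" using xs(1) z by simp
   finally show "eval_at z \<alpha> = eval_at z (\<Sum>x\<in>xs. ?l x)" by (rule sym)
  qed
  also have "\<dots> = (\<Sum>x\<in>xs. snd W (?l x) (\<mu> v))" by (rule fsp.linear_on_sum[OF WD(4)[OF wv] M l])
  also have "\<dots> = (\<Sum>x\<in>xs. \<mu> (v(x := snd (pullback x (?R x)) \<alpha> (v x))))"
  proof (rule sum.cong[OF refl])
   fix x assume x: "x \<in> xs"
   show "snd W (?l x) (\<mu> v) = \<mu> (v(x := snd (pullback x (?R x)) \<alpha> (v x)))"
    using bspec[OF bspec[OF bspec[OF \<mu>(3) x] I[OF x]] v] by (simp only: \<tau>_def pullback_simps snd_conv)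
  qed
  finally show "snd W \<alpha> (\<mu> v) = (\<Sum>x\<in>xs. \<mu> (v(x := snd (pullback x (?R x)) \<alpha> (v x))))" .
 qed
 obtain \<Psi> where \<Psi>: "\<Psi> \<in> equivariant_class_functions" and R\<Psi>: "!!x. x \<in> xs ==> ?R x \<in> \<Psi> x"
  and supp: "!!y. y \<in> class_support \<Psi> ==> \<exists>x\<in>xs. y \<in> orb x"
  by (rule class_function_extending[where R = ?R, OF xs irrR]) blast+
 have "ev_class \<Psi> = rep_class fscale tensor_bracket map_algebra (eval_rep xs ?R)"
  by (rule ev_class_cover[OF \<Psi> xs supp R\<Psi>])
 also have "\<dots> = C"
  unfolding CW by (rule rep_class_eq[OF irreducible_repD(1)[OF irrE] iso])
 finally have "ev_class \<Psi> = C" .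
 then show ?thesis using \<Psi> by blast
qed

theorem ev_class_bijective:
 assumes "perfect fscale tensor_bracket map_algebra"
 shows "bij_betw ev_class equivariant_class_functions map_algebra_classes"
 unfolding bij_betw_def
proof (intro conjI ev_class_injective subset_antisym)
 show "ev_class ` equivariant_class_functions \<subseteq> map_algebra_classes" by (rule image_subsetI) (rule ev_class_in)
 show "map_algebra_classes \<subseteq> ev_class ` equivariant_class_functions"
  using ev_class_surjective[OF assms] by blast
qed

section \<open>Sufficient conditions for perfectness\<close>

lemma killing_act:
 assumes g: "g \<in> grp" shows "killing (actg g x) (actg g y) = killing x y"
proof -
 have i: "inv g \<in> grp" using g by simp
 have lin: "linear_on sg sg UNIV (actg h)" if "h \<in> grp" for h
  using actg_hom[OF that] by (simp add: linear_on_def)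
 let ?T = "\<lambda>v. br x (br y (actg (inv g) v))"
 have T: "linear_on sg sg UNIV ?T" using actg_hom[OF i] by (simp add: linear_on_def br_add br_scale)
 have "(\<lambda>v. br (actg g x) (br (actg g y) v)) = (\<lambda>v. actg g (?T v))"
  by (rule ext) (simp only: actg_br[OF g] actg_inv(2)[OF g])
 then have "killing (actg g x) (actg g y) = tr (\<lambda>v. actg g (?T v))" by (simp only: killing_def)
 also have "\<dots> = tr (\<lambda>v. ?T (actg g v))" by (rule tr_commute[OF lin[OF g] T])
 finally show ?thesis by (simp only: actg_inv(1)[OF g] killing_def)
qed

text \<open>
  Since the fixed algebra is perfect, a vector orthogonal to its brackets is orthogonal to the algebra
  itself. So its average is orthogonal to everything and vanishes, and the vector lies in the
  coinvariant part, where it spans a trivial submodule.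
\<close>

lemma commutator_full_simple:
 assumes simple: "simple_lie sg br UNIV" and perf: "perfect sg br (fixed_subalgebra grp)"
  and no_triv: "\<not> has_nonzero_trivial_submodule sg br (fixed_subalgebra grp) coinvariant_part"
 shows "commutator sg br (fixed_subalgebra grp) UNIV = UNIV"
proof (rule centralizer_zero_imp_commutator_full)
 let ?U = "fixed_subalgebra grp"
 show nd: "x = 0" if "!!y. killing x y = 0" for x
  by (rule semisimple_killing_nondegenerate[OF simple_imp_semisimple[OF simple] that])
 fix v assume perp: "!!u w. u \<in> ?U ==> killing v (br u w) = 0" and cent: "!!u. u \<in> ?U ==> br u v = 0"
 have vU: "killing v u = 0" if "u \<in> ?U" for u
 proof -
  have "u \<in> span {br a b | a b. a \<in> ?U & b \<in> ?U}" using that perf unfolding perfect_def commutator_def by simp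
  then show ?thesis
  proof (induction rule: span_induct_alt)
   case (step c x y)
   then show ?case using perp by (auto simp: killing_bilinear)
  qed simp
 qed
 have avg: "(\<Sum>g\<in>grp. actg g y) \<in> ?U" for y
 proof -
  have "actg h (\<Sum>g\<in>grp. actg g y) = (\<Sum>g\<in>grp. actg g y)" if h: "h \<in> grp" for h
  proof -
   have "actg h (\<Sum>g\<in>grp. actg g y) = (\<Sum>g\<in>grp. actg h (actg g y))"
    using module_hom.sum[of sg sg "actg h"] actg_linear[OF h] by (simp add: module_hom_iff_linear)
   also have "\<dots> = (\<Sum>g\<in>grp. actg (h \<otimes> g) y)" using h by (simp add: group_act_mult cong: sum.cong)
   finally show ?thesis by (simp add: sum_left_translate[OF h, of "\<lambda>g. actg g y"])
  qed
  then show ?thesis by (simp add: fixed_subalgebra_def)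
 qed
 let ?s = "\<Sum>g\<in>grp. actg g v"
 have k1: "killing (\<Sum>g\<in>J. f g) y = (\<Sum>g\<in>J. killing (f g) y)" for J y and f :: "'c => 'g"
  by (induction J rule: infinite_finite_induct) (simp_all add: killing_bilinear)
 have k2: "killing y (\<Sum>g\<in>J. f g) = (\<Sum>g\<in>J. killing y (f g))" for J y and f :: "'c => 'g"
  by (induction J rule: infinite_finite_induct) (simp_all add: killing_bilinear)
 have s0: "?s = 0"
 proof (rule nd)
  fix y
  have "killing ?s y = (\<Sum>g\<in>grp. killing v (actg (inv g) y))"
   unfolding k1
  proof (rule sum.cong[OF refl])
   fix g assume g: "g \<in> grp"
   show "killing (actg g v) y = killing v (actg (inv g) y)"
    using killing_act[OF g, of v "actg (inv g) y"] by (simp only: actg_inv(2)[OF g])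
  qed
  also have "\<dots> = (\<Sum>g\<in>grp. killing v (actg g y))"
   by (rule sum.reindex_bij_witness[of _ "\<lambda>g. inv g" "\<lambda>g. inv g"]) simp_all
  also have "\<dots> = 0" using vU[OF avg[of y]] by (simp only: k2)
  finally show "killing ?s y = 0" .
 qed
 have "(\<Sum>g\<in>grp. actg g v - v) = - sg (of_nat (card grp)) v"
  by (simp add: sum_subtractf s0 sum_constant_scale)
 moreover have "(\<Sum>g\<in>grp. actg g v - v) \<in> coinvariant_part"
  unfolding coinvariant_part_def by (rule span_sum) (rule span_base, blast)
 ultimately have "- sg (of_nat (card grp)) v \<in> coinvariant_part" by (simp only:)
 then have "sg (- 1 / of_nat (card grp)) (- sg (of_nat (card grp)) v) \<in> coinvariant_part"
  unfolding coinvariant_part_def by (rule span_scale)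
 then have vc: "v \<in> coinvariant_part" using card_group_nonzero by simp
 show "v = 0"
 proof (rule ccontr)
  assume v: "v ~= 0"
  have "span {v} \<subseteq> coinvariant_part" using vc unfolding coinvariant_part_def by (intro span_minimal) auto
  moreover have "br u w = 0" if "u \<in> ?U" "w \<in> span {v}" for u w
   using that(2) cent that(1) by (auto simp: span_singleton br_scale)
  moreover have "span {v} ~= {0}" using v span_base[of v "{v}"] by blast
  ultimately have "has_nonzero_trivial_submodule sg br ?U coinvariant_part"
   unfolding has_nonzero_trivial_submodule_def
   by (intro exI[of _ "span {v}"]) (auto intro: span_zero)
  then show False using no_triv by blast
 qed
qed

lemma commutator_full_diagram:
 assumes ss: "semisimple_lie sg br UNIV" and gen: "chevalley_generators sg br UNIV I h e f"
  and act: "acts_by_diagram_automorphisms sg br \<Gamma> actg I h e f"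
 shows "commutator sg br (fixed_subalgebra grp) UNIV = UNIV"
proof (rule centralizer_zero_imp_commutator_full)
 show nd: "x = 0" if "!!y. killing x y = 0" for x
  by (rule semisimple_killing_nondegenerate[OF ss that])
 obtain \<pi> where \<pi>: "group_action \<Gamma> I \<pi>"
   "\<forall>g\<in>grp. \<forall>i\<in>I. actg g (h i) = h (\<pi> g i) & actg g (e i) = e (\<pi> g i) & actg g (f i) = f (\<pi> g i)"
  using act unfolding acts_by_diagram_automorphisms_def by blast
 fix v assume cent: "!!u. u \<in> fixed_subalgebra grp ==> br u v = 0"
 show "v = 0"
 proof (rule chevalley_centralizer_zero[OF nd gen, where G = "actg ` grp"])
  fix a assume "a \<in> actg ` grp"
  then obtain g where g: "g \<in> grp" "a = actg g" by blast
  show "linear_on sg sg UNIV a" using actg_hom[OF g(1)] by (simp add: g(2) linear_on_def)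
  show "a (br u w) = br (a u) (a w)" for u w by (simp only: g(2) actg_br[OF g(1)])
  have "bij_betw (\<pi> g) I I"
   using group_action.bij_prop0[OF \<pi>(1) g(1)] by (simp add: Bij_def)
  then show "\<exists>\<pi>. bij_betw \<pi> I I & (\<forall>i\<in>I. a (h i) = h (\<pi> i) & a (e i) = e (\<pi> i))"
   using \<pi>(2) g by blast
 next
  show "br u v = 0" if "!!a. a \<in> actg ` grp ==> a u = u" for u
   using cent that by (simp add: fixed_subalgebra_def)
 qed
qed

end

theorem corollary5p8:
  fixes sg :: "'k::{alg_closed_field, field_char_0} \<Rightarrow> 'g::ab_group_add \<Rightarrow> 'g"
    and br :: "'g \<Rightarrow> 'g \<Rightarrow> 'g"
    and sA :: "'k \<Rightarrow> 'a::comm_ring \<Rightarrow> 'a"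
    and oneA :: 'a
    and \<Gamma> :: "('c, 'd) monoid_scheme"
    and actg :: "'c \<Rightarrow> 'g \<Rightarrow> 'g"
    and actA :: "'c \<Rightarrow> 'a \<Rightarrow> 'a"
    and I :: "'i set" and h e f :: "'i \<Rightarrow> 'g"
  assumes "equivariant_maps sg br sA oneA \<Gamma> actg actA"
    and "perfect fscale (equivariant_maps.tensor_bracket sg br sA)
           (equivariant_maps.map_algebra sg sA \<Gamma> actg actA) \<or>
         commutator sg br (equivariant_maps.fixed_subalgebra actg (carrier \<Gamma>)) UNIV = UNIV \<or>
         (simple_lie sg br UNIV \<and>
          equivariant_maps.fixed_subalgebra actg (carrier \<Gamma>) \<noteq> {0} \<and>
          perfect sg br (equivariant_maps.fixed_subalgebra actg (carrier \<Gamma>)) \<and>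
          \<not> has_nonzero_trivial_submodule sg br
             (equivariant_maps.fixed_subalgebra actg (carrier \<Gamma>))
             (equivariant_maps.coinvariant_part sg \<Gamma> actg)) \<or>
         (semisimple_lie sg br UNIV \<and> chevalley_generators sg br UNIV I h e f \<and>
          acts_by_diagram_automorphisms sg br \<Gamma> actg I h e f)"
  shows "bij_betw (equivariant_maps.ev_class sg br sA oneA \<Gamma> actg actA)
           (equivariant_maps.equivariant_class_functions sg br sA oneA \<Gamma> actg actA)
           (equivariant_maps.map_algebra_classes sg br sA \<Gamma> actg actA)"
proof -
  interpret equivariant_maps sg br sA oneA \<Gamma> actg actA by (rule assms(1))
  have "perfect fscale tensor_bracket map_algebra"
    using assms(2)
  proof (elim disjE conjE)
    assume "commutator sg br (fixed_subalgebra (carrier \<Gamma>)) UNIV = UNIV"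
    then show ?thesis by (rule perfect_if_commutator_full)
  next
    assume "simple_lie sg br UNIV" "perfect sg br (fixed_subalgebra (carrier \<Gamma>))"
      "\<not> has_nonzero_trivial_submodule sg br (fixed_subalgebra (carrier \<Gamma>)) coinvariant_part"
    then show ?thesis by (rule perfect_if_commutator_full[OF commutator_full_simple])
  next
    assume "semisimple_lie sg br UNIV" "chevalley_generators sg br UNIV I h e f"
      "acts_by_diagram_automorphisms sg br \<Gamma> actg I h e f"
    then show ?thesis by (rule perfect_if_commutator_full[OF commutator_full_diagram])
  qed
  then show ?thesis by (rule ev_class_bijective)
qed

end
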